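(* Let $\Omega\subset\mathbb{R}^d$ be a bounded set with Lipschitz boundary, satisfying an interior cone condition with angle $\theta\in(0,\pi/2)$ and radius $r>0$. Let $m$ be a positive integer, $0\leqslant s<1$, $p\in[1,\infty)$, $q\in[1,\infty]$, and let $\alpha\in\mathbb{N}_0^d$ be a multi-index satisfying $m>|\alpha|+d/p$ if $p>1$ and $m\geqslant|\alpha|+d$ if $p=1$. Let $\phi:[0,\infty)\to\mathbb{R}$ be a weight profile which is nonnegative, positive on $[0,1/2]$, supported in $[0,1]$ and whose even extension belongs to $C^m(\mathbb{R})$, and let $c_{\mathrm{qu}}>0$. Then there exist constants $C>0$ and $h_0>0$ such that for all $u\in W_p^{m+s}(\Omega)$ and all finite sets $X=\{x_1,\ldots,x_N\}\subset\Omega$ with $h_{X,\Omega}\leqslant\min\{h_0,1\}$ which are quasi-uniform with the same constant $c_{\mathrm{qu}}$, the estimate $$\|u-s_{u,X}\|_{W_q^{|\alpha|}(\Omega)}\leqslant C\,h_{X,\Omega}^{\,m+s-|\alpha|-d(1/p-1/q)_+}\,\|u\|_{W_p^{m+s}(\Omega)}$$ holds, where $(x)_+=\max\{x,0\}$ (with $1/q=0$ if $q=\infty$) and $s_{u,X}$ is the moving least squares approximation of $u$ on $X$ of degree $m$ with weights $w_j(x)=\phi(\|x-x_j\|_2/\delta)$, $\delta=2C_2h_{X,\Omega}$, $C_2=\frac{16(1+\sin\theta)^2m^2}{3\sin^2\theta}$, computed with the shifted scaled polynomial basis.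
   Context: Sobolev spaces: for $k\in\mathbb{N}_0$ and $p\in[1,\infty)$, $W_p^k(\Omega)$ is the usual integer-order Sobolev space, with $|u|_{W_p^k(\Omega)}=(\sum_{|\beta|=k}\|D^\beta u\|_{L^p(\Omega)}^p)^{1/p}$ and $\|u\|_{W_p^k(\Omega)}=(\sum_{|\beta|\leqslant k}\|D^\beta u\|_{L^p(\Omega)}^p)^{1/p}$; for $p=\infty$, $\|u\|_{W_\infty^k(\Omega)}=\sup_{|\beta|\leqslant k}\|D^\beta u\|_{L^\infty(\Omega)}$. For $0<s<1$ and $p\in[1,\infty)$, $W_p^{k+s}(\Omega)$ is the space of $u$ for which $\|u\|_{W_p^{k+s}(\Omega)}=(\|u\|_{W_p^k(\Omega)}^p+|u|_{W_p^{k+s}(\Omega)}^p)^{1/p}$ is finite, where $|u|_{W_p^{k+s}(\Omega)}=\big(\sum_{|\beta|=k}\int_\Omega\int_\Omega\frac{|D^\beta u(x)-D^\beta u(y)|^p}{|x-y|^{d+ps}}\,dx\,dy\big)^{1/p}$. Point values of $u$ are those of its continuous representative. Point sets: $h_{X,\Omega}=\sup_{x\in\Omega}\min_{1\leqslant j\leqslant N}\|x-x_j\|_2$ (fill distance), $q_X=\frac12\min_{i\neq j}\|x_i-x_j\|_2$ (separation distance). $X$ is quasi-uniform with constant $c_{\mathrm{qu}}>0$ if $q_X\leqslant h_{X,\Omega}\leqslant c_{\mathrm{qu}}q_X$. Interior cone condition with angle $\theta\in(0,\pi/2)$ and radius $r>0$: for every $x\in\Omega$ there is a unit vector $\xi(x)$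 such that $\{x+ty:\ y\in\mathbb{R}^d,\ \|y\|_2=1,\ y^T\xi(x)\geqslant\cos\theta,\ t\in[0,r]\}\subset\Omega$. (A bounded set with Lipschitz boundary satisfies such a condition for some $\theta,r$.) Moving least squares (MLS) approximation: let $\mathbb{P}_m^d$ be the space of $d$-variable polynomials of degree at most $m$, $Q=\binom{m+d}{d}$ its dimension, and $p_1,\dots,p_Q$ a basis. The MLS approximation of $u$ is $s_{u,X}(x)=\sum_{j=1}^N a_j(x)u(x_j)$, with shape functions $a_j(x)=w_j(x)\sum_{k=1}^Q\lambda_k(x)p_k(x_j)$, where $(\lambda_k(x))_k$ is the unique solution of $\sum_{k=1}^Q\lambda_k(x)\sum_{j=1}^N w_j(x)p_k(x_j)p_\ell(x_j)=p_\ell(x)$, $1\leqslant\ell\leqslant Q$. The functions $a_j$ do not depend on the choice of basis. The shifted scaled basis is $\{(x-z)^\beta/h_{X,\Omega}^{|\beta|}\}_{0\leqslant|\beta|\leqslant m}$, where for each evaluation point $\hat x$ one takes $z=\hat x$ (held fixed under differentiation). *)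

theory Defs
  imports "HOL-Analysis.Analysis" "HOL-Probability.Essential_Supremum"
begin

section \<open>Powers and Lebesgue norms with values in \<open>[0, \<infinity>]\<close>\<close>

text \<open>Used for exponents \<open>a > 0\<close> only, so \<open>\<infinity>\<close> is mapped to \<open>\<infinity>\<close>.\<close>

definition ennreal_powr :: "ennreal \<Rightarrow> real \<Rightarrow> ennreal" where
  "ennreal_powr x a = (if x = \<infinity> then \<infinity> else ennreal (enn2real x powr a))"

definition Lp_norm :: "(real^'d) set \<Rightarrow> ennreal \<Rightarrow> (real^'d \<Rightarrow> real) \<Rightarrow> ennreal" where
  "Lp_norm \<Omega> q f =
     (if q = \<infinity> then esssup (lebesgue_on \<Omega>) (\<lambda>x. ennreal \<bar>f x\<bar>)
      else ennreal_powr (\<integral>\<^sup>+x. ennreal (\<bar>f x\<bar> powr enn2real q) \<partial>lebesgue_on \<Omega>) (1 / enn2real q))"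


section \<open>Multi-indices and classical partial derivatives\<close>

text \<open>A multi-index in \<open>\<nat>\<^sub>0\<^sup>d\<close> is a function \<open>'d \<Rightarrow> nat\<close>, where \<open>d = CARD('d)\<close>.\<close>

definition mi_size :: "('d::finite \<Rightarrow> nat) \<Rightarrow> nat" where
  "mi_size \<beta> = (\<Sum>i\<in>UNIV. \<beta> i)"

lemma finite_mi_size_le: "finite {\<beta> :: 'd::finite \<Rightarrow> nat. mi_size \<beta> \<le> k}"
proof (rule finite_subset)
  have "\<beta> i \<le> mi_size \<beta>" for \<beta> :: "'d \<Rightarrow> nat" and i
    unfolding mi_size_def by (rule member_le_sum) auto
  then show "{\<beta> :: 'd \<Rightarrow> nat. mi_size \<beta> \<le> k} \<subseteq> PiE UNIV (\<lambda>_. {..k})"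
    by (auto intro: order_trans)
  show "finite (PiE (UNIV :: 'd set) (\<lambda>_. {..k}))"
    by (rule finite_PiE) auto
qed

definition partial_deriv :: "'d::finite \<Rightarrow> (real^'d \<Rightarrow> real) \<Rightarrow> real^'d \<Rightarrow> real" where
  "partial_deriv i f x = frechet_derivative f (at x) (axis i 1)"

definition iter_partial :: "'d::finite list \<Rightarrow> (real^'d \<Rightarrow> real) \<Rightarrow> real^'d \<Rightarrow> real" where
  "iter_partial is f = foldr partial_deriv is f"

text \<open>Only applied to smooth functions, for which the order in which the partial
  derivatives are taken is irrelevant.\<close>

definition multi_deriv :: "('d::finite \<Rightarrow> nat) \<Rightarrow> (real^'d \<Rightarrow> real) \<Rightarrow> real^'d \<Rightarrow> real" where
  "multi_deriv \<beta> f = iter_partial (SOME is. \<forall>i. count_list is i = \<beta> i) f"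

lemma ex_list_of_multi_index: "\<exists>is. \<forall>i. count_list is i = (\<beta> :: 'd::finite \<Rightarrow> nat) i"
proof -
  have "finite {i. 0 < \<beta> i}" by simp
  then have "count (Abs_multiset \<beta>) = \<beta>" by simp
  moreover obtain xs where "mset xs = Abs_multiset \<beta>" using ex_mset by blast
  ultimately have "\<forall>i. count_list xs i = \<beta> i"
    by (metis count_mset)
  then show ?thesis by blast
qed

text \<open>Smooth functions on \<open>\<real>\<^sup>d\<close> whose support is a compact subset of \<open>\<Omega>\<close>.\<close>

definition test_function :: "(real^'d::finite) set \<Rightarrow> (real^'d \<Rightarrow> real) \<Rightarrow> bool" where
  "test_function \<Omega> \<psi> \<longleftrightarrow>
     (\<forall>is. iter_partial is \<psi> differentiable_on UNIV) \<and>
     compact (closure {x. \<psi> x \<noteq> 0}) \<and> closure {x. \<psi> x \<noteq> 0} \<subseteq> \<Omega>"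


section \<open>Sobolev spaces\<close>

definition locally_integrable :: "(real^'d::finite) set \<Rightarrow> (real^'d \<Rightarrow> real) \<Rightarrow> bool" where
  "locally_integrable \<Omega> f \<longleftrightarrow> (\<forall>K. compact K \<and> K \<subseteq> \<Omega> \<longrightarrow> f absolutely_integrable_on K)"

definition has_weak_deriv ::
  "(real^'d::finite) set \<Rightarrow> ('d \<Rightarrow> nat) \<Rightarrow> (real^'d \<Rightarrow> real) \<Rightarrow> (real^'d \<Rightarrow> real) \<Rightarrow> bool" where
  "has_weak_deriv \<Omega> \<beta> u g \<longleftrightarrow>
     locally_integrable \<Omega> u \<and> locally_integrable \<Omega> g \<and>
     (\<forall>\<psi>. test_function \<Omega> \<psi> \<longrightarrow>
        (\<integral>x. u x * multi_deriv \<beta> \<psi> x \<partial>lebesgue_on \<Omega>) =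
        (-1) ^ mi_size \<beta> * (\<integral>x. g x * \<psi> x \<partial>lebesgue_on \<Omega>))"

text \<open>Weak derivatives are unique up to null sets; this picks one representative.\<close>

definition weak_deriv ::
  "(real^'d::finite) set \<Rightarrow> ('d \<Rightarrow> nat) \<Rightarrow> (real^'d \<Rightarrow> real) \<Rightarrow> real^'d \<Rightarrow> real" where
  "weak_deriv \<Omega> \<beta> u = (SOME g. has_weak_deriv \<Omega> \<beta> u g)"

text \<open>The norms are \<open>\<infinity>\<close> exactly for the functions that are not in the space. In particular,
  an upper bound by a finite quantity includes membership in the space.\<close>

definition sobolev_norm ::
  "(real^'d::finite) set \<Rightarrow> nat \<Rightarrow> ennreal \<Rightarrow> (real^'d \<Rightarrow> real) \<Rightarrow> ennreal" where
  "sobolev_norm \<Omega> k q u =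
     (if \<exists>\<beta>. mi_size \<beta> \<le> k \<and> \<not> (\<exists>g. has_weak_deriv \<Omega> \<beta> u g) then \<infinity>
      else if q = \<infinity> then SUP \<beta>\<in>{\<beta>. mi_size \<beta> \<le> k}. Lp_norm \<Omega> \<infinity> (weak_deriv \<Omega> \<beta> u)
      else ennreal_powr
             (\<Sum>\<beta> | mi_size \<beta> \<le> k. ennreal_powr (Lp_norm \<Omega> q (weak_deriv \<Omega> \<beta> u)) (enn2real q))
             (1 / enn2real q))"

definition frac_sobolev_seminorm ::
  "(real^'d::finite) set \<Rightarrow> nat \<Rightarrow> real \<Rightarrow> real \<Rightarrow> (real^'d \<Rightarrow> real) \<Rightarrow> ennreal" where
  "frac_sobolev_seminorm \<Omega> k s p u =
     ennreal_powr
       (\<Sum>\<beta> | mi_size \<beta> = k.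
          \<integral>\<^sup>+y. (\<integral>\<^sup>+x. ennreal (\<bar>weak_deriv \<Omega> \<beta> u x - weak_deriv \<Omega> \<beta> u y\<bar> powr p
                              / norm (x - y) powr (real CARD('d) + p * s))
                 \<partial>lebesgue_on \<Omega>) \<partial>lebesgue_on \<Omega>)
       (1 / p)"

definition frac_sobolev_norm ::
  "(real^'d::finite) set \<Rightarrow> nat \<Rightarrow> real \<Rightarrow> real \<Rightarrow> (real^'d \<Rightarrow> real) \<Rightarrow> ennreal" where
  "frac_sobolev_norm \<Omega> k s p u =
     (if s = 0 then sobolev_norm \<Omega> k (ennreal p) u
      else ennreal_powr
             (ennreal_powr (sobolev_norm \<Omega> k (ennreal p) u) p +
              ennreal_powr (frac_sobolev_seminorm \<Omega> k s p u) p)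
             (1 / p))"

definition frac_sobolev_space ::
  "(real^'d::finite) set \<Rightarrow> nat \<Rightarrow> real \<Rightarrow> real \<Rightarrow> (real^'d \<Rightarrow> real) set" where
  "frac_sobolev_space \<Omega> k s p = {u. frac_sobolev_norm \<Omega> k s p u < \<infinity>}"

definition continuous_rep :: "(real^'d::finite) set \<Rightarrow> (real^'d \<Rightarrow> real) \<Rightarrow> real^'d \<Rightarrow> real" where
  "continuous_rep \<Omega> u =
     (SOME v. continuous_on \<Omega> v \<and> (AE x in lebesgue_on \<Omega>. v x = u x))"


section \<open>Domains\<close>

text \<open>Near each boundary point, \<open>\<Omega>\<close> is the strict epigraph, in some direction \<open>n\<close>, of a
  Lipschitz function on the hyperplane orthogonal to \<open>n\<close>. Such a set contains none of its
  boundary points, so it is open.\<close>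

definition lipschitz_boundary :: "(real^'d::finite) set \<Rightarrow> bool" where
  "lipschitz_boundary \<Omega> \<longleftrightarrow>
     (\<forall>z\<in>frontier \<Omega>. \<exists>\<rho>>0. \<exists>n g L. norm n = 1 \<and> L-lipschitz_on {v. v \<bullet> n = 0} g \<and>
        \<Omega> \<inter> ball z \<rho> = {x \<in> ball z \<rho>. x \<bullet> n > g (x - (x \<bullet> n) *\<^sub>R n)})"

definition interior_cone_condition :: "(real^'d::finite) set \<Rightarrow> real \<Rightarrow> real \<Rightarrow> bool" where
  "interior_cone_condition \<Omega> \<theta> r \<longleftrightarrow>
     (\<forall>x\<in>\<Omega>. \<exists>\<xi>. norm \<xi> = 1 \<and>
        {x + t *\<^sub>R y | t y. norm y = 1 \<and> y \<bullet> \<xi> \<ge> cos \<theta> \<and> 0 \<le> t \<and> t \<le> r} \<subseteq> \<Omega>)"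


section \<open>Point sets\<close>

definition fill_distance :: "(real^'d::finite) set \<Rightarrow> (real^'d) set \<Rightarrow> real" where
  "fill_distance X \<Omega> = (SUP x\<in>\<Omega>. Min ((\<lambda>y. norm (x - y)) ` X))"

definition separation_distance :: "(real^'d::finite) set \<Rightarrow> real" where
  "separation_distance X = (1/2) * Min {norm (x - y) | x y. x \<in> X \<and> y \<in> X \<and> x \<noteq> y}"

text \<open>The minimum defining the separation distance exists only for at least two points.\<close>

definition quasi_uniform :: "real \<Rightarrow> (real^'d::finite) set \<Rightarrow> (real^'d) set \<Rightarrow> bool" where
  "quasi_uniform c X \<Omega> \<longleftrightarrow>
     2 \<le> card X \<and> separation_distance X \<le> fill_distance X \<Omega> \<and>
     fill_distance X \<Omega> \<le> c * separation_distance X"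


section \<open>Moving least squares\<close>

text \<open>The polynomial basis is a family \<open>b\<close> indexed by the finite set \<open>K\<close>, and \<open>w y x\<close> is the
  weight of the node \<open>y\<close> at the evaluation point \<open>x\<close>. The coefficients are the unique solution
  of the moment equations; being zero outside \<open>K\<close> makes them unique as a function.\<close>

definition mls_coeffs ::
  "'k set \<Rightarrow> ('k \<Rightarrow> real^'d::finite \<Rightarrow> real) \<Rightarrow> (real^'d \<Rightarrow> real^'d \<Rightarrow> real) \<Rightarrow> (real^'d) set \<Rightarrow>
   real^'d \<Rightarrow> 'k \<Rightarrow> real" where
  "mls_coeffs K b w X x =
     (THE c. (\<forall>k. k \<notin> K \<longrightarrow> c k = 0) \<and>
        (\<forall>l\<in>K. (\<Sum>k\<in>K. c k * (\<Sum>y\<in>X. w y x * b k y * b l y)) = b l x))"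

definition mls_shape ::
  "'k set \<Rightarrow> ('k \<Rightarrow> real^'d::finite \<Rightarrow> real) \<Rightarrow> (real^'d \<Rightarrow> real^'d \<Rightarrow> real) \<Rightarrow> (real^'d) set \<Rightarrow>
   real^'d \<Rightarrow> real^'d \<Rightarrow> real" where
  "mls_shape K b w X y x = w y x * (\<Sum>k\<in>K. mls_coeffs K b w X x k * b k y)"

text \<open>\<open>{\<lambda>y. (y - z)\<^sup>\<beta> / h^|\<beta>|}\<close>, indexed by the multi-indices \<open>\<beta>\<close> with \<open>|\<beta>| \<le> m\<close>.\<close>

definition shifted_scaled_basis ::
  "real^'d::finite \<Rightarrow> real \<Rightarrow> ('d \<Rightarrow> nat) \<Rightarrow> real^'d \<Rightarrow> real" where
  "shifted_scaled_basis z h \<beta> y = (\<Prod>i\<in>UNIV. (y $ i - z $ i) ^ \<beta> i) / h ^ mi_size \<beta>"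

text \<open>At each evaluation point \<open>x\<close> the basis is the one centred at \<open>z = x\<close>. Since the shape
  functions do not depend on the basis, differentiating them with \<open>z\<close> held fixed is the same as
  differentiating the function of \<open>x\<close> defined here.\<close>

definition mls_approx ::
  "nat \<Rightarrow> real \<Rightarrow> (real^'d::finite \<Rightarrow> real^'d \<Rightarrow> real) \<Rightarrow> (real^'d) set \<Rightarrow> (real^'d \<Rightarrow> real) \<Rightarrow>
   real^'d \<Rightarrow> real" where
  "mls_approx m h w X u x =
     (\<Sum>y\<in>X. mls_shape {\<beta>. mi_size \<beta> \<le> m} (shifted_scaled_basis x h) w X y x * u y)"

definition mls_weight :: "(real \<Rightarrow> real) \<Rightarrow> real \<Rightarrow> real^'d::finite \<Rightarrow> real^'d \<Rightarrow> real" where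
  "mls_weight \<phi> \<delta> y x = \<phi> (norm (x - y) / \<delta>)"

definition Ck_real :: "nat \<Rightarrow> (real \<Rightarrow> real) \<Rightarrow> bool" where
  "Ck_real k f \<longleftrightarrow>
     (\<forall>j<k. (deriv ^^ j) f differentiable_on UNIV) \<and> continuous_on UNIV ((deriv ^^ k) f)"

text \<open>The profile is a function on \<open>[0, \<infinity>)\<close>; its values at negative arguments play no role.\<close>

definition weight_profile :: "nat \<Rightarrow> (real \<Rightarrow> real) \<Rightarrow> bool" where
  "weight_profile m \<phi> \<longleftrightarrow>
     (\<forall>t\<ge>0. 0 \<le> \<phi> t) \<and> (\<forall>t. 0 \<le> t \<and> t \<le> 1/2 \<longrightarrow> 0 < \<phi> t) \<and> (\<forall>t>1. \<phi> t = 0) \<and>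
     Ck_real m (\<lambda>t. \<phi> \<bar>t\<bar>)"

definition mls_C2 :: "real \<Rightarrow> nat \<Rightarrow> real" where
  "mls_C2 \<theta> m = 16 * (1 + sin \<theta>)\<^sup>2 * (real m)\<^sup>2 / (3 * (sin \<theta>)\<^sup>2)"

end

(* Write h for the fill distance. A uniform interior cone, a Markov-type inequality and the constant C2 make
 the nodes near each point a norming set, so the moment matrix is uniformly positive definite; the shape
 functions and their derivatives of order j are then O(h^-j), and only boundedly many act at a point.
 Near x, u is compared with a Taylor polynomial averaged over a bump at distance O(h) inside the cone, whose
 derivatives of order m are replaced by constants (zero if s = 0, means if s > 0). Contracting the
 bump towards a point y moves the averaged polynomial to u(y), and the derivative of this path is an integral
 of the m-th order oscillation of u: this yields the continuous representatives of u and of its derivatives up to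
 order |alpha|, and a pointwise bound by the local mass of an integrable density, without extension operators.
 Moving least squares reproduce the polynomial, so the error inherits the bound, and integrating
 the local masses over the domain gives the L^q estimate. *)

theory Submission
 imports Defs
begin

text \<open>Moving least squares sample u at points, while u is given only up to null sets and only
  on \<Omega>. An embedding and an error bound must therefore come out of one argument with
  constants uniform in h, in which no kernel leaves \<Omega>. The delicate case is p = 1 with m -
  |\<beta>| = d: the bound for the derivative of the path is then of order 1/t, which is not
  integrable, so the integration in t is carried out under the integral over w with an explicit
  bounded primitive. Derivatives cost nothing extra: D^\<beta> of the averaged Taylor polynomial of
  u is the averaged polynomial, of degree m - |\<beta>|, of D^\<beta> u with the same bump and the
  same constants. The constant C2 reflects Chebyshev polynomials: along a segment of length \<rho>
  that starts at its maximum, a polynomial of degree m keeps half its size up to distance 33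
  \<rho>/(160 m^2), and a node is available within 11h/5; this asks for \<rho> >= 32/3 m^2 h. The
  weight is used as a C^(m-1) function of x only, which suffices because |\<alpha>| <= m -
  1.\<close>

abbreviation nn_lborel :: "('a::euclidean_space => ennreal) => ennreal" (binder "LNN " 10) where
 "nn_lborel f \<equiv> nn_integral lborel f"


section \<open>Products of smooth functions of one variable\<close>


definition smooth1 :: "(real => real) => bool" where
 "smooth1 f \<longleftrightarrow> (\<forall>n x. (deriv ^^ n) f field_differentiable at x)"

text \<open>A class of differentiable functions closed under \<open>deriv\<close> contains all
  iterated derivatives of its members. Smoothness thus follows from guessing such a class, without a
  formula for the n-th derivative.\<close>

lemma smooth1_coinduct:
 assumes "f \<in> A" and A: "!!g. g \<in> A ==> (\<forall>x. g field_differentiable at x) \<and> deriv g \<in> A"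
 shows "smooth1 f"
proof -
 have "(deriv ^^ n) f \<in> A" for n by (induction n) (use assms in auto)
 then show ?thesis using A unfolding smooth1_def by blast
qed

lemma smooth1_has_deriv: "smooth1 f ==> (f has_real_derivative deriv f x) (at x)" using DERIV_deriv_iff_field_differentiable[of f x]
 by (auto simp: smooth1_def dest: spec[of _ 0])

lemma smooth1_deriv: "smooth1 f ==> smooth1 (deriv f)"
 unfolding smooth1_def using funpow_swap1[of deriv] by (metis comp_apply funpow_Suc_right)

lemma smooth1_funpow: "smooth1 f ==> smooth1 ((deriv ^^ n) f)" by (induction n) (auto intro: smooth1_deriv)

lemma smooth1_continuous: "smooth1 f ==> continuous_on A f"
 by (rule continuous_at_imp_continuous_on) (blast intro: DERIV_isCont smooth1_has_deriv)

lemma smooth1_continuous_compose: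
 "smooth1 f ==> continuous_on A g ==> continuous_on A (%x. f (g x))" using continuous_on_compose2[OF smooth1_continuous[of f UNIV]] by blast

text \<open>Products of smooth functions alone are not closed under \<open>deriv\<close>, because
  Leibniz's rule produces sums. The algebra generated by sums and products is closed, which is what
  \<open>smooth1_coinduct\<close> asks for.\<close>

inductive_set smooth_alg :: "(real => real) set" where
 base: "smooth1 f ==> f \<in> smooth_alg"
| add: "f \<in> smooth_alg ==> g \<in> smooth_alg ==> (%x. f x + g x) \<in> smooth_alg"
| mult: "f \<in> smooth_alg ==> g \<in> smooth_alg ==> (%x. f x * g x) \<in> smooth_alg"

lemma smooth_alg_deriv:
 "f \<in> smooth_alg ==> (\<forall>x. f field_differentiable at x) \<and> deriv f \<in> smooth_alg"
proof (induction rule: smooth_alg.induct)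
 case (base f)
 then show ?case using smooth1_has_deriv smooth1_deriv smooth_alg.base field_differentiable_def by blast
next
 case (add f g)
 then have "deriv (%x. f x + g x) = (%x. deriv f x + deriv g x)" by (intro ext deriv_add) auto
 then show ?case using add by (auto intro!: smooth_alg.add field_differentiable_add)
next
 case (mult f g)
 then have "deriv (%x. f x * g x) = (%x. f x * deriv g x + deriv f x * g x)" by (intro ext deriv_mult) auto
 then show ?case using mult by (auto intro!: smooth_alg.add smooth_alg.mult field_differentiable_mult)
qed

lemma smooth_alg_smooth1: "f \<in> smooth_alg ==> smooth1 f" by (rule smooth1_coinduct[OF _ smooth_alg_deriv])

lemma smooth1_mult: "smooth1 f ==> smooth1 g ==> smooth1 (%x. f x * g x)"
 by (rule smooth_alg_smooth1[OF smooth_alg.mult[OF smooth_alg.base smooth_alg.base]])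

lemma smooth1_const: "smooth1 (%x. c)" by (rule smooth1_coinduct[of _ "range (%c x. c)"]) auto

lemma smooth1_affine:
 assumes "smooth1 f" shows "smooth1 (%x. f (a * x + b))"
proof (rule smooth1_coinduct[where A = "{%x. c * g (a * x + b) | g c. smooth1 g}"])
 show "(%x. f (a * x + b)) \<in> {%x. c * g (a * x + b) | g c. smooth1 g}" using assms by (intro CollectI exI[of _ f] exI[of _ 1]) auto
 fix h assume "h \<in> {%x. c * g (a * x + b) | g c. smooth1 g}"
 then obtain g c where h: "h = (%x. c * g (a * x + b))" "smooth1 g" by blast
 have "(h has_real_derivative (c * a) * deriv g (a * x + b)) (at x)" for x unfolding h
  by (rule DERIV_cong[OF DERIV_cmult[OF DERIV_chain2[OF smooth1_has_deriv[OF h(2)], of "%x. a * x + b" a]]])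
    (auto intro!: derivative_eq_intros)
 then have "\<forall>x. h field_differentiable at x" "deriv h = (%x. (c * a) * deriv g (a * x + b))"
  using field_differentiable_def DERIV_imp_deriv by blast+
 then show "(\<forall>x. h field_differentiable at x) \<and> deriv h \<in> {%x. c * g (a * x + b) | g c. smooth1 g}"
  using smooth1_deriv[OF h(2)] by blast
qed

lemma smooth1_ident: "smooth1 (%x. x)" by (rule smooth1_coinduct[where A = "insert (%x. x) (range (%c x. c))"]) auto

lemma smooth1_power: "smooth1 f ==> smooth1 (%x. f x ^ n)" by (induction n) (auto intro: smooth1_const smooth1_mult)

section \<open>The flat step exp(-1/t)\<close>

lemma poly_exp_tendsto_0: "((%u. poly P u * exp (-u)) \<longlongrightarrow> (0::real)) at_top"
proof -
 have "((%u. \<Sum>i\<le>degree P. coeff P i * (u ^ i / exp u)) \<longlongrightarrow> (\<Sum>i\<le>degree P. coeff P i * 0)) at_top"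
  by (intro tendsto_intros tendsto_power_div_exp_0)
 then show ?thesis by (simp add: poly_altdef sum_distrib_right exp_minus divide_inverse mult.assoc)
qed

definition exp_step :: "real => real" where
 "exp_step t = (if t > 0 then exp (- (1 / t)) else 0)"

text \<open>For positive t every derivative is a polynomial in 1/t times exp(-1/t), and this form is
  closed under \<open>deriv\<close>: the polynomial P becomes X^2 (P - P'). At 0 the difference
  quotients tend to 0 because the exponential beats every polynomial in 1/t.\<close>

lemma smooth1_exp_step: "smooth1 exp_step"
proof -
 define B where "B P = (%t::real. if t > 0 then poly P (1 / t) * exp (- (1 / t)) else 0)" for P
 have D: "(B P has_real_derivative B ([:0,0,1:] * (P - pderiv P)) t) (at t)" for P t proof -
  consider "t > 0" | "t < 0" | "t = 0" by linarith
  then show ?thesis proof cases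
   case 1
   have "((%t. poly P (1 / t) * exp (- (1 / t))) has_real_derivative
       B ([:0,0,1:] * (P - pderiv P)) t) (at t)" using 1 unfolding B_def
    by (auto intro!: derivative_eq_intros DERIV_chain2[OF poly_DERIV] simp: field_simps power2_eq_square)
   then show ?thesis by (rule has_field_derivative_transform_within_open[of _ _ _ "{0<..}"]) (use 1 in "auto simp: B_def")
  next
   case 2
   have "((%t. 0) has_real_derivative B ([:0,0,1:] * (P - pderiv P)) t) (at t)" using 2 by (auto simp: B_def)
   then show ?thesis by (rule has_field_derivative_transform_within_open[of _ _ _ "{..<0}"]) (use 2 in "auto simp: B_def")
  next
   case 3
   have "((%y. B P y / y) \<longlongrightarrow> 0) (at_right 0)" proof -
    have "((%u. poly ([:0,1:] * P) u * exp (-u)) \<longlongrightarrow> 0) at_top" by (rule poly_exp_tendsto_0)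
    then have "((%t. poly ([:0,1:] * P) (inverse t) * exp (- inverse t)) \<longlongrightarrow> 0) (at_right 0)"
     by (rule filterlim_compose) (rule filterlim_inverse_at_top_right)
    then show ?thesis by (rule tendsto_cong[THEN iffD1, rotated])
       (auto simp: eventually_at B_def field_simps intro!: exI[of _ 1])
   qed
   moreover have "((%y. B P y / y) \<longlongrightarrow> 0) (at_left 0)" by (rule tendsto_cong[THEN iffD1, OF _ tendsto_const])
      (auto simp: eventually_at B_def intro!: exI[of _ 1])
   ultimately have "((%y. B P y / y) \<longlongrightarrow> 0) (at 0)" by (simp add: filterlim_split_at)
   then show ?thesis using 3 by (simp add: has_field_derivative_iff B_def)
  qed
 qed
 show ?thesis proof (rule smooth1_coinduct[of _ "range B"])
  show "exp_step \<in> range B" by (rule range_eqI[of _ _ "[:1:]"]) (auto simp: B_def exp_step_def fun_eq_iff)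
  fix g assume "g \<in> range B"
  then obtain P where g: "g = B P" by blast
  have "deriv g = B ([:0,0,1:] * (P - pderiv P))" unfolding g using D DERIV_imp_deriv by blast
  moreover have "\<forall>x. g field_differentiable at x" unfolding g using D field_differentiable_def by blast
  ultimately show "(\<forall>x. g field_differentiable at x) \<and> deriv g \<in> range B" by blast
 qed
qed

lemma exp_step_bounds: "0 <= exp_step t" "exp_step t <= 1" "t > 0 ==> exp_step t > 0" "t <= 0 ==> exp_step t = 0"
 by (auto simp: exp_step_def)

text \<open>Dilations turn the smooth step into the indicator of the open half line; this is how
  indicators of boxes are reached by smooth products.\<close>

lemma exp_step_limit: "(%n. exp_step (real n * t)) \<longlonglongrightarrow> (if t > 0 then 1 else 0)"
proof (cases "t > 0")
 case True
 have "(%n. exp (- ((1/t) * (1 / real n)))) \<longlonglongrightarrow> exp (- ((1/t) * 0))" by (intro tendsto_intros lim_1_over_n)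
 then have "(%n. exp (- (1 / (real n * t)))) \<longlonglongrightarrow> 1" by (simp add: mult.commute)
 then have "(%n. exp_step (real n * t)) \<longlonglongrightarrow> 1" by (rule Lim_transform_eventually)
    (use True in "auto simp: exp_step_def eventually_sequentially intro!: exI[of _ 1]")
 then show ?thesis using True by simp
next
 case False
 then have "real n * t <= 0" for n by (simp add: mult_nonneg_nonpos)
 then show ?thesis using False by (simp add: exp_step_bounds)
qed

text \<open>Test functions and averaging weights are taken in product form: a partial derivative
  then acts on one factor, and everything reduces to calculus in one variable.\<close>

definition prodf :: "('d::finite => real => real) => real^'d => real" where
 "prodf G x = (\<Prod>i\<in>UNIV. G i (x $ i))"

lemma prodf_remove: "prodf G x = G i (x $ i) * (\<Prod>j\<in>UNIV - {i}. G j (x $ j))" unfolding prodf_def by (rule prod.remove) auto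

lemma prodf_upd: "prodf (G(i := g)) x = g (x $ i) * (\<Prod>j\<in>UNIV - {i}. G j (x $ j))"
 unfolding prodf_remove[of _ _ i] by (auto intro!: arg_cong2[where f="(*)"] prod.cong)

lemma prodf_continuous: "(!!i. smooth1 (G i)) ==> continuous_on A (prodf G)" unfolding prodf_def
 by (rule continuous_on_prod, rule smooth1_continuous_compose) (auto intro: continuous_intros)

lemma prodf_measurable: "(!!i. smooth1 (G i)) ==> prodf G \<in> borel_measurable borel"
 by (rule borel_measurable_continuous_onI) (rule prodf_continuous)

lemma prodf_has_derivative:
 assumes "!!i. smooth1 (G i)"
 shows "(prodf G has_derivative (%v. \<Sum>i\<in>UNIV. v $ i * prodf (G(i := deriv (G i))) x)) (at x)"
proof -
 have "((%x. G i (x $ i)) has_derivative (%v. v $ i * deriv (G i) (x $ i))) (at x)" for i proof -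
  have "(G i has_derivative (%v. v * deriv (G i) (x $ i))) (at (x $ i))" using smooth1_has_deriv[OF assms, of i "x $ i"]
   by (simp add: has_field_derivative_def mult_commute_abs)
  then show ?thesis by (rule has_derivative_compose[of "%x. x $ i" "%v. v $ i", rotated])
     (auto intro!: derivative_eq_intros bounded_linear_imp_has_derivative bounded_linear_vec_nth)
 qed
 then have "((%x. \<Prod>i\<in>UNIV. G i (x $ i)) has_derivative
   (%v. \<Sum>i\<in>UNIV. v $ i * deriv (G i) (x $ i) * (\<Prod>j\<in>UNIV - {i}. G j (x $ j)))) (at x)" by (rule has_derivative_prod)
 then show ?thesis unfolding prodf_upd unfolding prodf_def[abs_def] mult.assoc[symmetric] .
qed

lemma partial_derivI: "(f has_derivative f') (at x) ==> partial_deriv i f x = f' (axis i 1)"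
 unfolding partial_deriv_def using frechet_derivative_at by metis

lemma partial_deriv_prodf:
 assumes "!!i. smooth1 (G i)"
 shows "partial_deriv i (prodf G) = prodf (G(i := deriv (G i)))"
proof
 fix x
 show "partial_deriv i (prodf G) x = prodf (G(i := deriv (G i))) x" unfolding partial_derivI[OF prodf_has_derivative[OF assms]]
  by (simp add: axis_def if_distrib[of "%a. a * _"] cong: if_cong)
qed

lemma iter_partial_Nil [simp]: "iter_partial [] f = f"
 and iter_partial_Cons [simp]: "iter_partial (i # is) f = partial_deriv i (iter_partial is f)" by (simp_all add: iter_partial_def)

lemma iter_partial_append: "iter_partial (xs @ ys) f = iter_partial xs (iter_partial ys f)" by (simp add: iter_partial_def)

lemma iter_partial_prodf:
 assumes "!!i. smooth1 (G i)"
 shows "iter_partial is (prodf G) = prodf (%i. (deriv ^^ count_list is i) (G i))"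
proof (induction "is")
 case (Cons k "is")
 have "iter_partial (k # is) (prodf G)
   = partial_deriv k (prodf (%i. (deriv ^^ count_list is i) (G i)))" using Cons by simp
 also have "... = prodf ((%i. (deriv ^^ count_list is i) (G i))(k := deriv ((deriv ^^ count_list is k) (G k))))"
  by (rule partial_deriv_prodf) (use assms smooth1_funpow in auto)
 also have "((%i. (deriv ^^ count_list is i) (G i))(k := deriv ((deriv ^^ count_list is k) (G k))))
   = (%i. (deriv ^^ count_list (k # is) i) (G i))" by (auto simp: fun_eq_iff)
 finally show ?case .
qed auto

definition mi_list :: "('d::finite => nat) => 'd list" where
 "mi_list \<beta> = (SOME is. \<forall>i. count_list is i = \<beta> i)"

lemma multi_deriv_mi_list: "multi_deriv \<beta> f = iter_partial (mi_list \<beta>) f" by (simp add: multi_deriv_def mi_list_def)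

lemma count_mi_list [simp]: "count_list (mi_list \<beta>) i = \<beta> i"
 using someI_ex[OF ex_list_of_multi_index[of \<beta>]] unfolding mi_list_def by blast

lemma length_mi_list [simp]: "length (mi_list \<beta>) = mi_size \<beta>"
proof -
 have "length (mi_list \<beta>) = (\<Sum>i\<in>UNIV. count_list (mi_list \<beta>) i)" by (subst sum_count_set) auto
 then show ?thesis by (simp add: mi_size_def)
qed

lemma multi_deriv_prodf:
 "(!!i. smooth1 (G i)) ==> multi_deriv \<beta> (prodf G) = prodf (%i. (deriv ^^ \<beta> i) (G i))"
 by (simp add: multi_deriv_mi_list iter_partial_prodf)

text \<open>The closed box inside \<Omega> makes the support of the product compact in \<Omega>.
  These special test functions already determine a locally integrable function almost
  everywhere.\<close>

definition box_product :: "(real^'d::finite) set => ('d => real => real) => bool" where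
 "box_product \<Omega> G \<longleftrightarrow> (\<forall>i. smooth1 (G i)) \<and>
   (\<exists>a b. (\<forall>i t. t \<notin> {a $ i..b $ i} --> G i t = 0) \<and> cbox a b \<subseteq> \<Omega>)"

lemma deriv_zero_outside:
 fixes f :: "real => real"
 assumes "\<forall>t. t \<notin> {a..b} --> f t = 0" and "t \<notin> {a..b}"
 shows "deriv f t = 0"
proof -
 have "(f has_real_derivative 0) (at t)" by (rule has_field_derivative_transform_within_open[of "%_. 0" _ _ "- {a..b}"])
    (use assms in "auto intro: open_Compl")
 then show ?thesis by (rule DERIV_imp_deriv)
qed

lemma box_product_upd:
 assumes "box_product \<Omega> G" shows "box_product \<Omega> (G(i := deriv (G i)))"
proof -
 obtain a b where ab: "!!i. smooth1 (G i)" "!!i t. t \<notin> {a $ i..b $ i} ==> G i t = 0" "cbox a b \<subseteq> \<Omega>"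
  using assms unfolding box_product_def by metis
 have "(G(i := deriv (G i))) j t = 0" if "t \<notin> {a $ j..b $ j}" for j t
  using that ab(2) deriv_zero_outside[of "a $ i" "b $ i" "G i" t] by (cases "j = i") auto
 moreover have "smooth1 ((G(i := deriv (G i))) j)" for j using ab(1) smooth1_deriv by auto
 ultimately show ?thesis using ab(3) unfolding box_product_def by blast
qed

lemma prodf_zero_outside:
 "(!!i t. t \<notin> {a $ i..b $ i} ==> G i t = 0) ==> x \<notin> cbox a b ==> prodf G x = 0"
 unfolding prodf_def mem_box_cart by (metis UNIV_I atLeastAtMost_iff finite prod_zero)

lemma box_product_test_function:
 assumes "box_product \<Omega> G" shows "test_function \<Omega> (prodf G)"
proof -
 obtain a b where ab: "!!i. smooth1 (G i)" "!!i t. t \<notin> {a $ i..b $ i} ==> G i t = 0" "cbox a b \<subseteq> \<Omega>"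
  using assms unfolding box_product_def by metis
 have "{x. prodf G x ~= 0} \<subseteq> cbox a b" using prodf_zero_outside[of a b G] ab(2) by blast
 then have cl: "closure {x. prodf G x ~= 0} \<subseteq> cbox a b" by (intro closure_minimal closed_cbox)
 then have "compact (closure {x. prodf G x ~= 0})" using bounded_subset[OF bounded_cbox] by (simp add: compact_eq_bounded_closed)
 moreover have "iter_partial is (prodf G) differentiable_on UNIV" for "is" unfolding iter_partial_prodf[OF ab(1)] differentiable_on_def
  using prodf_has_derivative[of "%i. (deriv ^^ count_list is i) (G i)"] smooth1_funpow[OF ab(1)] by (auto simp: differentiable_def)
 ultimately show ?thesis unfolding test_function_def using cl ab(3) by auto
qed

lemma box_product_bounded:
 assumes "box_product \<Omega> G" obtains B where "!!x. \<bar>prodf G x\<bar> <= B"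
proof -
 obtain a b where ab: "!!i. smooth1 (G i)" "!!i t. t \<notin> {a $ i..b $ i} ==> G i t = 0" "cbox a b \<subseteq> \<Omega>"
  using assms unfolding box_product_def by metis
 have "compact (prodf G ` cbox a b)" by (intro compact_continuous_image prodf_continuous ab compact_cbox)
 then have "bounded (prodf G ` cbox a b)" by (rule compact_imp_bounded)
 then obtain B where B: "!!x. x \<in> cbox a b ==> \<bar>prodf G x\<bar> <= B" by (auto simp: bounded_iff)
 have "\<bar>prodf G x\<bar> <= max B 0" for x using B[of x] prodf_zero_outside[of a b G x] ab(2) by (cases "x \<in> cbox a b") auto
 then show ?thesis using that by blast
qed


section \<open>Weak derivatives and Borel representatives\<close>


lemma integrable_mult_bounded:
 fixes f g :: "'a => real"
 assumes f: "integrable M f" and g: "g \<in> borel_measurable M" and B: "!!x. \<bar>g x\<bar> <= B"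
 shows "integrable M (%x. f x * g x)"
proof (rule Bochner_Integration.integrable_bound)
 show "integrable M (%x. B * f x)" using f by simp
 show "(%x. f x * g x) \<in> borel_measurable M" using borel_measurable_integrable[OF f] g by measurable
 have "\<bar>g x\<bar> * \<bar>f x\<bar> <= \<bar>B\<bar> * \<bar>f x\<bar>" for x using B[of x] by (intro mult_right_mono) auto
 then show "AE x in M. norm (f x * g x) <= norm (B * f x)" by (auto simp: abs_mult mult.commute)
qed

text \<open>The positive and the negative part of f define two finite measures that agree on open
  boxes, an intersection-stable generator of the Borel sets. Hence the measures and their densities
  coincide, which forces f = 0.\<close>

lemma AE_zero_if_box_integrals_zero:
 fixes f :: "'a::euclidean_space => real"
 assumes f: "integrable lborel f" and box: "!!a b. (LBINT x. f x * indicator (box a b) x) = 0"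
 shows "AE x in lborel. f x = 0"
proof -
 note [measurable] = borel_measurable_integrable[OF f]
 \<comment> \<open>\<open>ennreal\<close> cuts off negative values, so these are the densities of
   the positive and the negative part.\<close>
 let ?M = "density lborel (%x. ennreal (f x))" and ?N = "density lborel (%x. ennreal (- f x))"
 have fin: "(LNN x. ennreal (f x)) < \<infinity>" "(LNN x. ennreal (- f x)) < \<infinity>"
  using f by (auto simp: real_integrable_def top.not_eq_extremum less_top)
 have eq: "emeasure ?M (box a b) = emeasure ?N (box a b)" for a b proof -
  let ?g = "%x. f x * indicator (box a b) x"
  have g: "integrable lborel ?g" by (rule integrable_real_mult_indicator) (use f in auto)
  have "emeasure ?M (box a b) = (LNN x. ennreal (?g x))"
   "emeasure ?N (box a b) = (LNN x. ennreal (- ?g x))" by (auto simp: emeasure_density intro!: nn_integral_cong split: split_indicator)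
  moreover have "enn2real (LNN x. ennreal (?g x)) = enn2real (LNN x. ennreal (- ?g x))"
   using real_lebesgue_integral_def[OF g] box[of a b] by simp
  moreover have "(LNN x. ennreal (?g x)) < \<infinity>" "(LNN x. ennreal (- ?g x)) < \<infinity>"
   using g by (auto simp: real_integrable_def top.not_eq_extremum less_top)
  ultimately show ?thesis by (metis ennreal_enn2real infinity_ennreal_def)
 qed
 have "?M = ?N" proof (rule measure_eqI_generator_eq)
  let ?E = "range (%(a, b). box a b :: 'a set)"
  show "Int_stable ?E" by (auto simp: Int_stable_def box_Int_box)
  show "?E \<subseteq> Pow UNIV" by auto
  show "sets ?M = sigma_sets UNIV ?E" "sets ?N = sigma_sets UNIV ?E" by (simp_all add: borel_eq_box)
  let ?A = "%n::nat. box (- (real n *\<^sub>R One)) (real n *\<^sub>R One) :: 'a set"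
  show "range ?A \<subseteq> ?E" "(\<Union>i. ?A i) = UNIV" unfolding UN_box_eq_UNIV by auto
  show "emeasure ?M (?A i) ~= \<infinity>" for i proof -
   have "emeasure ?M (?A i) <= emeasure ?M UNIV" by (rule emeasure_mono) auto
   also have "... < \<infinity>" using fin by (simp add: emeasure_density)
   finally show ?thesis by simp
  qed
  show "emeasure ?M X = emeasure ?N X" if "X \<in> ?E" for X using eq that by auto
 qed
 then have "AE x in lborel. ennreal (f x) = ennreal (- f x)" by (subst (asm) finite_density_unique) (use fin in auto)
 moreover have "c = 0" if "ennreal c = ennreal (- c)" for c using that by (cases "c >= 0") (auto simp: ennreal_neg ennreal_eq_0_iff)
 ultimately show ?thesis by (auto elim: eventually_mono)
qed

text \<open>By Lindelof's theorem countably many of the neighbourhoods suffice to cover \<Omega>, so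
  the exceptional sets add up to a null set.\<close>

lemma AE_local:
 assumes "open \<Omega>" and loc: "!!x. x \<in> \<Omega> ==> \<exists>U. open U \<and> x \<in> U \<and> (AE y in M. y \<in> U --> P y)"
 shows "AE y in M. y \<in> (\<Omega> :: 'a::second_countable_topology set) --> P y"
proof -
 define F where "F = {U. open U \<and> (AE y in M. y \<in> U --> P y)}"
 obtain F' where F': "F' \<subseteq> F" "countable F'" "\<Union>F' = \<Union>F" by (rule Lindelof[of F]) (auto simp: F_def)
 have "AE y in M. \<forall>U\<in>F'. y \<in> U --> P y" using F' by (intro AE_ball_countable') (auto simp: F_def)
 then show ?thesis by eventually_elim (use F'(3) loc in "fastforce simp: F_def")
qed

lemma integral_zero_outside:
 fixes f :: "'a => real"
 assumes "!!x. x \<notin> A ==> g x = 0"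
 shows "(\<integral>x. (f x * indicator A x) * g x \<partial>M) = (\<integral>x. f x * g x \<partial>M)"
 by (rule Bochner_Integration.integral_cong) (use assms in "auto split: split_indicator")

text \<open>Indicators of open boxes are bounded pointwise limits of smooth products supported in
  the closed box, so dominated convergence transfers the hypothesis from products to boxes. Near
  each point f, cut off to a box, then vanishes almost everywhere.\<close>

lemma fundamental_lemma:
 fixes f :: "real^'d::finite => real"
 assumes "open \<Omega>" and int: "!!a b. cbox a b \<subseteq> \<Omega> ==> integrable lborel (%x. f x * indicator (cbox a b) x)"
  and test: "!!G. box_product \<Omega> G ==> (LBINT x. f x * prodf G x) = 0"
 shows "AE x in lborel. x \<in> \<Omega> --> f x = 0"
proof -
 have 1: "(LBINT x. f x * indicator (box a b) x) = 0" if ab: "cbox a b \<subseteq> \<Omega>" for a b proof -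
  define G where "G n = (%i t. exp_step (real n * (t - a $ i)) * exp_step (real n * (b $ i - t)))" for n
  have sm: "smooth1 (G n i)" for n i proof -
   have "smooth1 (%t. exp_step (real n * t + (- real n * a $ i)) * exp_step (- real n * t + real n * b $ i))"
    by (intro smooth1_mult smooth1_affine smooth1_exp_step)
   then show ?thesis by (simp add: G_def algebra_simps)
  qed
  have z: "G n i t = 0" if "t \<notin> {a $ i..b $ i}" for n i t
   using that unfolding G_def by (auto simp: exp_step_bounds mult_nonneg_nonpos)
  have z': "prodf (G n) x = 0" if "x \<notin> cbox a b" for n x using z that by (rule prodf_zero_outside)
  have bp: "box_product \<Omega> (G n)" for n unfolding box_product_def using sm z ab by blast
  have le1: "\<bar>prodf (G n) x\<bar> <= 1" for n x
   unfolding prodf_def abs_prod by (intro prod_le_1) (auto simp: G_def abs_mult exp_step_bounds mult_le_one)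
  have lim: "(%n. prodf (G n) x) \<longlonglongrightarrow> indicator (box a b) x" for x proof -
   have "(%n. prodf (G n) x) \<longlonglongrightarrow>
     (\<Prod>i\<in>UNIV. (if x $ i - a $ i > 0 then 1 else 0) * (if b $ i - x $ i > 0 then 1 else 0))"
    unfolding prodf_def G_def by (intro tendsto_prod tendsto_mult exp_step_limit)
   also have "(\<Prod>i\<in>UNIV. (if x $ i - a $ i > 0 then 1 else 0) * (if b $ i - x $ i > 0 then 1 else 0))
     = (indicator (box a b) x :: real)" by (auto simp: indicator_def mem_box_cart prod_zero_iff)
   finally show ?thesis .
  qed
  let ?h = "%x. f x * indicator (cbox a b) x"
  note h = int[OF ab]
  note [measurable] = borel_measurable_integrable[OF h] prodf_measurable[OF sm]
  have "(%n. \<integral>x. ?h x * prodf (G n) x \<partial>lborel) \<longlonglongrightarrow> (LBINT x. ?h x * indicator (box a b) x)"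
  proof (rule integral_dominated_convergence[where w = "%x. \<bar>?h x\<bar>"])
   show "integrable lborel (%x. \<bar>?h x\<bar>)" using h by (rule integrable_abs)
   show "AE x in lborel. (%n. ?h x * prodf (G n) x) \<longlonglongrightarrow> ?h x * indicator (box a b) x"
    by (intro always_eventually allI tendsto_intros lim)
   show "AE x in lborel. norm (?h x * prodf (G n) x) <= \<bar>?h x\<bar>" for n
    using le1[of n] mult_left_le[OF le1[of n]] by (auto simp: abs_mult mult_left_le)
  qed (measurable)
  moreover have "(LBINT x. ?h x * prodf (G n) x) = 0" for n
   using integral_zero_outside[where A="cbox a b" and g="prodf (G n)" and f=f] z' test[OF bp] by simp
  moreover have "(LBINT x. ?h x * indicator (box a b) x) = (LBINT x. f x * indicator (box a b) x)"
   by (rule integral_zero_outside) (auto simp: box_subset_cbox[THEN subsetD] indicator_def)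
  ultimately show ?thesis by (simp add: LIMSEQ_const_iff)
 qed
 show ?thesis proof (rule AE_local[OF \<open>open \<Omega>\<close>])
  fix x assume "x \<in> \<Omega>"
  then obtain a b where ab: "x \<in> box a b" "cbox a b \<subseteq> \<Omega>" using \<open>open \<Omega>\<close> open_contains_cbox by metis
  have "AE y in lborel. f y * indicator (box a b) y = 0" proof (rule AE_zero_if_box_integrals_zero)
   have "integrable lborel (%y. f y * indicator (cbox a b) y * indicator (box a b) y)" by (intro integrable_real_mult_indicator int ab) auto
   also have "(%y. f y * indicator (cbox a b) y * indicator (box a b) y) = (%y. f y * indicator (box a b) y)"
    using box_subset_cbox[of a b] by (auto simp: fun_eq_iff indicator_def)
   finally show "integrable lborel (%y. f y * indicator (box a b) y)" .
   fix c e :: "real^'d"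
   obtain l u where lu: "box a b \<inter> box c e = box l u" using box_Int_box by blast
   have "(LBINT y. f y * indicator (box a b) y * indicator (box c e) y) =
    (LBINT y. f y * indicator (box l u) y)" unfolding lu[symmetric] by (simp add: indicator_inter_arith mult.assoc)
   also have "... = 0" proof (cases "box l u = {}")
    case False
    then have "cbox l u \<subseteq> cbox a b"
     using lu by (metis closure_box closure_minimal closed_cbox box_subset_cbox inf.cobounded1 order_trans)
    then show ?thesis using 1 ab(2) by blast
   qed auto
   finally show "(LBINT y. f y * indicator (box a b) y * indicator (box c e) y) = 0" .
  qed
  then have "AE y in lborel. y \<in> box a b --> f y = 0" by eventually_elim auto
  then show "\<exists>U. open U \<and> x \<in> U \<and> (AE y in lborel. y \<in> U --> f y = 0)" using ab(1) by blast
 qed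
qed

text \<open>Weak derivatives are only Lebesgue measurable, and only on \<Omega>. A Borel function
  that vanishes outside \<Omega> turns their integrals into integrals over the whole space, where
  Fubini's theorem, translations and dilations are available.\<close>

definition borel_rep :: "(real^'d::finite) set => (real^'d => real) => (real^'d => real) => bool" where
 "borel_rep \<Omega> g f \<longleftrightarrow> f \<in> borel_measurable borel \<and> (\<forall>x. x \<notin> \<Omega> --> f x = 0) \<and>
   (AE x in lebesgue. x \<in> \<Omega> --> f x = g x)"

text \<open>Local integrability speaks of compact subsets only; an exhaustion of \<Omega> by compact
  sets gives measurability on all of \<Omega>.\<close>

lemma locally_integrable_measurable:
 assumes "open \<Omega>" "locally_integrable \<Omega> g"
 shows "(%x. indicator \<Omega> x * g x) \<in> borel_measurable lebesgue"
proof -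
 obtain C where C: "!!n. compact (C n)" "!!n. C n \<subseteq> \<Omega>" "!!n. C n \<subseteq> interior (C (Suc n))" "\<Union> (range C) = \<Omega>"
   "!!K. compact K ==> K \<subseteq> \<Omega> ==> \<exists>N. \<forall>n\<ge>N. K \<subseteq> C n"
  by (rule open_Union_compact_subsets[OF assms(1)], rule that)
 show ?thesis proof (rule borel_measurable_LIMSEQ_real)
  show "(%x. indicator (C n) x * g x) \<in> borel_measurable lebesgue" for n
   using assms(2) C(1,2)[of n] unfolding locally_integrable_def set_integrable_def by (auto dest!: borel_measurable_integrable)
  show "(%n. indicator (C n) x * g x) \<longlonglongrightarrow> indicator \<Omega> x * g x" for x proof (rule tendsto_eventually)
   show "\<forall>\<^sub>F n in sequentially. indicator (C n) x * g x = indicator \<Omega> x * g x" proof (cases "x \<in> \<Omega>")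
    case True
    then obtain N where "\<forall>n\<ge>N. {x} \<subseteq> C n" using C(5)[of "{x}"] by auto
    then show ?thesis using True by (auto simp: eventually_sequentially intro!: exI[of _ N])
   next
    case False
    then show ?thesis using C(2) by (intro always_eventually) (auto simp: indicator_def)
   qed
  qed
 qed
qed

lemma borel_rep_exists:
 assumes "open \<Omega>" "locally_integrable \<Omega> g"
 shows "\<exists>f. borel_rep \<Omega> g f"
proof -
 have "(%x. indicator \<Omega> x * g x) \<in> borel_measurable (completion lborel)" using locally_integrable_measurable[OF assms] by simp
 from completion_ex_borel_measurable_real[OF this]
 obtain f where f: "f \<in> borel_measurable lborel" "AE x in lborel. indicator \<Omega> x * g x = f x" by blast
 have "AE x in lebesgue. indicator \<Omega> x * g x = f x" using f(2) by (rule AE_completion)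
 then have "AE x in lebesgue. x \<in> \<Omega> --> indicator \<Omega> x * f x = g x" by eventually_elim auto
 moreover have "(%x. indicator \<Omega> x * f x) \<in> borel_measurable borel"
  using f(1) assms(1) by (intro borel_measurable_times borel_measurable_indicator) auto
 ultimately show ?thesis unfolding borel_rep_def by (intro exI[of _ "%x. indicator \<Omega> x * f x"]) auto
qed

lemma integral_borel_rep:
 assumes "open \<Omega>" "locally_integrable \<Omega> g" "borel_rep \<Omega> g f" and [measurable]: "\<psi> \<in> borel_measurable borel"
 shows "(\<integral>x. g x * \<psi> x \<partial>lebesgue_on \<Omega>) = (LBINT x. f x * \<psi> x)"
proof -
 have [measurable]: "f \<in> borel_measurable borel" using assms(3) by (simp add: borel_rep_def)
 have fl: "h \<in> borel_measurable lebesgue" if "h \<in> borel_measurable borel" for h :: "real^'d => real"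
  using that by (intro measurable_completion) simp
 have gl: "g \<in> borel_measurable (lebesgue_on \<Omega>)" using locally_integrable_measurable[OF assms(1,2)] assms(1)
  by (subst borel_measurable_restrict_space_iff) auto
 have "(\<integral>x. g x * \<psi> x \<partial>lebesgue_on \<Omega>) = (\<integral>x. f x * \<psi> x \<partial>lebesgue_on \<Omega>)"
 proof (rule integral_cong_AE)
  show "(%x. g x * \<psi> x) \<in> borel_measurable (lebesgue_on \<Omega>)"
   "(%x. f x * \<psi> x) \<in> borel_measurable (lebesgue_on \<Omega>)"
   by (intro borel_measurable_times gl measurable_restrict_space1 fl; measurable)+
  show "AE x in lebesgue_on \<Omega>. g x * \<psi> x = f x * \<psi> x" using assms(3) unfolding borel_rep_def
   by (auto simp: AE_restrict_space_iff \<open>open \<Omega>\<close>)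
 qed
 also have "... = (\<integral>x. indicator \<Omega> x *\<^sub>R (f x * \<psi> x) \<partial>lebesgue)"
  by (rule integral_restrict_space) (simp add: \<open>open \<Omega>\<close>)
 also have "... = (\<integral>x. f x * \<psi> x \<partial>lebesgue)"
  using assms(3) by (intro Bochner_Integration.integral_cong) (auto simp: borel_rep_def indicator_def)
 also have "... = (LBINT x. f x * \<psi> x)" by (rule integral_completion) simp
 finally show ?thesis .
qed

lemma borel_rep_integrable:
 assumes "locally_integrable \<Omega> g" "borel_rep \<Omega> g f" "compact K" "K \<subseteq> \<Omega>"
 shows "integrable lborel (%x. f x * indicator K x)"
proof -
 have [measurable]: "f \<in> borel_measurable borel" "K \<in> sets borel" using assms(2,3) by (auto simp: borel_rep_def borel_compact)
 have "integrable lebesgue (%x. indicator K x *\<^sub>R g x)" using assms by (simp add: locally_integrable_def set_integrable_def)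
 then have "integrable lebesgue (%x. f x * indicator K x)" proof (rule integrable_cong_AE_imp)
  show "AE x in lebesgue. indicator K x *\<^sub>R g x = f x * indicator K x"
   using assms(2,4) unfolding borel_rep_def by (auto simp: indicator_def elim!: eventually_mono)
  show "(%x. f x * indicator K x) \<in> borel_measurable lebesgue" by (intro measurable_completion) simp
 qed
 then show ?thesis by (subst (asm) integrable_completion) auto
qed

lemma AE_lebesgue_on_iff:
 "open \<Omega> ==> (AE x in lebesgue_on \<Omega>. P x) \<longleftrightarrow> (AE x in lebesgue. x \<in> \<Omega> --> P x)"
 by (rule AE_restrict_space_iff) auto

lemma AE_lebesgue_lborel:
 assumes "AE x in lborel. P x" shows "AE x in lebesgue. P x" using assms by (rule AE_completion)

text \<open>\<open>weak_deriv\<close> is an arbitrary choice; uniqueness transfers what is proved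
  for an explicit weak derivative to the chosen one.\<close>

lemma has_weak_deriv_unique:
 assumes \<Omega>: "open \<Omega>" and g: "has_weak_deriv \<Omega> \<beta> u g" and g': "has_weak_deriv \<Omega> \<beta> u g'"
 shows "AE x in lebesgue_on \<Omega>. g x = g' x"
proof -
 have li: "locally_integrable \<Omega> g" "locally_integrable \<Omega> g'" using g g' by (auto simp: has_weak_deriv_def)
 obtain f f' where f: "borel_rep \<Omega> g f" "borel_rep \<Omega> g' f'" using borel_rep_exists[OF \<Omega>] li by blast
 have "AE x in lborel. x \<in> \<Omega> --> f x - f' x = 0" proof (rule fundamental_lemma[OF \<Omega>])
  have i: "integrable lborel (%x. f x * indicator (cbox a b) x)" "integrable lborel (%x. f' x * indicator (cbox a b) x)"
   if "cbox a b \<subseteq> \<Omega>" for a b using borel_rep_integrable[OF li(1) f(1) compact_cbox that]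
    borel_rep_integrable[OF li(2) f(2) compact_cbox that] by auto
  then show "integrable lborel (%x. (f x - f' x) * indicator (cbox a b) x)" if "cbox a b \<subseteq> \<Omega>" for a b
   unfolding left_diff_distrib using that by (intro Bochner_Integration.integrable_diff) auto
  fix G assume G: "box_product \<Omega> G"
  have test: "test_function \<Omega> (prodf G)" using G by (rule box_product_test_function)
  obtain a b where ab: "!!i. smooth1 (G i)" "!!i t. t \<notin> {a $ i..b $ i} ==> G i t = 0" "cbox a b \<subseteq> \<Omega>"
   using G unfolding box_product_def by metis
  have z: "prodf G x = 0" if "x \<notin> cbox a b" for x using ab(2) that by (rule prodf_zero_outside)
  note [measurable] = prodf_measurable[OF ab(1)]
  have eq: "(LBINT x. f x * prodf G x) = (LBINT x. f' x * prodf G x)"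
   using g g' test integral_borel_rep[OF \<Omega> li(1) f(1), of "prodf G"] integral_borel_rep[OF \<Omega> li(2) f(2), of "prodf G"]
   by (auto simp: has_weak_deriv_def)
  have int: "integrable lborel (%x. h x * prodf G x)"
   if "integrable lborel (%x. h x * indicator (cbox a b) x)" for h :: "real^'a => real" proof -
   obtain B where B: "!!x. \<bar>prodf G x\<bar> <= B" using box_product_bounded[OF G] by blast
   have "integrable lborel (%x. (h x * indicator (cbox a b) x) * prodf G x)" by (rule integrable_mult_bounded) (use that B in auto)
   also have "(%x. (h x * indicator (cbox a b) x) * prodf G x) = (%x. h x * prodf G x)" using z by (auto simp: indicator_def fun_eq_iff)
   finally show ?thesis .
  qed
  show "(LBINT x. (f x - f' x) * prodf G x) = 0" unfolding left_diff_distrib using eq int i[OF ab(3)] by simp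
 qed
 then have "AE x in lebesgue. x \<in> \<Omega> --> f x - f' x = 0" by (rule AE_lebesgue_lborel)
 moreover have "AE x in lebesgue. x \<in> \<Omega> --> f x = g x" "AE x in lebesgue. x \<in> \<Omega> --> f' x = g' x"
  using f by (auto simp: borel_rep_def)
 ultimately show ?thesis unfolding AE_lebesgue_on_iff[OF \<Omega>] by eventually_elim auto
qed

definition mi_inc :: "('d => nat) => 'd => 'd => nat" where
 "mi_inc \<beta> i = \<beta>(i := Suc (\<beta> i))"

lemma mi_size_inc [simp]: "mi_size (mi_inc \<beta> i) = Suc (mi_size \<beta>)"
 unfolding mi_size_def mi_inc_def by (simp add: sum.remove[of UNIV i])

text \<open>A single step of weak differentiation, tested with products only. The path argument uses
  a chain of such steps in place of weak derivatives of higher order.\<close>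

definition weak_partial :: "(real^'d::finite) set => 'd => (real^'d => real) => (real^'d => real) => bool" where
 "weak_partial \<Omega> i f g \<longleftrightarrow> (\<forall>G. box_product \<Omega> G -->
   (LBINT x. f x * prodf (G(i := deriv (G i))) x) = - (LBINT x. g x * prodf G x))"

text \<open>The i-th partial derivative of a test product is again one. Testing \<beta> with this
  derivative and \<beta> + e_i with the product itself gives the same integral against u, and the
  two signs differ by one factor -1.\<close>

lemma weak_partial_rep:
 assumes \<Omega>: "open \<Omega>" and g: "has_weak_deriv \<Omega> \<beta> u g" and g': "has_weak_deriv \<Omega> (mi_inc \<beta> i) u g'"
  and f: "borel_rep \<Omega> g f" and f': "borel_rep \<Omega> g' f'"
 shows "weak_partial \<Omega> i f f'" unfolding weak_partial_def
proof (intro allI impI)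
 have li: "locally_integrable \<Omega> g" "locally_integrable \<Omega> g'" using g g' by (auto simp: has_weak_deriv_def)
 fix G assume G: "box_product \<Omega> G"
 let ?H = "G(i := deriv (G i))"
 have H: "box_product \<Omega> ?H" using G by (rule box_product_upd)
 have sm: "smooth1 (G i)" "smooth1 (?H i)" for i using G H unfolding box_product_def by auto
 note [measurable] = prodf_measurable[OF sm(1)] prodf_measurable[OF sm(2)]
 have md: "multi_deriv (mi_inc \<beta> i) (prodf G) = multi_deriv \<beta> (prodf ?H)"
  unfolding multi_deriv_prodf[OF sm(1)] multi_deriv_prodf[OF sm(2)]
  by (rule arg_cong[where f=prodf]) (auto simp: mi_inc_def fun_eq_iff funpow_swap1)
 have "(-1) ^ mi_size (mi_inc \<beta> i) * (\<integral>x. g' x * prodf G x \<partial>lebesgue_on \<Omega>)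
  = (-1) ^ mi_size \<beta> * (\<integral>x. g x * prodf ?H x \<partial>lebesgue_on \<Omega>)" proof -
  have "(\<integral>x. u x * multi_deriv (mi_inc \<beta> i) (prodf G) x \<partial>lebesgue_on \<Omega>)
    = (-1) ^ mi_size (mi_inc \<beta> i) * (\<integral>x. g' x * prodf G x \<partial>lebesgue_on \<Omega>)"
   using g' box_product_test_function[OF G] unfolding has_weak_deriv_def by blast
  moreover have "(\<integral>x. u x * multi_deriv \<beta> (prodf ?H) x \<partial>lebesgue_on \<Omega>)
    = (-1) ^ mi_size \<beta> * (\<integral>x. g x * prodf ?H x \<partial>lebesgue_on \<Omega>)"
   using g box_product_test_function[OF H] unfolding has_weak_deriv_def by blast
  ultimately show ?thesis unfolding md by simp
 qed
 then show "(LBINT x. f x * prodf ?H x) = - (LBINT x. f' x * prodf G x)"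
  using integral_borel_rep[OF \<Omega> li(1) f, of "prodf ?H"] integral_borel_rep[OF \<Omega> li(2) f', of "prodf G"]
  by (cases "even (mi_size \<beta>)") simp_all
qed


section \<open>Integrals that depend on a parameter, and integrals of partial derivatives\<close>

lemma param_integrand_measurable:
 fixes f :: "'a::euclidean_space => real"
 assumes f: "f \<in> borel_measurable borel" and "compact C" and zero: "!!w. w \<notin> C ==> f w = 0"
  and k: "continuous_on C k"
 shows "(%w. f w * k w) \<in> borel_measurable borel"
proof -
 have [measurable]: "(%w. indicator C w *\<^sub>R k w) \<in> borel_measurable borel"
  using k \<open>compact C\<close> by (intro borel_measurable_continuous_on_indicator) (auto simp: borel_compact)
 note [measurable] = f
 have "(%w. f w * (indicator C w *\<^sub>R k w)) \<in> borel_measurable borel" by measurable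
 also have "(%w. f w * (indicator C w *\<^sub>R k w)) = (%w. f w * k w)" using zero by (auto simp: fun_eq_iff indicator_def)
 finally show ?thesis .
qed

lemma continuous_param_integral:
 fixes f :: "'a::euclidean_space => real" and K :: "'b::metric_space => 'a => real"
 assumes f: "integrable lborel f" and zero: "!!w. w \<notin> C ==> f w = 0" and "compact C" "compact A"
  and K: "continuous_on (A \<times> C) (%z. K (fst z) (snd z))"
 shows "continuous_on A (%y. \<integral>w. f w * K y w \<partial>lborel)"
  and "!!y. y \<in> A ==> integrable lborel (%w. f w * K y w)"
proof -
 have "compact ((%z. K (fst z) (snd z)) ` (A \<times> C))" using assms by (intro compact_continuous_image compact_Times)
 then obtain B0 where B0: "!!y w. y \<in> A ==> w \<in> C ==> \<bar>K y w\<bar> <= B0"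
  using compact_imp_bounded by (force simp: bounded_iff)
 have bd: "\<bar>f w * K y w\<bar> <= B0 * \<bar>f w\<bar>" if "y \<in> A" for y w
  using B0[OF that, of w] zero[of w] mult_left_mono[of "\<bar>K y w\<bar>" B0 "\<bar>f w\<bar>"]
  by (cases "w \<in> C") (auto simp: abs_mult mult.commute)
 have Kc: "continuous_on C (K y)" if "y \<in> A" for y
  by (rule continuous_on_compose2[OF K, of C "%w. (y, w)", simplified]) (use that in "auto intro!: continuous_intros")
 have m: "(%w. f w * K y w) \<in> borel_measurable borel" if "y \<in> A" for y
  by (rule param_integrand_measurable[of f C]) (use borel_measurable_integrable[OF f] assms Kc that in auto)
 show int: "integrable lborel (%w. f w * K y w)" if "y \<in> A" for y
  by (rule Bochner_Integration.integrable_bound[of _ "%w. B0 * \<bar>f w\<bar>"])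
    (use f m[OF that] bd[OF that] in "auto intro: order_trans[OF _ abs_ge_self]")
 show "continuous_on A (%y. \<integral>w. f w * K y w \<partial>lborel)" unfolding continuous_on_sequentially comp_def
 proof (intro allI ballI impI)
  fix x a assume a: "a \<in> A" and x: "(\<forall>n. x n \<in> A) \<and> x \<longlonglongrightarrow> a"
  show "(%n. \<integral>w. f w * K (x n) w \<partial>lborel) \<longlonglongrightarrow> (LBINT w. f w * K a w)"
  proof (rule integral_dominated_convergence[where w = "%w. B0 * \<bar>f w\<bar>"])
   show "(%w. f w * K a w) \<in> borel_measurable lborel" "!!n. (%w. f w * K (x n) w) \<in> borel_measurable lborel" using m a x by auto
   show "integrable lborel (%w. B0 * \<bar>f w\<bar>)" using f by simp
   show "AE w in lborel. norm (f w * K (x n) w) <= B0 * \<bar>f w\<bar>" for n using bd x by auto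
   show "AE w in lborel. (%n. f w * K (x n) w) \<longlonglongrightarrow> f w * K a w" proof (intro always_eventually allI)
    fix w
    show "(%n. f w * K (x n) w) \<longlonglongrightarrow> f w * K a w" proof (cases "w \<in> C")
     case True
     have "(%n. K (fst (x n, w)) (snd (x n, w))) \<longlonglongrightarrow> K (fst (a, w)) (snd (a, w))"
      by (rule continuous_on_tendsto_compose[OF K]) (use x a True in "auto intro!: tendsto_intros")
     then show ?thesis by (auto intro!: tendsto_intros)
    qed (simp add: zero)
   qed
  qed
 qed
qed

lemma deriv_param_integral:
 fixes f :: "'a::euclidean_space => real" and K :: "real => 'a => real"
 assumes f: "integrable lborel f" and zero: "!!w. w \<notin> C ==> f w = 0" and C: "compact C"
  and t: "t \<in> {a<..<b}"
  and D: "!!s w. s \<in> {a..b} ==> w \<in> C ==> ((%s. K s w) has_real_derivative K' s w) (at s)"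
  and Kc: "continuous_on ({a..b} \<times> C) (%z. K (fst z) (snd z))"
  and K': "continuous_on ({a..b} \<times> C) (%z. K' (fst z) (snd z))"
 shows "((%s. \<integral>w. f w * K s w \<partial>lborel) has_real_derivative (LBINT w. f w * K' t w)) (at t)"
proof -
 have "compact ((%z. K' (fst z) (snd z)) ` ({a..b} \<times> C))" using assms by (intro compact_continuous_image compact_Times) auto
 then obtain B0 where B0: "!!y w. y \<in> {a..b} ==> w \<in> C ==> \<bar>K' y w\<bar> <= B0"
  using compact_imp_bounded by (force simp: bounded_iff)
 have int: "integrable lborel (%w. f w * K s w)" if "s \<in> {a..b}" for s
  by (rule continuous_param_integral(2)[OF f _ C compact_Icc Kc]) (use zero that in auto)
 have int': "integrable lborel (%w. f w * K' s w)" if "s \<in> {a..b}" for s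
  by (rule continuous_param_integral(2)[OF f _ C compact_Icc K']) (use zero that in auto)
 let ?q = "%s w. (K s w - K t w) / (s - t)"
 have "((%s. ((LBINT w. f w * K s w) - (LBINT w. f w * K t w)) / (s - t)) \<longlongrightarrow>
   (LBINT w. f w * K' t w)) (at t within {a<..<b})" unfolding tendsto_at_iff_sequentially comp_def proof (intro allI impI)
  fix X assume X: "\<forall>i. X i \<in> {a<..<b} - {t}" and lim: "X \<longlonglongrightarrow> t"
  have Xab: "X n \<in> {a..b}" "t \<in> {a..b}" "X n ~= t" for n using X t by (auto simp: less_imp_le)
  have "(%n. \<integral>w. f w * ?q (X n) w \<partial>lborel) \<longlonglongrightarrow> (LBINT w. f w * K' t w)"
  proof (rule integral_dominated_convergence[where w = "%w. B0 * \<bar>f w\<bar>"])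
   show "integrable lborel (%w. B0 * \<bar>f w\<bar>)" using f by simp
   show "(%w. f w * K' t w) \<in> borel_measurable lborel" using int'[OF Xab(2)] by (rule borel_measurable_integrable)
   have "(%w. (f w * K (X n) w - f w * K t w) / (X n - t)) \<in> borel_measurable lborel" for n
    using int[OF Xab(1)[of n]] int[OF Xab(2)] by (intro borel_measurable_divide borel_measurable_diff borel_measurable_integrable) auto
   then show "(%w. f w * ?q (X n) w) \<in> borel_measurable lborel" for n by (simp add: algebra_simps)
   show "AE w in lborel. (%n. f w * ?q (X n) w) \<longlonglongrightarrow> f w * K' t w" proof (intro always_eventually allI)
    fix w
    show "(%n. f w * ?q (X n) w) \<longlonglongrightarrow> f w * K' t w" proof (cases "w \<in> C")
     case True
     then have "((%s. ?q s w) \<longlongrightarrow> K' t w) (at t)" using D[OF Xab(2)] by (simp add: has_field_derivative_iff)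
     then have "(%n. ?q (X n) w) \<longlonglongrightarrow> K' t w" using lim Xab(3) unfolding tendsto_at_iff_sequentially comp_def by auto
     then show ?thesis by (intro tendsto_intros)
    qed (simp add: zero)
   qed
   show "AE w in lborel. norm (f w * ?q (X n) w) <= B0 * \<bar>f w\<bar>" for n proof (intro always_eventually allI)
    fix w
    show "norm (f w * ?q (X n) w) <= B0 * \<bar>f w\<bar>" proof (cases "w \<in> C")
     case True
     have "norm (K (X n) w - K t w) <= B0 * norm (X n - t)" proof (rule field_differentiable_bound[of "{a..b}" "%s. K s w" "%s. K' s w"])
      show "((%s. K s w) has_field_derivative K' z w) (at z within {a..b})" if "z \<in> {a..b}" for z
       using D[OF that True] by (rule has_field_derivative_at_within)
     qed (use B0 True Xab(1)[of n] Xab(2) in auto)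
     then have "\<bar>?q (X n) w\<bar> <= B0" using Xab(3)[of n] by (simp add: field_simps abs_divide)
     then show ?thesis using mult_left_mono[of "\<bar>?q (X n) w\<bar>" B0 "\<bar>f w\<bar>"] by (simp add: abs_mult mult.commute)
    qed (simp add: zero)
   qed
  qed
  moreover have "(LBINT w. f w * ?q (X n) w) =
    ((LBINT w. f w * K (X n) w) - (LBINT w. f w * K t w)) / (X n - t)" for n proof -
   have "(LBINT w. f w * ?q (X n) w) = (LBINT w. (f w * K (X n) w - f w * K t w) / (X n - t))" by (simp add: algebra_simps)
   also have "... = (LBINT w. f w * K (X n) w - f w * K t w) / (X n - t)" by simp
   also have "(LBINT w. f w * K (X n) w - f w * K t w)
     = (LBINT w. f w * K (X n) w) - (LBINT w. f w * K t w)" by (rule Bochner_Integration.integral_diff) (use int Xab in auto)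
   finally show ?thesis .
  qed
  ultimately show "(%n. ((LBINT w. f w * K (X n) w) - (LBINT w. f w * K t w)) / (X n - t))
   \<longlonglongrightarrow> (LBINT w. f w * K' t w)" by (simp only:)
 qed
 moreover have "at t within {a<..<b} = at t" using t by (intro at_within_open) auto
 ultimately show ?thesis by (simp only: has_field_derivative_iff)
qed

lemma partial_deriv_line:
 assumes "f differentiable (at (x + t *\<^sub>R axis i 1))"
 shows "((%t. f (x + t *\<^sub>R axis i 1)) has_real_derivative partial_deriv i f (x + t *\<^sub>R axis i 1)) (at t)"
proof -
 let ?D = "frechet_derivative f (at (x + t *\<^sub>R axis i 1))"
 have D: "(f has_derivative ?D) (at (x + t *\<^sub>R axis i 1))" using assms frechet_derivative_works by blast
 have "((%t. f (x + t *\<^sub>R axis i 1)) has_derivative (%s. ?D (s *\<^sub>R axis i 1))) (at t)"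
  by (rule has_derivative_compose[where f = "%t. x + t *\<^sub>R axis i 1" and g = f, OF _ D]) (auto intro!: derivative_eq_intros)
 moreover have "?D (s *\<^sub>R axis i 1) = partial_deriv i f (x + t *\<^sub>R axis i 1) * s" for s
  using linear_scale[OF has_derivative_linear[OF D]] by (simp add: partial_deriv_def)
 ultimately show ?thesis by (simp add: has_field_derivative_def)
qed

lemma partial_deriv_zero_open:
 assumes "open U" "x \<in> U" "!!y. y \<in> U ==> f y = 0"
 shows "partial_deriv i f x = 0"
proof -
 have "(f has_derivative (%_. 0)) (at x)" by (rule has_derivative_transform_within_open[of "%_. 0" _ _ _ U]) (use assms in auto)
 then show ?thesis by (simp add: partial_derivI)
qed

lemma integral_translate_lborel:
 fixes f :: "'a::euclidean_space => real"
 assumes "f \<in> borel_measurable borel"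
 shows "(LBINT x. f (x + v)) = (LBINT x. f x)"
proof -
 have "(LBINT x. f x) = (\<integral>x. f x \<partial>distr lborel borel ((+) v))" by (simp add: lborel_distr_plus)
 also have "... = (LBINT x. f (v + x))" using assms by (subst integral_distr) auto
 finally show ?thesis by (simp add: add.commute)
qed

text \<open>Difference quotients of F integrate to 0 by translation invariance and converge to the
  partial derivative. They are dominated because all of them vanish outside the compact set swept by
  the box under translations of length at most 1.\<close>

lemma integral_partial_deriv_zero:
 fixes F :: "real^'d::finite => real"
 assumes diff: "!!x. F differentiable (at x)" and cont: "continuous_on UNIV (partial_deriv i F)"
  and zero: "!!x. x \<notin> cbox a b ==> F x = 0"
 shows "(LBINT x. partial_deriv i F x) = 0"
proof -
 let ?e = "axis i (1::real)" and ?D = "partial_deriv i F"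
 define S where "S = (%(x, t). x - t *\<^sub>R ?e) ` (cbox a b \<times> {0..1::real})"
 have S: "compact S" unfolding S_def
  by (intro compact_continuous_image compact_Times) (auto simp: case_prod_unfold intro!: continuous_intros)
 have zD: "?D x = 0" if "x \<notin> cbox a b" for x
  by (rule partial_deriv_zero_open[of "- cbox a b"]) (use that zero in "auto simp: open_Compl")
 have Fc: "continuous_on UNIV F" using diff by (simp add: continuous_at_imp_continuous_on differentiable_imp_continuous_within)
 note [measurable] = borel_measurable_continuous_onI[OF cont] borel_measurable_continuous_onI[OF Fc]
 have "compact (?D ` cbox a b)" by (intro compact_continuous_image continuous_on_subset[OF cont]) auto
 then obtain B0 where B0: "!!x. x \<in> cbox a b ==> \<bar>?D x\<bar> <= B0" using compact_imp_bounded by (force simp: bounded_iff)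
 have B: "\<bar>?D x\<bar> <= max B0 0" for x using B0[of x] zD[of x] by (cases "x \<in> cbox a b") auto
 let ?q = "%n x. real (Suc n) * (F (x + (1 / real (Suc n)) *\<^sub>R ?e) - F x)"
 have line: "((%t. F (x + t *\<^sub>R ?e)) has_real_derivative ?D (x + t *\<^sub>R ?e)) (at t)" for x t
  by (rule partial_deriv_line[OF diff])
 have "(%n. \<integral>x. ?q n x \<partial>lborel) \<longlonglongrightarrow> (LBINT x. ?D x)"
 proof (rule integral_dominated_convergence[where w = "%x. max B0 0 * indicator S x"])
  show "integrable lborel (%x. max B0 0 * indicator S x)" using S emeasure_bounded_finite[OF compact_imp_bounded[OF S]]
   by (intro integrable_mult_right integrable_real_indicator) (auto simp: borel_compact)
  show "AE x in lborel. (%n. ?q n x) \<longlonglongrightarrow> ?D x" proof (intro always_eventually allI)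
   fix x
   have "((%t. (F (x + t *\<^sub>R ?e) - F (x + 0 *\<^sub>R ?e)) / (t - 0)) \<longlongrightarrow> ?D (x + 0 *\<^sub>R ?e)) (at 0)"
    using line[of x 0] by (simp only: has_field_derivative_iff)
   moreover have "(%n. 1 / real (Suc n)) \<longlonglongrightarrow> 0" using LIMSEQ_Suc[OF lim_1_over_n] by simp
   ultimately have "(%n. (F (x + (1 / real (Suc n)) *\<^sub>R ?e) - F (x + 0 *\<^sub>R ?e)) / (1 / real (Suc n) - 0)) \<longlonglongrightarrow> ?D (x + 0 *\<^sub>R ?e)"
    unfolding tendsto_at_iff_sequentially comp_def by (elim allE[of _ "%n. 1 / real (Suc n)"]) (auto simp: add_eq_0_iff)
   then show "(%n. ?q n x) \<longlonglongrightarrow> ?D x" by (simp add: mult.commute)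
  qed
  show "AE x in lborel. norm (?q n x) <= max B0 0 * indicator S x" for n proof (intro always_eventually allI)
   fix x
   let ?t = "1 / real (Suc n)"
   show "norm (?q n x) <= max B0 0 * indicator S x" proof (cases "x \<in> S")
    case True
    have "norm (F (x + ?t *\<^sub>R ?e) - F (x + 0 *\<^sub>R ?e)) <= max B0 0 * norm (?t - 0)"
     by (rule field_differentiable_bound[of UNIV "%t. F (x + t *\<^sub>R ?e)" "%t. ?D (x + t *\<^sub>R ?e)"])
       (use line B in auto)
    then have "real (Suc n) * \<bar>F (x + ?t *\<^sub>R ?e) - F x\<bar> <= max B0 0" by (simp add: field_simps)
    then show ?thesis using True by (simp add: abs_mult)
   next
    case False
    have "x \<notin> cbox a b" using False unfolding S_def by (force simp: image_iff)
    moreover have "x + ?t *\<^sub>R ?e \<notin> cbox a b" proof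
     assume "x + ?t *\<^sub>R ?e \<in> cbox a b"
     then have "(%(x, t). x - t *\<^sub>R ?e) (x + ?t *\<^sub>R ?e, ?t) \<in> S" unfolding S_def by (intro imageI) auto
     then show False using False by simp
    qed
    ultimately show ?thesis using False zero by simp
   qed
  qed
 qed measurable
 moreover have "(LBINT x. ?q n x) = 0" for n proof -
  have int: "integrable lborel F" proof -
   have "integrable lborel (%x. indicator (cbox a b) x *\<^sub>R F x)"
    by (rule borel_integrable_compact) (auto intro: continuous_on_subset[OF Fc])
   also have "(%x. indicator (cbox a b) x *\<^sub>R F x) = F" using zero by (auto simp: fun_eq_iff indicator_def)
   finally show ?thesis .
  qed
  have int': "integrable lborel (%x. F (x + v))" for v proof -
   have "integrable (distr lborel borel ((+) v)) F" using int by (simp add: lborel_distr_plus)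
   then show ?thesis by (subst (asm) integrable_distr_eq) (auto simp: add.commute)
  qed
  have "(LBINT x. F (x + (1 / real (Suc n)) *\<^sub>R ?e) - F x) = 0" using int int' integral_translate_lborel[of F] by simp
  then show ?thesis by simp
 qed
 ultimately show ?thesis by (simp add: LIMSEQ_const_iff)
qed

lemma integral_prodf_deriv_zero:
 assumes "box_product \<Omega> G"
 shows "(LBINT x. prodf (G(i := deriv (G i))) x) = 0"
proof -
 obtain a b where ab: "!!i. smooth1 (G i)" "!!i t. t \<notin> {a $ i..b $ i} ==> G i t = 0" using assms unfolding box_product_def by metis
 have sm: "smooth1 ((G(i := deriv (G i))) j)" for j using ab(1) smooth1_deriv by simp
 have "(LBINT x. partial_deriv i (prodf G) x) = 0" proof (rule integral_partial_deriv_zero)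
  show "prodf G differentiable at x" for x using prodf_has_derivative[of G, OF ab(1)] by (auto simp: differentiable_def)
  show "continuous_on UNIV (partial_deriv i (prodf G))" unfolding partial_deriv_prodf[OF ab(1)] by (rule prodf_continuous[OF sm])
  show "prodf G x = 0" if "x \<notin> cbox a b" for x using ab(2) that by (rule prodf_zero_outside)
 qed
 then show ?thesis by (simp add: partial_deriv_prodf[OF ab(1)])
qed


section \<open>Averaged Taylor polynomials along a contraction\<close>


definition kern1 :: "(real => real) => real => real => nat => real => real" where
 "kern1 g y t n s = g (y + (s - y) / t) * (s - y) ^ n / t"

lemma smooth1_kern1:
 assumes "smooth1 g" shows "smooth1 (kern1 g y t n)"
proof -
 have "smooth1 (%s. (g ((1/t) * s + (y - y/t)) * (1 * s + - y) ^ n) * (1/t))"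
  by (intro smooth1_mult smooth1_affine[OF assms] smooth1_power smooth1_affine[OF smooth1_ident] smooth1_const)
 moreover have "(%s. (g ((1/t) * s + (y - y/t)) * (1 * s + - y) ^ n) * (1/t)) = kern1 g y t n"
  by (auto simp: kern1_def fun_eq_iff diff_divide_distrib algebra_simps)
 ultimately show ?thesis by simp
qed

lemma kern1_deriv_s:
 assumes "smooth1 g" "t ~= 0"
 shows "deriv (kern1 g y t (Suc n)) s =
  deriv g (y + (s - y) / t) * (s - y) ^ Suc n / t\<^sup>2 + g (y + (s - y) / t) * real (Suc n) * (s - y) ^ n / t"
proof -
 have 1: "((%s. g (y + (s - y) / t)) has_real_derivative deriv g (y + (s - y) / t) * (1 / t)) (at s)"
  by (rule DERIV_chain2[OF smooth1_has_deriv[OF assms(1)]]) (use assms(2) in "auto intro!: derivative_eq_intros")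
 have 2: "((%s. (s - y) ^ Suc n) has_real_derivative real (Suc n) * (s - y) ^ n) (at s)"
  by (rule DERIV_cong[OF DERIV_power[of "%s. s - y" 1 s UNIV "Suc n"]]) (auto intro!: derivative_eq_intros)
 show ?thesis unfolding kern1_def by (rule DERIV_imp_deriv, rule DERIV_cong, rule DERIV_cdivide[OF DERIV_mult[OF 1 2]])
    (use assms(2) in "simp add: field_simps power2_eq_square")
qed

text \<open>The t-derivative of the contracted kernel is an s-derivative of the kernel with one more
  factor s - y, plus a multiple of the kernel itself. The s-derivative can later be moved onto a
  weakly differentiable function.\<close>

lemma kern1_deriv_t:
 assumes "smooth1 g" "t ~= 0"
 shows "((%t. kern1 g y t n s) has_real_derivative
  - (1 / t) * deriv (kern1 g y t (Suc n)) s + real n / t * kern1 g y t n s) (at t)"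
proof -
 have 1: "((%t. g (y + (s - y) / t)) has_real_derivative deriv g (y + (s - y) / t) * (- (s - y) / t\<^sup>2)) (at t)"
  by (rule DERIV_chain2[OF smooth1_has_deriv[OF assms(1)]])
    (use assms(2) in "auto intro!: derivative_eq_intros simp: power2_eq_square")
 have 2: "((%t. g (y + (s - y) / t) * (s - y) ^ n / t) has_real_derivative
   (deriv g (y + (s - y) / t) * (- (s - y) / t\<^sup>2) * (s - y) ^ n * t - g (y + (s - y) / t) * (s - y) ^ n * 1) / (t * t)) (at t)"
  by (rule DERIV_divide[OF DERIV_cmult_right[OF 1] DERIV_ident assms(2)])
 show ?thesis unfolding kern1_deriv_s[OF assms] unfolding kern1_def
  by (rule DERIV_cong[OF 2]) (use assms(2) in "simp add: field_simps power2_eq_square")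
qed

definition kfac :: "('d::finite => real => real) => real^'d => real => ('d => nat) => 'd => real => real" where
 "kfac G y t \<gamma> i = kern1 (G i) (y $ i) t (\<gamma> i)"

text \<open>The function \<open>w \<mapsto> t\<^sup>-\<^sup>d \<eta>(y + (w - y)/t) (w - y)\<^sup>\<gamma>\<close>, where \<open>\<eta> = prodf G\<close>.\<close>

definition kf :: "('d::finite => real => real) => real^'d => real => ('d => nat) => real^'d => real" where
 "kf G y t \<gamma> = prodf (kfac G y t \<gamma>)"

text \<open>The i-th partial derivative of \<open>kf G y t (mi_inc \<gamma> i)\<close>, written as a
  product so that \<open>weak_partial\<close> applies to it.\<close>

definition kfd :: "('d::finite => real => real) => real^'d => real => ('d => nat) => 'd => real^'d => real" where
 "kfd G y t \<gamma> i =
   prodf ((kfac G y t (mi_inc \<gamma> i))(i := deriv (kfac G y t (mi_inc \<gamma> i) i)))"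

lemma kfd_eq:
 "kfd G y t \<gamma> i w = deriv (kern1 (G i) (y $ i) t (Suc (\<gamma> i))) (w $ i) *
   (\<Prod>j\<in>UNIV - {i}. kern1 (G j) (y $ j) t (\<gamma> j) (w $ j))"
 unfolding kfd_def prodf_upd by (auto simp: kfac_def mi_inc_def intro!: prod.cong)

lemma kf_deriv_t:
 assumes sm: "!!i. smooth1 (G i)" and t: "t ~= 0"
 shows "((%t. kf G y t \<gamma> w) has_real_derivative
   - (1 / t) * (\<Sum>i\<in>UNIV. kfd G y t \<gamma> i w) + real (mi_size \<gamma>) / t * kf G y t \<gamma> w) (at t)"
proof -
 let ?k = "%i t. kern1 (G i) (y $ i) t (\<gamma> i) (w $ i)"
 let ?d = "%i. - (1 / t) * deriv (kern1 (G i) (y $ i) t (Suc (\<gamma> i))) (w $ i) + real (\<gamma> i) / t * ?k i t"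
 have "((%t. ?k i t) has_derivative (%s. s * ?d i)) (at t)" for i using kern1_deriv_t[OF sm t, of i "y $ i" "\<gamma> i" "w $ i"]
  by (simp only: has_field_derivative_def mult_commute_abs)
 then have "((%t. \<Prod>i\<in>UNIV. ?k i t) has_derivative
   (%s. \<Sum>i\<in>UNIV. s * ?d i * (\<Prod>j\<in>UNIV - {i}. ?k j t))) (at t)" by (rule has_derivative_prod)
 moreover have "(\<Sum>i\<in>UNIV. s * ?d i * (\<Prod>j\<in>UNIV - {i}. ?k j t)) =
   (- (1 / t) * (\<Sum>i\<in>UNIV. kfd G y t \<gamma> i w) + real (mi_size \<gamma>) / t * kf G y t \<gamma> w) * s" for s proof -
  have kf: "?k i t * (\<Prod>j\<in>UNIV - {i}. ?k j t) = kf G y t \<gamma> w" for i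
   unfolding kf_def prodf_remove[of _ _ i] by (simp add: kfac_def)
  have "s * ?d i * (\<Prod>j\<in>UNIV - {i}. ?k j t) = s * (- (1 / t) * kfd G y t \<gamma> i w + real (\<gamma> i) / t * kf G y t \<gamma> w)" for i
   unfolding kfd_eq kf[of i, symmetric] by (simp only: algebra_simps)
  then have "(\<Sum>i\<in>UNIV. s * ?d i * (\<Prod>j\<in>UNIV - {i}. ?k j t)) =
   (\<Sum>i\<in>UNIV. s * (- (1 / t) * kfd G y t \<gamma> i w + real (\<gamma> i) / t * kf G y t \<gamma> w))" by (rule sum.cong[OF refl])
  also have "... = s * (- (1 / t) * (\<Sum>i\<in>UNIV. kfd G y t \<gamma> i w) + (\<Sum>i\<in>UNIV. real (\<gamma> i)) / t * kf G y t \<gamma> w)"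
   by (simp only: sum_distrib_left[symmetric] sum.distrib sum_distrib_right[symmetric] sum_divide_distrib[symmetric])
  finally show ?thesis by (simp add: mi_size_def mult.commute)
 qed
 moreover have "(%t. \<Prod>i\<in>UNIV. ?k i t) = (%t. kf G y t \<gamma> w)" by (simp add: kf_def prodf_def kfac_def)
 ultimately show ?thesis by (simp only: has_field_derivative_def)
qed

lemma kern1_continuous:
 assumes "smooth1 g" "continuous_on S y" "continuous_on S t" "continuous_on S s" "!!z. z \<in> S ==> t z ~= 0"
 shows "continuous_on S (%z. kern1 g (y z) (t z) n (s z))" unfolding kern1_def
 by (intro continuous_on_divide continuous_on_mult continuous_on_power
   smooth1_continuous_compose[OF assms(1)] continuous_on_add continuous_on_diff assms ballI)

lemma kf_continuous:
 assumes sm: "!!i. smooth1 (G i)" and c: "continuous_on S y" "continuous_on S t" "continuous_on S w" "!!z. z \<in> S ==> t z ~= 0"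
 shows "continuous_on S (%z. kf G (y z) (t z) \<gamma> (w z))" unfolding kf_def prodf_def kfac_def
 using c by (intro continuous_on_prod kern1_continuous[OF sm] continuous_on_component) auto

lemma kfd_continuous:
 assumes sm: "!!i. smooth1 (G i)" and c: "continuous_on S y" "continuous_on S t" "continuous_on S w" "!!z. z \<in> S ==> t z ~= 0"
 shows "continuous_on S (%z. kfd G (y z) (t z) \<gamma> i (w z))"
proof -
 have 1: "continuous_on S (%z. deriv (G i) (y z $ i + (w z $ i - y z $ i) / t z) * (w z $ i - y z $ i) ^ Suc (\<gamma> i) / (t z)\<^sup>2
   + G i (y z $ i + (w z $ i - y z $ i) / t z) * real (Suc (\<gamma> i)) * (w z $ i - y z $ i) ^ \<gamma> i / t z)"
  by (intro continuous_on_add continuous_on_divide continuous_on_mult continuous_on_power continuous_on_const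
   smooth1_continuous_compose[OF sm] smooth1_continuous_compose[OF smooth1_deriv[OF sm]] continuous_on_diff
   continuous_on_component c) (simp_all add: c(4) Ball_def)
 have 2: "continuous_on S (%z. deriv (kern1 (G i) (y z $ i) (t z) (Suc (\<gamma> i))) (w z $ i))"
  by (rule continuous_on_eq[OF 1]) (simp only: kern1_deriv_s[OF sm c(4)])
 show ?thesis unfolding kfd_eq by (intro continuous_on_mult 2 continuous_on_prod kern1_continuous[OF sm] c continuous_on_component)
qed

lemma kern1_zero:
 assumes "!!s. s \<notin> {a..b} ==> g s = 0" "t > 0" "s \<notin> {y + t * (a - y)..y + t * (b - y)}"
 shows "kern1 g y t n s = 0"
proof -
 have "y + (s - y) / t \<notin> {a..b}" using assms(2,3) by (auto simp: field_simps)
 then show ?thesis using assms(1) by (simp add: kern1_def)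
qed

lemma kf_zero:
 assumes "!!i s. s \<notin> {a $ i..b $ i} ==> G i s = 0" "t > 0" "w \<notin> cbox (y + t *\<^sub>R (a - y)) (y + t *\<^sub>R (b - y))"
 shows "kf G y t \<gamma> w = 0" unfolding kf_def
 by (rule prodf_zero_outside[OF _ assms(3)]) (use kern1_zero[OF assms(1,2)] in "auto simp: kfac_def")

lemma box_product_kfac:
 assumes "!!i. smooth1 (G i)" "!!i s. s \<notin> {a $ i..b $ i} ==> G i s = 0" "t > 0"
  and "cbox (y + t *\<^sub>R (a - y)) (y + t *\<^sub>R (b - y)) \<subseteq> \<Omega>"
 shows "box_product \<Omega> (kfac G y t \<gamma>)" unfolding box_product_def
proof (intro conjI exI allI impI)
 show "smooth1 (kfac G y t \<gamma> i)" for i unfolding kfac_def by (intro smooth1_kern1 assms)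
 show "kfac G y t \<gamma> i s = 0"
  if "s \<notin> {(y + t *\<^sub>R (a - y)) $ i..(y + t *\<^sub>R (b - y)) $ i}" for i s
  unfolding kfac_def by (rule kern1_zero[OF assms(2,3)]) (use that in auto)
qed (fact assms(4))

text \<open>Differentiation in t produces partial derivatives of the kernel in w, and integration by
  parts moves them to V: the order of the derivative of V and the degree of the monomial both grow
  by one. This is what makes the Taylor terms telescope.\<close>

lemma kf_integral_deriv:
 assumes V: "integrable lborel V" "!!w. w \<notin> \<Omega> ==> V w = 0" and "bounded \<Omega>"
  and weak: "!!i. weak_partial \<Omega> i V (V' i)"
  and sm: "!!i. smooth1 (G i)" and supp: "!!i s. s \<notin> {a $ i..b $ i} ==> G i s = 0" and t: "t > 0"
  and sub: "cbox (y + t *\<^sub>R (a - y)) (y + t *\<^sub>R (b - y)) \<subseteq> \<Omega>"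
 shows "((%t. \<integral>w. V w * kf G y t \<gamma> w \<partial>lborel) has_real_derivative
   (1 / t) * ((\<Sum>i\<in>UNIV. \<integral>w. V' i w * kf G y t (mi_inc \<gamma> i) w \<partial>lborel)
    + real (mi_size \<gamma>) * (LBINT w. V w * kf G y t \<gamma> w))) (at t)"
proof -
 let ?C = "closure \<Omega>" and ?A = "{t/2..2*t}"
 have zero: "V w = 0" if "w \<notin> ?C" for w using V(2) that closure_subset by blast
 let ?K' = "%t w. - (1 / t) * (\<Sum>i\<in>UNIV. kfd G y t \<gamma> i w) + real (mi_size \<gamma>) / t * kf G y t \<gamma> w"
 have D: "((%t. \<integral>w. V w * kf G y t \<gamma> w \<partial>lborel) has_real_derivative (LBINT w. V w * ?K' t w)) (at t)"
 proof (rule deriv_param_integral[OF V(1) zero])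
  show "compact ?C" using \<open>bounded \<Omega>\<close> by (simp add: compact_closure)
  show "t \<in> {t/2<..<2*t}" using t by auto
  show "((%t. kf G y t \<gamma> w) has_real_derivative ?K' s w) (at s)" if "s \<in> ?A" for s w
   by (rule kf_deriv_t[OF sm]) (use that t in auto)
  show "continuous_on (?A \<times> ?C) (%z. kf G y (fst z) \<gamma> (snd z))"
   by (rule kf_continuous[OF sm]) (use t in "auto intro!: continuous_intros")
  show "continuous_on (?A \<times> ?C) (%z. ?K' (fst z) (snd z))"
   by (intro continuous_on_add continuous_on_mult continuous_on_minus continuous_on_sum continuous_on_divide
     kf_continuous[OF sm] kfd_continuous[OF sm] continuous_on_const continuous_on_fst continuous_on_snd continuous_on_id)
     (use t in auto)
 qed
 have bp: "box_product \<Omega> (kfac G y t \<delta>)" for \<delta> by (rule box_product_kfac[OF sm supp t sub])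
 have int: "integrable lborel (%w. V w * prodf H w)" if H: "box_product \<Omega> H" for H proof -
  obtain B where B: "!!x. \<bar>prodf H x\<bar> <= B" using box_product_bounded[OF H] by blast
  show ?thesis by (rule integrable_mult_bounded[OF V(1) _ B]) (use prodf_measurable[of H] H in "auto simp: box_product_def")
 qed
 have ik: "integrable lborel (%w. V w * kf G y t \<gamma> w)" unfolding kf_def by (rule int[OF bp])
 have id: "integrable lborel (%w. V w * kfd G y t \<gamma> i w)" for i unfolding kfd_def by (rule int[OF box_product_upd[OF bp]])
 have wp: "(LBINT w. V w * kfd G y t \<gamma> i w) = - (LBINT w. V' i w * kf G y t (mi_inc \<gamma> i) w)" for i
  using weak[of i] bp[of "mi_inc \<gamma> i"] unfolding weak_partial_def kfd_def kf_def by blast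
 have "(LBINT w. V w * ?K' t w) =
   (LBINT w. - (1 / t) * (\<Sum>i\<in>UNIV. V w * kfd G y t \<gamma> i w) + real (mi_size \<gamma>) / t * (V w * kf G y t \<gamma> w))"
  by (rule Bochner_Integration.integral_cong) (simp_all only: sum_distrib_left[symmetric] algebra_simps)
 also have "... = - (1 / t) * (\<Sum>i\<in>UNIV. \<integral>w. V w * kfd G y t \<gamma> i w \<partial>lborel)
   + real (mi_size \<gamma>) / t * (LBINT w. V w * kf G y t \<gamma> w)" using ik id by (subst Bochner_Integration.integral_add)
   (auto intro!: Bochner_Integration.integrable_sum simp: Bochner_Integration.integral_sum simp del: mult_minus_left)
 also have "... = (1 / t) * ((\<Sum>i\<in>UNIV. \<integral>w. V' i w * kf G y t (mi_inc \<gamma> i) w \<partial>lborel)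
    + real (mi_size \<gamma>) * (LBINT w. V w * kf G y t \<gamma> w))"
  unfolding wp sum_negf by (simp only: minus_mult_minus distrib_left) simp
 finally show ?thesis using D by simp
qed

definition mi_fact :: "('d::finite => nat) => real" where
 "mi_fact \<gamma> = (\<Prod>i\<in>UNIV. fact (\<gamma> i))"

lemma mi_fact_pos: "mi_fact \<gamma> > 0" unfolding mi_fact_def by (intro prod_pos) auto

lemma mi_fact_inc: "mi_fact (mi_inc \<gamma> i) = real (Suc (\<gamma> i)) * mi_fact \<gamma>"
proof -
 have "mi_fact (mi_inc \<gamma> i) = fact (Suc (\<gamma> i)) * (\<Prod>j\<in>UNIV - {i}. fact (mi_inc \<gamma> i j))"
  unfolding mi_fact_def by (subst prod.remove[of UNIV i]) (auto simp: mi_inc_def)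
 also have "(\<Prod>j\<in>UNIV - {i}. fact (mi_inc \<gamma> i j)) = (\<Prod>j\<in>UNIV - {i}. fact (\<gamma> j) :: real)"
  by (rule prod.cong) (auto simp: mi_inc_def)
 finally show ?thesis unfolding mi_fact_def by (subst prod.remove[of UNIV i]) auto
qed

lemma finite_mi_size_eq [simp]: "finite {\<beta> :: 'd::finite => nat. mi_size \<beta> = k}"
 by (rule finite_subset[OF _ finite_mi_size_le[of k]]) auto

text \<open>A multi-index \<delta> of size n + 1 arises as \<gamma> + e_i once for each i with
  \<delta>_i > 0, and the quotient of the factorials contributes \<delta>_i. These numbers add up to
  n + 1.\<close>

lemma sum_mi_inc:
 fixes f :: "('d::finite => nat) => real"
 shows "(\<Sum>\<gamma> | mi_size \<gamma> = n. (\<Sum>i\<in>UNIV. f (mi_inc \<gamma> i)) / mi_fact \<gamma>)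
  = real (Suc n) * (\<Sum>\<gamma> | mi_size \<gamma> = Suc n. f \<gamma> / mi_fact \<gamma>)"
proof -
 let ?A = "SIGMA \<gamma>:{\<gamma> :: 'd => nat. mi_size \<gamma> = n}. (UNIV :: 'd set)"
 let ?B = "SIGMA \<delta>:{\<delta> :: 'd => nat. mi_size \<delta> = Suc n}. {i. \<delta> i > 0}"
 have "(\<Sum>\<gamma> | mi_size \<gamma> = n. (\<Sum>i\<in>UNIV. f (mi_inc \<gamma> i)) / mi_fact \<gamma>)
   = (\<Sum>(\<gamma>, i)\<in>?A. f (mi_inc \<gamma> i) / mi_fact \<gamma>)" unfolding sum_divide_distrib by (rule sum.Sigma) auto
 also have "... = (\<Sum>(\<delta>, i)\<in>?B. real (\<delta> i) * f \<delta> / mi_fact \<delta>)"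
 proof (rule sum.reindex_bij_witness[where i = "%(\<delta>, i). (\<delta>(i := \<delta> i - 1), i)" and j = "%(\<gamma>, i). (mi_inc \<gamma> i, i)"])
  fix z assume "z \<in> ?B"
  then obtain \<delta> i where z: "z = (\<delta>, i)" "mi_size \<delta> = Suc n" "\<delta> i > 0" by auto
  then have inc: "mi_inc (\<delta>(i := \<delta> i - 1)) i = \<delta>" by (auto simp: mi_inc_def fun_eq_iff)
  then have "mi_size (\<delta>(i := \<delta> i - 1)) = n" using mi_size_inc[of "\<delta>(i := \<delta> i - 1)" i] z(2) by simp
  then show "(case z of (\<delta>, i) => (\<delta>(i := \<delta> i - 1), i)) \<in> ?A" using z by simp
  show "(case (case z of (\<delta>, i) => (\<delta>(i := \<delta> i - 1), i)) of (\<gamma>, i) => (mi_inc \<gamma> i, i)) = z"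
   using z inc by simp
 next
  fix z assume "z \<in> ?A"
  then obtain \<gamma> i where z: "z = (\<gamma>, i)" "mi_size \<gamma> = n" by auto
  have inv: "(mi_inc \<gamma> i)(i := mi_inc \<gamma> i i - 1) = \<gamma>" and ii: "mi_inc \<gamma> i i = Suc (\<gamma> i)"
   by (auto simp: mi_inc_def)
  show "(case (case z of (\<gamma>, i) => (mi_inc \<gamma> i, i)) of (\<delta>, i) => (\<delta>(i := \<delta> i - 1), i)) = z"
   using inv by (simp add: z)
  show "(case z of (\<gamma>, i) => (mi_inc \<gamma> i, i)) \<in> ?B" using z ii by simp
  show "(case (case z of (\<gamma>, i) => (mi_inc \<gamma> i, i)) of (\<delta>, i) => real (\<delta> i) * f \<delta> / mi_fact \<delta>)
    = (case z of (\<gamma>, i) => f (mi_inc \<gamma> i) / mi_fact \<gamma>)"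
   unfolding z prod.case ii mi_fact_inc using mi_fact_pos[of \<gamma>] by (simp del: of_nat_Suc)
 qed
 also have "... = (\<Sum>\<delta> | mi_size \<delta> = Suc n. \<Sum>i | \<delta> i > 0. real (\<delta> i) * f \<delta> / mi_fact \<delta>)"
  by (rule sum.Sigma[symmetric]) auto
 also have "... = (\<Sum>\<delta> | mi_size \<delta> = Suc n. real (Suc n) * (f \<delta> / mi_fact \<delta>))"
 proof (rule sum.cong[OF refl])
  fix \<delta> :: "'d => nat" assume "\<delta> \<in> {\<delta>. mi_size \<delta> = Suc n}"
  then have "real (Suc n) = (\<Sum>i\<in>UNIV. real (\<delta> i))" by (simp add: mi_size_def flip: of_nat_sum)
  also have "... = (\<Sum>i | \<delta> i > 0. real (\<delta> i))" by (rule sum.mono_neutral_right) auto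
  finally show "(\<Sum>i | \<delta> i > 0. real (\<delta> i) * f \<delta> / mi_fact \<delta>) = real (Suc n) * (f \<delta> / mi_fact \<delta>)"
   by (simp add: sum_distrib_right sum_divide_distrib)
 qed
 finally show ?thesis by (simp add: sum_distrib_left)
qed


section \<open>The limit of the contracted kernels as t tends to 0\<close>

lemma integral_lborel_affine:
 fixes f :: "'a::euclidean_space => real"
 assumes [measurable]: "f \<in> borel_measurable borel" and "c ~= 0"
 shows "(LBINT y. f y) = \<bar>c\<bar> ^ DIM('a) * (LBINT z. f (w + c *\<^sub>R z))"
proof -
 have "(LBINT y. f y) = (\<integral>y. f y \<partial>density (distr lborel borel (%x. w + c *\<^sub>R x)) (%_. ennreal (\<bar>c\<bar> ^ DIM('a))))"
  by (subst lborel_affine[OF \<open>c ~= 0\<close>, of w]) (simp add: ennreal_power)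
 also have "... = (\<integral>y. \<bar>c\<bar> ^ DIM('a) * f y \<partial>distr lborel borel (%x. w + c *\<^sub>R x))"
  by (subst integral_density) auto
 also have "... = (LBINT z. \<bar>c\<bar> ^ DIM('a) * f (w + c *\<^sub>R z))" by (subst integral_distr) auto
 finally show ?thesis by simp
qed

lemma integrable_indicator_times:
 fixes V :: "'b::euclidean_space => real"
 assumes V: "integrable lborel V" and C: "compact (C :: 'a::euclidean_space set)"
 shows "integrable lborel (%z. indicator C (fst z) * V (snd z))"
proof -
 note [measurable] = borel_measurable_integrable[OF V]
 have [measurable]: "C \<in> sets borel" using C by (simp add: borel_compact)
 have "integrable (lborel \<Otimes>\<^sub>M lborel) (%z. indicator C (fst z) * V (snd z))" proof (rule lborel_pair.Fubini_integrable)
  show "(%z. indicator C (fst z) * V (snd z)) \<in> borel_measurable (lborel \<Otimes>\<^sub>M lborel)" by measurable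
  have "integrable lborel (indicator C :: 'a => real)" using C emeasure_bounded_finite[OF compact_imp_bounded[OF C]]
   by (intro integrable_real_indicator) (auto simp: borel_compact)
  then have "integrable lborel (%x. indicator C x * (LBINT y. norm (V y)))" by simp
  then show "integrable lborel (%x. \<integral>y. norm (indicator C (fst (x, y)) * V (snd (x, y))) \<partial>lborel)"
   by (simp add: abs_mult)
  show "AE x in lborel. integrable lborel (%y. indicator C (fst (x, y)) * V (snd (x, y)))" using V by simp
 qed
 then show ?thesis by (simp add: lborel_prod)
qed

lemma integrable_times_continuous:
 fixes f :: "'a::euclidean_space => real"
 assumes f: "integrable lborel f" and zero: "!!w. w \<notin> C ==> f w = 0" and "compact C" and k: "continuous_on C k"
 shows "integrable lborel (%w. f w * k w)"
proof (rule continuous_param_integral(2)[OF f zero \<open>compact C\<close>, of "{0::real}" "%_. k" 0])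
 show "continuous_on ({0::real} \<times> C) (%z. k (snd z))" by (rule continuous_on_compose2[OF k]) (auto intro!: continuous_intros)
qed auto

lemma param_fubini:
 fixes V :: "'b::euclidean_space => real" and K :: "'a::euclidean_space => 'b => real"
 assumes V: "integrable lborel V" and zero: "!!w. w \<notin> C1 ==> V w = 0" and C: "compact C1" "compact C2"
  and K: "continuous_on (C2 \<times> C1) (%z. K (fst z) (snd z))"
 shows "(LBINT y. indicator C2 y * (LBINT w. V w * K y w))
   = (LBINT w. V w * (LBINT y. indicator C2 y * K y w))"
  and "(LBINT z. indicator C2 (fst z) * V (snd z) * K (fst z) (snd z))
   = (LBINT w. V w * (LBINT y. indicator C2 y * K y w))"
proof -
 have zero': "V w ~= 0 ==> w \<in> C1" for w using zero by blast
 have "integrable lborel (%z. (indicator C2 (fst z) * V (snd z)) * K (fst z) (snd z))"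
  by (rule integrable_times_continuous[where C = "C2 \<times> C1"])
    (use integrable_indicator_times[OF V C(2)] zero' C K in "auto intro: compact_Times simp: indicator_def")
 then have int: "integrable (lborel \<Otimes>\<^sub>M lborel) (%(y, w). indicator C2 y * V w * K y w)"
  by (simp add: lborel_prod case_prod_beta')
 have 1: "(LBINT y. indicator C2 y * (LBINT w. V w * K y w))
  = (LBINT y. (LBINT w. indicator C2 y * V w * K y w))" by (simp add: mult.assoc)
 have 2: "(LBINT w. V w * (LBINT y. indicator C2 y * K y w))
  = (LBINT w. (LBINT y. indicator C2 y * V w * K y w))" unfolding integral_mult_right_zero[symmetric] by (simp add: ac_simps)
 show "(LBINT y. indicator C2 y * (LBINT w. V w * K y w))
   = (LBINT w. V w * (LBINT y. indicator C2 y * K y w))" unfolding 1 2 by (rule lborel_pair.Fubini_integral[OF int, symmetric])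
 show "(LBINT z. indicator C2 (fst z) * V (snd z) * K (fst z) (snd z))
   = (LBINT w. V w * (LBINT y. indicator C2 y * K y w))"
  unfolding 2 using lborel_pair.integral_snd[OF int] by (simp add: lborel_prod case_prod_beta')
qed

text \<open>The substitution y = w - tz removes the singular factor t^(-d): the bump is then
  evaluated at w + (1 - t)z and the monomial at tz, so the integrand is continuous up to t = 0.
  There the bump integrates to a constant, and monomials of positive degree vanish.\<close>

lemma kf_test_limit:
 fixes \<gamma> :: "'d::finite => nat"
 assumes V: "integrable lborel V" "!!w. w \<notin> \<Omega> ==> V w = 0" and \<Omega>: "bounded \<Omega>"
  and sm: "!!i. smooth1 (G i)" and supp: "!!i s. s \<notin> {a $ i..b $ i} ==> G i s = 0"
  and H: "continuous_on UNIV H" "!!y. y \<notin> cbox l u ==> H y = 0"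
 shows "((%t. \<integral>y. H y * (LBINT w. V w * kf G y t \<gamma> w) \<partial>lborel) \<longlongrightarrow>
  (if \<gamma> = (%_. 0) then (LBINT x. prodf G x) * (LBINT w. V w * H w) else 0)) (at_right 0)"
proof -
 let ?C = "closure \<Omega>"
 have zero: "V w = 0" if "w \<notin> ?C" for w using V(2) that closure_subset by blast
 have zero': "V w ~= 0 ==> w \<in> ?C" for w using zero by blast
 have cC: "compact ?C" using \<Omega> by (simp add: compact_closure)
 obtain R1 where R1: "!!w. w \<in> ?C ==> norm w <= R1" using compact_imp_bounded[OF cC] by (auto simp: bounded_iff)
 obtain R2 where R2: "!!w. w \<in> cbox a b ==> norm w <= R2" using bounded_cbox[of a b] by (auto simp: bounded_iff)
 \<comment> \<open>For t <= 1/2, a point w + (1 - t)z in the support of the bump has |z|/2 <=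
   \<open>R1 + R2\<close>, so this ball contains every z that matters.\<close>
 define Z where "Z = cball (0 :: real^'d) (2 * (R1 + R2))"
 have cZ: "compact Z" by (simp add: Z_def)
 define J where "J t w z = H (w - t *\<^sub>R z) * (prodf G (w + (1 - t) *\<^sub>R z) * (\<Prod>i\<in>UNIV. (t * z $ i) ^ \<gamma> i))" for t w z
 have zZ: "prodf G (w + (1 - t) *\<^sub>R z) = 0" if "z \<notin> Z" "w \<in> ?C" "t \<in> {0..1/2}" for w z t
 proof (rule prodf_zero_outside[OF supp])
  show "w + (1 - t) *\<^sub>R z \<notin> cbox a b" proof
   assume "w + (1 - t) *\<^sub>R z \<in> cbox a b"
   then have "norm (w + (1 - t) *\<^sub>R z) <= R2" by (rule R2)
   moreover have "norm ((1 - t) *\<^sub>R z) <= norm (w + (1 - t) *\<^sub>R z) + norm w"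
    by (metis add_diff_cancel_left' norm_triangle_ineq4)
   moreover have "norm w <= R1" using R1 that by blast
   moreover have "(1/2) * norm z <= (1 - t) * norm z" using that by (intro mult_right_mono) auto
   moreover have "norm ((1 - t) *\<^sub>R z) = (1 - t) * norm z" using that by simp
   ultimately have "(1/2) * norm z <= R1 + R2" by linarith
   then show False using that(1) by (simp add: Z_def)
  qed
 qed
 have Hc: "continuous_on S (%x. H (g x))" if "continuous_on S g" for S :: "'z::topological_space set" and g
  by (rule continuous_on_compose2[OF H(1) that]) auto
 have Gc: "continuous_on S (%x. prodf G (g x))" if "continuous_on S g" for S :: "'z::topological_space set" and g
  by (rule continuous_on_compose2[OF prodf_continuous[of G, OF sm, of UNIV] that]) auto
 have Jc: "continuous_on S (%x. J (t x) (w x) (z x))"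
  if "continuous_on S t" "continuous_on S w" "continuous_on S z" for S :: "'z::topological_space set" and t w z
  unfolding J_def by (intro continuous_on_mult Hc Gc continuous_on_prod continuous_on_power continuous_on_add
   continuous_on_diff continuous_on_scaleR continuous_on_const continuous_on_component that)
 define \<Phi> where "\<Phi> t = (LBINT x. (indicator Z (fst x) * V (snd x)) * J t (snd x) (fst x))" for t
 have "continuous_on {0..1/2} \<Phi>" unfolding \<Phi>_def proof (rule continuous_param_integral(1)[where C = "Z \<times> ?C"])
  show "integrable lborel (%x. indicator Z (fst x) * V (snd x))" by (rule integrable_indicator_times[OF V(1) cZ])
  show "continuous_on ({0..1/2::real} \<times> Z \<times> ?C) (%z. J (fst z) (snd (snd z)) (fst (snd z)))" by (intro Jc continuous_intros)
 qed (use zero' cZ cC in "auto intro: compact_Times simp: indicator_def")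
 then have lim: "(\<Phi> \<longlongrightarrow> \<Phi> 0) (at_right 0)" by (rule continuous_on_Icc_at_rightD) auto
 have \<Phi>: "\<Phi> t = (LBINT w. V w * (LBINT z. indicator Z z * J t w z))" for t unfolding \<Phi>_def
  by (rule param_fubini(2)[where K = "%z w. J t w z" and ?C1.0 = ?C and ?C2.0 = Z])
    (use V zero cZ cC in "auto intro!: Jc continuous_intros")
 have \<Phi>0: "\<Phi> 0 = (if \<gamma> = (%_. 0) then (LBINT x. prodf G x) * (LBINT w. V w * H w) else 0)" proof -
  have "V w * (LBINT z. indicator Z z * J 0 w z) =
    (if \<gamma> = (%_. 0) then (LBINT x. prodf G x) * (V w * H w) else 0)" for w proof (cases "w \<in> ?C")
   case True
   show ?thesis proof (cases "\<gamma> = (%_. 0)")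
    case g: True
    have "(LBINT z. indicator Z z * J 0 w z) = (LBINT z. H w * prodf G (z + w))"
     using zZ[OF _ True, of _ 0] by (intro Bochner_Integration.integral_cong) (auto simp: J_def g indicator_def add.commute)
    also have "... = H w * (LBINT x. prodf G x)" using integral_translate_lborel[OF prodf_measurable[of G, OF sm], of w] by simp
    finally show ?thesis using g by simp
   next
    case False
    then obtain i where "\<gamma> i ~= 0" by auto
    then have "(\<Prod>i\<in>UNIV. (0 * z $ i) ^ \<gamma> i) = 0" for z :: "real^'d" by (intro prod_zero) auto
    then have "J 0 w z = 0" for z unfolding J_def by simp
    then show ?thesis using False by simp
   qed
  qed (use zero in simp)
  then show ?thesis unfolding \<Phi> by simp
 qed
 have ev: "\<forall>\<^sub>F t in at_right 0. \<Phi> t = (LBINT y. H y * (LBINT w. V w * kf G y t \<gamma> w))" proof -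
  have "\<Phi> t = (LBINT y. H y * (LBINT w. V w * kf G y t \<gamma> w))" if t: "t \<in> {0<..<1/2}" for t proof -
   have kfc: "continuous_on S (%x. kf G (y x) t \<gamma> (w x))"
    if "continuous_on S y" "continuous_on S w" for S :: "'z::topological_space set" and y w
    by (rule kf_continuous[OF sm that(1) continuous_on_const that(2)]) (use t in auto)
   have "V w * (LBINT z. indicator Z z * J t w z) =
     V w * (LBINT y. indicator (cbox l u) y * (H y * kf G y t \<gamma> w))" for w proof (cases "w \<in> ?C")
    case True
    let ?f = "%y. H y * kf G y t \<gamma> w"
    have f: "?f \<in> borel_measurable borel" by (rule borel_measurable_continuous_onI) (intro continuous_on_mult H kfc continuous_intros)
    have "(LBINT y. indicator (cbox l u) y * ?f y) = (LBINT y. ?f y)"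
     using H(2) by (intro Bochner_Integration.integral_cong) (auto simp: indicator_def)
    also have "... = t ^ CARD('d) * (LBINT z. ?f (w + (- t) *\<^sub>R z))" using integral_lborel_affine[OF f, of "- t" w] t by simp
    also have "... = (LBINT z. t ^ CARD('d) * ?f (w + (- t) *\<^sub>R z))" by simp
    also have "... = (LBINT z. indicator Z z * J t w z)" proof (rule Bochner_Integration.integral_cong[OF refl])
     fix z
     have "kf G (w - t *\<^sub>R z) t \<gamma> w = (\<Prod>i\<in>UNIV. G i (w $ i + (1 - t) * z $ i) * (t * z $ i) ^ \<gamma> i * (1 / t))"
      unfolding kf_def prodf_def kfac_def kern1_def using t by (intro prod.cong) (auto simp: algebra_simps)
     also have "... = prodf G (w + (1 - t) *\<^sub>R z) * (\<Prod>i\<in>UNIV. (t * z $ i) ^ \<gamma> i) * (1 / t) ^ CARD('d)"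
      unfolding prod.distrib prodf_def by simp
     finally have "t ^ CARD('d) * ?f (w + (- t) *\<^sub>R z) = J t w z" using t by (simp add: J_def power_divide)
     then show "t ^ CARD('d) * ?f (w + (- t) *\<^sub>R z) = indicator Z z * J t w z"
      using zZ[OF _ True, of z t] t by (auto simp: indicator_def J_def)
    qed
    finally show ?thesis by simp
   qed (use zero in simp)
   then have "\<Phi> t = (LBINT w. V w * (LBINT y. indicator (cbox l u) y * (H y * kf G y t \<gamma> w)))"
    unfolding \<Phi> by (intro Bochner_Integration.integral_cong) auto
   also have "... = (LBINT y. indicator (cbox l u) y * (LBINT w. V w * (H y * kf G y t \<gamma> w)))"
    by (rule param_fubini(1)[where ?C1.0 = ?C, symmetric])
      (use V zero cC in "auto intro!: continuous_on_mult Hc kfc continuous_intros")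
   also have "... = (LBINT y. H y * (LBINT w. V w * kf G y t \<gamma> w))" proof (rule Bochner_Integration.integral_cong[OF refl])
    fix y
    have "(LBINT w. V w * (H y * kf G y t \<gamma> w)) = H y * (LBINT w. V w * kf G y t \<gamma> w)" by (simp add: mult.left_commute)
    then show "indicator (cbox l u) y * (LBINT w. V w * (H y * kf G y t \<gamma> w)) = H y * (LBINT w. V w * kf G y t \<gamma> w)"
     using H(2)[of y] by (auto simp: indicator_def)
   qed
   finally show ?thesis .
  qed
  then show ?thesis by (intro eventually_at_rightI[of 0 "1/2"]) auto
 qed
 show ?thesis using Lim_transform_eventually[OF lim ev] unfolding \<Phi>0 .
qed

text \<open>F - \<Psi> and -F - \<Psi> are nonincreasing in t, so F is Cauchy as t tends to 0, with
  error at most \<Psi>. The convergence of \<Psi> need not be uniform in y: for continuity of the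
  limit at y one fixes a t with \<open>\<Psi> y t\<close> small and uses that F and \<Psi> are
  continuous in y at this t.\<close>

lemma path_limit:
 fixes F D \<Psi> \<Psi>' :: "'a::metric_space => real => real"
 assumes F: "!!y t. y \<in> U ==> t \<in> {0<..1} ==> (F y has_real_derivative D y t) (at t)"
  and P: "!!y t. y \<in> U ==> t \<in> {0<..1} ==> (\<Psi> y has_real_derivative \<Psi>' y t) (at t)"
  and bd: "!!y t. y \<in> U ==> t \<in> {0<..1} ==> \<bar>D y t\<bar> <= \<Psi>' y t"
  and P0: "!!y t. y \<in> U ==> t \<in> {0<..1} ==> 0 <= \<Psi> y t" "!!y. y \<in> U ==> (\<Psi> y \<longlongrightarrow> 0) (at_right 0)"
  and Fc: "!!t. t \<in> {0<..1} ==> continuous_on U (%y. F y t)"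
  and Pc: "!!t. t \<in> {0<..1} ==> continuous_on U (%y. \<Psi> y t)"
 shows "\<exists>v. continuous_on U v \<and>
  (\<forall>y\<in>U. (F y \<longlongrightarrow> v y) (at_right 0) \<and> (\<forall>t\<in>{0<..1}. \<bar>F y t - v y\<bar> <= \<Psi> y 1))"
proof -
 have diff: "\<bar>F y t - F y s\<bar> <= \<Psi> y t - \<Psi> y s" if "y \<in> U" "0 < s" "s <= t" "t <= 1" for y s t proof -
  have "F y t - \<Psi> y t <= F y s - \<Psi> y s" proof (rule DERIV_nonpos_imp_nonincreasing[OF that(3), of "%t. F y t - \<Psi> y t"])
   fix x assume x: "s <= x" "x <= t"
   then have "x \<in> {0<..1}" using that by auto
   then show "\<exists>z. ((%t. F y t - \<Psi> y t) has_real_derivative z) (at x) \<and> z <= 0"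
    using F[OF that(1)] P[OF that(1)] bd[OF that(1), of x]
    by (intro exI[of _ "D y x - \<Psi>' y x"]) (auto intro!: derivative_intros simp: abs_le_iff)
  qed
  moreover have "- F y t - \<Psi> y t <= - F y s - \<Psi> y s"
  proof (rule DERIV_nonpos_imp_nonincreasing[OF that(3), of "%t. - F y t - \<Psi> y t"])
   fix x assume x: "s <= x" "x <= t"
   then have "x \<in> {0<..1}" using that by auto
   then show "\<exists>z. ((%t. - F y t - \<Psi> y t) has_real_derivative z) (at x) \<and> z <= 0"
    using F[OF that(1)] P[OF that(1)] bd[OF that(1), of x]
    by (intro exI[of _ "- D y x - \<Psi>' y x"]) (auto intro!: derivative_intros simp: abs_le_iff)
  qed
  ultimately show ?thesis by linarith
 qed
 have "\<exists>v. \<forall>t\<in>{0<..1}. \<bar>F y t - v\<bar> <= \<Psi> y t" if y: "y \<in> U" for y proof -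
  define X where "X n = F y (1 / real (Suc n))" for n
  have seq0: "filterlim (%n. 1 / real (Suc n)) (at_right 0) sequentially" using LIMSEQ_Suc[OF lim_1_over_n[where 'a=real]]
   by (intro filterlim_at_withinI) (auto intro!: always_eventually)
  have ps: "(%n. \<Psi> y (1 / real (Suc n))) \<longlonglongrightarrow> 0" by (rule filterlim_compose[OF P0(2)[OF y] seq0])
  have d: "\<bar>F y t - X n\<bar> <= \<Psi> y t" if "t \<in> {0<..1}" "1 / real (Suc n) <= t" for t n
   using diff[OF y, of "1 / real (Suc n)" t] P0(1)[OF y, of "1 / real (Suc n)"] that by (auto simp: X_def)
  have "Cauchy X" proof (rule metric_CauchyI)
   fix e :: real assume "e > 0"
   then obtain N where N: "\<Psi> y (1 / real (Suc N)) < e / 2"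
    using order_tendstoD(2)[OF ps, of "e/2"] by (auto simp: eventually_sequentially)
   have "dist (X m) (X n) < e" if "m >= N" "n >= N" for m n proof -
    have "\<bar>X N - X m\<bar> <= \<Psi> y (1 / real (Suc N))" "\<bar>X N - X n\<bar> <= \<Psi> y (1 / real (Suc N))"
     using d[of "1 / real (Suc N)" m] d[of "1 / real (Suc N)" n] that by (auto simp: X_def frac_le)
    then show ?thesis using N unfolding dist_real_def by linarith
   qed
   then show "\<exists>M. \<forall>m\<ge>M. \<forall>n\<ge>M. dist (X m) (X n) < e" by blast
  qed
  then obtain v where v: "X \<longlonglongrightarrow> v" using Cauchy_convergent convergent_def by blast
  have "\<bar>F y t - v\<bar> <= \<Psi> y t" if t: "t \<in> {0<..1}" for t proof (rule tendsto_upperbound)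
   show "(%n. \<bar>F y t - X n\<bar>) \<longlonglongrightarrow> \<bar>F y t - v\<bar>" by (intro tendsto_intros v)
   have "\<forall>\<^sub>F n in sequentially. 1 / real (Suc n) < t"
    using t by (intro order_tendstoD(2)[OF LIMSEQ_Suc[OF lim_1_over_n]]) auto
   then show "\<forall>\<^sub>F n in sequentially. \<bar>F y t - X n\<bar> <= \<Psi> y t" by eventually_elim (use d[OF t] in auto)
  qed auto
  then show ?thesis by blast
 qed
 then obtain v where v: "!!y t. y \<in> U ==> t \<in> {0<..1} ==> \<bar>F y t - v y\<bar> <= \<Psi> y t" by metis
 have "continuous_on U v" unfolding continuous_on_iff proof (intro ballI allI impI)
  fix y and e :: real assume y: "y \<in> U" and "e > 0"
  have "\<forall>\<^sub>F t in at_right 0. \<Psi> y t < e / 4" using P0(2)[OF y] \<open>e > 0\<close> by (intro order_tendstoD(2)) auto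
  moreover have "\<forall>\<^sub>F t in at_right (0::real). t \<in> {0<..1}" by (rule eventually_at_rightI[of 0 1]) auto
  ultimately have "\<forall>\<^sub>F t in at_right 0. \<Psi> y t < e / 4 \<and> t \<in> {0<..1}" by eventually_elim auto
  then obtain t where t: "\<Psi> y t < e / 4" "t \<in> {0<..1}"
   using eventually_happens[of _ "at_right (0::real)"] by (auto simp: trivial_limit_at_right_real)
  obtain d1 where d1: "d1 > 0" "!!z. z \<in> U ==> dist z y < d1 ==> dist (F z t) (F y t) < e / 4"
   using Fc[OF t(2)] y \<open>e > 0\<close> unfolding continuous_on_iff by (metis zero_less_divide_iff zero_less_numeral)
  obtain d2 where d2: "d2 > 0" "!!z. z \<in> U ==> dist z y < d2 ==> dist (\<Psi> z t) (\<Psi> y t) < e / 4 - \<Psi> y t"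
   using Pc[OF t(2)] y t(1) unfolding continuous_on_iff by (metis diff_gt_0_iff_gt)
  have "dist (v z) (v y) < e" if "z \<in> U" "dist z y < min d1 d2" for z proof -
   have "\<bar>F z t - F y t\<bar> < e / 4" "\<bar>\<Psi> z t - \<Psi> y t\<bar> < e / 4 - \<Psi> y t"
    using d1(2)[of z] d2(2)[of z] that by (auto simp: dist_real_def)
   then show ?thesis using v[OF \<open>z \<in> U\<close> t(2)] v[OF y t(2)] t(1) unfolding dist_real_def by linarith
  qed
  then show "\<exists>d>0. \<forall>x'\<in>U. dist x' y < d --> dist (v x') (v y) < e"
   using d1(1) d2(1) by (intro exI[of _ "min d1 d2"]) auto
 qed
 moreover have "(F y \<longlongrightarrow> v y) (at_right 0)" if y: "y \<in> U" for y proof -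
  have "\<forall>\<^sub>F t in at_right 0. norm (F y t - v y) <= \<Psi> y t" by (rule eventually_at_rightI[of 0 1]) (use v[OF y] in auto)
  then have "((%t. F y t - v y) \<longlongrightarrow> 0) (at_right 0)" by (rule Lim_null_comparison) (rule P0(2)[OF y])
  then show ?thesis by (rule LIM_zero_cancel)
 qed
 moreover have "\<bar>F y t - v y\<bar> <= \<Psi> y 1" if "y \<in> U" "t \<in> {0<..1}" for y t
  using v[OF that] diff[OF that(1), of t 1] that(2) by auto
 ultimately show ?thesis by blast
qed


lemma mi_size_0 [simp]: "mi_size (%_. 0) = 0" by (simp add: mi_size_def)

lemma mi_size_eq_0: "mi_size \<gamma> = 0 \<longleftrightarrow> \<gamma> = (%_. 0)" by (auto simp: mi_size_def fun_eq_iff)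

lemma mi_fact_ge_1: "1 <= mi_fact \<gamma>" unfolding mi_fact_def by (intro prod_ge_1) auto

lemma kf_bound:
 fixes y :: "real^'d::finite"
 assumes G: "!!i s. \<bar>G i s\<bar> <= B" and t: "t > 0"
 shows "\<bar>kf G y t \<gamma> w\<bar> <= (B / t) ^ CARD('d) * norm (w - y) ^ mi_size \<gamma>"
proof -
 have B: "0 <= B" using G[of undefined 0] by linarith
 have "\<bar>kf G y t \<gamma> w\<bar> = (\<Prod>i\<in>UNIV. \<bar>kern1 (G i) (y $ i) t (\<gamma> i) (w $ i)\<bar>)"
  unfolding kf_def prodf_def kfac_def by (rule abs_prod)
 also have "... <= (\<Prod>i\<in>UNIV. (B / t) * norm (w - y) ^ \<gamma> i)" proof (intro prod_mono conjI)
  fix i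
  have "\<bar>w $ i - y $ i\<bar> ^ \<gamma> i <= norm (w - y) ^ \<gamma> i"
   using component_le_norm_cart[of "w - y" i] by (intro power_mono) auto
  then have "\<bar>G i (y $ i + (w $ i - y $ i) / t)\<bar> * \<bar>w $ i - y $ i\<bar> ^ \<gamma> i <= B * norm (w - y) ^ \<gamma> i"
   using B by (intro mult_mono G) auto
  then show "\<bar>kern1 (G i) (y $ i) t (\<gamma> i) (w $ i)\<bar> <= B / t * norm (w - y) ^ \<gamma> i"
   using t by (simp add: kern1_def abs_mult power_abs divide_right_mono)
 qed auto
 also have "... = (B / t) ^ CARD('d) * norm (w - y) ^ mi_size \<gamma>" unfolding prod.distrib by (simp add: mi_size_def power_sum)
 finally show ?thesis .
qed

lemma kf_zero_cball:
 assumes supp: "!!i s. s \<notin> {a $ i..b $ i} ==> G i s = 0" and "t > 0" and R: "cbox a b \<subseteq> cball y R"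
  and w: "w \<notin> cball y (t * R)"
 shows "kf G y t \<gamma> w = 0"
proof (rule kf_zero[OF supp \<open>t > 0\<close>])
 show "w \<notin> cbox (y + t *\<^sub>R (a - y)) (y + t *\<^sub>R (b - y))" proof
  assume "w \<in> cbox (y + t *\<^sub>R (a - y)) (y + t *\<^sub>R (b - y))"
  then have "t * (a $ i - y $ i) <= w $ i - y $ i" "w $ i - y $ i <= t * (b $ i - y $ i)" for i by (auto simp: mem_box_cart algebra_simps)
  then have "a $ i - y $ i <= (w $ i - y $ i) / t" "(w $ i - y $ i) / t <= b $ i - y $ i" for i
   using \<open>t > 0\<close> by (auto simp: pos_le_divide_eq pos_divide_le_eq mult.commute)
  then have "y + (1 / t) *\<^sub>R (w - y) \<in> cbox a b" by (simp add: mem_box_cart le_diff_eq diff_le_eq add.commute)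
  then have "norm ((1 / t) *\<^sub>R (w - y)) <= R" using R by (auto simp: dist_norm norm_minus_commute)
  then have "norm (w - y) / t <= R" unfolding norm_scaleR using \<open>t > 0\<close> by simp
  then have "norm (w - y) <= t * R" using \<open>t > 0\<close> by (simp add: pos_divide_le_eq mult.commute)
  then show False using w by (simp add: dist_norm norm_minus_commute)
 qed
qed

lemma box_product_zero_outside: "box_product \<Omega> H ==> x \<notin> \<Omega> ==> prodf H x = 0"
 unfolding box_product_def using prodf_zero_outside by (metis subsetD)

text \<open>Constants on \<Omega> have vanishing weak derivatives. With this,
  \<open>kf_integral_deriv\<close> also covers the constants that replace the derivatives of highest
  order.\<close>

lemma weak_partial_indicator: "weak_partial \<Omega> i (indicator \<Omega>) (%_. 0)" unfolding weak_partial_def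
proof (intro allI impI)
 fix G assume G: "box_product \<Omega> G"
 have "(LBINT x. indicator \<Omega> x * prodf (G(i := deriv (G i))) x) = (LBINT x. prodf (G(i := deriv (G i))) x)"
  using box_product_zero_outside[OF box_product_upd[OF G]] by (intro Bochner_Integration.integral_cong) (auto simp: indicator_def)
 then show "(LBINT x. indicator \<Omega> x * prodf (G(i := deriv (G i))) x) = - (LBINT x. 0 * prodf G x)"
  using integral_prodf_deriv_zero[OF G] by simp
qed

text \<open>\<open>W\<close> stands for the derivatives up to order \<open>M\<close> of one function
  \<open>W (%_. 0)\<close>. In the application this function is itself a weak derivative of u, and
  \<open>M\<close> is m minus its order.\<close>

locale taylor_path =
 fixes \<Omega> :: "(real^'d::finite) set" and W :: "('d => nat) => real^'d => real" and M :: nat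
  and c :: "('d => nat) => real" and G :: "'d => real => real" and a b :: "real^'d"
 assumes opn: "open \<Omega>" and bdd: "bounded \<Omega>"
  and W_int: "!!\<gamma>. mi_size \<gamma> <= M ==> integrable lborel (W \<gamma>)"
  and W_zero: "!!\<gamma> w. mi_size \<gamma> <= M ==> w \<notin> \<Omega> ==> W \<gamma> w = 0"
  and W_weak: "!!\<gamma> i. mi_size \<gamma> < M ==> weak_partial \<Omega> i (W \<gamma>) (W (mi_inc \<gamma> i))"
  and sm: "!!i. smooth1 (G i)" and supp: "!!i s. s \<notin> {a $ i..b $ i} ==> G i s = 0"
begin

text \<open>The kernel contains powers of w - y, whereas a Taylor polynomial expanded at w and
  evaluated at y has powers of y - w; hence the signs (-1)^n in \<open>pathF\<close>.\<close>

definition pathS :: "real^'d => nat => real => real" where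
 "pathS y n t = (\<Sum>\<gamma> | mi_size \<gamma> = n. (LBINT w. W \<gamma> w * kf G y t \<gamma> w) / mi_fact \<gamma>)"

definition pathC :: "real^'d => real => real" where
 "pathC y t = (\<Sum>\<gamma> | mi_size \<gamma> = M. c \<gamma> * (LBINT w. indicator \<Omega> w * kf G y t \<gamma> w) / mi_fact \<gamma>)"

text \<open>The Taylor polynomial of degree \<open>M\<close> at \<open>y\<close>, averaged over a neighbourhood that shrinks to \<open>y\<close>
  as \<open>t\<close> tends to 0; the derivatives of order \<open>M\<close> are replaced by the constants \<open>c\<close>.\<close>

definition pathF :: "real^'d => real => real" where
 "pathF y t = (\<Sum>n<M. (-1) ^ n * pathS y n t) + (-1) ^ M * pathC y t"

definition pathD :: "real^'d => real => real" where
 "pathD y t = - ((-1) ^ M) * (real M / t) *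
   (\<Sum>\<gamma> | mi_size \<gamma> = M. (LBINT w. (W \<gamma> w - c \<gamma> * indicator \<Omega> w) * kf G y t \<gamma> w) / mi_fact \<gamma>)"

lemma indicator_int: "integrable lborel (indicator \<Omega> :: _ => real)"
 using opn emeasure_bounded_finite[OF bdd] by (intro integrable_real_indicator) auto

lemma kf_cont: "t > 0 ==> continuous_on S y ==> continuous_on S w ==> continuous_on S (%z. kf G (y z) t \<gamma> (w z))"
 by (rule kf_continuous[where G = G and t = "%_. t", OF sm]) auto

lemma compact_cl: "compact (closure \<Omega>)" using bdd by (simp add: compact_closure)

lemma int_kf:
 assumes "integrable lborel V" "!!w. w \<notin> \<Omega> ==> V w = 0" "t > 0"
 shows "integrable lborel (%w. V w * kf G y t \<gamma> w)" by (rule integrable_times_continuous[OF assms(1) _ compact_cl])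
   (use assms closure_subset in "auto intro!: kf_cont continuous_intros")

text \<open>Up to the factor 1/t, the derivative of the n-th term is n + 1 times the next term plus
  n times the term itself. In the alternating sum everything cancels except the term of order
  \<open>M\<close>, which meets the constants.\<close>

lemma pathF_deriv:
 assumes sub: "cbox (y + t *\<^sub>R (a - y)) (y + t *\<^sub>R (b - y)) \<subseteq> \<Omega>" and t: "t > 0"
 shows "(pathF y has_real_derivative pathD y t) (at t)"
proof -
 let ?I = "%\<gamma> t. \<integral>w. W \<gamma> w * kf G y t \<gamma> w \<partial>lborel" and ?J = "%\<gamma> t. \<integral>w. indicator \<Omega> w * kf G y t \<gamma> w \<partial>lborel"
 let ?s = "%n. real (Suc n) * pathS y (Suc n) t + real n * pathS y n t"
 have S: "(pathS y n has_real_derivative (1 / t) * ?s n) (at t)"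
  if n: "n < M" for n proof -
  have "(pathS y n has_real_derivative (\<Sum>\<gamma> | mi_size \<gamma> = n.
    ((1 / t) * ((\<Sum>i\<in>UNIV. ?I (mi_inc \<gamma> i) t)
    + real (mi_size \<gamma>) * ?I \<gamma> t)) / mi_fact \<gamma>)) (at t)" unfolding pathS_def proof (intro DERIV_sum DERIV_cdivide)
   fix \<gamma> :: "'d => nat" assume "\<gamma> \<in> {\<gamma>. mi_size \<gamma> = n}"
   then have g: "mi_size \<gamma> = n" "mi_size \<gamma> < M" using n by auto
   show "((%t. ?I \<gamma> t) has_real_derivative
     (1 / t) * ((\<Sum>i\<in>UNIV. ?I (mi_inc \<gamma> i) t)
    + real (mi_size \<gamma>) * ?I \<gamma> t)) (at t)"
    by (rule kf_integral_deriv[OF W_int W_zero bdd W_weak sm supp t sub]) (use g in auto)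
  qed
  also have "(\<Sum>\<gamma> | mi_size \<gamma> = n.
    ((1 / t) * ((\<Sum>i\<in>UNIV. ?I (mi_inc \<gamma> i) t)
    + real (mi_size \<gamma>) * ?I \<gamma> t)) / mi_fact \<gamma>)
   = (1 / t) * ((\<Sum>\<gamma> | mi_size \<gamma> = n. (\<Sum>i\<in>UNIV. ?I (mi_inc \<gamma> i) t) / mi_fact \<gamma>)
     + real n * pathS y n t)" proof -
   have alg: "((1 / t) * (X + real n * Y)) / F = (1 / t) * (X / F + real n * (Y / F))" for X Y F :: real
    by (simp add: add_divide_distrib mult.commute[of t])
   show ?thesis unfolding pathS_def sum_distrib_left sum.distrib[symmetric] by (rule sum.cong) (simp_all only: mem_Collect_eq alg)
  qed
  also have "... = (1 / t) * ?s n" unfolding pathS_def sum_mi_inc[of "%\<gamma>. ?I \<gamma> t" n] ..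
  finally show ?thesis .
 qed
 have C: "(pathC y has_real_derivative (real M / t) * pathC y t) (at t)" proof -
  have "(pathC y has_real_derivative (\<Sum>\<gamma> | mi_size \<gamma> = M.
    c \<gamma> * ((1 / t) * ((\<Sum>i\<in>(UNIV::'d set). \<integral>w. 0 * kf G y t (mi_inc \<gamma> i) w \<partial>lborel)
    + real (mi_size \<gamma>) * ?J \<gamma> t)) / mi_fact \<gamma>)) (at t)" unfolding pathC_def
   by (intro DERIV_sum DERIV_cdivide DERIV_cmult
      kf_integral_deriv[OF indicator_int _ bdd weak_partial_indicator sm supp t sub]) auto
  also have "(\<Sum>\<gamma> | mi_size \<gamma> = M.
    c \<gamma> * ((1 / t) * ((\<Sum>i\<in>(UNIV::'d set). \<integral>w. 0 * kf G y t (mi_inc \<gamma> i) w \<partial>lborel)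
    + real (mi_size \<gamma>) * ?J \<gamma> t)) / mi_fact \<gamma>)
   = (real M / t) * pathC y t" unfolding pathC_def sum_distrib_left by (intro sum.cong refl) simp
  finally show ?thesis .
 qed
 have tel: "(\<Sum>n<M. (-1) ^ n * ((1 / t) * ?s n))
   = - ((-1) ^ M) * (real M / t) * pathS y M t" by (induction M) (simp_all add: add_divide_distrib algebra_simps)
 have D: "((%t. (\<Sum>n<M. (-1) ^ n * pathS y n t) + (-1) ^ M * pathC y t) has_real_derivative
   (\<Sum>n<M. (-1) ^ n * ((1 / t) * ?s n))
   + (-1) ^ M * ((real M / t) * pathC y t)) (at t)" by (intro DERIV_add DERIV_sum DERIV_cmult S C) auto
 have E: "pathD y t = - ((-1) ^ M) * (real M / t) * (pathS y M t - pathC y t)" proof -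
  have "(LBINT w. (W \<gamma> w - c \<gamma> * indicator \<Omega> w) * kf G y t \<gamma> w) / mi_fact \<gamma> =
   ?I \<gamma> t / mi_fact \<gamma> - c \<gamma> * ?J \<gamma> t / mi_fact \<gamma>"
   if "mi_size \<gamma> = M" for \<gamma> proof -
   have "(LBINT w. (W \<gamma> w - c \<gamma> * indicator \<Omega> w) * kf G y t \<gamma> w) =
    (LBINT w. W \<gamma> w * kf G y t \<gamma> w - c \<gamma> * (indicator \<Omega> w * kf G y t \<gamma> w))" by (simp add: algebra_simps)
   also have "... = ?I \<gamma> t - c \<gamma> * ?J \<gamma> t"
    using int_kf[of "W \<gamma>" t y \<gamma>, OF W_int W_zero t] int_kf[OF indicator_int _ t, of y \<gamma>] that
    by (subst Bochner_Integration.integral_diff) auto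
   finally show ?thesis by (simp add: diff_divide_distrib)
  qed
  then show ?thesis unfolding pathD_def pathS_def pathC_def sum_subtractf[symmetric]
   by (intro arg_cong2[where f = "(*)"] refl sum.cong) auto
 qed
 show ?thesis unfolding pathF_def[abs_def] by (rule DERIV_cong[OF D]) (simp only: tel E, simp add: algebra_simps)
qed

text \<open>The oscillation of order \<open>M\<close> about the constants \<open>c\<close>. The set
  A is one that the contracted boxes do not leave, so that only the local part of the oscillation
  enters the estimates.\<close>

definition defect :: "(real^'d) set => real^'d => real" where
 "defect A w = indicator A w * (\<Sum>\<gamma> | mi_size \<gamma> = M. \<bar>W \<gamma> w - c \<gamma> * indicator \<Omega> w\<bar>)"

lemma defect_nonneg: "0 <= defect A w" unfolding defect_def by (intro mult_nonneg_nonneg sum_nonneg) auto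

lemma defect_zero: "w \<notin> \<Omega> ==> defect A w = 0" unfolding defect_def by (simp add: W_zero)

lemma defect_int:
 assumes [measurable]: "A \<in> sets borel" shows "integrable lborel (defect A)"
proof -
 have "integrable lborel (%w. \<Sum>\<gamma> | mi_size \<gamma> = M. \<bar>W \<gamma> w - c \<gamma> * indicator \<Omega> w\<bar>)"
  by (intro Bochner_Integration.integrable_sum integrable_abs Bochner_Integration.integrable_diff
    integrable_mult_right indicator_int) (auto intro: W_int)
 then have "integrable lborel (%w. (\<Sum>\<gamma> | mi_size \<gamma> = M. \<bar>W \<gamma> w - c \<gamma> * indicator \<Omega> w\<bar>) * indicator A w)"
  by (intro integrable_real_mult_indicator) auto
 then show ?thesis unfolding defect_def[abs_def] by (simp add: mult.commute)
qed

lemma pathD_bound: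
 assumes B: "!!i s. \<bar>G i s\<bar> <= B" and t: "t > 0" and R: "cbox a b \<subseteq> cball y R" and A: "A \<in> sets borel"
  and sub: "cbox (y + t *\<^sub>R (a - y)) (y + t *\<^sub>R (b - y)) \<subseteq> A"
 shows "\<bar>pathD y t\<bar> <= (LBINT w. defect A w * (real M / t * (B / t) ^ CARD('d) * norm (w - y) ^ M * indicator (cball y (t * R)) w))"
  and "integrable lborel (%w. defect A w * (norm (w - y) ^ M * indicator (cball y (t * R)) w))"
proof -
 have B0: "0 <= B" using B[of undefined 0] by linarith
 have "integrable lborel (%w. defect A w * norm (w - y) ^ M)" by (rule integrable_times_continuous[OF defect_int[OF A] _ compact_cl])
    (use defect_zero closure_subset in "auto intro!: continuous_intros")
 then have "integrable lborel (%w. (defect A w * norm (w - y) ^ M) * indicator (cball y (t * R)) w)"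
  by (intro integrable_real_mult_indicator) auto
 then show int: "integrable lborel (%w. defect A w * (norm (w - y) ^ M * indicator (cball y (t * R)) w))" by (simp add: mult.assoc)
 let ?K = "%w. (B / t) ^ CARD('d) * norm (w - y) ^ M * indicator (cball y (t * R)) w"
 have k: "\<bar>kf G y t \<gamma> w\<bar> <= indicator A w * ?K w" if "mi_size \<gamma> = M" for \<gamma> w
 proof (cases "w \<in> A \<and> w \<in> cball y (t * R)")
  case True
  then show ?thesis using kf_bound[of G B t y \<gamma> w, OF B t] that by simp
 next
  case False
  moreover have "kf G y t \<gamma> w = 0" if "w \<notin> A" by (rule kf_zero[of a b G, OF supp t]) (use that sub in auto)
  moreover have "kf G y t \<gamma> w = 0" if "w \<notin> cball y (t * R)" by (rule kf_zero_cball[of a b G, OF supp t R that])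
  ultimately show ?thesis by (auto simp: indicator_def)
 qed
 let ?V = "%\<gamma> w. W \<gamma> w - c \<gamma> * indicator \<Omega> w"
 have iV: "integrable lborel (%w. ?V \<gamma> w * kf G y t \<gamma> w)" if "mi_size \<gamma> = M" for \<gamma>
  by (rule int_kf) (use that W_int W_zero indicator_int t in auto)
 have "\<bar>\<Sum>\<gamma> | mi_size \<gamma> = M. (LBINT w. ?V \<gamma> w * kf G y t \<gamma> w) / mi_fact \<gamma>\<bar>
   <= (\<Sum>\<gamma> | mi_size \<gamma> = M. (LBINT w. \<bar>?V \<gamma> w * kf G y t \<gamma> w\<bar>))"
 proof (rule order_trans[OF sum_abs sum_mono])
  fix \<gamma> :: "'d => nat"
  have "\<bar>(LBINT w. ?V \<gamma> w * kf G y t \<gamma> w)\<bar> / mi_fact \<gamma> <= \<bar>(LBINT w. ?V \<gamma> w * kf G y t \<gamma> w)\<bar> / 1"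
   by (rule divide_left_mono) (use mi_fact_ge_1[of \<gamma>] in auto)
  also have "... <= (LBINT w. \<bar>?V \<gamma> w * kf G y t \<gamma> w\<bar>)" using integral_abs_bound by simp
  finally show "\<bar>(LBINT w. ?V \<gamma> w * kf G y t \<gamma> w) / mi_fact \<gamma>\<bar> <= (LBINT w. \<bar>?V \<gamma> w * kf G y t \<gamma> w\<bar>)"
   using mi_fact_pos[of \<gamma>] by simp
 qed
 also have "... = (LBINT w. (\<Sum>\<gamma> | mi_size \<gamma> = M. \<bar>?V \<gamma> w * kf G y t \<gamma> w\<bar>))"
  by (rule Bochner_Integration.integral_sum[symmetric]) (use iV in auto)
 also have "... <= (LBINT w. defect A w * ?K w)" proof (rule integral_mono)
  show "integrable lborel (%w. \<Sum>\<gamma> | mi_size \<gamma> = M. \<bar>?V \<gamma> w * kf G y t \<gamma> w\<bar>)"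
   using iV by (intro Bochner_Integration.integrable_sum integrable_abs) auto
  show "integrable lborel (%w. defect A w * ?K w)" using integrable_mult_right[OF int, of "(B / t) ^ CARD('d)"] by (simp add: ac_simps)
  fix w
  have "(\<Sum>\<gamma> | mi_size \<gamma> = M. \<bar>?V \<gamma> w * kf G y t \<gamma> w\<bar>) <= (\<Sum>\<gamma> | mi_size \<gamma> = M. \<bar>?V \<gamma> w\<bar> * (indicator A w * ?K w))"
   unfolding abs_mult using k by (intro sum_mono mult_left_mono) auto
  also have "... = defect A w * ?K w" unfolding defect_def sum_distrib_right[symmetric] by (simp only: mult_ac)
  finally show "(\<Sum>\<gamma> | mi_size \<gamma> = M. \<bar>?V \<gamma> w * kf G y t \<gamma> w\<bar>) <= defect A w * ?K w" .
 qed
 finally have "(real M / t) * \<bar>\<Sum>\<gamma> | mi_size \<gamma> = M. (LBINT w. ?V \<gamma> w * kf G y t \<gamma> w) / mi_fact \<gamma>\<bar>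
   <= (real M / t) * (LBINT w. defect A w * ?K w)" by (rule mult_left_mono) (use t in auto)
 also have "... = (LBINT w. (real M / t) * (defect A w * ?K w))" by simp
 finally show "\<bar>pathD y t\<bar> <= (LBINT w. defect A w * (real M / t * (B / t) ^ CARD('d) * norm (w - y) ^ M * indicator (cball y (t * R)) w))"
  using t by (simp add: pathD_def abs_mult power_abs mult_ac)
qed

end


lemma mi_fact_nonzero [simp]: "mi_fact \<gamma> ~= 0" using mi_fact_pos[of \<gamma>] by simp

context taylor_path begin

lemma kf_integral_continuous:
 assumes V: "integrable lborel V" "!!w. w \<notin> \<Omega> ==> V w = 0" and t: "t > 0" and K: "compact K"
 shows "continuous_on K (%y. \<integral>w. V w * kf G y t \<gamma> w \<partial>lborel)"
 by (rule continuous_param_integral(1)[OF V(1) _ compact_cl K])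
   (use V(2) t closure_subset in "auto intro!: kf_cont continuous_intros")

lemma pathF_continuous:
 assumes "t > 0" "compact K" shows "continuous_on K (%y. pathF y t)" unfolding pathF_def pathS_def pathC_def
 by (intro continuous_on_add continuous_on_sum continuous_on_mult continuous_on_const continuous_on_divide
   kf_integral_continuous) (use assms W_int W_zero indicator_int in auto)

text \<open>Only the term with \<gamma> = 0 survives the limit, and the bump has mass 1. The
  condition \<open>M > 0\<close> ensures that this term carries \<open>W\<close> and not one of the
  constants.\<close>

lemma pathF_test_limit:
 assumes M: "M > 0" and H: "continuous_on UNIV H" "!!y. y \<notin> cbox l u ==> H y = 0"
  and one: "(LBINT x. prodf G x) = 1"
 shows "((%t. \<integral>y. H y * pathF y t \<partial>lborel) \<longlongrightarrow> (LBINT w. W (%_. 0) w * H w)) (at_right 0)"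
proof -
 let ?A = "%F. \<Sum>n<M. (-1) ^ n * (\<Sum>\<gamma> | mi_size \<gamma> = n. F (W \<gamma>) \<gamma> / mi_fact \<gamma>)"
 let ?B = "%F. (-1) ^ M * (\<Sum>\<gamma> | mi_size \<gamma> = M. c \<gamma> * F (indicator \<Omega>) \<gamma> / mi_fact \<gamma>)"
 have Hint: "integrable lborel H" proof -
  have "integrable lborel (%x. indicator (cbox l u) x *\<^sub>R H x)"
   by (rule borel_integrable_compact) (auto intro: continuous_on_subset[OF H(1)])
  also have "(%x. indicator (cbox l u) x *\<^sub>R H x) = H" using H(2) by (auto simp: fun_eq_iff indicator_def)
  finally show ?thesis .
 qed
 let ?T = "%V \<gamma> t. \<integral>y. H y * (LBINT w. V w * kf G y t \<gamma> w) \<partial>lborel"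
 let ?L = "%V \<gamma>. (if \<gamma> = (%_. 0) then (LBINT w. V w * H w) else 0)"
 have lim: "(?T V \<gamma> \<longlongrightarrow> ?L V \<gamma>) (at_right 0)" if "integrable lborel V" "!!w. w \<notin> \<Omega> ==> V w = 0" for V \<gamma>
  using kf_test_limit[where G = G and a = a and b = b and l = l and u = u and \<gamma> = \<gamma>, OF that bdd sm supp H]
  unfolding one mult_1 .
 have int: "integrable lborel (%y. H y * (LBINT w. V w * kf G y t \<gamma> w))"
  if "integrable lborel V" "!!w. w \<notin> \<Omega> ==> V w = 0" "t > 0" for V \<gamma> t
  by (rule integrable_times_continuous[where C = "cbox l u", OF Hint H(2) compact_cbox kf_integral_continuous]) (use that in auto)
 note intW = int[OF W_int W_zero] and intI = int[OF indicator_int]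
 have "((%t. ?A (%V \<gamma>. ?T V \<gamma> t)
   + ?B (%V \<gamma>. ?T V \<gamma> t)) \<longlongrightarrow>
   ?A ?L
   + ?B ?L) (at_right 0)" by (intro tendsto_add tendsto_sum tendsto_mult tendsto_divide tendsto_const lim)
    (use W_int W_zero indicator_int in auto)
 moreover have "?A ?L
   + ?B ?L
   = (LBINT w. W (%_. 0) w * H w)" proof -
  have "(\<Sum>\<gamma> | mi_size \<gamma> = n. ?L (W \<gamma>) \<gamma> / mi_fact \<gamma>) = (if n = 0 then (LBINT w. W (%_. 0) w * H w) else 0)" for n
  proof (cases "n = 0")
   case True
   then have "{\<gamma> :: 'd => nat. mi_size \<gamma> = n} = {%_. 0}" by (auto simp: mi_size_eq_0)
   then show ?thesis using True by (simp add: mi_fact_def)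
  next
   case False
   then show ?thesis by (auto intro!: sum.neutral)
  qed
  moreover have "(\<Sum>\<gamma> | mi_size \<gamma> = M. c \<gamma> * ?L (indicator \<Omega>) \<gamma> / mi_fact \<gamma>) = 0"
   using M by (auto intro!: sum.neutral)
  ultimately show ?thesis using M by (simp add: if_distrib[of "%x. _ * x"] sum.delta cong: if_cong)
 qed
 moreover have "\<forall>\<^sub>F t in at_right 0. ?A (%V \<gamma>. ?T V \<gamma> t)
   + ?B (%V \<gamma>. ?T V \<gamma> t) = (LBINT y. H y * pathF y t)" proof (rule eventually_at_rightI[of 0 1])
  fix t :: real assume "t \<in> {0<..<1}"
  then have t: "t > 0" by simp
  let ?I = "%V \<gamma> y. H y * (LBINT w. V w * kf G y t \<gamma> w)"
  have "(LBINT y. H y * pathF y t) = (LBINT y. ?A (%V \<gamma>. ?I V \<gamma> y)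
   + ?B (%V \<gamma>. ?I V \<gamma> y))" unfolding pathF_def pathS_def pathC_def
   by (rule Bochner_Integration.integral_cong) (simp_all add: sum_distrib_left distrib_left mult_ac)
  also have "... = ?A (%V \<gamma>. ?T V \<gamma> t)
   + ?B (%V \<gamma>. ?T V \<gamma> t)" proof (subst Bochner_Integration.integral_add, goal_cases)
   case 1 show ?case by (intro Bochner_Integration.integrable_sum integrable_mult_right integrable_divide intW) (use t in auto)
  next
   case 2 show ?case by (intro Bochner_Integration.integrable_sum integrable_mult_right integrable_divide intI) (use t in auto)
  next
   case 3
   have "(LBINT y. ?A (%V \<gamma>. ?I V \<gamma> y))
    = ?A (%V \<gamma>. ?T V \<gamma> t)"
    by (subst Bochner_Integration.integral_sum, intro integrable_mult_right Bochner_Integration.integrable_sum integrable_divide intW)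
      (use t intW in "auto intro!: sum.cong simp: Bochner_Integration.integral_sum")
   moreover have "(LBINT y. ?B (%V \<gamma>. ?I V \<gamma> y))
    = ?B (%V \<gamma>. ?T V \<gamma> t)" using t intI by (simp add: Bochner_Integration.integral_sum)
   ultimately show ?case by simp
  qed
  finally show "?A (%V \<gamma>. ?T V \<gamma> t)
   + ?B (%V \<gamma>. ?T V \<gamma> t) = (LBINT y. H y * pathF y t)" by simp
 qed simp
 ultimately show ?thesis using Lim_transform_eventually by fastforce
qed

text \<open>As t tends to 0, \<open>pathF\<close> converges pointwise to v with an error bounded by
  a continuous function, and against test functions it converges to \<open>W (%_. 0)\<close>. By
  \<open>fundamental_lemma\<close> the two limits agree almost everywhere.\<close>

lemma path_limit_AE:
 assumes M: "M > 0" and one: "(LBINT x. prodf G x) = 1" and U: "open U" "U \<subseteq> \<Omega>"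
  and v: "continuous_on U v" "!!y. y \<in> U ==> (pathF y \<longlongrightarrow> v y) (at_right 0)"
  and P: "continuous_on U P" "!!y t. y \<in> U ==> t \<in> {0<..1} ==> \<bar>pathF y t - v y\<bar> <= P y"
 shows "AE y in lborel. y \<in> U --> v y = W (%_. 0) y"
proof -
 let ?W = "W (%_. 0)"
 have W0: "integrable lborel ?W" by (rule W_int) simp
 have "AE y in lborel. y \<in> U --> indicator U y * v y - ?W y = 0" proof (rule fundamental_lemma[OF U(1)])
  fix l u assume lu: "cbox l u \<subseteq> U"
  have 1: "integrable lborel (%x. indicator (cbox l u) x *\<^sub>R v x)"
   by (rule borel_integrable_compact) (auto intro: continuous_on_subset[OF v(1) lu])
  have 2: "integrable lborel (%x. ?W x * indicator (cbox l u) x)" by (rule integrable_real_mult_indicator[OF _ W0]) auto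
  show "integrable lborel (%x. (indicator U x * v x - ?W x) * indicator (cbox l u) x)" using Bochner_Integration.integrable_diff[OF 1 2]
   by (rule Bochner_Integration.integrable_cong[THEN iffD1, OF refl, rotated])
     (use lu in "auto simp: indicator_def")
 next
  fix G' assume G': "box_product U G'"
  obtain l u where lu: "!!i. smooth1 (G' i)" "!!i t. t \<notin> {l $ i..u $ i} ==> G' i t = 0" "cbox l u \<subseteq> U"
   using G' unfolding box_product_def by metis
  let ?H = "prodf G'"
  have H0: "?H y = 0" if "y \<notin> cbox l u" for y by (rule prodf_zero_outside[OF lu(2) that])
  have Hc: "continuous_on S ?H" for S by (rule prodf_continuous[OF lu(1)])
  have Hint: "integrable lborel ?H" proof -
   have "integrable lborel (%x. indicator (cbox l u) x *\<^sub>R ?H x)" by (rule borel_integrable_compact) (auto intro: Hc)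
   also have "(%x. indicator (cbox l u) x *\<^sub>R ?H x) = ?H" using H0 by (auto simp: fun_eq_iff indicator_def)
   finally show ?thesis .
  qed
  have int: "integrable lborel (%y. ?H y * k y)" if "continuous_on U k" for k
   by (rule integrable_times_continuous[where C = "cbox l u", OF Hint H0 compact_cbox continuous_on_subset[OF that lu(3)]])
  define t where "t n = 1 / real (Suc n)" for n
  have seq0: "filterlim t (at_right 0) sequentially" unfolding t_def using LIMSEQ_Suc[OF lim_1_over_n[where 'a=real]]
   by (intro filterlim_at_withinI) (auto intro!: always_eventually)
  have t01: "t n \<in> {0<..1}" "t n > 0" for n by (auto simp: t_def)
  have UK: "continuous_on U (%y. pathF y (t n))" for n
   by (rule continuous_on_subset[OF pathF_continuous[OF t01(2) compact_cl]]) (use U(2) closure_subset in blast)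
  have "(%n. \<integral>y. ?H y * pathF y (t n) \<partial>lborel) \<longlonglongrightarrow> (LBINT y. ?H y * v y)"
  proof (rule integral_dominated_convergence[where w = "%y. \<bar>?H y * (\<bar>v y\<bar> + P y)\<bar>"])
   show "integrable lborel (%y. \<bar>?H y * (\<bar>v y\<bar> + P y)\<bar>)" by (intro integrable_abs int continuous_intros v(1) P(1))
   show "(%y. ?H y * v y) \<in> borel_measurable lborel" "!!n. (%y. ?H y * pathF y (t n)) \<in> borel_measurable lborel"
    by (intro borel_measurable_integrable int v(1) UK)+
   show "AE y in lborel. (%n. ?H y * pathF y (t n)) \<longlonglongrightarrow> ?H y * v y" proof (intro always_eventually allI)
    fix y
    show "(%n. ?H y * pathF y (t n)) \<longlonglongrightarrow> ?H y * v y" proof (cases "y \<in> U")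
     case True
     then show ?thesis by (intro tendsto_mult tendsto_const filterlim_compose[OF v(2) seq0])
    next
     case False
     then have "?H y = 0" using lu(3) by (intro H0) auto
     then show ?thesis by simp
    qed
   qed
   show "AE y in lborel. norm (?H y * pathF y (t n)) <= \<bar>?H y * (\<bar>v y\<bar> + P y)\<bar>" for n
   proof (intro always_eventually allI)
    fix y
    show "norm (?H y * pathF y (t n)) <= \<bar>?H y * (\<bar>v y\<bar> + P y)\<bar>" proof (cases "y \<in> U")
     case True
     then have "\<bar>pathF y (t n)\<bar> <= \<bar>\<bar>v y\<bar> + P y\<bar>" using P(2)[OF True t01(1)[of n]] by linarith
     then show ?thesis by (simp add: abs_mult mult_left_mono)
    next
     case False
     then have "?H y = 0" using lu(3) by (intro H0) auto
     then show ?thesis by simp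
    qed
   qed
  qed
  moreover have "(%n. \<integral>y. ?H y * pathF y (t n) \<partial>lborel) \<longlonglongrightarrow> (LBINT w. ?W w * ?H w)"
   by (rule filterlim_compose[OF pathF_test_limit[where l = l and u = u, OF M Hc H0 one] seq0])
  ultimately have eq: "(LBINT y. ?H y * v y) = (LBINT w. ?W w * ?H w)" by (rule LIMSEQ_unique)
  obtain B where B: "!!x. \<bar>?H x\<bar> <= B" using box_product_bounded[OF G'] by blast
  have iW: "integrable lborel (%x. ?W x * ?H x)"
   by (rule integrable_mult_bounded[OF W0 _ B]) (use prodf_measurable[of G', OF lu(1)] in simp)
  have "(LBINT x. (indicator U x * v x - ?W x) * ?H x) = (LBINT x. ?H x * v x - ?W x * ?H x)"
   using H0 lu(3) by (intro Bochner_Integration.integral_cong) (auto simp: indicator_def algebra_simps)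
  also have "... = 0" using eq iW int[OF v(1)] by simp
  finally show "(LBINT x. (indicator U x * v x - ?W x) * ?H x) = 0" .
 qed
 then show ?thesis by eventually_elim auto
qed

end


text \<open>For \<open>M \<ge> d\<close> the bound of \<open>pathD\<close> has the primitive \<open>t\<^sup>dR\<^sup>d / (t\<^sup>dR\<^sup>d + |w - y|\<^sup>d)\<close> in \<open>t\<close>,
  up to a constant. It stays bounded even when \<open>M = d\<close>.\<close>

lemma majorant_deriv:
 fixes z R t :: real
 assumes "R > 0" "t > 0" "z >= 0" "n > 0"
 shows "((%t. t ^ n * R ^ n / (t ^ n * R ^ n + z ^ n)) has_real_derivative
  real n * (t ^ n / t) * R ^ n * z ^ n / (t ^ n * R ^ n + z ^ n)\<^sup>2) (at t)"
proof -
 have pos: "t ^ n * R ^ n + z ^ n > 0" using assms by (intro add_pos_nonneg) auto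
 have tn: "real n * t ^ (n - 1) = real n * (t ^ n / t)" using assms by (cases n) auto
 have 1: "((%t. t ^ n * R ^ n) has_real_derivative real n * (t ^ n / t) * R ^ n) (at t)"
  by (rule DERIV_cong[OF DERIV_cmult_right[OF DERIV_pow]]) (simp only: tn[unfolded One_nat_def])
 have num: "real n * q * \<rho> * (a * \<rho> + \<zeta>) - a * \<rho> * (real n * q * \<rho> + 0) = real n * q * \<rho> * \<zeta>" for q a \<rho> \<zeta> :: real
  by (simp add: algebra_simps)
 show ?thesis by (rule DERIV_cong[OF DERIV_divide[OF 1 DERIV_add[OF 1 DERIV_const]]])
    (use pos in simp, simp only: num power2_eq_square)
qed

text \<open>For z <= tR one has (tR)^n + z^n <= 2 (tR)^n, whose square explains the factor 4, and
  z^M <= z^n R^(M - n).\<close>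

lemma majorant_ineq:
 fixes z R t B :: real
 assumes R: "R > 0" and t: "0 < t" "t <= 1" and z: "0 <= z" "z <= t * R" and "n > 0" "n <= M" "B >= 0"
 shows "real M / t * (B / t) ^ n * z ^ M <=
  4 * real M * B ^ n * R ^ M / real n * (real n * (t ^ n / t) * R ^ n * z ^ n / (t ^ n * R ^ n + z ^ n)\<^sup>2)"
proof -
 define a where "a = t ^ n"
 define \<rho> where "\<rho> = R ^ n"
 define \<zeta> where "\<zeta> = z ^ n"
 have pos: "a > 0" "\<rho> > 0" "\<zeta> >= 0" using assms by (auto simp: a_def \<rho>_def \<zeta>_def)
 have le: "\<zeta> <= a * \<rho>" unfolding a_def \<rho>_def \<zeta>_def power_mult_distrib[symmetric] using z by (intro power_mono)
 have "z <= R" using z(2) mult_right_mono[OF t(2), of R] R by linarith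
 then have zM: "z ^ M <= \<zeta> * R ^ (M - n)" using z power_mono[of z R "M - n"] power_add[of z n "M - n"] \<open>n <= M\<close>
  by (simp add: \<zeta>_def mult_left_mono)
 have RM: "R ^ M = \<rho> * R ^ (M - n)" using \<open>n <= M\<close> by (simp add: \<rho>_def flip: power_add)
 have "(a * \<rho> + \<zeta>)\<^sup>2 <= (2 * (a * \<rho>))\<^sup>2" using le pos by (intro power_mono) linarith+
 then have sq: "(a * \<rho> + \<zeta>)\<^sup>2 <= 4 * (a * \<rho>)\<^sup>2" by (simp add: power_mult_distrib)
 have s: "(a * \<rho> + \<zeta>)\<^sup>2 > 0" using pos by (intro zero_less_power add_pos_nonneg) auto
 have "1 <= 4 * (a * \<rho>)\<^sup>2 / (a * \<rho> + \<zeta>)\<^sup>2" using sq s by (simp add: pos_le_divide_eq)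
 then have "real M / t * B ^ n / a * (\<zeta> * R ^ (M - n)) * 1 <=
   real M / t * B ^ n / a * (\<zeta> * R ^ (M - n)) * (4 * (a * \<rho>)\<^sup>2 / (a * \<rho> + \<zeta>)\<^sup>2)"
  using assms pos by (intro mult_left_mono) auto
 also have "... = 4 * real M * B ^ n * R ^ M / real n * (real n * (a / t) * \<rho> * \<zeta> / (a * \<rho> + \<zeta>)\<^sup>2)"
  unfolding RM using \<open>n > 0\<close> pos by (simp add: power2_eq_square)
 finally have "real M / t * B ^ n / a * (\<zeta> * R ^ (M - n)) <= ..." by simp
 moreover have "real M / t * (B / t) ^ n * z ^ M <= real M / t * B ^ n / a * (\<zeta> * R ^ (M - n))"
  unfolding power_divide a_def[symmetric] times_divide_eq_right using assms pos zM by (intro mult_left_mono) auto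
 ultimately show ?thesis unfolding a_def \<rho>_def \<zeta>_def by linarith
qed

context taylor_path begin

text \<open>Two majorants feed \<open>path_limit\<close>. For p > 1 the mass bound \<open>E\<close>
  makes \<open>pathD\<close> at most a multiple of t^(M - d/p - 1), which is integrable at 0. For p
  = 1 this exponent may be -1, and the primitive from \<open>majorant_deriv\<close> is integrated
  against the defect instead. The two summands of the constant belong to the two cases; for p = 1
  and M = d the first is a division by zero and has the value 0.\<close>

lemma local_rep:
 fixes p B R E :: real
 assumes U: "open U" "U \<subseteq> \<Omega>" and A: "A \<in> sets borel"
  and sub: "!!y t. y \<in> U ==> t \<in> {0<..1} ==> cbox (y + t *\<^sub>R (a - y)) (y + t *\<^sub>R (b - y)) \<subseteq> \<Omega> \<inter> A"
  and R: "R > 0" "!!y. y \<in> U ==> cbox a b \<subseteq> cball y R"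
  and B: "!!i s. \<bar>G i s\<bar> <= B" and one: "(LBINT x. prodf G x) = 1"
  and p: "1 <= p" "p > 1 ==> real CARD('d) / p < real M" "p = 1 ==> CARD('d) <= M"
  and E: "E >= 0" "!!y r. y \<in> U ==> r > 0 ==>
   (LBINT w. defect A w * indicator (cball y r) w) <= E * r powr (real CARD('d) - real CARD('d) / p)"
 shows "\<exists>v. continuous_on U v \<and> (AE y in lborel. y \<in> U --> v y = W (%_. 0) y) \<and>
  (\<forall>y\<in>U. \<bar>pathF y 1 - v y\<bar> <= (real M / (real M - real CARD('d) / p) + 4 * real M / real CARD('d))
    * B ^ CARD('d) * R powr (real M + real CARD('d) - real CARD('d) / p) * E)"
proof -
 let ?K = "%(y :: real^'d) t w. real M / t * (B / t) ^ CARD('d) * norm (w - y) ^ M * indicator (cball y (t * R)) w"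
 let ?n = "CARD('d)" and ?d = "real CARD('d)"
 let ?e = "real M - ?d / p" and ?P = "defect A"
 have B0: "0 <= B" using B[of undefined 0] by linarith
 have n0: "?n > 0" by simp
 have e0: "?e >= 0" "M > 0" proof -
  show "?e >= 0" using p by (cases "p = 1") auto
  have "?d / p > 0" using p(1) by simp
  then have "p > 1 ==> real M > 0" using p(2) by linarith
  moreover have "p = 1 ==> M > 0" using p(3) n0 by linarith
  ultimately show "M > 0" using p(1) by (cases "p = 1") auto
 qed
 have F: "(pathF y has_real_derivative pathD y t) (at t)" if "y \<in> U" "t \<in> {0<..1}" for y t
  by (rule pathF_deriv) (use sub[OF that] that in auto)
 have Fc: "continuous_on U (%y. pathF y t)" if "t \<in> {0<..1}" for t
  by (rule continuous_on_subset[OF pathF_continuous[OF _ compact_cl]]) (use U(2) closure_subset that in auto)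
 have D: "\<bar>pathD y t\<bar> <= (LBINT w. ?P w * ?K y t w)"
  "integrable lborel (%w. ?P w * (norm (w - y) ^ M * indicator (cball y (t * R)) w))" if "y \<in> U" "t \<in> {0<..1}" for y t
  using pathD_bound[OF B _ R(2)[OF that(1)] A, of t] sub[OF that] that by auto
 let ?k = "real M * B ^ ?n * R powr (real M + ?d - ?d / p) * E"
 let ?bound = "(real M / ?e + 4 * real M / ?d) * B ^ ?n * R powr (real M + ?d - ?d / p) * E"
 have "\<exists>\<Psi> \<Psi>'. (\<forall>y\<in>U. \<forall>t\<in>{0<..1}. (\<Psi> y has_real_derivative \<Psi>' y t) (at t) \<and> \<bar>pathD y t\<bar> <= \<Psi>' y t \<and> 0 <= \<Psi> y t)
   \<and> (\<forall>y\<in>U. (\<Psi> y \<longlongrightarrow> 0) (at_right 0) \<and> \<Psi> y 1 <= ?bound) \<and> (\<forall>t\<in>{0<..1}. continuous_on U (%y. \<Psi> y t))"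
 proof (cases "p = 1")
  case False
  then have e: "?e > 0" using p by auto
  let ?\<Psi> = "%(y::real^'d) t. ?k / ?e * t powr ?e" and ?\<Psi>' = "%(y::real^'d) t. ?k * t powr (?e - 1)"
  have "(?\<Psi> y has_real_derivative ?\<Psi>' y t) (at t)" if "t > 0" for y :: "real^'d" and t proof -
   have "((%t. k / ?e * t powr ?e) has_real_derivative k * t powr (?e - 1)) (at t)" for k
    by (rule DERIV_cong[OF DERIV_cmult[OF has_real_derivative_powr[OF that]]]) (use e in simp)
   then show ?thesis .
  qed
  moreover have "\<bar>pathD y t\<bar> <= ?\<Psi>' y t" if y: "y \<in> U" and t: "t \<in> {0<..1}" for y :: "real^'d" and t proof -
   have tp: "t > 0" "t * R > 0" using t R by auto
   have iP: "integrable lborel (%w. ?P w * indicator (cball y (t * R)) w)"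
    by (rule integrable_real_mult_indicator[OF _ defect_int[OF A]]) auto
   have "\<bar>pathD y t\<bar> <= (LBINT w. ?P w * ?K y t w)" by (rule D(1)[OF y t])
   also have "... <= (LBINT w. real M / t * (B / t) ^ ?n * (t * R) ^ M * (?P w * indicator (cball y (t * R)) w))" proof (rule integral_mono)
    show "integrable lborel (%w. ?P w * ?K y t w)"
     using integrable_mult_right[OF D(2)[OF y t], of "real M / t * (B / t) ^ ?n"] by (simp add: mult_ac)
    show "integrable lborel (%w. real M / t * (B / t) ^ ?n * (t * R) ^ M * (?P w * indicator (cball y (t * R)) w))"
     by (rule integrable_mult_right[OF iP])
    fix w
    have "norm (w - y) ^ M * indicator (cball y (t * R)) w <= (t * R) ^ M * indicator (cball y (t * R)) w"
     by (auto simp: indicator_def dist_norm norm_minus_commute intro!: power_mono)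
    then have "(real M / t * (B / t) ^ ?n * ?P w) * (norm (w - y) ^ M * indicator (cball y (t * R)) w)
      <= (real M / t * (B / t) ^ ?n * ?P w) * ((t * R) ^ M * indicator (cball y (t * R)) w)"
     using tp B0 defect_nonneg by (intro mult_left_mono) auto
    then show "?P w * ?K y t w
      <= real M / t * (B / t) ^ ?n * (t * R) ^ M * (?P w * indicator (cball y (t * R)) w)" by (simp only: mult_ac)
   qed
   also have "... = real M / t * (B / t) ^ ?n * (t * R) ^ M * (LBINT w. ?P w * indicator (cball y (t * R)) w)" by simp
   also have "... <= real M / t * (B / t) ^ ?n * (t * R) ^ M * (E * (t * R) powr (?d - ?d / p))"
    using E(2)[OF y tp(2)] tp B0 by (intro mult_left_mono) auto
   also have "... = real M * B ^ ?n * E * ((R ^ M * R powr (?d - ?d / p)) * ((1 / t) * (1 / t ^ ?n) * t ^ M * t powr (?d - ?d / p)))"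
    using tp R by (simp add: powr_mult power_mult_distrib power_divide)
   also have "R ^ M * R powr (?d - ?d / p) = R powr (real M + ?d - ?d / p)"
    using R(1) by (simp add: powr_add[symmetric] powr_realpow[symmetric] add_diff_eq)
   also have "(1 / t) * (1 / t ^ ?n) * t ^ M * t powr (?d - ?d / p) = t powr (?e - 1)" proof -
    have eqs: "(1 / t) = t powr (-1)" "1 / t ^ ?n = t powr (- ?d)" "t ^ M = t powr (real M)"
     using tp by (simp_all add: powr_minus powr_realpow divide_inverse)
    show ?thesis unfolding eqs powr_add[symmetric] by (rule arg_cong[where f = "%x. t powr x"]) simp
   qed
   finally show ?thesis by (simp add: mult_ac)
  qed
  moreover have "0 <= ?\<Psi> y t" for y :: "real^'d" and t using e E(1) B0 by (intro mult_nonneg_nonneg divide_nonneg_nonneg) auto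
  moreover have "(?\<Psi> y \<longlongrightarrow> 0) (at_right 0)" for y :: "real^'d" proof -
   have "((%t. t powr ?e) \<longlongrightarrow> 0) (at_right 0)"
    using e by (intro tendsto_zero_powrI[where b = ?e]) (auto intro!: tendsto_eq_intros eventually_at_rightI[of 0 1])
   then show ?thesis by (rule tendsto_mult_right_zero)
  qed
  moreover have "?\<Psi> y 1 <= ?bound" for y :: "real^'d" proof -
   have "?\<Psi> y 1 = (real M / ?e) * (B ^ ?n * R powr (real M + ?d - ?d / p) * E)" by simp
   also have "... <= (real M / ?e + 4 * real M / ?d) * (B ^ ?n * R powr (real M + ?d - ?d / p) * E)"
    using B0 E(1) by (intro mult_right_mono mult_nonneg_nonneg) auto
   finally show ?thesis by (simp only: mult_ac)
  qed
  ultimately show ?thesis by (intro exI[of _ ?\<Psi>] exI[of _ ?\<Psi>']) auto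
 next
  case True
  then have nM: "?n <= M" using p by simp
  define A0 where "A0 = 4 * real M * B ^ ?n * R ^ M / ?d"
  have A0: "A0 >= 0" unfolding A0_def using B0 R by simp
  define k where "k y t w = t ^ ?n * R ^ ?n / (t ^ ?n * R ^ ?n + norm (w - y) ^ ?n)" for y w :: "real^'d" and t
  define k' where "k' y t w = ?d * (t ^ ?n / t) * R ^ ?n * norm (w - y) ^ ?n / (t ^ ?n * R ^ ?n + norm (w - y) ^ ?n)\<^sup>2" for y w :: "real^'d" and t
  have pos: "t ^ ?n * R ^ ?n + norm (z :: real^'d) ^ ?n > 0" if "t > 0" for t z using that R by (intro add_pos_nonneg) auto
  have k01: "0 <= k y t w" "k y t w <= 1" if "t >= 0" for y t w proof -
   have "0 <= t ^ ?n * R ^ ?n" "0 <= norm (w - y) ^ ?n" using that R by auto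
   then show "0 <= k y t w" "k y t w <= 1" unfolding k_def by (auto simp: divide_le_eq_1 intro!: divide_nonneg_nonneg)
  qed
  have kc: "continuous_on S (%x. k (y x) (t x) (w x))"
   if "continuous_on S y" "continuous_on S t" "continuous_on S w" "!!x. x \<in> S ==> t x > 0"
   for S :: "'z::topological_space set" and y t w proof -
   have "t x ^ ?n * R ^ ?n + norm (w x - y x) ^ ?n ~= 0" if "x \<in> S" for x
    using pos[of "t x" "w x - y x"] \<open>!!x. x \<in> S ==> t x > 0\<close>[OF that] by simp
   then show ?thesis unfolding k_def by (intro continuous_intros that(1-3)) auto
  qed
  have kc': "continuous_on S (%x. k' (y x) (t x) (w x))"
   if "continuous_on S y" "continuous_on S t" "continuous_on S w" "!!x. x \<in> S ==> t x > 0"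
   for S :: "'z::topological_space set" and y t w proof -
   have "t x ^ ?n * R ^ ?n + norm (w x - y x) ^ ?n ~= 0" "t x ~= 0" if "x \<in> S" for x
    using pos[of "t x" "w x - y x"] \<open>!!x. x \<in> S ==> t x > 0\<close>[OF that] by simp_all
   then show ?thesis unfolding k'_def by (intro continuous_intros that(1-3)) auto
  qed
  have Pz: "?P w = 0" if "w \<notin> closure \<Omega>" for w using defect_zero closure_subset that by blast
  let ?\<Psi> = "%y t. A0 * (LBINT w. ?P w * k y t w)" and ?\<Psi>' = "%y t. A0 * (LBINT w. ?P w * k' y t w)"
  have "(?\<Psi> y has_real_derivative ?\<Psi>' y t) (at t)" if t: "t \<in> {0<..1}" for y t
  proof (rule DERIV_cmult, rule deriv_param_integral[OF defect_int[OF A] Pz compact_cl])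
   show "t \<in> {t/2<..<2*t}" using t by auto
   show "((%s. k y s w) has_real_derivative k' y s w) (at s)" if "s \<in> {t/2..2*t}" for s w
    unfolding k_def k'_def by (rule majorant_deriv) (use that t R in auto)
   show "continuous_on ({t/2..2*t} \<times> closure \<Omega>) (%z. k y (fst z) (snd z))"
    by (rule kc) (use t in "auto intro!: continuous_intros")
   show "continuous_on ({t/2..2*t} \<times> closure \<Omega>) (%z. k' y (fst z) (snd z))"
    by (rule kc') (use t in "auto intro!: continuous_intros")
  qed
  moreover have "\<bar>pathD y t\<bar> <= ?\<Psi>' y t" if y: "y \<in> U" and t: "t \<in> {0<..1}" for y t proof -
   have i2: "integrable lborel (%w. ?P w * k' y t w)" by (rule integrable_times_continuous[OF defect_int[OF A] Pz compact_cl])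
      (use t in "auto intro!: kc' continuous_intros")
   have "\<bar>pathD y t\<bar> <= (LBINT w. ?P w * ?K y t w)" by (rule D(1)[OF y t])
   also have "... <= (LBINT w. A0 * (?P w * k' y t w))" proof (rule integral_mono)
    show "integrable lborel (%w. ?P w * ?K y t w)"
     using integrable_mult_right[OF D(2)[OF y t], of "real M / t * (B / t) ^ ?n"] by (simp add: mult_ac)
    show "integrable lborel (%w. A0 * (?P w * k' y t w))" by (rule integrable_mult_right[OF i2])
    fix w
    have "?K y t w <= A0 * k' y t w" proof (cases "w \<in> cball y (t * R)")
     case True
     then show ?thesis unfolding A0_def k'_def
      using majorant_ineq[OF R(1), of t "norm (w - y)" ?n M B] t nM B0 by (simp add: dist_norm norm_minus_commute)
    next
     case False
     have "0 <= k' y t w" unfolding k'_def using t R by (intro divide_nonneg_nonneg mult_nonneg_nonneg) auto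
     then show ?thesis using False A0 by simp
    qed
    then show "?P w * ?K y t w <= A0 * (?P w * k' y t w)" using mult_left_mono[OF _ defect_nonneg[of A w]] by (metis mult.left_commute)
   qed
   finally show ?thesis by simp
  qed
  moreover have "0 <= ?\<Psi> y t" if "t \<in> {0<..1}" for y t
   using that A0 k01[of t y] defect_nonneg by (intro mult_nonneg_nonneg integral_nonneg_AE) auto
  moreover have "(?\<Psi> y \<longlongrightarrow> 0) (at_right 0)" for y proof -
   have "((%t. \<integral>w. ?P w * k y t w \<partial>lborel) \<longlongrightarrow> 0) (at_right 0)"
    unfolding tendsto_at_iff_sequentially comp_def proof (intro allI impI)
    fix X :: "nat => real" assume "\<forall>i. X i \<in> {0<..} - {0}" and X0: "X \<longlonglongrightarrow> 0"
    then have X: "X n > 0" for n by auto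
    have "(%n. \<integral>w. ?P w * k y (X n) w \<partial>lborel) \<longlonglongrightarrow> (\<integral>w. 0 \<partial>(lborel :: (real^'d) measure))"
    proof (rule integral_dominated_convergence[where w = ?P])
     show "integrable lborel ?P" by (rule defect_int[OF A])
     show "(%w. ?P w * k y (X n) w) \<in> borel_measurable lborel" for n
      by (rule borel_measurable_integrable, rule integrable_times_continuous[OF defect_int[OF A] Pz compact_cl])
        (use X in "auto intro!: kc continuous_intros")
     show "AE w in lborel. norm (?P w * k y (X n) w) <= ?P w" for n using k01[of "X n" y] X[of n] defect_nonneg[of A]
      by (intro always_eventually allI) (simp add: abs_mult mult_left_le)
     \<comment> \<open>For w different from y the quotient \<open>k\<close> tends to 0. At w = y it
       is 1 for all positive t, but a single point is a null set.\<close>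
     show "AE w in lborel. (%n. ?P w * k y (X n) w) \<longlonglongrightarrow> 0" using AE_lborel_singleton[of y] proof eventually_elim
      case (elim w)
      have "(%n. k y (X n) w) \<longlonglongrightarrow> 0 ^ ?n * R ^ ?n / (0 ^ ?n * R ^ ?n + norm (w - y) ^ ?n)"
       unfolding k_def by (intro tendsto_intros X0) (use elim in "auto simp: power_0_left")
      then show ?case by (auto intro!: tendsto_mult_right_zero simp: power_0_left)
     qed
    qed simp
    then show "(%n. \<integral>w. ?P w * k y (X n) w \<partial>lborel) \<longlonglongrightarrow> 0" by simp
   qed
   then show ?thesis by (rule tendsto_mult_right_zero)
  qed
  moreover have "?\<Psi> y 1 <= ?bound" if y: "y \<in> U" for y proof -
   \<comment> \<open>For p = 1 the radius enters the mass bound with exponent 0, so a ball that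
     contains all of \<Omega> costs nothing.\<close>
   obtain r where r: "r > 0" "\<Omega> \<subseteq> cball y r" using bounded_subset_ballD[OF bdd, of y] ball_subset_cball by blast
   have "(LBINT w. ?P w * k y 1 w) <= (LBINT w. ?P w * indicator (cball y r) w)" proof (rule integral_mono)
    show "integrable lborel (%w. ?P w * k y 1 w)"
     by (rule integrable_times_continuous[OF defect_int[OF A] Pz compact_cl]) (auto intro!: kc continuous_intros)
    show "integrable lborel (%w. ?P w * indicator (cball y r) w)" by (rule integrable_real_mult_indicator[OF _ defect_int[OF A]]) auto
    show "?P w * k y 1 w <= ?P w * indicator (cball y r) w" for w using defect_zero[of w A] r(2) k01[of 1 y w] defect_nonneg[of A w]
     by (cases "w \<in> \<Omega>") (auto simp: mult_left_le subset_eq)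
   qed
   also have "... <= E" using E(2)[OF y r(1)] True r by simp
   finally have "?\<Psi> y 1 <= A0 * E" using A0 by (rule mult_left_mono)
   also have "... = (4 * real M / ?d) * (B ^ ?n * R powr (real M + ?d - ?d / p) * E)"
    unfolding A0_def using True R by (simp add: powr_realpow)
   also have "... <= (real M / ?e + 4 * real M / ?d) * (B ^ ?n * R powr (real M + ?d - ?d / p) * E)"
    using B0 E(1) e0 by (intro mult_right_mono mult_nonneg_nonneg) auto
   finally show ?thesis by (simp only: mult_ac)
  qed
  moreover have "continuous_on U (%y. ?\<Psi> y t)" if "t \<in> {0<..1}" for t proof (rule continuous_on_subset[of "closure \<Omega>"])
   show "continuous_on (closure \<Omega>) (%y. ?\<Psi> y t)"
    by (intro continuous_on_mult continuous_on_const continuous_param_integral(1)[OF defect_int[OF A] Pz compact_cl compact_cl])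
      (use that in "auto intro!: kc continuous_intros")
  qed (use U(2) closure_subset in blast)
  ultimately show ?thesis by (intro exI[of _ ?\<Psi>] exI[of _ ?\<Psi>'] conjI ballI)
 qed
 then obtain \<Psi> \<Psi>' where
  P1: "\<forall>y\<in>U. \<forall>t\<in>{0<..1}. (\<Psi> y has_real_derivative \<Psi>' y t) (at t) \<and> \<bar>pathD y t\<bar> <= \<Psi>' y t \<and> 0 <= \<Psi> y t"
  and P2: "\<forall>y\<in>U. (\<Psi> y \<longlongrightarrow> 0) (at_right 0) \<and> \<Psi> y 1 <= ?bound"
  and P3: "\<forall>t\<in>{0<..1}. continuous_on U (%y. \<Psi> y t)" by (elim exE conjE)
 have \<Psi>: "!!y t. y \<in> U ==> t \<in> {0<..1} ==> (\<Psi> y has_real_derivative \<Psi>' y t) (at t)"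
  "!!y t. y \<in> U ==> t \<in> {0<..1} ==> \<bar>pathD y t\<bar> <= \<Psi>' y t" "!!y t. y \<in> U ==> t \<in> {0<..1} ==> 0 <= \<Psi> y t"
  "!!y. y \<in> U ==> (\<Psi> y \<longlongrightarrow> 0) (at_right 0)" "!!y. y \<in> U ==> \<Psi> y 1 <= ?bound"
  "!!t. t \<in> {0<..1} ==> continuous_on U (%y. \<Psi> y t)" using P1 P2 P3 by (meson bspec)+
 obtain v where v: "continuous_on U v" "!!y. y \<in> U ==> (pathF y \<longlongrightarrow> v y) (at_right 0)"
  "!!y t. y \<in> U ==> t \<in> {0<..1} ==> \<bar>pathF y t - v y\<bar> <= \<Psi> y 1"
  using path_limit[of U pathF pathD \<Psi> \<Psi>', OF F \<Psi>(1-4) Fc \<Psi>(6)] by metis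
 have "AE y in lborel. y \<in> U --> v y = W (%_. 0) y" by (rule path_limit_AE[OF e0(2) one U v(1,2) \<Psi>(6)[of 1] v(3)]) auto
 moreover have "\<bar>pathF y 1 - v y\<bar> <= ?bound" if "y \<in> U" for y using v(3)[OF that, of 1] \<Psi>(5)[OF that] by simp
 ultimately show ?thesis using v(1) by blast
qed

end


section \<open>Uniform interior cones\<close>


text \<open>With \<epsilon> = 1/(2 + 2L), a direction v within \<epsilon> of n climbs by at least 1
  - \<epsilon> per unit of t and moves sideways by at most 2\<epsilon>. The graph rises by at most
  2L\<epsilon> meanwhile, and 2L\<epsilon> <= 1 - \<epsilon>.\<close>

lemma epigraph_cone:
 fixes n :: "'a::euclidean_space"
 assumes n: "norm n = 1" and g: "L-lipschitz_on {v. v \<bullet> n = 0} g" and y: "y \<bullet> n > g (y - (y \<bullet> n) *\<^sub>R n)"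
  and v: "norm (v - n) <= 1 / (2 + 2 * L)" and t: "t >= 0"
 shows "(y + t *\<^sub>R v) \<bullet> n > g ((y + t *\<^sub>R v) - ((y + t *\<^sub>R v) \<bullet> n) *\<^sub>R n)"
proof -
 define \<epsilon> where "\<epsilon> = 1 / (2 + 2 * L)"
 define P where "P v = v - (v \<bullet> n) *\<^sub>R n" for v
 have L: "L >= 0" using g by (rule lipschitz_on_nonneg)
 have nn: "n \<bullet> n = 1" using n by (simp add: norm_eq_1)
 have P: "P v \<in> {v. v \<bullet> n = 0}" for v by (simp add: P_def inner_diff_left nn)
 have vn: "\<bar>1 - v \<bullet> n\<bar> <= \<epsilon>" proof -
  have "1 - v \<bullet> n = (n - v) \<bullet> n" by (simp add: inner_diff_left nn)
  also have "\<bar>...\<bar> <= norm (n - v) * norm n" by (rule Cauchy_Schwarz_ineq2)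
  finally show ?thesis using v n by (simp add: norm_minus_commute \<epsilon>_def)
 qed
 have Pv: "norm (P v) <= 2 * \<epsilon>" proof -
  have "P v = (v - n) + (1 - v \<bullet> n) *\<^sub>R n" by (simp add: P_def algebra_simps)
  then have "norm (P v) <= norm (v - n) + \<bar>1 - v \<bullet> n\<bar>" using norm_triangle_ineq[of "v - n" "(1 - v \<bullet> n) *\<^sub>R n"] n by simp
  then show ?thesis using v vn by (simp add: \<epsilon>_def)
 qed
 have "dist (g (P (y + t *\<^sub>R v))) (g (P y)) <= L * dist (P (y + t *\<^sub>R v)) (P y)" by (rule lipschitz_onD[OF g P P])
 also have "P (y + t *\<^sub>R v) - P y = t *\<^sub>R P v" by (simp add: P_def algebra_simps)
 then have "dist (P (y + t *\<^sub>R v)) (P y) = t * norm (P v)" using t by (simp add: dist_norm)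
 also have "L * (t * norm (P v)) <= L * (t * (2 * \<epsilon>))" using L t Pv by (intro mult_left_mono) auto
 finally have "g (P (y + t *\<^sub>R v)) <= g (P y) + t * (2 * L * \<epsilon>)" by (simp add: dist_real_def abs_le_iff algebra_simps)
 also have "... <= g (P y) + t * (v \<bullet> n)" proof -
  have "2 * L * \<epsilon> + \<epsilon> <= 1" using L by (simp add: \<epsilon>_def field_simps)
  then have "2 * L * \<epsilon> <= v \<bullet> n" using vn by linarith
  then show ?thesis using t by (simp add: mult_left_mono)
 qed
 also have "... < y \<bullet> n + t * (v \<bullet> n)" using y by (simp add: P_def)
 finally show ?thesis by (simp add: P_def inner_add_left)
qed

text \<open>A strict epigraph of a continuous function is open, so a boundary point lying in
  \<Omega> would be an interior point.\<close>

lemma lipschitz_boundary_open: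
 assumes "lipschitz_boundary \<Omega>" shows "open \<Omega>"
proof -
 have "\<Omega> \<inter> frontier \<Omega> = {}" proof (rule ccontr)
  assume "\<Omega> \<inter> frontier \<Omega> ~= {}"
  then obtain z where z: "z \<in> \<Omega>" "z \<in> frontier \<Omega>" by blast
  then obtain \<rho> n g L where *: "\<rho> > 0" "norm n = 1" "L-lipschitz_on {v. v \<bullet> n = 0} g"
   "\<Omega> \<inter> ball z \<rho> = {x \<in> ball z \<rho>. x \<bullet> n > g (x - (x \<bullet> n) *\<^sub>R n)}"
   using assms[unfolded lipschitz_boundary_def, rule_format, OF z(2)] by (elim exE conjE)
  have nn: "n \<bullet> n = 1" using *(2) by (simp add: norm_eq_1)
  have gc: "continuous_on UNIV (%x. g (x - (x \<bullet> n) *\<^sub>R n))"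
   by (rule continuous_on_compose2[OF lipschitz_on_continuous_on[OF *(3)]])
     (auto intro!: continuous_intros simp: inner_diff_left nn)
  have "open {x. g (x - (x \<bullet> n) *\<^sub>R n) < x \<bullet> n}" by (intro open_Collect_less gc continuous_intros)
  then have "open (\<Omega> \<inter> ball z \<rho>)" unfolding *(4) by (simp only: Collect_conj_eq Collect_mem_eq open_Int open_ball)
  then have "z \<in> interior \<Omega>" using z(1) *(1) by (meson Int_iff centre_in_ball inf_le1 interiorI)
  then show False using z(2) by (simp add: frontier_def)
 qed
 then show ?thesis by (metis frontier_disjoint_eq inf_commute)
qed

text \<open>The interior cone condition gives directions to single points, without relating those of
  neighbours. Here one direction has to serve all points of \<Omega> near x, so that a single bump
  is visible from all of them. Compactness of the frontier makes \<tau> and \<epsilon>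
  uniform.\<close>

lemma uniform_cone:
 assumes bdd: "bounded \<Omega>" and lip: "lipschitz_boundary (\<Omega> :: (real^'d::finite) set)"
 shows "\<exists>\<tau>>0. \<exists>\<epsilon>>0. \<epsilon> <= 1 \<and> (\<forall>x\<in>\<Omega>. \<exists>n. norm n = 1 \<and>
  (\<forall>y\<in>\<Omega> \<inter> ball x \<tau>. \<forall>v. norm (v - n) <= \<epsilon> --> (\<forall>t\<in>{0..\<tau>}. y + t *\<^sub>R v \<in> \<Omega>)))"
proof -
 define Q where "Q z \<rho> n g L \<longleftrightarrow> \<rho> > (0::real) \<and> norm n = 1 \<and> L-lipschitz_on {v. v \<bullet> n = 0} g \<and>
   \<Omega> \<inter> ball z \<rho> = {x \<in> ball z \<rho>. x \<bullet> n > g (x - (x \<bullet> n) *\<^sub>R n)}" for z \<rho> n g L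
 have "\<exists>\<rho> n g L. Q z \<rho> n g L" if "z \<in> frontier \<Omega>" for z
  using lip[unfolded lipschitz_boundary_def, rule_format, OF that] unfolding Q_def by (elim exE conjE) (intro exI conjI)
 then obtain \<rho> n g L where "!!z. z \<in> frontier \<Omega> ==> Q z (\<rho> z) (n z) (g z) (L z)" by metis
 note F = this[unfolded Q_def]
 have cf: "compact (frontier \<Omega>)" using bdd by (rule compact_frontier_bounded)
 have sub: "frontier \<Omega> \<subseteq> (\<Union>z\<in>frontier \<Omega>. ball z (\<rho> z / 2))" using F by force
 obtain D where D: "D \<subseteq> frontier \<Omega>" "finite D" "frontier \<Omega> \<subseteq> (\<Union>z\<in>D. ball z (\<rho> z / 2))"
  by (rule compactE_image[OF cf _ sub]) (rule open_ball, rule that)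
 \<comment> \<open>If x is within 3\<tau> of a frontier point and y within \<tau> of x, then y is at
   distance less than \<rho>/2 + 4\<tau> from a chart centre and moves by at most 2\<tau>. To stay
   in the chart, 6\<tau> must not exceed \<rho>/2.\<close>
 define \<tau> where "\<tau> = Min (insert 1 (\<rho> ` D)) / 12"
 define \<epsilon> where "\<epsilon> = Min (insert 1 ((%z. 1 / (2 + 2 * L z)) ` D))"
 have L0: "L z >= 0" if "z \<in> D" for z using F[of z] that D(1) lipschitz_on_nonneg by blast
 have \<tau>: "\<tau> > 0" "!!z. z \<in> D ==> 12 * \<tau> <= \<rho> z" using D F by (auto simp: \<tau>_def Min_gr_iff)
 have \<epsilon>: "\<epsilon> > 0" "\<epsilon> <= 1" "!!z. z \<in> D ==> \<epsilon> <= 1 / (2 + 2 * L z)"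
  using D L0 by (auto simp: \<epsilon>_def Min_gr_iff add_pos_nonneg)
 have "\<exists>n. norm n = 1 \<and> (\<forall>y\<in>\<Omega> \<inter> ball x \<tau>. \<forall>v. norm (v - n) <= \<epsilon> --> (\<forall>t\<in>{0..\<tau>}. y + t *\<^sub>R v \<in> \<Omega>))"
  if x: "x \<in> \<Omega>" for x proof -
  have small: "norm (t *\<^sub>R v) <= 2 * \<tau>" if "norm n = 1" "norm (v - n) <= \<epsilon>" "t \<in> {0..\<tau>}" for n v :: "real^'d" and t
  proof -
   have "norm v <= 2" using norm_triangle_ineq2[of v n] that \<epsilon>(2) by linarith
   then have "t * norm v <= \<tau> * 2" using that \<tau>(1) by (intro mult_mono) auto
   then show ?thesis using that by simp
  qed
  show ?thesis proof (cases "ball x (3 * \<tau>) \<inter> frontier \<Omega> = {}")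
   case True
   have sub: "ball x (3 * \<tau>) \<subseteq> \<Omega>" proof (rule ccontr)
    assume "\<not> ball x (3 * \<tau>) \<subseteq> \<Omega>"
    then have "ball x (3 * \<tau>) \<inter> frontier \<Omega> ~= {}" proof (intro connected_Int_frontier)
     show "ball x (3 * \<tau>) \<inter> \<Omega> ~= {}" using x \<tau>(1) by (metis IntI centre_in_ball emptyE mult_pos_pos zero_less_numeral)
    qed (use \<open>\<not> ball x (3 * \<tau>) \<subseteq> \<Omega>\<close> in auto)
    then show False using True by simp
   qed
   let ?n = "axis undefined 1 :: real^'d"
   have "y + t *\<^sub>R v \<in> \<Omega>" if "y \<in> ball x \<tau>" "norm (v - ?n) <= \<epsilon>" "t \<in> {0..\<tau>}" for y v t proof -
    have "norm (t *\<^sub>R v) <= 2 * \<tau>" by (rule small[OF _ that(2,3)]) simp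
    moreover have "norm (x - (y + t *\<^sub>R v)) <= norm (x - y) + norm (t *\<^sub>R v)"
     using norm_triangle_ineq4[of "x - y" "t *\<^sub>R v"] by (simp add: algebra_simps)
    ultimately show ?thesis using that(1) sub by (auto simp: dist_norm subset_eq)
   qed
   then show ?thesis by (intro exI[of _ ?n]) auto
  next
   case False
   then obtain w where w: "dist x w < 3 * \<tau>" "w \<in> frontier \<Omega>" by auto
   then obtain z where z: "z \<in> D" "dist z w < \<rho> z / 2" using D(3) by auto
   have Fz: "norm (n z) = 1" "(L z)-lipschitz_on {v. v \<bullet> n z = 0} (g z)"
    "\<Omega> \<inter> ball z (\<rho> z) = {x \<in> ball z (\<rho> z). x \<bullet> n z > g z (x - (x \<bullet> n z) *\<^sub>R n z)}"
    using F[of z] z D(1) by auto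
   have "y + t *\<^sub>R v \<in> \<Omega>" if y: "y \<in> \<Omega>" "y \<in> ball x \<tau>" and v: "norm (v - n z) <= \<epsilon>" and t: "t \<in> {0..\<tau>}" for y v t
   proof -
    have zy: "dist z y < \<rho> z / 2 + 4 * \<tau>"
     using dist_triangle[of z y w] dist_triangle[of w y x] w(1) z(2) y(2) by (simp add: dist_commute)
    have "dist z (y + t *\<^sub>R v) <= dist z y + norm (t *\<^sub>R v)"
     using dist_triangle[of z "y + t *\<^sub>R v" y] by (simp add: dist_norm)
    also have "... < \<rho> z" using zy small[OF Fz(1) v t] \<tau>(2)[OF z(1)] by linarith
    finally have b: "y + t *\<^sub>R v \<in> ball z (\<rho> z)" by simp
    have "y \<in> \<Omega> \<inter> ball z (\<rho> z)" using y zy \<tau>(2)[OF z(1)] \<tau>(1) by auto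
    then have "y \<bullet> n z > g z (y - (y \<bullet> n z) *\<^sub>R n z)" unfolding Fz(3) by simp
    from epigraph_cone[OF Fz(1,2) this, of v t] v t \<epsilon>(3)[OF z(1)]
    have "y + t *\<^sub>R v \<in> {x \<in> ball z (\<rho> z). x \<bullet> n z > g z (x - (x \<bullet> n z) *\<^sub>R n z)}" using b by simp
    then show ?thesis unfolding Fz(3)[symmetric] by simp
   qed
   then show ?thesis using Fz(1) by (intro exI[of _ "n z"]) auto
  qed
 qed
 then show ?thesis using \<tau>(1) \<epsilon>(1,2) by blast
qed

text \<open>The ball centred on the axis at distance c = l/(1 + sin \<theta>) with radius c sin
  \<theta> touches both the mantle and the spherical cap of the cone.\<close>

lemma cone_contains_ball:
 assumes cone: "interior_cone_condition \<Omega> \<theta> r" and \<theta>: "0 < \<theta>" "\<theta> < pi / 2" and x: "x \<in> \<Omega>" and l: "0 < l" "l <= r"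
 shows "\<exists>z. norm (z - x) <= l \<and> cball z (l * sin \<theta> / (1 + sin \<theta>)) \<subseteq> \<Omega> \<inter> cball x l"
proof -
 obtain \<xi> where \<xi>: "norm \<xi> = 1" "{x + t *\<^sub>R y | t y. norm y = 1 \<and> y \<bullet> \<xi> >= cos \<theta> \<and> 0 <= t \<and> t <= r} \<subseteq> \<Omega>"
  using cone x unfolding interior_cone_condition_def by blast
 have s: "0 < sin \<theta>" "sin \<theta> < 1" "0 < cos \<theta>"
  using \<theta> sin_gt_zero cos_gt_zero sin_monotone_2pi[of \<theta> "pi/2"] by auto
 define s where "s = sin \<theta>"
 define c where "c = l / (1 + s)"
 have c: "c > 0" "c * (1 + s) = l" using l s by (auto simp: c_def s_def)
 have xx: "\<xi> \<bullet> \<xi> = 1" using \<xi>(1) by (simp add: norm_eq_1)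
 have "x + (c *\<^sub>R \<xi> + u) \<in> \<Omega> \<inter> cball x l" if u: "norm u <= c * s" for u proof -
  define w where "w = c *\<^sub>R \<xi> + u"
  define a where "a = u \<bullet> \<xi>"
  have nw: "norm w <= l" using norm_triangle_ineq[of "c *\<^sub>R \<xi>" u] u \<xi>(1) c by (simp add: w_def algebra_simps)
  have a: "\<bar>a\<bar> <= c * s" using Cauchy_Schwarz_ineq2[of u \<xi>] u \<xi>(1) by (simp add: a_def)
  have wx: "w \<bullet> \<xi> = c + a" by (simp add: w_def a_def inner_add_left xx)
  have "c * s < c" using c s by (simp add: s_def)
  then have ca: "c + a > 0" using a by linarith
  have w2: "w \<bullet> w = c\<^sup>2 + 2 * c * a + u \<bullet> u"
   by (simp add: w_def a_def inner_add_left inner_add_right xx power2_eq_square inner_commute)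
  have uu: "u \<bullet> u <= (c * s)\<^sup>2" using u by (simp add: power2_norm_eq_inner[symmetric] power_mono)
  have cs: "(cos \<theta>)\<^sup>2 = 1 - s\<^sup>2" by (simp add: s_def cos_squared_eq)
  \<comment> \<open>The angle condition is proved in squared form; the right side turns out to be (c
    + a)^2 minus a square.\<close>
  have "(cos \<theta>)\<^sup>2 * (w \<bullet> w) <= (1 - s\<^sup>2) * (c\<^sup>2 + 2 * c * a + (c * s)\<^sup>2)"
   unfolding cs w2 using uu s by (intro mult_left_mono) (auto simp: s_def power_le_one)
  also have "... = (c + a)\<^sup>2 - (c * s\<^sup>2 + a)\<^sup>2" by (simp add: power2_eq_square algebra_simps)
  also have "... <= (c + a)\<^sup>2" by simp
  finally have "(cos \<theta> * norm w)\<^sup>2 <= (c + a)\<^sup>2" by (simp add: power_mult_distrib power2_norm_eq_inner)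
  then have ang: "cos \<theta> * norm w <= w \<bullet> \<xi>" unfolding wx by (rule power2_le_imp_le) (use ca in simp)
  have w0: "w ~= 0" using wx ca by auto
  let ?y = "(1 / norm w) *\<^sub>R w"
  have "x + w = x + norm w *\<^sub>R ?y" using w0 by simp
  moreover have "norm ?y = 1" "?y \<bullet> \<xi> >= cos \<theta>" using w0 ang by (auto simp: pos_le_divide_eq)
  ultimately have "x + w \<in> {x + t *\<^sub>R y | t y. norm y = 1 \<and> y \<bullet> \<xi> >= cos \<theta> \<and> 0 <= t \<and> t <= r}"
   using nw l by (intro CollectI exI[of _ "norm w"] exI[of _ ?y]) auto
  then have "x + w \<in> \<Omega>" by (rule subsetD[OF \<xi>(2)])
  moreover have "x + w \<in> cball x l" using nw by (simp add: dist_norm)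
  ultimately show ?thesis by (simp add: w_def)
 qed
 note * = this
 have cs: "l * sin \<theta> / (1 + sin \<theta>) = c * s" by (simp add: c_def s_def)
 show ?thesis proof (intro exI[of _ "x + c *\<^sub>R \<xi>"] conjI subsetI)
  have "c * 1 <= c * (1 + s)" using c s by (intro mult_left_mono) (auto simp: s_def)
  then have "c <= l" using c by simp
  then show "norm (x + c *\<^sub>R \<xi> - x) <= l" using c \<xi>(1) by simp
  fix y assume "y \<in> cball (x + c *\<^sub>R \<xi>) (l * sin \<theta> / (1 + sin \<theta>))"
  then have "norm (y - (x + c *\<^sub>R \<xi>)) <= c * s" by (simp add: cs dist_norm norm_minus_commute)
  from *[OF this] show "y \<in> \<Omega> \<inter> cball x l" by (simp add: algebra_simps)
 qed
qed


section \<open>Polynomial inequalities and norming balls\<close>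


definition lag :: "(nat => real) => nat => nat => real poly" where
 "lag x m k = (\<Prod>j\<in>{..m} - {k}. smult (1 / (x k - x j)) [:- x j, 1:])"

lemma poly_lag: "poly (lag x m k) t = (\<Prod>j\<in>{..m} - {k}. (t - x j) / (x k - x j))"
 unfolding lag_def poly_prod by (intro prod.cong refl) (simp add: diff_divide_distrib)

lemma degree_lag:
 assumes "k <= m" shows "degree (lag x m k) <= m"
proof -
 have "degree (lag x m k) <= (\<Sum>j\<in>{..m} - {k}. degree (smult (1 / (x k - x j)) [:- x j, 1:]))" unfolding lag_def
  by (rule order_trans[OF degree_prod_sum_le]) (simp_all only: comp_def order_refl finite_Diff finite_atMost)
 also have "... <= (\<Sum>j\<in>{..m} - {k}. 1)" by (intro sum_mono order_trans[OF degree_smult_le]) simp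
 also have "... = m" using assms by simp
 finally show ?thesis .
qed

lemma lagrange_interpolation:
 assumes inj: "inj_on x {..m}" and P: "degree P <= m"
 shows "P = (\<Sum>k\<le>m. smult (poly P (x k)) (lag x m k))"
proof (rule poly_eqI_degree[of "x ` {..m}"])
 have card: "card (x ` {..m}) = Suc m" using inj by (simp add: card_image)
 show "card (x ` {..m}) > degree P" using P card by simp
 have "degree (\<Sum>k\<le>m. smult (poly P (x k)) (lag x m k)) <= m"
  by (intro degree_sum_le) (auto intro!: order_trans[OF degree_smult_le] degree_lag)
 then show "card (x ` {..m}) > degree (\<Sum>k\<le>m. smult (poly P (x k)) (lag x m k))" using card by simp
 fix t assume "t \<in> x ` {..m}"
 then obtain i where i: "i <= m" "t = x i" by auto
 have "poly (lag x m k) (x i) = (if k = i then 1 else 0)" if "k <= m" for k proof (cases "k = i")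
  case True
  have "x i ~= x j" if "j \<in> {..m} - {i}" for j using inj_onD[OF inj, of i j] i that by auto
  then have "(\<Prod>j\<in>{..m} - {i}. (x i - x j) / (x i - x j)) = 1" by (intro prod.neutral) auto
  then show ?thesis unfolding poly_lag using True by simp
 next
  case False
  then show ?thesis unfolding poly_lag using i that by (auto intro!: prod_zero)
 qed
 then have "(\<Sum>k\<le>m. poly P (x k) * poly (lag x m k) (x i)) = (\<Sum>k\<le>m. if k = i then poly P (x k) else 0)"
  by (intro sum.cong) auto
 then show "poly P t = poly (\<Sum>k\<le>m. smult (poly P (x k)) (lag x m k)) t" using i by (simp add: poly_sum)
qed

fun cheb :: "nat => real poly" where
 "cheb 0 = 1"
| "cheb (Suc 0) = [:0, 1:]"
| "cheb (Suc (Suc n)) = [:0, 2:] * cheb (Suc n) - cheb n"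

lemma degree_cheb: "degree (cheb n) <= n"
proof (induction n rule: cheb.induct)
 case (3 n)
 have "degree ([:0, 2:] * cheb (Suc n)) <= Suc (Suc n)" using 3 by (intro order_trans[OF degree_mult_le]) simp
 then show ?case using 3 by (auto intro!: degree_diff_le)
qed auto

lemma poly_cheb: "poly (cheb n) (cos t) = cos (real n * t)"
proof (induction n rule: cheb.induct)
 case (3 n)
 have "cos (real (Suc (Suc n)) * t) + cos (real n * t) = 2 * cos t * cos (real (Suc n) * t)"
  using cos_add[of "real (Suc n) * t" t] cos_diff[of "real (Suc n) * t" t] by (simp add: algebra_simps)
 then show ?case using 3 by simp
qed auto

lemma prod_nonpos_sign:
 fixes a :: "'a => real"
 assumes "!!j. j \<in> S ==> a j <= 0"
 shows "0 <= (-1) ^ card S * (\<Prod>j\<in>S. a j)"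
proof -
 have "(-1) ^ card S * (\<Prod>j\<in>S. a j) = (\<Prod>j\<in>S. - a j)" using prod.distrib[of "%_. -1" a S] by simp
 also have "... >= 0" using assms by (intro prod_nonneg) auto
 finally show ?thesis .
qed

text \<open>Among polynomials with P(1) = 1 that are bounded by 1 on [-1, 1], the Chebyshev
  polynomial T_m drops fastest to the left of 1. In the Lagrange formula at its extremal points x_k,
  the value of P - T_m between x_1 and x_0 is a sum of nonnegative terms: for k > 0 both P(x_k) -
  (-1)^k and the k-th basis polynomial carry the sign (-1)^(k - 1) or vanish.\<close>

lemma chebyshev_comparison:
 assumes m: "m >= 1" and P: "degree P <= m" "poly P 1 = 1" "!!x. x \<in> {-1..1} ==> \<bar>poly P x\<bar> <= 1"
  and t: "0 < t" "t < pi / real m"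
 shows "cos (real m * t) <= poly P (cos t)"
proof -
 define x where "x k = cos (real k * pi / real m)" for k
 have ang: "0 <= real k * pi / real m" "real k * pi / real m <= pi" if "k <= m" for k
  using that m by (auto simp: divide_le_eq mult_right_mono)
 have dec: "x k < x j" if "j < k" "k <= m" for j k
  unfolding x_def by (rule cos_monotone_0_pi) (use that m ang in "auto simp: divide_strict_right_mono")
 have inj: "inj_on x {..m}" by (rule linorder_inj_onI) (use dec in force)+
 let ?u = "cos t"
 have m0: "real m > 0" using m by simp
 have "pi / real m <= pi / 1" using m by (intro divide_left_mono) auto
 then have tm: "t < pi" using t(2) by simp
 have u0: "?u < x 0" using cos_monotone_0_pi[of 0 t] t(1) tm by (simp add: x_def)
 have u1: "x j < ?u" if "1 <= j" "j <= m" for j proof -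
  have "pi / real m <= real j * pi / real m" using that m0 by (intro divide_right_mono) auto
  then show ?thesis unfolding x_def using t that ang[of j] by (intro cos_monotone_0_pi) auto
 qed
 have xr: "x k \<in> {-1..1}" for k by (simp add: x_def)
 have T: "poly (cheb m) (x k) = (-1) ^ k" for k using m0 poly_cheb[of m "real k * pi / real m"] by (simp add: x_def)
 have "poly P ?u - poly (cheb m) ?u = (\<Sum>k\<le>m. (poly P (x k) - (-1) ^ k) * poly (lag x m k) ?u)"
  by (subst lagrange_interpolation[OF inj P(1)], subst lagrange_interpolation[OF inj degree_cheb])
    (simp add: poly_sum T sum_subtractf[symmetric] left_diff_distrib)
 also have "... >= 0" proof (rule sum_nonneg)
  fix k assume "k \<in> {..m}"
  show "0 <= (poly P (x k) - (-1) ^ k) * poly (lag x m k) ?u" proof (cases "k = 0")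
   case True
   then have "x k = 1" by (simp add: x_def)
   then show ?thesis using P(2) True by simp
  next
   case False
   let ?a = "%j. (?u - x j) / (x k - x j)"
   have split: "{..m} - {k} = insert 0 ({1..<k} \<union> {k<..m})" using False \<open>k \<in> {..m}\<close> by auto
   have "poly (lag x m k) ?u = ?a 0 * ((\<Prod>j\<in>{1..<k}. ?a j) * (\<Prod>j\<in>{k<..m}. ?a j))" proof -
    have "prod ?a ({1..<k} \<union> {k<..m}) = prod ?a {1..<k} * prod ?a {k<..m}" by (rule prod.union_disjoint) auto
    then show ?thesis unfolding poly_lag split by (subst prod.insert) auto
   qed
   moreover have a0: "?a 0 >= 0" using u0 dec[of 0 k] False \<open>k \<in> {..m}\<close> by (intro divide_nonpos_neg) auto
   moreover have a2: "(\<Prod>j\<in>{k<..m}. ?a j) >= 0" proof (rule prod_nonneg)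
    fix j assume "j \<in> {k<..m}"
    then show "0 <= ?a j" using u1[of j] dec[of k j] by (intro divide_nonneg_pos) auto
   qed
   moreover have a1: "0 <= (-1) ^ card {1..<k} * (\<Prod>j\<in>{1..<k}. ?a j)" proof (rule prod_nonpos_sign)
    fix j assume "j \<in> {1..<k}"
    then show "?a j <= 0" using u1[of j] dec[of j k] \<open>k \<in> {..m}\<close> by (intro divide_nonneg_neg) auto
   qed
   ultimately have "0 <= ?a 0 * (((-1) ^ (k - 1) * (\<Prod>j\<in>{1..<k}. ?a j)) * (\<Prod>j\<in>{k<..m}. ?a j))"
    using a1 by (intro mult_nonneg_nonneg[OF a0] mult_nonneg_nonneg[OF _ a2]) simp
   then have l: "0 <= (-1) ^ (k - 1) * poly (lag x m k) ?u" using \<open>poly (lag x m k) ?u = _\<close> by (simp only: mult_ac)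
   have "0 <= (-1) ^ (k - 1) * (poly P (x k) - (-1) ^ k)" proof -
    have "(-1) ^ (k - 1) * (-1::real) ^ k = -1" using False by (cases k) (auto simp: power_mult_distrib[symmetric])
    moreover have "\<bar>(-1) ^ (k - 1) * poly P (x k)\<bar> <= 1" using P(3)[OF xr] by (simp add: abs_mult power_abs)
    ultimately show ?thesis by (simp add: right_diff_distrib abs_le_iff)
   qed
   then have "0 <= ((-1) ^ (k - 1) * (poly P (x k) - (-1) ^ k)) * ((-1) ^ (k - 1) * poly (lag x m k) ?u)"
    using l by (rule mult_nonneg_nonneg)
   also have "... = ((-1) ^ (k - 1) * (-1) ^ (k - 1)) * ((poly P (x k) - (-1) ^ k) * poly (lag x m k) ?u)" by (simp only: mult_ac)
   also have "(-1) ^ (k - 1) * (-1::real) ^ (k - 1) = 1" by (simp add: power_mult_distrib[symmetric])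
   finally show ?thesis by simp
  qed
 qed
 finally show ?thesis by (simp add: poly_cheb)
qed

text \<open>The bound 1 - x^2/2 + x^4/24 with x <= 1 would allow 11/24. The smaller 33/80 is twice
  the fraction 33/160 that \<open>norming_ball\<close> needs; the factor 2 comes from mapping [0, L]
  to [-1, 1].\<close>

lemma cos_inverse_bound:
 assumes "m >= 1" shows "cos (1 / real m) <= 1 - 33 / 80 / (real m)\<^sup>2"
proof -
 define x where "x = 1 / real m"
 have x: "0 < x" "x <= 1" using assms by (auto simp: x_def)
 obtain t where t: "cos x = (\<Sum>i<4. cos_coeff i * x ^ i) + cos (t + 1/2 * real 4 * pi) / fact 4 * x ^ 4"
  using Maclaurin_cos_expansion2[OF x(1), of 4] by auto
 have "cos (t + 1/2 * real 4 * pi) * (x ^ 4 / 24) <= 1 * (x ^ 4 / 24)" by (rule mult_right_mono) auto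
 moreover have S: "(\<Sum>i<4. cos_coeff i * x ^ i) = 1 - x\<^sup>2 / 2" proof -
  have "{..<4::nat} = {0, 1, 2, 3}" by auto
  then show ?thesis by (simp add: cos_coeff_def)
 qed
 moreover have "x ^ 4 <= x\<^sup>2" using x by (intro power_decreasing) auto
 moreover have "0 <= x\<^sup>2" by simp
 moreover have "cos x = 1 - x\<^sup>2 / 2 + cos (t + 1/2 * real 4 * pi) * (x ^ 4 / 24)" unfolding t S by (simp add: fact_numeral)
 ultimately have "cos x <= 1 - 33 / 80 * x\<^sup>2" by linarith
 then show ?thesis by (simp add: x_def power_divide)
qed

lemma cos_1_ge: "1 / 2 <= cos (1::real)"
proof -
 have "cos (pi / 3) <= cos (1::real)" by (rule cos_monotone_0_pi_le) (use pi_gt3 in auto)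
 then show ?thesis by (simp add: cos_60)
qed

text \<open>An affine map puts the maximum at 1 and the point at cos t with t <= 1/m. There the
  Chebyshev polynomial is cos(mt) >= cos 1 >= cos(\<pi>/3) = 1/2.\<close>

lemma poly_half_near_max:
 fixes P :: "real poly"
 assumes m: "m >= 1" and P: "degree P <= m" and L: "L > 0" and max: "!!s. s \<in> {0..L} ==> \<bar>poly P s\<bar> <= \<bar>poly P 0\<bar>"
  and s: "0 <= s" "s <= 33 / 160 * L / (real m)\<^sup>2"
 shows "\<bar>poly P 0\<bar> <= 2 * \<bar>poly P s\<bar>"
proof (cases "poly P 0 = 0 \<or> s = 0")
 case False
 define g where "g = smult (1 / poly P 0) (pcompose P [:L / 2, - L / 2:])"
 have g: "poly g \<xi> = poly P (L / 2 - L / 2 * \<xi>) / poly P 0" for \<xi> by (simp add: g_def poly_pcompose mult.commute)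
 have dg: "degree g <= m" proof -
  have "degree g <= degree (pcompose P [:L / 2, - L / 2:])" unfolding g_def by (rule degree_smult_le)
  also have "... <= m" using P L by (simp add: degree_pcompose)
  finally show ?thesis .
 qed
 have s0: "s > 0" using False s by simp
 define \<xi> where "\<xi> = 1 - 2 * s / L"
 have "\<xi> >= 1 - 33 / 80 / (real m)\<^sup>2" using s L m by (simp add: \<xi>_def field_simps)
 then have \<xi>m: "cos (1 / real m) <= \<xi>" using cos_inverse_bound[OF m] by linarith
 have m1: "1 / real m <= 1" using m by simp
 have "0 <= 1 / real m" by simp
 then have "0 <= cos (1 / real m)" using m1 pi_gt3 by (intro cos_ge_zero) linarith+
 then have "0 <= \<xi>" using \<xi>m by linarith
 moreover have "\<xi> < 1" using s0 L by (simp add: \<xi>_def)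
 ultimately have \<xi>: "0 <= \<xi>" "\<xi> < 1" by auto
 define t where "t = arccos \<xi>"
 have ct: "cos t = \<xi>" unfolding t_def using \<xi> by (intro cos_arccos) auto
 have t: "0 <= t" "t <= pi" unfolding t_def using \<xi> by (auto intro: arccos_lbound arccos_ubound)
 have t0: "t > 0" using t ct \<xi> by (cases "t = 0") auto
 have tm: "t <= 1 / real m" proof (rule ccontr)
  assume "\<not> t <= 1 / real m"
  then have "cos t < cos (1 / real m)" using t m by (intro cos_monotone_0_pi) auto
  then show False using \<xi>m ct by simp
 qed
 have "cos (real m * t) <= poly g (cos t)" proof (rule chebyshev_comparison[OF m dg])
  show "poly g 1 = 1" using False by (simp add: g)
  show "\<bar>poly g x\<bar> <= 1" if "x \<in> {-1..1}" for x proof -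
   have "L / 2 * x <= L / 2 * 1" "L / 2 * (-1) <= L / 2 * x" using that L by (intro mult_left_mono; simp)+
   then have "L / 2 - L / 2 * x \<in> {0..L}" by simp
   from max[OF this] show ?thesis using False by (simp add: g)
  qed
  have "1 / real m < pi / real m" using m pi_gt3 by (intro divide_strict_right_mono) auto
  then show "t < pi / real m" using tm by simp
 qed (rule t0)
 moreover have "cos 1 <= cos (real m * t)" using t0 tm m pi_gt3 by (intro cos_monotone_0_pi_le) (auto simp: field_simps)
 ultimately have "1 / 2 <= poly g \<xi>" using cos_1_ge unfolding ct by linarith
 also have "poly g \<xi> = poly P s / poly P 0" using L by (simp add: g \<xi>_def right_diff_distrib)
 also have "... <= \<bar>poly P s\<bar> / \<bar>poly P 0\<bar>" by (metis abs_divide abs_ge_self)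
 finally show ?thesis using False by (simp add: pos_le_divide_eq)
qed auto


section \<open>Polynomials of several variables\<close>

definition mimono :: "('d::finite => nat) => real^'d => real" where
 "mimono \<gamma> v = (\<Prod>i\<in>UNIV. (v $ i) ^ \<gamma> i)"

definition mpoly :: "nat => (('d::finite => nat) => real) => real^'d => real" where
 "mpoly m c v = (\<Sum>\<gamma> | mi_size \<gamma> <= m. c \<gamma> * mimono \<gamma> v)"

text \<open>The only properties of a polynomial in \<open>d\<close> variables that the norming argument uses.\<close>

definition line_poly :: "nat => (real^'d::finite => real) => bool" where
 "line_poly m q \<longleftrightarrow> (\<forall>x v. \<exists>P. degree P <= m \<and> (\<forall>t. poly P t = q (x + t *\<^sub>R v)))"

declare finite_mi_size_le [simp]

lemma mpoly_line_poly:
 fixes c :: "('d::finite => nat) => real"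
 shows "line_poly m (mpoly m c)" unfolding line_poly_def
proof (intro allI)
 fix x v :: "real^'d"
 define P where "P = (\<Sum>\<gamma> | mi_size \<gamma> <= m. smult (c \<gamma>) (\<Prod>i\<in>UNIV. [:x $ i, v $ i:] ^ \<gamma> i))"
 have "degree (\<Prod>i\<in>UNIV. [:x $ i, v $ i:] ^ \<gamma> i) <= mi_size \<gamma>" for \<gamma> :: "'d => nat" proof -
  have "degree (\<Prod>i\<in>UNIV. [:x $ i, v $ i:] ^ \<gamma> i) <= (\<Sum>i\<in>UNIV. degree ([:x $ i, v $ i:] ^ \<gamma> i))"
   by (rule order_trans[OF degree_prod_sum_le]) (simp_all add: comp_def)
  also have "... <= (\<Sum>i\<in>UNIV. 1 * \<gamma> i)" by (intro sum_mono order_trans[OF degree_power_le] mult_right_mono) auto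
  finally show ?thesis by (simp add: mi_size_def)
 qed
 then have "degree P <= m" unfolding P_def by (intro degree_sum_le) (auto intro!: order_trans[OF degree_smult_le] intro: order_trans)
 moreover have "poly P t = mpoly m c (x + t *\<^sub>R v)" for t by (simp add: P_def mpoly_def mimono_def poly_sum poly_prod poly_power)
 ultimately show "\<exists>P. degree P <= m \<and> (\<forall>t. poly P t = mpoly m c (x + t *\<^sub>R v))" by blast
qed

lemma line_poly_affine:
 assumes "line_poly m q" shows "line_poly m (%y. q (a *\<^sub>R (y - z)))" unfolding line_poly_def
proof (intro allI)
 fix x v
 obtain P where "degree P <= m" "!!t. poly P t = q (a *\<^sub>R (x - z) + t *\<^sub>R (a *\<^sub>R v))"
  using assms unfolding line_poly_def by metis
 then show "\<exists>P. degree P <= m \<and> (\<forall>t. poly P t = q (a *\<^sub>R (x + t *\<^sub>R v - z)))"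
  by (intro exI[of _ P]) (auto simp: algebra_simps)
qed

lemma mpoly_continuous: "continuous_on S (mpoly m c)" unfolding mpoly_def mimono_def by (intro continuous_intros)

text \<open>From a maximum point x_0 of |q| in the ball one aims at a node x whose direction makes
  an angle of at most 60 degrees with the direction to the centre. The segment of length \<rho> from
  x_0 through x then stays in the ball, and \<open>poly_half_near_max\<close> applies along
  it.\<close>

lemma norming_ball:
 fixes q :: "real^'d::finite => real"
 assumes m: "m >= 1" and h: "h > 0" and \<rho>: "32 / 3 * (real m)\<^sup>2 * h <= \<rho>" and q: "line_poly m q" "continuous_on UNIV q"
  and fill: "!!y. y \<in> cball z \<rho> ==> \<exists>x\<in>X. norm (y - x) <= h" and y: "y \<in> cball z \<rho>"
 shows "\<exists>x\<in>X \<inter> cball z \<rho>. \<bar>q y\<bar> <= 2 * \<bar>q x\<bar>"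
proof -
 have m2: "(real m)\<^sup>2 >= 1" using m by simp
 then have "32 / 3 * 1 * h <= 32 / 3 * (real m)\<^sup>2 * h" using h by (intro mult_mono) auto
 then have \<rho>h: "32 / 3 * h <= \<rho>" using \<rho> by linarith
 have "\<exists>x0\<in>cball z \<rho>. \<forall>y\<in>cball z \<rho>. \<bar>q y\<bar> <= \<bar>q x0\<bar>"
  using y zero_le_dist[of z y, THEN order_trans, of \<rho>] by (intro continuous_attains_sup) (auto intro!: continuous_on_rabs continuous_on_subset[OF q(2)])
 then obtain x0 where x0: "x0 \<in> cball z \<rho>" "!!y. y \<in> cball z \<rho> ==> \<bar>q y\<bar> <= \<bar>q x0\<bar>" by blast
 define r where "r = norm (z - x0)"
 have r: "0 <= r" "r <= \<rho>" using x0(1) by (auto simp: r_def dist_norm)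
 obtain e :: "real^'d" where e: "norm e = 1" "z - x0 = r *\<^sub>R e" proof (cases "r = 0")
  case True
  then show ?thesis by (intro that[of "axis undefined 1"]) (auto simp: r_def)
 next
  case False
  then show ?thesis by (intro that[of "(1 / r) *\<^sub>R (z - x0)"]) (auto simp: r_def)
 qed
 have ee: "e \<bullet> e = 1" using e(1) by (simp add: norm_eq_1)
 \<comment> \<open>A node within h of this point is at distance at most 11/5 h from x_0 and, as 5/6
   is less than the sine of 60 degrees, within the required angle. The ratio of 11/5 to 32/3 is the
   33/160 of \<open>poly_half_near_max\<close>.\<close>
 define z' where "z' = x0 + (6/5 * h) *\<^sub>R e"
 have z'eq: "z' - z = (6/5 * h - r) *\<^sub>R e" using e(2) by (simp add: z'_def algebra_simps)
 have "norm (z' - z) <= \<rho>" unfolding z'eq using e(1) r \<rho>h h by (simp add: abs_le_iff)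
 then have "z' \<in> cball z \<rho>" by (simp add: dist_norm norm_minus_commute)
 then obtain x where x: "x \<in> X" "norm (z' - x) <= h" using fill by blast
 define u where "u = x - z'"
 have u: "norm u <= h" using x by (simp add: u_def norm_minus_commute)
 define b where "b = u \<bullet> e"
 have b: "\<bar>b\<bar> <= h" using Cauchy_Schwarz_ineq2[of u e] u e(1) by (simp add: b_def)
 define s where "s = norm (x - x0)"
 have xx: "x - x0 = (6/5 * h) *\<^sub>R e + u" by (simp add: u_def z'_def)
 have s2: "s\<^sup>2 = (6/5 * h)\<^sup>2 + 2 * (6/5 * h) * b + u \<bullet> u" unfolding s_def xx power2_norm_eq_inner
  by (simp add: inner_add_left inner_add_right ee b_def inner_commute power2_eq_square)
 have xe: "(x - x0) \<bullet> e = 6/5 * h + b" unfolding xx by (simp add: inner_add_left ee b_def)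
 have s_up: "s <= 11/5 * h" using norm_triangle_ineq[of "(6/5 * h) *\<^sub>R e" u] u e(1) h unfolding s_def xx by simp
 have pos: "6/5 * h + b > 0" using b h by linarith
 have "s > 0" using xe pos unfolding s_def by auto
 have uu: "u \<bullet> u <= h\<^sup>2" using u by (simp add: power2_norm_eq_inner[symmetric] power_mono)
 have "s\<^sup>2 <= (2 * (6/5 * h + b))\<^sup>2" proof -
  have "(b + 9/10 * h)\<^sup>2 * 4 = 4 * (b * b) + 36/5 * (b * h) + 81/25 * (h * h)"
   "(2 * (6/5 * h + b))\<^sup>2 = 144/25 * (h * h) + 48/5 * (b * h) + 4 * (b * b)"
   "(6/5 * h)\<^sup>2 + 2 * (6/5 * h) * b = 36/25 * (h * h) + 12/5 * (b * h)"
   "h\<^sup>2 = h * h" by (simp_all add: power2_eq_square algebra_simps)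
  moreover have "0 <= (b + 9/10 * h)\<^sup>2 * 4" "0 <= h * h" by simp_all
  ultimately show ?thesis using uu unfolding s2 by linarith
 qed
 then have half: "s <= 2 * (6/5 * h + b)" using pos by (intro power2_le_imp_le[of s]) auto
 define \<omega> where "\<omega> = (1 / s) *\<^sub>R (x - x0)"
 have \<omega>: "norm \<omega> = 1" "x = x0 + s *\<^sub>R \<omega>" "\<omega> \<bullet> e >= 1/2"
  using \<open>s > 0\<close> half by (auto simp: \<omega>_def s_def xe[unfolded s_def] pos_le_divide_eq)
 have \<rho>0: "\<rho> > 0" using \<rho>h h by linarith
 have seg: "x0 + t *\<^sub>R \<omega> \<in> cball z \<rho>" if t: "0 <= t" "t <= \<rho>" for t proof -
  have eq: "x0 + t *\<^sub>R \<omega> - z = t *\<^sub>R \<omega> - r *\<^sub>R e" using e(2) by (simp add: algebra_simps)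
  have "(norm (x0 + t *\<^sub>R \<omega> - z))\<^sup>2 = t\<^sup>2 - 2 * t * r * (\<omega> \<bullet> e) + r\<^sup>2"
   unfolding eq power2_norm_eq_inner using \<omega>(1) ee by (simp add: inner_diff_left inner_diff_right inner_commute power2_eq_square norm_eq_1 algebra_simps)
  also have "... <= t\<^sup>2 - t * r + r\<^sup>2" using mult_left_mono[OF \<omega>(3), of "2 * t * r"] t r by simp
  also have "... <= \<rho>\<^sup>2" proof -
   have "t\<^sup>2 - t * r + r\<^sup>2 <= \<rho>\<^sup>2" proof (cases "t <= r")
    case True
    then have "t * t <= t * r" using t by (intro mult_left_mono) auto
    moreover have "r\<^sup>2 <= \<rho>\<^sup>2" using r by (intro power_mono) auto
    ultimately show ?thesis by (simp add: power2_eq_square)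
   next
    case False
    then have "r * r <= t * r" using r by (intro mult_right_mono) auto
    moreover have "t\<^sup>2 <= \<rho>\<^sup>2" using t by (intro power_mono) auto
    ultimately show ?thesis by (simp add: power2_eq_square)
   qed
   then show ?thesis .
  qed
  finally have "norm (x0 + t *\<^sub>R \<omega> - z) <= \<rho>" using \<rho>0 by (intro power2_le_imp_le[of "norm (x0 + t *\<^sub>R \<omega> - z)"]) auto
  then show ?thesis by (simp add: dist_norm norm_minus_commute)
 qed
 obtain P where P: "degree P <= m" "!!t. poly P t = q (x0 + t *\<^sub>R \<omega>)" using q(1) unfolding line_poly_def by metis
 have "s <= 33 / 160 * \<rho> / (real m)\<^sup>2" proof -
  have "11/5 * h * (real m)\<^sup>2 <= 33 / 160 * \<rho>" using \<rho> by (simp add: mult_ac)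
  then have "s * (real m)\<^sup>2 <= 33 / 160 * \<rho>" using mult_right_mono[OF s_up, of "(real m)\<^sup>2"] by simp
  then show ?thesis using m by (simp add: pos_le_divide_eq)
 qed
 then have "\<bar>poly P 0\<bar> <= 2 * \<bar>poly P s\<bar>"
  using poly_half_near_max[OF m P(1) \<rho>0, of s] seg x0(2) P(2) \<open>s > 0\<close> by auto
 then have "\<bar>q x0\<bar> <= 2 * \<bar>q x\<bar>" using P(2) \<omega>(2) by simp
 moreover have "x \<in> cball z \<rho>" using seg[of s] \<omega>(2) s_up \<rho>h h \<open>s > 0\<close> by simp
 ultimately show ?thesis using x(1) x0(2)[OF y] by (intro bexI[of _ x]) auto
qed

text \<open>Lagrange interpolation in each variable writes the coefficients as linear combinations
  of the values on a tensor grid inside the unit ball. The order of the quantifiers matters: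
  \<open>K\<close> depends on degree and dimension only.\<close>

lemma coefficient_bound:
 "\<exists>K>0. \<forall>c S. (\<forall>v :: real^'d::finite. norm v <= 1 --> \<bar>mpoly m c v\<bar> <= S) --> (\<forall>\<gamma>. mi_size \<gamma> <= m --> \<bar>c \<gamma>\<bar> <= K * S)"
proof -
 \<comment> \<open>The spacing 1/(md + 1) keeps even the sum of all d coordinates of a grid point
   below 1, hence the grid inside the unit ball.\<close>
 define x where "x l = real l * (1 / (real m * real CARD('d) + 1))" for l
 \<comment> \<open>Weights of the j-th coefficient functional: paired with the values of t^n at the
   nodes they give 1 if n = j and 0 otherwise.\<close>
 define \<Lambda> where "\<Lambda> j l = coeff (lag x m l) j" for j l
 have den: "real m * real CARD('d) + 1 > 0" by (simp add: add_nonneg_pos)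
 have inj: "inj_on x {..m}" using den by (auto simp: inj_on_def x_def)
 have \<Lambda>: "(\<Sum>l\<le>m. \<Lambda> j l * x l ^ n) = (if n = j then 1 else 0)" if "n <= m" for j n proof -
  have "coeff (monom 1 n) j = coeff (\<Sum>k\<le>m. smult (poly (monom 1 n) (x k)) (lag x m k)) j"
   by (subst lagrange_interpolation[OF inj, of "monom 1 n"]) (use that in "auto simp: degree_monom_eq")
  then show ?thesis by (simp add: coeff_sum poly_monom \<Lambda>_def mult.commute)
 qed
 let ?I = "PiE (UNIV :: 'd set) (%_. {..m})"
 have finI: "finite ?I" by (intro finite_PiE) auto
 define V where "V l = (\<chi> i. x (l i))" for l :: "'d => nat"
 have V1: "norm (V l) <= 1" if "l \<in> ?I" for l proof -
  have "norm (V l) <= (\<Sum>i\<in>UNIV. \<bar>V l $ i\<bar>)" by (rule norm_le_l1_cart)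
  also have "... <= (\<Sum>i\<in>(UNIV :: 'd set). real m * (1 / (real m * real CARD('d) + 1)))" proof (rule sum_mono)
   fix i :: 'd
   have "l i <= m" using that by auto
   then show "\<bar>V l $ i\<bar> <= real m * (1 / (real m * real CARD('d) + 1))"
    using den unfolding V_def x_def by (simp add: divide_right_mono)
  qed
  also have "... <= 1" using den by (simp add: divide_le_eq mult.commute)
  finally show ?thesis .
 qed
 define K where "K \<gamma> = (\<Sum>l\<in>?I. \<bar>\<Prod>i\<in>UNIV. \<Lambda> (\<gamma> i) (l i)\<bar>)" for \<gamma> :: "'d => nat"
 have ext: "c \<gamma> = (\<Sum>l\<in>?I. (\<Prod>i\<in>UNIV. \<Lambda> (\<gamma> i) (l i)) * mpoly m c (V l))" if \<gamma>: "mi_size \<gamma> <= m" for c \<gamma>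
 proof -
  have comp: "\<delta> i <= m" if "mi_size \<delta> <= m" for \<delta> :: "'d => nat" and i
   using member_le_sum[of i UNIV \<delta>] that by (simp add: mi_size_def)
  have "(\<Sum>l\<in>?I. (\<Prod>i\<in>UNIV. \<Lambda> (\<gamma> i) (l i)) * mpoly m c (V l))
   = (\<Sum>l\<in>?I. \<Sum>\<delta> | mi_size \<delta> <= m. c \<delta> * (\<Prod>i\<in>UNIV. \<Lambda> (\<gamma> i) (l i) * x (l i) ^ \<delta> i))"
   unfolding mpoly_def mimono_def V_def sum_distrib_left by (simp add: prod.distrib mult_ac)
  also have "... = (\<Sum>\<delta> | mi_size \<delta> <= m. c \<delta> * (\<Sum>l\<in>?I. \<Prod>i\<in>UNIV. \<Lambda> (\<gamma> i) (l i) * x (l i) ^ \<delta> i))"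
   unfolding sum_distrib_left by (rule sum.swap)
  also have "... = (\<Sum>\<delta> | mi_size \<delta> <= m. c \<delta> * (\<Prod>i\<in>UNIV. \<Sum>l\<le>m. \<Lambda> (\<gamma> i) l * x l ^ \<delta> i))"
   by (subst prod_sum_PiE) auto
  also have "... = (\<Sum>\<delta> | mi_size \<delta> <= m. c \<delta> * (if \<delta> = \<gamma> then 1 else 0))"
  proof (intro sum.cong refl arg_cong2[where f = "(*)"])
   fix \<delta> :: "'d => nat" assume "\<delta> \<in> {\<delta>. mi_size \<delta> <= m}"
   then have "(\<Prod>i\<in>UNIV. \<Sum>l\<le>m. \<Lambda> (\<gamma> i) l * x l ^ \<delta> i) = (\<Prod>i\<in>UNIV. if \<delta> i = \<gamma> i then 1 else 0)"
    using \<Lambda> comp by (intro prod.cong) auto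
   also have "... = (if \<delta> = \<gamma> then 1 else 0)" by (auto simp: fun_eq_iff intro!: prod_zero)
   finally show "(\<Prod>i\<in>UNIV. \<Sum>l\<le>m. \<Lambda> (\<gamma> i) l * x l ^ \<delta> i) = (if \<delta> = \<gamma> then 1 else 0)" .
  qed
  also have "... = c \<gamma>" using \<gamma> by (simp add: if_distrib[of "%a. _ * a"] sum.delta cong: if_cong)
  finally show ?thesis by simp
 qed
 have Kn: "0 <= K \<gamma>" for \<gamma> unfolding K_def by (intro sum_nonneg) auto
 define KK where "KK = 1 + (\<Sum>\<gamma> | mi_size \<gamma> <= m. K \<gamma>)"
 have "KK > 0" unfolding KK_def using Kn by (intro add_pos_nonneg sum_nonneg) auto
 moreover have "\<bar>c \<gamma>\<bar> <= KK * S" if b: "\<forall>v :: real^'d. norm v <= 1 --> \<bar>mpoly m c v\<bar> <= S" and \<gamma>: "mi_size \<gamma> <= m" for c S \<gamma>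
 proof -
  have S: "S >= 0" using b[rule_format, of 0] by simp
  have "\<bar>c \<gamma>\<bar> <= (\<Sum>l\<in>?I. \<bar>\<Prod>i\<in>UNIV. \<Lambda> (\<gamma> i) (l i)\<bar> * S)"
   unfolding ext[OF \<gamma>, of c] using b V1 by (intro order_trans[OF sum_abs] sum_mono) (auto simp: abs_mult intro!: mult_left_mono)
  also have "... = K \<gamma> * S" by (simp add: K_def sum_distrib_right)
  also have "... <= KK * S" proof (intro mult_right_mono S)
   have "K \<gamma> <= (\<Sum>\<gamma> | mi_size \<gamma> <= m. K \<gamma>)" using \<gamma> Kn by (intro member_le_sum) auto
   then show "K \<gamma> <= KK" by (simp add: KK_def)
  qed
  finally show ?thesis .
 qed
 ultimately show ?thesis by blast
qed

text \<open>Binomial expansion in each coordinate, which does not raise the degree. It serves to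
  change the centre of the polynomial basis.\<close>

lemma mimono_shift:
 assumes \<gamma>: "mi_size \<gamma> <= m"
 shows "\<exists>T. \<forall>u :: real^'d::finite. mimono \<gamma> (u + a) = (\<Sum>l | mi_size l <= m. T l * mimono l u)"
proof -
 let ?I = "PiE (UNIV :: 'd set) (%i. {..\<gamma> i})"
 define T where "T l = (if l \<in> ?I then \<Prod>i\<in>UNIV. real (\<gamma> i choose l i) * (a $ i) ^ (\<gamma> i - l i) else 0)" for l
 have sub: "?I \<subseteq> {l. mi_size l <= m}" proof
  fix l assume "l \<in> ?I"
  then have "mi_size l <= mi_size \<gamma>" unfolding mi_size_def by (intro sum_mono) auto
  then show "l \<in> {l. mi_size l <= m}" using \<gamma> by simp
 qed
 have "mimono \<gamma> (u + a) = (\<Sum>l | mi_size l <= m. T l * mimono l u)" for u proof -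
  have "mimono \<gamma> (u + a) = (\<Prod>i\<in>UNIV. \<Sum>k\<le>\<gamma> i. real (\<gamma> i choose k) * (u $ i) ^ k * (a $ i) ^ (\<gamma> i - k))"
   unfolding mimono_def by (simp add: binomial_ring)
  also have "... = (\<Sum>l\<in>?I. \<Prod>i\<in>UNIV. real (\<gamma> i choose l i) * (u $ i) ^ l i * (a $ i) ^ (\<gamma> i - l i))"
   by (rule prod_sum_PiE) auto
  also have "... = (\<Sum>l\<in>?I. T l * mimono l u)" by (intro sum.cong) (simp_all add: T_def mimono_def prod.distrib mult_ac)
  also have "... = (\<Sum>l | mi_size l <= m. T l * mimono l u)" by (rule sum.mono_neutral_left) (use sub in "auto simp: T_def")
  finally show ?thesis .
 qed
 then show ?thesis by blast
qed


section \<open>Scale-invariant bounds for derivatives\<close>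


lemma partial_deriv_cong_open:
 assumes "open U" "x \<in> U" "!!y. y \<in> U ==> f y = g y"
 shows "partial_deriv i f x = partial_deriv i g x"
proof -
 have "(f has_derivative D) (at x) = (g has_derivative D) (at x)" for D
  using has_derivative_transform_within_open[of f D x UNIV U g] has_derivative_transform_within_open[of g D x UNIV U f] assms by auto
 then show ?thesis by (simp add: partial_deriv_def frechet_derivative_def)
qed

lemma differentiable_cong_open:
 assumes "open U" "x \<in> U" "!!y. y \<in> U ==> f y = g y" "f differentiable (at x)"
 shows "g differentiable (at x)" using assms has_derivative_transform_within_open[of f _ x UNIV U g] unfolding differentiable_def by metis

lemma partial_deriv_add:
 assumes "f differentiable (at x)" "g differentiable (at x)"
 shows "partial_deriv i (%x. f x + g x) x = partial_deriv i f x + partial_deriv i g x"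
 using has_derivative_add[OF assms[unfolded frechet_derivative_works]] by (simp add: partial_derivI) (simp add: partial_deriv_def)

lemma partial_deriv_mult:
 fixes f g :: "real^'d::finite => real"
 assumes "f differentiable (at x)" "g differentiable (at x)"
 shows "partial_deriv i (%x. f x * g x) x = f x * partial_deriv i g x + partial_deriv i f x * g x"
 using has_derivative_mult[OF assms[unfolded frechet_derivative_works]] by (simp add: partial_derivI) (simp add: partial_deriv_def)

lemma partial_deriv_const [simp]: "partial_deriv i (%x. c) x = 0" by (rule partial_derivI) (rule has_derivative_const)

lemma partial_deriv_inverse:
 fixes f :: "real^'d::finite => real"
 assumes "f differentiable (at x)" "f x ~= 0"
 shows "partial_deriv i (%x. inverse (f x)) x = - (partial_deriv i f x * (inverse (f x) * inverse (f x)))"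
proof -
 have "((%x. inverse (f x)) has_derivative (%v. - (inverse (f x) * frechet_derivative f (at x) v * inverse (f x)))) (at x)"
  using assms by (intro Deriv.has_derivative_inverse) (auto simp: frechet_derivative_works)
 then show ?thesis by (simp add: partial_derivI) (simp add: partial_deriv_def mult_ac)
qed

text \<open>\<open>CB k h U A f\<close>: \<open>f\<close> is \<open>C\<^sup>k\<close> on the open set \<open>U\<close> and its derivatives of order \<open>j\<close>
  are bounded by \<open>A / h\<^sup>j\<close>.\<close>

primrec CB :: "nat => real => (real^'d::finite) set => real => (real^'d => real) => bool" where
 "CB 0 h U A f \<longleftrightarrow> continuous_on U f \<and> (\<forall>x\<in>U. \<bar>f x\<bar> <= A)"
| "CB (Suc k) h U A f \<longleftrightarrow> (\<forall>x\<in>U. f differentiable (at x) \<and> \<bar>f x\<bar> <= A) \<and>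
   (\<forall>i. CB k h U (A / h) (partial_deriv i f))"

lemma CB_bound: "CB k h U A f ==> x \<in> U ==> \<bar>f x\<bar> <= A" by (cases k) auto

lemma CB_continuous: "CB k h U A f ==> continuous_on U f"
 by (cases k) (auto intro!: continuous_at_imp_continuous_on differentiable_imp_continuous_within)

lemma CB_cong:
 assumes "open U" shows "(!!x. x \<in> U ==> f x = g x) ==> CB k h U A f ==> CB k h U A g"
proof (induction k arbitrary: f g A)
 case 0
 have "continuous_on U g" by (rule continuous_on_eq[of U f]) (use 0 in auto)
 then show ?case using 0 by (metis CB.simps(1))
next
 case (Suc k)
 have "CB k h U (A / h) (partial_deriv i g)" for i proof (rule Suc.IH[of "partial_deriv i f"])
  show "partial_deriv i f x = partial_deriv i g x" if "x \<in> U" for x by (rule partial_deriv_cong_open[OF assms that]) (rule Suc.prems(1))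
 qed (use Suc.prems(2) in simp)
 moreover have "g differentiable (at x)" "\<bar>g x\<bar> <= A" if "x \<in> U" for x
  using differentiable_cong_open[OF assms that, of f g] Suc.prems that by auto
 ultimately show ?case by simp
qed

lemma CB_mono: "h > 0 ==> CB k h U A f ==> A <= B ==> CB k h U B f"
proof (induction k arbitrary: f A B)
 case (Suc k)
 have "A / h <= B / h" using Suc.prems by (simp add: divide_right_mono)
 then show ?case using Suc.prems Suc.IH[of "A / h" _ "B / h"] by force
qed force

lemma CB_Suc_lower: "CB (Suc k) h U A f ==> CB k h U A f"
proof (induction k arbitrary: f A)
 case 0
 then show ?case using CB_continuous[OF 0] by auto
qed auto

lemma CB_add:
 assumes "open U" shows "CB k h U A f ==> CB k h U B g ==> CB k h U (A + B) (%x. f x + g x)"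
proof (induction k arbitrary: f g A B)
 case 0
 then show ?case by (auto intro!: continuous_intros order_trans[OF abs_triangle_ineq] add_mono)
next
 case (Suc k)
 have "CB k h U (A / h + B / h) (partial_deriv i (%x. f x + g x))" for i
  by (rule CB_cong[OF assms _ Suc.IH[of "A / h" "partial_deriv i f" "B / h" "partial_deriv i g"]])
    (use Suc.prems in "auto simp: partial_deriv_add")
 then show ?case using Suc.prems by (auto simp: add_divide_distrib intro!: derivative_intros order_trans[OF abs_triangle_ineq] add_mono)
qed

lemma CB_const:
 assumes "open U" "h > 0" shows "\<bar>c\<bar> <= A ==> CB k h U A (%x. c)"
proof (induction k arbitrary: c A)
 case (Suc k)
 have "CB k h U (A / h) (partial_deriv i (%x. c))" for i
  by (rule CB_cong[OF assms(1) _ Suc.IH[of 0]]) (use Suc.prems assms(2) in "auto intro!: divide_nonneg_pos")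
 then show ?case using Suc.prems by simp
qed auto

lemma CB_sum:
 assumes "open U" "h > 0"
 shows "finite S ==> (!!s. s \<in> S ==> CB k h U (A s) (f s)) ==> CB k h U (\<Sum>s\<in>S. A s) (%x. \<Sum>s\<in>S. f s x)"
proof (induction S rule: finite_induct)
 case empty
 then show ?case using CB_const[OF assms] by simp
next
 case (insert s S)
 then show ?case using CB_add[OF assms(1), of k h "A s" "f s"] by simp
qed

text \<open>Leibniz's rule yields two terms per derivative, hence the factor 2^k.\<close>

lemma CB_mult:
 assumes "open U" "h > 0" shows "0 <= A ==> 0 <= B ==> CB k h U A f ==> CB k h U B g ==> CB k h U (2 ^ k * A * B) (%x. f x * g x)"
proof (induction k arbitrary: f g A B)
 case 0
 then show ?case by (auto intro!: continuous_intros simp: abs_mult intro: mult_mono)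
next
 case (Suc k)
 have "CB k h U (2 ^ Suc k * A * B / h) (partial_deriv i (%x. f x * g x))" for i proof -
  have 1: "CB k h U (2 ^ k * A * (B / h)) (%x. f x * partial_deriv i g x)"
   by (rule Suc.IH) (use Suc.prems assms(2) CB_Suc_lower[OF Suc.prems(3)] in auto)
  have 2: "CB k h U (2 ^ k * (A / h) * B) (%x. partial_deriv i f x * g x)"
   by (rule Suc.IH) (use Suc.prems assms(2) CB_Suc_lower[OF Suc.prems(4)] in auto)
  have "CB k h U (2 ^ k * A * (B / h) + 2 ^ k * (A / h) * B) (partial_deriv i (%x. f x * g x))"
   by (rule CB_cong[OF assms(1) _ CB_add[OF assms(1) 1 2]]) (use Suc.prems in "auto simp: partial_deriv_mult")
  then show ?thesis by (simp add: mult_ac)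
 qed
 moreover have "\<bar>f x * g x\<bar> <= 2 ^ Suc k * A * B" if "x \<in> U" for x proof -
  have "\<bar>f x * g x\<bar> <= A * B" using that Suc.prems by (auto simp: abs_mult intro!: mult_mono)
  also have "... = 1 * (A * B)" by simp
  also have "... <= 2 ^ Suc k * (A * B)" using Suc.prems by (intro mult_right_mono one_le_power) auto
  finally show ?thesis by (simp add: mult_ac)
 qed
 ultimately show ?case using Suc.prems by (auto intro!: derivative_intros)
qed

lemma CB_uminus: "open U ==> CB k h U A f ==> CB k h U A (%x. - f x)"
proof (induction k arbitrary: f A)
 case 0
 then show ?case by (auto intro!: continuous_intros)
next
 case (Suc k)
 have neg: "partial_deriv i (%x. - f x) x = - partial_deriv i f x" if "x \<in> U" for i x proof -
  have "f differentiable (at x)" using Suc.prems that by simp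
  then have "((%x. - f x) has_derivative (%v. - frechet_derivative f (at x) v)) (at x)"
   by (intro has_derivative_minus) (simp add: frechet_derivative_works)
  then show ?thesis by (simp add: partial_derivI) (simp add: partial_deriv_def)
 qed
 have "CB k h U (A / h) (partial_deriv i (%x. - f x))" for i proof (rule CB_cong[OF Suc.prems(1), of "%x. - partial_deriv i f x"])
  show "CB k h U (A / h) (%x. - partial_deriv i f x)" by (rule Suc.IH[OF Suc.prems(1)]) (use Suc.prems(2) in simp)
 qed (simp add: neg)
 then show ?case using Suc.prems by (auto intro!: derivative_intros)
qed

text \<open>The constant is chosen before h, U and f. All bounds for the shape functions have to be
  uniform over point sets and evaluation points, and this uniformity starts here.\<close>

lemma CB_inverse:
 assumes "\<kappa> > 0"
 shows "\<exists>C\<ge>0. \<forall>h (U :: (real^'d::finite) set) f. h > 0 --> open U --> CB k h U A f --> (\<forall>x\<in>U. \<kappa> <= f x) --> CB k h U C (%x. inverse (f x))"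
proof (induction k)
 case 0
 show ?case proof (intro exI[of _ "1 / \<kappa>"] conjI allI impI)
  fix h and U :: "(real^'d) set" and f assume f: "CB 0 h U A f" and ge: "\<forall>x\<in>U. \<kappa> <= f x"
  have pos: "f x > 0" if "x \<in> U" for x using ge that assms by force
  show "CB 0 h U (1 / \<kappa>) (%x. inverse (f x))" unfolding CB.simps proof (intro conjI ballI)
   show "continuous_on U (%x. inverse (f x))" by (rule continuous_on_inverse) (use f pos in force)+
   fix x assume x: "x \<in> U"
   have "inverse (f x) <= inverse \<kappa>" by (rule le_imp_inverse_le) (use ge x assms in auto)
   then show "\<bar>inverse (f x)\<bar> <= 1 / \<kappa>" using pos[OF x] by (simp add: inverse_eq_divide)
  qed
 qed (use assms in simp)
next
 case (Suc k)
 then obtain C where C0: "C >= 0" and C1: "\<forall>h (U :: (real^'d) set) f. h > 0 --> open U --> CB k h U A f --> (\<forall>x\<in>U. \<kappa> <= f x) --> CB k h U C (%x. inverse (f x))"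
  by (elim exE conjE)
 note C = C0 C1[THEN spec, THEN spec, THEN spec, THEN mp, THEN mp, THEN mp, THEN mp]
 define C' where "C' = C + 2 ^ k * \<bar>A\<bar> * (2 ^ k * C * C)"
 have C': "C' >= C" "C' >= 2 ^ k * \<bar>A\<bar> * (2 ^ k * C * C)" using C(1) by (auto simp: C'_def)
 show ?case proof (intro exI[of _ C'] conjI allI impI)
  show "C' >= 0" using C(1) C'(1) by simp
  fix h and U :: "(real^'d) set" and f assume h: "h > 0" and U: "open U" and f: "CB (Suc k) h U A f" and \<kappa>: "\<forall>x\<in>U. \<kappa> <= f x"
  have inv: "CB k h U C (%x. inverse (f x))" by (rule C(2)[OF h U CB_Suc_lower[OF f] \<kappa>])
  have fd: "f differentiable (at x)" if "x \<in> U" for x using f that by simp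
  have nz: "f x ~= 0" if "x \<in> U" for x using \<kappa> assms that by force
  have "CB k h U (C' / h) (partial_deriv i (%x. inverse (f x)))" for i proof -
   have "CB k h U (\<bar>A\<bar> / h) (partial_deriv i f)"
    by (rule CB_mono[OF h, of _ _ "A / h"]) (use f h in "auto intro!: divide_right_mono")
   then have "CB k h U (2 ^ k * (\<bar>A\<bar> / h) * (2 ^ k * C * C)) (%x. partial_deriv i f x * (inverse (f x) * inverse (f x)))"
    using C(1) h by (intro CB_mult[OF U h] inv) auto
   from CB_uminus[OF U this] have "CB k h U (2 ^ k * (\<bar>A\<bar> / h) * (2 ^ k * C * C)) (partial_deriv i (%x. inverse (f x)))"
    by (rule CB_cong[OF U, rotated]) (simp add: partial_deriv_inverse fd nz)
   moreover have "2 ^ k * (\<bar>A\<bar> / h) * (2 ^ k * C * C) <= C' / h" using divide_right_mono[OF C'(2), of h] h by (simp add: mult_ac)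
   ultimately show ?thesis using CB_mono[OF h] by blast
  qed
  moreover have "\<bar>inverse (f x)\<bar> <= C'" if "x \<in> U" for x using CB_bound[OF inv that] C'(1) by simp
  moreover have "(%x. inverse (f x)) differentiable (at x)" if "x \<in> U" for x
   using fd[OF that] nz[OF that] by (rule differentiable_inverse)
  ultimately show "CB (Suc k) h U C' (%x. inverse (f x))" by simp
 qed
qed

lemma CB_iter_partial:
 "CB k h U A f ==> length is <= k ==> CB (k - length is) h U (A / h ^ length is) (iter_partial is f)"
proof (induction "is" arbitrary: f k A rule: rev_induct)
 case (snoc i "is")
 then obtain k' where k: "k = Suc k'" by (cases k) auto
 have "CB (k' - length is) h U (A / h / h ^ length is) (iter_partial is (partial_deriv i f))" by (rule snoc.IH) (use snoc.prems k in auto)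
 then show ?case using k by (simp add: iter_partial_append)
qed simp

lemma CB_local:
 assumes "!!x. x \<in> U ==> \<exists>V. open V \<and> x \<in> V \<and> CB k h V A f"
 shows "CB k h U A f" using assms
proof (induction k arbitrary: f A)
 case 0
 have "continuous_on U f" proof (rule continuous_at_imp_continuous_on, rule ballI)
  fix x assume "x \<in> U"
  then obtain V where "open V" "x \<in> V" "continuous_on V f" using 0 by auto
  then show "isCont f x" by (simp add: continuous_on_eq_continuous_at)
 qed
 then show ?case using 0 by fastforce
next
 case (Suc k)
 have "CB k h U (A / h) (partial_deriv i f)" for i by (rule Suc.IH) (use Suc.prems in fastforce)
 then show ?case using Suc.prems by fastforce
qed

text \<open>Gaussian elimination: the Schur complement of a positive definite matrix inherits the lower bound.\<close>

lemma pd_solve_CB: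
 assumes \<kappa>: "\<kappa> > 0"
 shows "finite K ==> \<exists>C\<ge>0. \<forall>h U (G :: 'k => 'k => real^'d::finite => real) b. h > 0 --> open U -->
   (\<forall>k\<in>K. \<forall>l\<in>K. CB n h U A (G k l) \<and> G k l = G l k) -->
   (\<forall>x\<in>U. \<forall>c. \<kappa> * (\<Sum>k\<in>K. (c k)\<^sup>2) <= (\<Sum>k\<in>K. \<Sum>l\<in>K. c k * c l * G k l x)) -->
   (\<forall>l\<in>K. CB n h U B (b l)) -->
   (\<exists>lam. (\<forall>k\<in>K. CB n h U C (lam k)) \<and> (\<forall>x\<in>U. \<forall>l\<in>K. (\<Sum>k\<in>K. lam k x * G k l x) = b l x))"
proof (induction K arbitrary: A B rule: finite_induct)
 case empty
 show ?case by (intro exI[of _ 0]) simp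
next
 case (insert k0 K)
 define A' where "A' = \<bar>A\<bar>"
 define B' where "B' = \<bar>B\<bar>"
 obtain Ci where Ci0: "Ci >= 0" and Ci1: "\<forall>h (U :: (real^'d) set) f. h > 0 --> open U --> CB n h U A' f --> (\<forall>x\<in>U. \<kappa> <= f x) --> CB n h U Ci (%x. inverse (f x))"
  using CB_inverse[OF \<kappa>, of n A'] by (elim exE conjE)
 note Ci = Ci0 Ci1[THEN spec, THEN spec, THEN spec, THEN mp, THEN mp, THEN mp, THEN mp]
 define A1 where "A1 = A' + 2 ^ n * (2 ^ n * A' * A') * Ci"
 define B1 where "B1 = B' + 2 ^ n * (2 ^ n * B' * A') * Ci"
 have nn: "A' >= 0" "B' >= 0" by (auto simp: A'_def B'_def)
 obtain C where Cn: "C >= 0" and C1: "\<forall>h U (G :: 'k => 'k => real^'d => real) b. h > 0 --> open U -->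
   (\<forall>k\<in>K. \<forall>l\<in>K. CB n h U A1 (G k l) \<and> G k l = G l k) -->
   (\<forall>x\<in>U. \<forall>c. \<kappa> * (\<Sum>k\<in>K. (c k)\<^sup>2) <= (\<Sum>k\<in>K. \<Sum>l\<in>K. c k * c l * G k l x)) -->
   (\<forall>l\<in>K. CB n h U B1 (b l)) -->
   (\<exists>lam. (\<forall>k\<in>K. CB n h U C (lam k)) \<and> (\<forall>x\<in>U. \<forall>l\<in>K. (\<Sum>k\<in>K. lam k x * G k l x) = b l x))"
  using insert.IH[of A1 B1] by (elim exE conjE)
 note C = Cn C1[THEN spec, THEN spec, THEN spec, THEN spec, THEN mp, THEN mp, THEN mp, THEN mp, THEN mp]
 define C0 where "C0 = 2 ^ n * (B' + (\<Sum>k\<in>K. 2 ^ n * C * A')) * Ci"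
 have C0: "C0 >= 0" unfolding C0_def using nn C(1) Ci(1) by (intro mult_nonneg_nonneg add_nonneg_nonneg sum_nonneg) auto
 show ?case proof (intro exI[of _ "C + C0"] conjI allI impI)
  show "C + C0 >= 0" using C(1) C0 by simp
  fix h U and G :: "'k => 'k => real^'d => real" and b
  assume h: "h > 0" and U: "open U"
   and G: "\<forall>k\<in>insert k0 K. \<forall>l\<in>insert k0 K. CB n h U A (G k l) \<and> G k l = G l k"
   and pd: "\<forall>x\<in>U. \<forall>c. \<kappa> * (\<Sum>k\<in>insert k0 K. (c k)\<^sup>2) <= (\<Sum>k\<in>insert k0 K. \<Sum>l\<in>insert k0 K. c k * c l * G k l x)"
   and b: "\<forall>l\<in>insert k0 K. CB n h U B (b l)"
  have GA: "CB n h U A' (G k l)" if "k \<in> insert k0 K" "l \<in> insert k0 K" for k l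
   by (rule CB_mono[OF h, of _ _ A]) (use G that in "auto simp: A'_def")
  have sym: "G k l x = G l k x" if "k \<in> insert k0 K" "l \<in> insert k0 K" for k l x using G that by metis
  have bB: "CB n h U B' (b l)" if "l \<in> insert k0 K" for l by (rule CB_mono[OF h, of _ _ B]) (use b that in "auto simp: B'_def")
  let ?a = "G k0 k0"
  have quad: "(\<Sum>k\<in>insert k0 K. \<Sum>l\<in>insert k0 K. c k * c l * G k l x) =
    (c k0)\<^sup>2 * ?a x + 2 * c k0 * (\<Sum>k\<in>K. c k * G k k0 x) + (\<Sum>k\<in>K. \<Sum>l\<in>K. c k * c l * G k l x)" for c x
  proof -
   have "(\<Sum>l\<in>K. c k0 * c l * G k0 l x) = c k0 * (\<Sum>k\<in>K. c k * G k k0 x)"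
    unfolding sum_distrib_left by (intro sum.cong refl) (use sym[of k0] in auto)
   moreover have "(\<Sum>k\<in>K. c k * c k0 * G k k0 x) = c k0 * (\<Sum>k\<in>K. c k * G k k0 x)"
    unfolding sum_distrib_left by (intro sum.cong refl) auto
   ultimately show ?thesis using insert.hyps by (simp add: sum.distrib power2_eq_square algebra_simps)
  qed
  have a: "\<kappa> <= ?a x" if "x \<in> U" for x proof -
   have "\<kappa> * (\<Sum>k\<in>insert k0 K. (if k = k0 then 1 else 0)\<^sup>2) <=
    (\<Sum>k\<in>insert k0 K. \<Sum>l\<in>insert k0 K. (if k = k0 then 1 else 0) * (if l = k0 then 1 else 0) * G k l x)"
    by (rule pd[rule_format, OF that, of "%k. if k = k0 then 1 else 0"])
   moreover have "(\<Sum>k\<in>insert k0 K. (if k = k0 then 1 else 0)\<^sup>2) = (1::real)" proof -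
    have "(\<Sum>k\<in>K. (if k = k0 then 1 else 0)\<^sup>2) = (0::real)" using insert.hyps(2) by (intro sum.neutral) auto
    then show ?thesis using insert.hyps by simp
   qed
   moreover have "(\<Sum>k\<in>K. (if k = k0 then 1 else 0) * G k k0 x) = 0" using insert.hyps(2) by (intro sum.neutral) auto
   moreover have "(\<Sum>k\<in>K. \<Sum>l\<in>K. (if k = k0 then 1 else 0) * (if l = k0 then 1 else 0) * G k l x) = 0"
    using insert.hyps(2) by (intro sum.neutral ballI) auto
   ultimately show ?thesis unfolding quad by simp
  qed
  have apos: "?a x > 0" if "x \<in> U" for x using a[OF that] \<kappa> by linarith
  have ainv: "CB n h U Ci (%x. inverse (?a x))" by (rule Ci(2)[OF h U]) (use GA a in auto)
  \<comment> \<open>The Schur complement of the pivot \<open>G k0 k0\<close>; \<open>b'\<close> is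
    the right-hand side that belongs to it.\<close>
  define G' where "G' k l x = G k l x + - (G k k0 x * G k0 l x * inverse (?a x))" for k l x
  define b' where "b' l x = b l x + - (b k0 x * G k0 l x * inverse (?a x))" for l x
  have G'CB: "CB n h U A1 (G' k l)" if "k \<in> K" "l \<in> K" for k l unfolding G'_def A1_def using that nn Ci(1)
   by (intro CB_add[OF U] CB_uminus[OF U] CB_mult[OF U h] GA ainv) auto
  have b'CB: "CB n h U B1 (b' l)" if "l \<in> K" for l unfolding b'_def B1_def using that nn Ci(1)
   by (intro CB_add[OF U] CB_uminus[OF U] CB_mult[OF U h] GA bB ainv) auto
  have G'sym: "G' k l = G' l k" if "k \<in> K" "l \<in> K" for k l
   unfolding G'_def fun_eq_iff using sym[of k l] sym[of k k0] sym[of l k0] that by auto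
  have G'pd: "\<kappa> * (\<Sum>k\<in>K. (c k)\<^sup>2) <= (\<Sum>k\<in>K. \<Sum>l\<in>K. c k * c l * G' k l x)" if x: "x \<in> U" for x c
  proof -
   define s where "s = (\<Sum>k\<in>K. c k * G k k0 x)"
   \<comment> \<open>The eliminated coordinate gets the value that minimises the full quadratic form
     for given c; there the full form equals that of the Schur complement.\<close>
   define e where "e = c(k0 := - s / ?a x)"
   have eK: "e k = c k" if "k \<in> K" for k using that insert.hyps(2) by (auto simp: e_def)
   have "\<kappa> * (\<Sum>k\<in>K. (c k)\<^sup>2) <= \<kappa> * (\<Sum>k\<in>insert k0 K. (e k)\<^sup>2)"
    using insert.hyps eK \<kappa> by (intro mult_left_mono) auto
   also have "... <= (\<Sum>k\<in>insert k0 K. \<Sum>l\<in>insert k0 K. e k * e l * G k l x)" using pd x by blast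
   also have "... = (- s / ?a x)\<^sup>2 * ?a x + 2 * (- s / ?a x) * s + (\<Sum>k\<in>K. \<Sum>l\<in>K. c k * c l * G k l x)"
    unfolding quad using eK by (simp add: s_def) (simp add: e_def s_def)
   also have "... = (\<Sum>k\<in>K. \<Sum>l\<in>K. c k * c l * G k l x) - s * s * inverse (?a x)"
    using apos[OF x] by (simp add: field_simps power2_eq_square)
   also have "s * s * inverse (?a x) = (\<Sum>k\<in>K. \<Sum>l\<in>K. c k * c l * (G k k0 x * G k0 l x * inverse (?a x)))" proof -
    have "s * s = (\<Sum>k\<in>K. \<Sum>l\<in>K. (c k * G k k0 x) * (c l * G l k0 x))" by (simp add: s_def sum_product)
    also have "... = (\<Sum>k\<in>K. \<Sum>l\<in>K. c k * c l * (G k k0 x * G k0 l x))" by (intro sum.cong refl) (use sym[of _ k0] in auto)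
    finally show ?thesis by (simp only: sum_distrib_right mult.assoc)
   qed
   finally show ?thesis by (simp add: G'_def sum_subtractf right_diff_distrib)
  qed
  obtain lam' where lam': "\<forall>k\<in>K. CB n h U C (lam' k)" "\<forall>x\<in>U. \<forall>l\<in>K. (\<Sum>k\<in>K. lam' k x * G' k l x) = b' l x"
  proof -
   have "\<exists>lam. (\<forall>k\<in>K. CB n h U C (lam k)) \<and> (\<forall>x\<in>U. \<forall>l\<in>K. (\<Sum>k\<in>K. lam k x * G' k l x) = b' l x)"
    by (rule C(2)[OF h U]) (intro ballI conjI allI impI G'CB G'sym G'pd b'CB; assumption)+
   then show ?thesis using that by blast
  qed
  \<comment> \<open>Back substitution into the equation of the pivot.\<close>
  define lam0 where "lam0 x = (b k0 x + - (\<Sum>k\<in>K. lam' k x * G k k0 x)) * inverse (?a x)" for x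
  have lam0: "CB n h U C0 lam0" unfolding lam0_def C0_def using nn C(1) Ci(1) lam'(1) insert.hyps(1)
   by (intro CB_mult[OF U h] CB_add[OF U] CB_uminus[OF U] CB_sum[OF U h] bB ainv GA add_nonneg_nonneg sum_nonneg) auto
  let ?lam = "lam'(k0 := lam0)"
  have lamK: "?lam k = lam' k" if "k \<in> K" for k using that insert.hyps(2) by auto
  show "\<exists>lam. (\<forall>k\<in>insert k0 K. CB n h U (C + C0) (lam k)) \<and> (\<forall>x\<in>U. \<forall>l\<in>insert k0 K. (\<Sum>k\<in>insert k0 K. lam k x * G k l x) = b l x)"
  proof (intro exI[of _ ?lam] conjI ballI)
   fix k assume "k \<in> insert k0 K"
   then show "CB n h U (C + C0) (?lam k)"
    using CB_mono[OF h lam0, of "C + C0"] CB_mono[OF h, of n U C "lam' k" "C + C0"] lam'(1) C(1) C0 by auto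
  next
   fix x l assume x: "x \<in> U" and l: "l \<in> insert k0 K"
   have sumK: "(\<Sum>k\<in>insert k0 K. ?lam k x * G k l x) = lam0 x * G k0 l x + (\<Sum>k\<in>K. lam' k x * G k l x)" for l
    using insert.hyps sum.cong[OF refl, of K "%k. ?lam k x * G k l x" "%k. lam' k x * G k l x"] lamK by simp
   show "(\<Sum>k\<in>insert k0 K. ?lam k x * G k l x) = b l x" proof (cases "l = k0")
    case True
    then show ?thesis unfolding sumK True lam0_def using apos[OF x] by (simp add: mult.assoc)
   next
    case False
    then have lK: "l \<in> K" using l by simp
    have "(\<Sum>k\<in>K. lam' k x * G k l x) - (\<Sum>k\<in>K. lam' k x * G k k0 x) * (G k0 l x * inverse (?a x)) = b' l x" proof -
     have "b' l x = (\<Sum>k\<in>K. lam' k x * G' k l x)" using lam'(2) x lK by simp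
     also have "... = (\<Sum>k\<in>K. lam' k x * G k l x - (lam' k x * G k k0 x) * (G k0 l x * inverse (?a x)))"
      unfolding G'_def by (intro sum.cong refl) (simp add: algebra_simps)
     also have "... = (\<Sum>k\<in>K. lam' k x * G k l x) - (\<Sum>k\<in>K. lam' k x * G k k0 x) * (G k0 l x * inverse (?a x))"
      by (simp only: sum_subtractf sum_distrib_right[symmetric])
     finally show ?thesis by simp
    qed
    then show ?thesis unfolding sumK b'_def lam0_def by (simp add: algebra_simps)
   qed
  qed
 qed
qed


lemma CB_cmult: "open U ==> CB k h U A f ==> CB k h U (\<bar>c\<bar> * A) (%x. c * f x)"
proof (induction k arbitrary: f A)
 case 0
 then show ?case by (auto intro!: continuous_intros mult_left_mono simp: abs_mult)
next
 case (Suc k)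
 have *: "partial_deriv i (%x. c * f x) x = c * partial_deriv i f x" if "x \<in> U" for i x
  using partial_deriv_mult[of "%x. c" x f i] Suc.prems that by simp
 have "CB k h U (\<bar>c\<bar> * A / h) (partial_deriv i (%x. c * f x))" for i
 proof (rule CB_cong[OF Suc.prems(1), of "%x. c * partial_deriv i f x"])
  have "CB k h U (\<bar>c\<bar> * (A / h)) (%x. c * partial_deriv i f x)" by (rule Suc.IH[OF Suc.prems(1)]) (use Suc.prems(2) in simp)
  then show "CB k h U (\<bar>c\<bar> * A / h) (%x. c * partial_deriv i f x)" by simp
 qed (simp add: *)
 then show ?case using Suc.prems by (auto simp: abs_mult intro!: mult_left_mono derivative_intros)
qed

lemma CB_coord:
 assumes U: "open U" and h: "h > 0" and A: "A >= 1" and bd: "!!x. x \<in> U ==> \<bar>x $ i - z $ i\<bar> <= A * h"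
 shows "CB k h U A (%x. (x $ i - z $ i) / h)"
proof -
 have bd': "\<bar>(x $ i - z $ i) / h\<bar> <= A" if "x \<in> U" for x using bd[OF that] h by (simp add: pos_divide_le_eq)
 show ?thesis proof (cases k)
  case 0
  then show ?thesis using bd' h by (auto intro!: continuous_intros)
 next
  case (Suc k')
  have D: "((%x. (x $ i - z $ i) / h) has_derivative (%v. v $ i / h)) (at x)" for x proof -
   have "((%x. x $ i - z $ i) has_derivative (%v. v $ i - 0)) (at x)"
    by (intro has_derivative_diff has_derivative_const bounded_linear_imp_has_derivative bounded_linear_vec_nth)
   from has_derivative_mult_left[OF this, of "inverse h"] show ?thesis by (simp add: divide_inverse)
  qed
  have "partial_deriv j (%x. (x $ i - z $ i) / h) = (%x. if j = i then 1 / h else 0)" for j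
   by (rule ext, subst partial_derivI[OF D]) (auto simp: axis_def)
  then have "CB k' h U (A / h) (partial_deriv j (%x. (x $ i - z $ i) / h))" for j
   using CB_const[OF U h, of "if j = i then 1 / h else 0" "A / h" k'] h A by (simp add: divide_right_mono)
  then show ?thesis using Suc D bd' by (auto simp: differentiable_def)
 qed
qed

lemma CB_power:
 assumes "open U" "h > 0" "A >= 0" "CB k h U A f"
 shows "CB k h U ((2 ^ k * A) ^ n) (%x. f x ^ n)"
proof (induction n)
 case 0
 then show ?case using CB_const[OF assms(1,2), of 1 1] by simp
next
 case (Suc n)
 have "CB k h U (2 ^ k * A * (2 ^ k * A) ^ n) (%x. f x * f x ^ n)"
  by (rule CB_mult[OF assms(1,2) assms(3) _ assms(4) Suc]) (use assms in auto)
 then show ?case by simp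
qed

lemma CB_prod:
 assumes "open U" "h > 0"
 shows "finite S ==> (!!s. s \<in> S ==> 0 <= A s \<and> CB k h U (A s) (f s)) ==> CB k h U (\<Prod>s\<in>S. 2 ^ k * A s) (%x. \<Prod>s\<in>S. f s x)"
proof (induction S rule: finite_induct)
 case empty
 then show ?case using CB_const[OF assms, of 1 1] by simp
next
 case (insert s S)
 have "CB k h U (2 ^ k * A s * (\<Prod>s\<in>S. 2 ^ k * A s)) (%x. f s x * (\<Prod>s\<in>S. f s x))"
  by (rule CB_mult[OF assms]) (use insert in "auto intro!: prod_nonneg")
 then show ?case using insert.hyps by simp
qed

lemma CB_mimono:
 assumes "open U" "h > 0" "A >= 1" "!!x i. x \<in> U ==> \<bar>x $ i - z $ i\<bar> <= A * h"
 shows "CB k h U (\<Prod>i\<in>UNIV. 2 ^ k * (2 ^ k * A) ^ \<gamma> i) (%x. mimono \<gamma> ((1 / h) *\<^sub>R (x - z)))"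
proof -
 have "CB k h U (\<Prod>i\<in>UNIV. 2 ^ k * (2 ^ k * A) ^ \<gamma> i) (%x. \<Prod>i\<in>UNIV. ((x $ i - z $ i) / h) ^ \<gamma> i)"
  by (intro CB_prod[OF assms(1,2)] conjI CB_power[OF assms(1,2)] CB_coord[OF assms(1-3)] assms(4))
    (use assms(3) in auto)
 then show ?thesis by (simp add: mimono_def)
qed

lemma CB_scale:
 assumes U: "open U" and h: "0 < h" "h <= \<delta>"
 shows "0 <= A ==> CB k 1 UNIV A \<Phi> ==> CB k h U A (%x. \<Phi> ((1 / \<delta>) *\<^sub>R (x - y)))"
proof (induction k arbitrary: \<Phi> A)
 case 0
 then have "continuous_on U (%x. \<Phi> ((1 / \<delta>) *\<^sub>R (x - y)))"
  by (intro continuous_on_compose2[of UNIV \<Phi> U "%x. (1 / \<delta>) *\<^sub>R (x - y)"]) (auto intro!: continuous_intros)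
 then show ?case using 0 by auto
next
 case (Suc k)
 let ?s = "%x. (1 / \<delta>) *\<^sub>R (x - y)"
 have D: "((%x. \<Phi> (?s x)) has_derivative
   (%v. frechet_derivative \<Phi> (at (?s x)) ((1 / \<delta>) *\<^sub>R v))) (at x)" for x
 proof (rule has_derivative_compose[of "%x. (1 / \<delta>) *\<^sub>R (x - y)"])
  show "((%x. (1 / \<delta>) *\<^sub>R (x - y)) has_derivative (%v. (1 / \<delta>) *\<^sub>R v)) (at x)"
   by (auto intro!: derivative_eq_intros)
  show "(\<Phi> has_derivative frechet_derivative \<Phi> (at (?s x))) (at (?s x))"
   using Suc.prems(2) by (simp add: frechet_derivative_works)
 qed
 have *: "partial_deriv i (%x. \<Phi> (?s x)) x = (1 / \<delta>) * partial_deriv i \<Phi> (?s x)" for i x proof -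
  have "linear (frechet_derivative \<Phi> (at (?s x)))" using Suc.prems(2) by (auto intro!: linear_frechet_derivative)
  then show ?thesis unfolding partial_derivI[OF D] by (simp add: partial_deriv_def linear_scale)
 qed
 have "CB k h U (A / h) (partial_deriv i (%x. \<Phi> (?s x)))" for i proof -
  have "CB k h U A (%x. partial_deriv i \<Phi> (?s x))" by (rule Suc.IH) (use Suc.prems in auto)
  from CB_cmult[OF U this, of "1 / \<delta>"] have "CB k h U (\<bar>1 / \<delta>\<bar> * A) (partial_deriv i (%x. \<Phi> (?s x)))"
   by (rule CB_cong[OF U, rotated]) (simp only: *)
  moreover have "\<bar>1 / \<delta>\<bar> * A <= A / h" using Suc.prems(1) h by (simp add: frac_le)
  ultimately show ?thesis using CB_mono[OF h(1)] by blast
 qed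
 then show ?case using Suc.prems D by (auto simp: differentiable_def)
qed

section \<open>Smoothness of radial functions at the origin\<close>

lemma mimono_prodf: "mimono g = prodf (%i t. t ^ g i)" by (simp add: mimono_def prodf_def fun_eq_iff)

lemma mimono_inc: "mimono (mi_inc g i) v = v $ i * mimono g v"
proof -
 have "(\<Prod>j\<in>UNIV - {i}. v $ j ^ mi_inc g i j) = (\<Prod>j\<in>UNIV - {i}. v $ j ^ g j)"
  by (intro prod.cong) (auto simp: mi_inc_def)
 then show ?thesis unfolding mimono_def by (simp add: prod.remove[of UNIV i]) (simp add: mi_inc_def)
qed

lemma partial_deriv_mimono:
 "partial_deriv i (mimono g) v = real (g i) * mimono (g(i := g i - 1)) v"
 and differentiable_mimono: "mimono g differentiable (at v)"
proof -
 have sm: "smooth1 (%t. t ^ g i)" for i by (rule smooth1_power[OF smooth1_ident])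
 have d: "deriv (%t::real. t ^ n) = (%t. real n * t ^ (n - 1))" for n
  by (rule ext, rule DERIV_imp_deriv) (auto intro!: derivative_eq_intros)
 have "(\<Prod>j\<in>UNIV - {i}. v $ j ^ g j) = (\<Prod>j\<in>UNIV - {i}. v $ j ^ (g(i := g i - 1)) j)" by (intro prod.cong) auto
 then show "partial_deriv i (mimono g) v = real (g i) * mimono (g(i := g i - 1)) v"
  unfolding mimono_prodf partial_deriv_prodf[of "%i t. t ^ g i", OF sm] prodf_upd prodf_remove[of _ _ i] d by simp
 show "mimono g differentiable (at v)"
  unfolding mimono_prodf using prodf_has_derivative[of "%i t. t ^ g i", OF sm] by (auto simp: differentiable_def)
qed

lemma mimono_le: "\<bar>mimono g v\<bar> <= norm v ^ mi_size g"
proof -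
 have "\<bar>mimono g v\<bar> <= (\<Prod>i\<in>UNIV. norm v ^ g i)" unfolding mimono_def abs_prod power_abs
  by (intro prod_mono conjI power_mono component_le_norm_cart) auto
 then show ?thesis by (simp add: mi_size_def power_sum)
qed

lemma radial_partial:
 assumes h: "(h has_real_derivative h') (at (norm v))" and v: "v ~= (0 :: real^'d::finite)"
 shows "partial_deriv a (%v. h (norm v)) v = h' * (v $ a / norm v)"
  and "(%v. h (norm v)) differentiable (at v)"
proof -
 have "(norm has_derivative (%w. v \<bullet> w / norm v)) (at v)"
  using has_derivative_norm[OF v] by (simp add: inner_commute divide_inverse sgn_div_norm mult.commute)
 then have D: "((%v. h (norm v)) has_derivative (%w. h' * (v \<bullet> w / norm v))) (at v)"
  by (rule has_derivative_compose[where f = norm and g = h, OF _ h[unfolded has_field_derivative_def]])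
 then show "(%v. h (norm v)) differentiable (at v)" by (auto simp: differentiable_def)
 show "partial_deriv a (%v. h (norm v)) v = h' * (v $ a / norm v)" unfolding partial_derivI[OF D] by (simp add: inner_axis)
qed

text \<open>\<open>R i\<close> is the i-th derivative of a profile that vanishes at 0 together with
  its derivatives up to order \<open>m\<close>. This is what remains of the weight profile once its
  Taylor polynomial at 0 is subtracted.\<close>

locale flat_profile =
 fixes m :: nat and R :: "nat => real => real"
 assumes R_deriv: "!!i t. i < m ==> (R i has_real_derivative R (Suc i) t) (at t)"
  and R_cont: "continuous_on UNIV (R m)" and R_0: "!!i. i <= m ==> R i 0 = 0"
begin

text \<open>Downward induction from order \<open>m\<close>: the mean value theorem gains one power
  of t per step. A bounded range of t is enough since the weight is 0 beyond 1.\<close>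

lemma R_bound: "\<exists>K\<ge>0. \<forall>i\<le>m. \<forall>t\<in>{0..2}. \<bar>R i t\<bar> <= K * t ^ (m - i)"
proof -
 have "compact (R m ` {0..2})" by (intro compact_continuous_image continuous_on_subset[OF R_cont]) auto
 then obtain K where K: "!!t. t \<in> {0..2} ==> \<bar>R m t\<bar> <= K" using compact_imp_bounded by (force simp: bounded_iff)
 have K0: "K >= 0" using K[of 0] by simp
 have "\<forall>t\<in>{0..2}. \<bar>R (m - j) t\<bar> <= K * t ^ j" if "j <= m" for j using that proof (induction j)
  case 0
  then show ?case using K by simp
 next
  case (Suc j)
  let ?i = "m - Suc j"
  have i: "?i < m" "Suc ?i = m - j" using Suc.prems by auto
  show ?case proof
   fix t :: real assume t: "t \<in> {0..2}"
   have "norm (R ?i t - R ?i 0) <= (K * t ^ j) * norm (t - 0)" proof (rule field_differentiable_bound[of "{0..t}" "R ?i" "R (m - j)"])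
    show "(R ?i has_field_derivative R (m - j) z) (at z within {0..t})" for z
     using R_deriv[OF i(1), of z] i(2) by (simp add: has_field_derivative_at_within)
    show "norm (R (m - j) z) <= K * t ^ j" if "z \<in> {0..t}" for z proof -
     have "\<bar>R (m - j) z\<bar> <= K * z ^ j" using Suc that t by auto
     also have "... <= K * t ^ j" using that K0 by (intro mult_left_mono power_mono) auto
     finally show ?thesis by simp
    qed
   qed (use t in auto)
   then show "\<bar>R ?i t\<bar> <= K * t ^ Suc j" using t R_0[of ?i] by (simp add: mult_ac)
  qed
 qed
 then have "\<forall>i\<le>m. \<forall>t\<in>{0..2}. \<bar>R i t\<bar> <= K * t ^ (m - i)" by (metis diff_diff_cancel diff_le_self)
 then show ?thesis using K0 by blast
qed

text \<open>The terms that arise when the function R(|v|) is differentiated repeatedly; their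
  partial derivatives away from 0 are combinations of terms of the same kind. The value at v = 0 is
  0 since \<open>R i 0 = 0\<close>.\<close>

definition rad :: "nat => ('d::finite => nat) => nat => real^'d => real" where
 "rad i g b v = R i (norm v) / norm v ^ b * mimono g v"

lemma rad_0: "i <= m ==> rad i g b 0 = 0" by (simp add: rad_def R_0)

lemma rad_bound:
 assumes "i <= m" "i + b <= m + mi_size g"
 shows "\<exists>K\<ge>0. \<forall>v\<in>ball 0 2. \<bar>rad i g b v\<bar> <= K * norm (v :: real^'d::finite) ^ (m + mi_size g - i - b)"
proof -
 obtain K where K: "K >= 0" "!!i t. i <= m ==> t \<in> {0..2} ==> \<bar>R i t\<bar> <= K * t ^ (m - i)" using R_bound by blast
 have "\<bar>rad i g b v\<bar> <= K * norm v ^ (m + mi_size g - i - b)" if v: "v \<in> ball 0 2" for v :: "real^'d" proof (cases "v = 0")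
  case True
  then show ?thesis using K(1) by (simp add: rad_0[OF assms(1)])
 next
  case False
  have "\<bar>rad i g b v\<bar> = \<bar>R i (norm v)\<bar> / norm v ^ b * \<bar>mimono g v\<bar>" by (simp add: rad_def abs_mult power_abs)
  also have "... <= (K * norm v ^ (m - i)) / norm v ^ b * norm v ^ mi_size g" using K(2)[OF assms(1), of "norm v"] v mimono_le[of g v] K(1)
   by (intro mult_mono divide_right_mono) auto
  also have "... = K * (norm v ^ (m - i + mi_size g) / norm v ^ b)" by (simp add: power_add)
  also have "norm v ^ (m - i + mi_size g) / norm v ^ b = norm v ^ (m - i + mi_size g - b)"
   using False assms by (intro power_diff[symmetric]) auto
  finally show ?thesis using assms(1) by (simp add: add.commute)
 qed
 then show ?thesis using K(1) by blast
qed

lemma rad_partial: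
 assumes "i < m" "v ~= 0"
 shows "partial_deriv a (rad i g b) v = rad (Suc i) (mi_inc g a) (Suc b) v +
   (real (g a) * rad i (g(a := g a - 1)) b v + - (real b * rad i (mi_inc g a) (b + 2) v))"
  and "rad i g b differentiable (at (v :: real^'d::finite))"
proof -
 define h where "h t = R i t / t ^ b" for t
 define h' where "h' = R (Suc i) (norm v) / norm v ^ b - real b * R i (norm v) / norm v ^ (Suc b)"
 have n0: "norm v ~= 0" using assms(2) by simp
 have h: "(h has_real_derivative h') (at (norm v))" unfolding h_def
 proof (rule DERIV_cong[OF DERIV_divide[OF R_deriv[OF assms(1)] DERIV_pow]])
  show "norm v ^ b ~= 0" using n0 by simp
  show "(R (Suc i) (norm v) * norm v ^ b - R i (norm v) * (real b * norm v ^ (b - Suc 0))) / (norm v ^ b * norm v ^ b) = h'"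
   using n0 by (cases b) (simp_all add: h'_def field_simps)
 qed
 have eq: "rad i g b = (%v. h (norm v) * mimono g v)" by (simp add: rad_def h_def fun_eq_iff)
 note r = radial_partial[OF h assms(2)]
 show "rad i g b differentiable (at v)" unfolding eq by (intro differentiable_mult r(2) differentiable_mimono)
 have "partial_deriv a (rad i g b) v = h (norm v) * (real (g a) * mimono (g(a := g a - 1)) v) + h' * (v $ a / norm v) * mimono g v"
  unfolding eq partial_deriv_mult[OF r(2) differentiable_mimono] partial_deriv_mimono r(1) ..
 moreover have hg: "h (norm v) * (real (g a) * mimono (g(a := g a - 1)) v) = real (g a) * rad i (g(a := g a - 1)) b v"
  by (simp add: rad_def h_def)
 moreover have "h' * (v $ a / norm v) * mimono g v = rad (Suc i) (mi_inc g a) (Suc b) v + - (real b * rad i (mi_inc g a) (b + 2) v)"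
  unfolding rad_def mimono_inc h'_def using n0 by (simp add: field_simps)
 ultimately show "partial_deriv a (rad i g b) v = rad (Suc i) (mi_inc g a) (Suc b) v +
   (real (g a) * rad i (g(a := g a - 1)) b v + - (real b * rad i (mi_inc g a) (b + 2) v))" by (simp only: hg add.left_commute)
qed

lemma rad_deriv_0:
 assumes "i <= m" "i + b + 2 <= m + mi_size g"
 shows "(rad i g b has_derivative (%_. 0)) (at (0 :: real^'d::finite))"
proof -
 obtain K where K: "K >= 0" "!!v :: real^'d. v \<in> ball 0 2 ==> \<bar>rad i g b v\<bar> <= K * norm v ^ (m + mi_size g - i - b)"
  using rad_bound[of i b g] assms by auto
 obtain n where n: "m + mi_size g - i - b = Suc (Suc n)" using assms by (intro that[of "m + mi_size g - i - b - 2"]) linarith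
 have n': "m + mi_size g - (i + b) = Suc (Suc n)" using n by simp
 have "((%v :: real^'d. norm (rad i g b v - rad i g b 0 - 0) / norm (v - 0)) \<longlongrightarrow> 0) (at 0)"
 proof (rule Lim_null_comparison)
  show "((%v :: real^'d. K * norm v ^ Suc n) \<longlongrightarrow> 0) (at 0)" by (auto intro!: tendsto_eq_intros)
  have "norm (norm (rad i g b v - rad i g b 0 - 0) / norm (v - 0)) <= K * norm v ^ Suc n" if "v \<in> ball 0 2" "v ~= 0" for v :: "real^'d"
   using K(2)[OF that(1)] that(2) assms(1) by (simp add: rad_0 n' divide_le_eq mult_ac)
  then show "\<forall>\<^sub>F v :: real^'d in at 0. norm (norm (rad i g b v - rad i g b 0 - 0) / norm (v - 0)) <= K * norm v ^ Suc n"
   unfolding eventually_at by (intro exI[of _ 2]) auto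
 qed
 then show ?thesis by (simp add: has_derivative_iff_norm)
qed

text \<open>The order of vanishing at 0 is m + |g| - i - b, and each of the three terms in
  \<open>rad_partial\<close> lowers it by exactly one. As long as it is still positive after k
  derivatives, nothing singular happens at 0.\<close>

lemma rad_CB:
 "i + k < m ==> i + b + k + 1 <= m + mi_size g ==> \<exists>A\<ge>0. CB k 1 (ball 0 2) A (rad i g b :: real^'d::finite => real)"
proof (induction k arbitrary: i g b)
 case 0
 obtain K where K: "K >= 0" "!!v :: real^'d. v \<in> ball 0 2 ==> \<bar>rad i g b v\<bar> <= K * norm v ^ (m + mi_size g - i - b)"
  using rad_bound[of i b g] 0 by auto
 let ?n = "m + mi_size g - i - b"
 have "isCont (rad i g b) v" if "v \<in> ball 0 2" for v :: "real^'d" proof (cases "v = 0")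
  case False
  then show ?thesis using rad_partial(2)[of i v] 0 by (auto intro: differentiable_imp_continuous_within)
 next
  case True
  have "(rad i g b \<longlongrightarrow> 0) (at (0 :: real^'d))" proof (rule Lim_null_comparison)
   show "((%v :: real^'d. K * norm v ^ ?n) \<longlongrightarrow> 0) (at 0)" using 0 by (auto intro!: tendsto_eq_intros simp: power_0_left)
   show "\<forall>\<^sub>F v :: real^'d in at 0. norm (rad i g b v) <= K * norm v ^ ?n"
    unfolding eventually_at using K(2) by (intro exI[of _ 2]) auto
  qed
  then show ?thesis using True 0 by (simp add: isCont_def rad_0)
 qed
 moreover have "\<bar>rad i g b v\<bar> <= K * 2 ^ ?n" if "v \<in> ball 0 2" for v :: "real^'d"
  using K(2)[OF that] that by (intro order_trans[OF K(2)[OF that]] mult_left_mono power_mono K(1)) auto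
 ultimately show ?case using K(1) by (intro exI[of _ "K * 2 ^ ?n"]) (auto intro: continuous_at_imp_continuous_on)
next
 case (Suc k)
 have "\<exists>A\<ge>0. CB k 1 (ball 0 2) A (partial_deriv a (rad i g b) :: real^'d => real)" for a proof -
  obtain A1 where A1: "A1 >= 0" "CB k 1 (ball 0 2) A1 (rad (Suc i) (mi_inc g a) (Suc b) :: real^'d => real)"
   using Suc.IH[of "Suc i" "Suc b" "mi_inc g a"] Suc.prems by auto
  obtain A2 where A2: "A2 >= 0" "CB k 1 (ball 0 2) A2 (%v :: real^'d. real (g a) * rad i (g(a := g a - 1)) b v)" proof (cases "g a = 0")
   case True
   then show ?thesis using CB_const[of "ball (0 :: real^'d) 2" 1 0 0 k] by (intro that[of 0]) auto
  next
   case False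
   then have "mi_inc (g(a := g a - 1)) a = g" by (auto simp: mi_inc_def fun_eq_iff)
   then have "Suc (mi_size (g(a := g a - 1))) = mi_size g" using mi_size_inc by metis
   then have "i + k < m" "i + b + k + 1 <= m + mi_size (g(a := g a - 1))" using Suc.prems by linarith+
   from Suc.IH[OF this] obtain A where "A >= 0" "CB k 1 (ball 0 2) A (rad i (g(a := g a - 1)) b :: real^'d => real)" by blast
   then show ?thesis by (intro that[of "\<bar>real (g a)\<bar> * A"] CB_cmult) auto
  qed
  obtain A3 where A3: "A3 >= 0" "CB k 1 (ball 0 2) A3 (rad i (mi_inc g a) (b + 2) :: real^'d => real)"
   using Suc.IH[of i "b + 2" "mi_inc g a"] Suc.prems by auto
  have "CB k 1 (ball 0 2) (A1 + (A2 + \<bar>real b\<bar> * A3)) (%v :: real^'d. rad (Suc i) (mi_inc g a) (Suc b) v +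
   (real (g a) * rad i (g(a := g a - 1)) b v + - (real b * rad i (mi_inc g a) (b + 2) v)))"
   by (intro CB_add CB_uminus CB_cmult A1 A2 A3 open_ball)
  moreover have "rad (Suc i) (mi_inc g a) (Suc b) v +
   (real (g a) * rad i (g(a := g a - 1)) b v + - (real b * rad i (mi_inc g a) (b + 2) v)) = partial_deriv a (rad i g b) v" for v :: "real^'d"
  proof (cases "v = 0")
   case True
   have "(rad i g b has_derivative (%_. 0)) (at (0 :: real^'d))" by (rule rad_deriv_0) (use Suc.prems in auto)
   then have "partial_deriv a (rad i g b) v = 0" using True by (simp add: partial_derivI)
   then show ?thesis using True Suc.prems by (simp add: rad_0)
  qed (use rad_partial(1)[of i v] Suc.prems in simp)
  ultimately have "CB k 1 (ball 0 2) (A1 + (A2 + \<bar>real b\<bar> * A3)) (partial_deriv a (rad i g b) :: real^'d => real)" by simp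
  then show ?thesis using A1(1) A2(1) A3(1) by (intro exI[of _ "A1 + (A2 + \<bar>real b\<bar> * A3)"]) auto
 qed
 then obtain A where A: "!!a. A a >= 0" "!!a. CB k 1 (ball 0 2) (A a) (partial_deriv a (rad i g b) :: real^'d => real)" by metis
 obtain K where K: "K >= 0" "!!v :: real^'d. v \<in> ball 0 2 ==> \<bar>rad i g b v\<bar> <= K * norm v ^ (m + mi_size g - i - b)"
  using rad_bound[of i b g] Suc.prems by auto
 let ?n = "m + mi_size g - i - b"
 define A' where "A' = K * 2 ^ ?n + (\<Sum>a\<in>UNIV. A a)"
 have sA: "A a <= (\<Sum>a\<in>UNIV. A a)" for a using A(1) by (intro member_le_sum) auto
 have "\<bar>rad i g b v\<bar> <= A'" if "v \<in> ball 0 2" for v :: "real^'d" proof -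
  have "K * norm v ^ ?n <= K * 2 ^ ?n" using that by (intro mult_left_mono power_mono K(1)) auto
  then show ?thesis using K(2)[OF that] sum_nonneg[of UNIV A] A(1) by (simp add: A'_def)
 qed
 moreover have "rad i g b differentiable (at v)" for v :: "real^'d" proof (cases "v = 0")
  case True
  have "(rad i g b has_derivative (%_. 0)) (at (0 :: real^'d))" by (rule rad_deriv_0) (use Suc.prems in auto)
  then show ?thesis using True by (auto simp: differentiable_def)
 qed (use rad_partial(2)[of i v] Suc.prems in simp)
 moreover have "CB k 1 (ball 0 2) (A' / 1) (partial_deriv a (rad i g b) :: real^'d => real)" for a
  using CB_mono[OF _ A(2)[of a], of A'] sA[of a] K(1) by (simp add: A'_def add_increasing)
 moreover have "A' >= 0" unfolding A'_def using K(1) A(1) by (intro add_nonneg_nonneg sum_nonneg) auto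
 ultimately show ?case by (intro exI[of _ A']) simp
qed

end


section \<open>Shape functions of moving least squares\<close>


text \<open>The norm is not smooth at 0, but the odd derivatives of an even profile vanish there, so
  its Taylor polynomial is a polynomial in |v|^2; the flat remainder is handled by
  \<open>rad_CB\<close>. One order is given up, which is harmless because only derivatives of order
  below m occur later.\<close>

lemma weight_CB:
 assumes \<phi>: "weight_profile m \<phi>" and m: "m > 0"
 shows "\<exists>A\<ge>0. CB (m - 1) 1 UNIV A (%v :: real^'d::finite. \<phi> (norm v))"
proof -
 define \<psi> where "\<psi> t = \<phi> \<bar>t\<bar>" for t
 define D where "D j = (deriv ^^ j) \<psi>" for j
 have Ck: "Ck_real m \<psi>" using \<phi> by (simp add: weight_profile_def \<psi>_def[abs_def])
 have D_deriv: "(D j has_real_derivative D (Suc j) t) (at t)" if "j < m" for j t proof -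
  have "D j differentiable_on UNIV" using Ck that unfolding Ck_real_def D_def by blast
  then have "D j differentiable (at t)" by (auto simp: differentiable_on_def)
  then show ?thesis by (simp add: D_def DERIV_deriv_iff_real_differentiable)
 qed
 have D_cont: "continuous_on UNIV (D m)" using Ck by (simp add: Ck_real_def D_def)
 have even: "D j (- t) = (-1) ^ j * D j t" if "j <= m" for j t using that proof (induction j arbitrary: t)
  case 0
  then show ?case by (simp add: D_def \<psi>_def)
 next
  case (Suc j)
  have 1: "((%t. D j (- t)) has_real_derivative D (Suc j) (- t) * (- 1)) (at t)"
   by (rule DERIV_chain2[OF D_deriv]) (use Suc.prems in "auto intro!: derivative_eq_intros")
  have 2: "((%t. (-1) ^ j * D j t) has_real_derivative (-1) ^ j * D (Suc j) t) (at t)"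
   by (rule DERIV_cmult[OF D_deriv]) (use Suc.prems in auto)
  have "(%t. D j (- t)) = (%t. (-1) ^ j * D j t)" using Suc by auto
  then show ?case using DERIV_unique[OF 1] 2 by force
 qed
 have odd0: "D j 0 = 0" if "j <= m" "odd j" for j using even[OF that(1), of 0] that(2) by simp
 define R where "R i t = D i t - (\<Sum>j\<in>{i..m}. D j 0 / fact (j - i) * t ^ (j - i))" for i t
 have R_deriv: "(R i has_real_derivative R (Suc i) t) (at t)" if i: "i < m" for i t proof -
  have "((%t. \<Sum>j\<in>{Suc i..m}. D j 0 / fact (j - i) * t ^ (j - i)) has_real_derivative
    (\<Sum>j\<in>{Suc i..m}. D j 0 / fact (j - Suc i) * t ^ (j - Suc i))) (at t)" proof (intro DERIV_sum)
   fix j assume j: "j \<in> {Suc i..m}"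
   then have ji: "j - i = Suc (j - Suc i)" by auto
   have "((%t. D j 0 / fact (j - i) * t ^ (j - i)) has_real_derivative
     D j 0 / fact (j - i) * (real (j - i) * t ^ (j - i - Suc 0))) (at t)" by (intro DERIV_cmult DERIV_pow)
   then show "((%t. D j 0 / fact (j - i) * t ^ (j - i)) has_real_derivative D j 0 / fact (j - Suc i) * t ^ (j - Suc i)) (at t)"
    unfolding ji by (simp add: field_simps del: of_nat_Suc)
  qed
  then have "((%t. D i t - (D i 0 + (\<Sum>j\<in>{Suc i..m}. D j 0 / fact (j - i) * t ^ (j - i)))) has_real_derivative
    D (Suc i) t - (0 + (\<Sum>j\<in>{Suc i..m}. D j 0 / fact (j - Suc i) * t ^ (j - Suc i)))) (at t)"
   by (intro DERIV_diff DERIV_add DERIV_const D_deriv i)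
  moreover have "(\<Sum>j\<in>{i..m}. D j 0 / fact (j - i) * t ^ (j - i)) = D i 0 + (\<Sum>j\<in>{Suc i..m}. D j 0 / fact (j - i) * t ^ (j - i))" for t
   using i by (subst sum.atLeast_Suc_atMost) auto
  ultimately show ?thesis unfolding R_def[abs_def] by simp
 qed
 interpret flat_profile m R proof
  show "continuous_on UNIV (R m)" unfolding R_def[abs_def] by (intro continuous_intros D_cont)
  show "R i 0 = 0" if "i <= m" for i proof -
   have "(\<Sum>j\<in>{i..m}. D j 0 / fact (j - i) * 0 ^ (j - i)) = (\<Sum>j\<in>{i..m}. if j = i then D i 0 else 0)"
    by (intro sum.cong) auto
   then show ?thesis using that by (simp add: R_def)
  qed
 qed (rule R_deriv)
 have eq: "\<phi> (norm v) = rad 0 (%_. 0) 0 v + (\<Sum>l | 2 * l <= m. D (2 * l) 0 / fact (2 * l) * (\<Sum>i\<in>UNIV. ((v $ i - 0 $ i) / 1) ^ 2) ^ l)"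
  for v :: "real^'d" proof -
  have "\<phi> (norm v) = D 0 (norm v)" by (simp add: D_def \<psi>_def)
  also have "... = R 0 (norm v) + (\<Sum>j\<le>m. D j 0 / fact j * norm v ^ j)" by (simp add: R_def atMost_atLeast0)
  also have "(\<Sum>j\<le>m. D j 0 / fact j * norm v ^ j) = (\<Sum>j | j <= m \<and> even j. D j 0 / fact j * norm v ^ j)"
   by (intro sum.mono_neutral_right) (auto simp: odd0)
  also have "... = (\<Sum>l | 2 * l <= m. D (2 * l) 0 / fact (2 * l) * norm v ^ (2 * l))"
   by (rule sum.reindex_bij_witness[of _ "%l. 2 * l" "%j. j div 2"]) auto
  also have "... = (\<Sum>l | 2 * l <= m. D (2 * l) 0 / fact (2 * l) * (\<Sum>i\<in>UNIV. ((v $ i - 0 $ i) / 1) ^ 2) ^ l)" proof -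
   have "(norm v)\<^sup>2 = (\<Sum>i\<in>UNIV. ((v $ i - 0 $ i) / 1) ^ 2)" by (simp add: norm_vec_def L2_set_def sum_nonneg)
   then show ?thesis by (simp add: power_mult)
  qed
  finally show ?thesis by (simp add: rad_def mimono_def)
 qed
 \<comment> \<open>On this ball the decomposition is used; outside the closed unit ball the weight
   is 0. The two open sets cover the space.\<close>
 let ?B = "ball (0 :: real^'d) 2" and ?k = "m - 1"
 have fin: "finite {l. 2 * l <= m}" by (rule finite_subset[of _ "{..m}"]) auto
 define S where "S = (\<Sum>i\<in>(UNIV :: 'd set). (2 ^ ?k * 2 :: real) ^ 2)"
 have S: "CB ?k 1 ?B S (%v. \<Sum>i\<in>UNIV. ((v $ i - 0 $ i) / 1) ^ 2)" "0 <= S" proof -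
  have "CB ?k 1 ?B 2 (%v. (v $ i - 0 $ i) / 1)" for i proof (rule CB_coord)
   show "\<bar>v $ i - 0 $ i\<bar> <= 2 * 1" if "v \<in> ?B" for v using that component_le_norm_cart[of v i] by simp
  qed auto
  then show "CB ?k 1 ?B S (%v. \<Sum>i\<in>UNIV. ((v $ i - 0 $ i) / 1) ^ 2)" unfolding S_def by (intro CB_sum CB_power) auto
  show "0 <= S" unfolding S_def by (intro sum_nonneg) auto
 qed
 obtain A1 where A1: "A1 >= 0" "CB ?k 1 ?B A1 (rad 0 (%_. 0) 0 :: real^'d => real)" using rad_CB[of 0 ?k 0 "%_. 0"] m by auto
 define A where "A = A1 + (\<Sum>l | 2 * l <= m. \<bar>D (2 * l) 0 / fact (2 * l)\<bar> * (2 ^ ?k * S) ^ l)"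
 have A0: "A >= 0" unfolding A_def using A1(1) S(2) by (intro add_nonneg_nonneg sum_nonneg) auto
 have "CB ?k 1 ?B A (%v. rad 0 (%_. 0) 0 v + (\<Sum>l | 2 * l <= m. D (2 * l) 0 / fact (2 * l) * (\<Sum>i\<in>UNIV. ((v $ i - 0 $ i) / 1) ^ 2) ^ l))"
  unfolding A_def using S A1 fin by (intro CB_add CB_sum CB_cmult CB_power) auto
 then have inner: "CB ?k 1 ?B A (%v. \<phi> (norm v))" by (simp add: eq)
 have outer: "CB ?k 1 (- cball 0 1) A (%v :: real^'d. \<phi> (norm v))" proof (rule CB_cong[where f = "%_. 0"])
  show "0 = \<phi> (norm x)" if "x \<in> - cball 0 1" for x :: "real^'d" using \<phi> that by (simp add: weight_profile_def)
  show "CB ?k 1 (- cball (0 :: real^'d) 1) A (%_. 0)" using A0 by (intro CB_const) (auto simp: open_Compl)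
 qed (auto simp: open_Compl)
 have "CB ?k 1 UNIV A (%v :: real^'d. \<phi> (norm v))" proof (rule CB_local)
  fix x :: "real^'d"
  show "\<exists>V. open V \<and> x \<in> V \<and> CB ?k 1 V A (%v. \<phi> (norm v))" proof (cases "norm x < 2")
   case True
   then show ?thesis using inner by (intro exI[of _ ?B]) auto
  next
   case False
   then show ?thesis using outer by (intro exI[of _ "- cball 0 1"]) (auto simp: open_Compl)
  qed
 qed
 then show ?thesis using A0 by blast
qed

lemma weight_lower:
 assumes \<phi>: "weight_profile m \<phi>" and m: "m > 0"
 shows "\<exists>c>0. \<forall>t\<in>{0..1/2}. c <= \<phi> t"
proof -
 have "(%t. \<phi> \<bar>t\<bar>) differentiable_on UNIV" using \<phi> m unfolding weight_profile_def Ck_real_def by (metis funpow_0)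
 then have "continuous_on {0..1/2} (%t. \<phi> \<bar>t\<bar>)" using differentiable_imp_continuous_on continuous_on_subset by blast
 then have "continuous_on {0..1/2} \<phi>" by (rule continuous_on_eq) auto
 then obtain t where t: "t \<in> {0..1/2}" "!!s. s \<in> {0..1/2} ==> \<phi> t <= \<phi> s"
  using continuous_attains_inf[of "{0..1/2::real}" \<phi>] by auto
 then show ?thesis using \<phi> by (intro exI[of _ "\<phi> t"]) (auto simp: weight_profile_def)
qed

section \<open>Fill distance, separation and packing\<close>

lemma fill_distance_node:
 assumes "bounded \<Omega>" "finite X" "X ~= {}" "z \<in> \<Omega>"
 shows "\<exists>y\<in>X. norm (z - y) <= fill_distance X \<Omega>"
proof -
 obtain R where R: "!!x. x \<in> \<Omega> ==> norm x <= R" using assms(1) by (auto simp: bounded_iff)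
 obtain y0 where y0: "y0 \<in> X" using assms(3) by blast
 have "bdd_above ((%x. Min ((%y. norm (x - y)) ` X)) ` \<Omega>)" proof (rule bdd_aboveI2)
  fix x assume "x \<in> \<Omega>"
  have "Min ((%y. norm (x - y)) ` X) <= norm (x - y0)" using assms(2) y0 by (intro Min_le) auto
  also have "... <= R + norm y0" using R[OF \<open>x \<in> \<Omega>\<close>] norm_triangle_ineq4[of x y0] by simp
  finally show "Min ((%y. norm (x - y)) ` X) <= R + norm y0" .
 qed
 then have "Min ((%y. norm (z - y)) ` X) <= fill_distance X \<Omega>" unfolding fill_distance_def by (rule cSUP_upper[OF assms(4)])
 moreover have "Min ((%y. norm (z - y)) ` X) \<in> (%y. norm (z - y)) ` X" using assms by (intro Min_in) auto
 ultimately show ?thesis by auto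
qed

lemma quasi_uniform_separated:
 assumes X: "finite X" and qu: "quasi_uniform c X \<Omega>" and c: "c > 0"
 shows "0 < fill_distance X \<Omega>" and "!!x y. x \<in> X ==> y \<in> X ==> x ~= y ==> 2 * fill_distance X \<Omega> / c <= norm (x - y)"
proof -
 let ?S = "{norm (x - y) | x y. x \<in> X \<and> y \<in> X \<and> x ~= y}"
 have "finite ((%(x, y). norm (x - y)) ` (X \<times> X))" using X by simp
 then have fin: "finite ?S" by (rule finite_subset[rotated]) auto
 have "\<not> X \<subseteq> {a}" for a using qu card_mono[of "{a}" X] by (auto simp: quasi_uniform_def)
 then have "\<exists>x y. x \<in> X \<and> y \<in> X \<and> x ~= y" by blast
 then have ne: "?S ~= {}" by blast
 have "Min ?S \<in> ?S" using fin ne by (rule Min_in)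
 then have pos: "Min ?S > 0" by auto
 then have "separation_distance X > 0" by (simp add: separation_distance_def)
 then show "0 < fill_distance X \<Omega>" using qu by (simp add: quasi_uniform_def)
 fix x y assume "x \<in> X" "y \<in> X" "x ~= y"
 then have "Min ?S <= norm (x - y)" using fin by (intro Min_le) auto
 then have "2 * separation_distance X <= norm (x - y)" by (simp add: separation_distance_def)
 moreover have "fill_distance X \<Omega> / c <= separation_distance X" using qu c by (simp add: quasi_uniform_def divide_le_eq mult.commute)
 ultimately show "2 * fill_distance X \<Omega> / c <= norm (x - y)" by simp
qed

text \<open>Packing: the disjoint balls of radius q around these points lie in a ball of radius
  \<rho> + q; compare volumes.\<close>

lemma card_separated:
 fixes X :: "(real^'d::finite) set"
 assumes X: "finite X" and q: "q > 0" and sep: "!!x y. x \<in> X ==> y \<in> X ==> x ~= y ==> 2 * q <= norm (x - y)"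
  and \<rho>: "0 <= \<rho>"
 shows "real (card {y \<in> X. norm (x - y) <= \<rho>}) <= (\<rho> / q + 1) ^ CARD('d)"
proof -
 let ?Y = "{y \<in> X. norm (x - y) <= \<rho>}" and ?v = "unit_ball_vol (real CARD('d))"
 have v: "?v > 0" by simp
 have disj: "disjoint_family_on (%y. ball y q) ?Y" unfolding disjoint_family_on_def proof (intro ballI impI)
  fix y y' assume y: "y \<in> ?Y" "y' \<in> ?Y" "y ~= y'"
  show "ball y q \<inter> ball y' q = {}" proof (rule ccontr)
   assume "ball y q \<inter> ball y' q ~= {}"
   then obtain z where "dist y z < q" "dist y' z < q" by auto
   then have "dist y y' < 2 * q" using dist_triangle2[of y y' z] by simp
   then show False using sep[of y y'] y by (simp add: dist_norm)
  qed
 qed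
 have "(\<Sum>y\<in>?Y. emeasure lborel (ball y q)) = emeasure lborel (\<Union>y\<in>?Y. ball y q)"
  using X disj by (intro sum_emeasure) auto
 also have "... <= emeasure lborel (ball x (\<rho> + q))" proof (rule emeasure_mono)
  show "(\<Union>y\<in>?Y. ball y q) \<subseteq> ball x (\<rho> + q)" proof
   fix z assume "z \<in> (\<Union>y\<in>?Y. ball y q)"
   then obtain y where "norm (x - y) <= \<rho>" "dist y z < q" by auto
   then show "z \<in> ball x (\<rho> + q)" using dist_triangle[of x z y] by (simp add: dist_norm)
  qed
 qed auto
 also have "... = ennreal (?v * (\<rho> + q) ^ CARD('d))" using \<rho> q by (simp add: emeasure_ball)
 finally have "ennreal (real (card ?Y) * (?v * q ^ CARD('d))) <= ennreal (?v * (\<rho> + q) ^ CARD('d))"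
  using q by (simp add: emeasure_ball ennreal_mult ennreal_of_nat_eq_real_of_nat)
 then have "real (card ?Y) * (?v * q ^ CARD('d)) <= ?v * (\<rho> + q) ^ CARD('d)" using v \<rho> q by (subst (asm) ennreal_le_iff) auto
 then have "?v * (real (card ?Y) * q ^ CARD('d)) <= ?v * (\<rho> + q) ^ CARD('d)" by (simp add: mult_ac)
 then have "real (card ?Y) * q ^ CARD('d) <= (\<rho> + q) ^ CARD('d)" using v by simp
 then have "real (card ?Y) <= (\<rho> + q) ^ CARD('d) / q ^ CARD('d)" using q by (simp add: pos_le_divide_eq)
 also have "... = (\<rho> / q + 1) ^ CARD('d)" using q by (simp add: power_divide[symmetric] add_divide_distrib)
 finally show ?thesis .
qed

lemma shifted_scaled_basis_mimono: "shifted_scaled_basis z h \<beta> y = mimono \<beta> ((1 / h) *\<^sub>R (y - z))"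
 by (simp add: shifted_scaled_basis_def mimono_def power_divide prod_dividef mi_size_def power_sum)

text \<open>The definition recentres the basis at every evaluation point, which hides how the shape
  function depends on x. It may be computed in a basis whose centre z stays fixed; there the
  smoothness in x is visible from the moment equations.\<close>

lemma mls_shape_basis_change:
 fixes w :: "real^'d::finite => real^'d => real" and x z :: "real^'d" and h :: real and m :: nat
 defines "b \<equiv> %k y. mimono k ((1 / h) *\<^sub>R (y - z))" and "K \<equiv> {\<beta> :: 'd => nat. mi_size \<beta> <= m}"
 assumes X: "finite X" and h: "h > 0"
  and pd: "!!c. (\<Sum>y\<in>X. w y x * (\<Sum>k\<in>K. c k * b k y)\<^sup>2) = 0 ==> \<forall>k\<in>K. c k = 0"
  and lam: "!!l. l \<in> K ==> (\<Sum>k\<in>K. lam k * (\<Sum>y\<in>X. w y x * b k y * b l y)) = b l x"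
 shows "mls_shape K (shifted_scaled_basis x' h) w X y x = w y x * (\<Sum>k\<in>K. lam k * b k y)"
proof -
 have finK: "finite K" by (simp add: K_def)
 define B where "B = shifted_scaled_basis x' h"
 have B: "B k y = mimono k ((1 / h) *\<^sub>R (y - x'))" for k y by (simp add: B_def shifted_scaled_basis_mimono)
 have "\<exists>T. \<forall>y. B k y = (\<Sum>l\<in>K. T l * b l y)" if "k \<in> K" for k proof -
  obtain T where T: "!!u. mimono k (u + (1 / h) *\<^sub>R (z - x')) = (\<Sum>l | mi_size l <= m. T l * mimono l u)"
   using mimono_shift[of k m] \<open>k \<in> K\<close> unfolding K_def by blast
  have "(1 / h) *\<^sub>R (y - x') = (1 / h) *\<^sub>R (y - z) + (1 / h) *\<^sub>R (z - x')" for y by (simp add: scaleR_add_right[symmetric])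
  then show ?thesis unfolding B b_def K_def using T by metis
 qed
 then obtain T where T: "!!k y. k \<in> K ==> B k y = (\<Sum>l\<in>K. T k l * b l y)" by metis
 have "\<exists>S. \<forall>y. b k y = (\<Sum>l\<in>K. S l * B l y)" if "k \<in> K" for k proof -
  obtain S where S: "!!u. mimono k (u + (1 / h) *\<^sub>R (x' - z)) = (\<Sum>l | mi_size l <= m. S l * mimono l u)"
   using mimono_shift[of k m] \<open>k \<in> K\<close> unfolding K_def by blast
  have "(1 / h) *\<^sub>R (y - z) = (1 / h) *\<^sub>R (y - x') + (1 / h) *\<^sub>R (x' - z)" for y by (simp add: scaleR_add_right[symmetric])
  then show ?thesis unfolding B b_def K_def using S by metis
 qed
 then obtain S where S: "!!k y. k \<in> K ==> b k y = (\<Sum>l\<in>K. S k l * B l y)" by metis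
 define p where "p y = (\<Sum>k\<in>K. lam k * b k y)" for y
 have pmom: "(\<Sum>y\<in>X. w y x * p y * b l y) = b l x" if "l \<in> K" for l proof -
  have "(\<Sum>y\<in>X. w y x * p y * b l y) = (\<Sum>y\<in>X. \<Sum>k\<in>K. lam k * (w y x * b k y * b l y))"
   by (simp add: p_def sum_distrib_left sum_distrib_right mult_ac)
  also have "... = (\<Sum>k\<in>K. lam k * (\<Sum>y\<in>X. w y x * b k y * b l y))" unfolding sum_distrib_left by (rule sum.swap)
  finally show ?thesis using lam[OF that] by simp
 qed
 define c where "c l = (if l \<in> K then \<Sum>k\<in>K. lam k * S k l else 0)" for l
 have pc: "p y = (\<Sum>l\<in>K. c l * B l y)" for y proof -
  have "p y = (\<Sum>k\<in>K. \<Sum>l\<in>K. lam k * S k l * B l y)" by (simp add: p_def S sum_distrib_left mult.assoc)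
  also have "... = (\<Sum>l\<in>K. \<Sum>k\<in>K. lam k * S k l * B l y)" by (rule sum.swap)
  also have "... = (\<Sum>l\<in>K. c l * B l y)" by (intro sum.cong) (auto simp: c_def sum_distrib_right)
  finally show ?thesis .
 qed
 have swap: "(\<Sum>k\<in>K. e k * (\<Sum>y\<in>X. w y x * B k y * B l y)) = (\<Sum>y\<in>X. w y x * (\<Sum>k\<in>K. e k * B k y) * B l y)" for e l
 proof -
  have "(\<Sum>k\<in>K. e k * (\<Sum>y\<in>X. w y x * B k y * B l y)) = (\<Sum>k\<in>K. \<Sum>y\<in>X. w y x * (e k * B k y) * B l y)"
   by (simp add: sum_distrib_left mult_ac)
  also have "... = (\<Sum>y\<in>X. \<Sum>k\<in>K. w y x * (e k * B k y) * B l y)" by (rule sum.swap)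
  finally show ?thesis by (simp add: sum_distrib_left sum_distrib_right)
 qed
 have cmom: "(\<Sum>k\<in>K. c k * (\<Sum>y\<in>X. w y x * B k y * B l y)) = B l x" if "l \<in> K" for l proof -
  have "(\<Sum>k\<in>K. c k * (\<Sum>y\<in>X. w y x * B k y * B l y)) = (\<Sum>y\<in>X. \<Sum>j\<in>K. T l j * (w y x * p y * b j y))"
   unfolding swap unfolding pc[symmetric] unfolding T[OF that] by (simp add: sum_distrib_left mult_ac)
  also have "... = (\<Sum>j\<in>K. T l j * (\<Sum>y\<in>X. w y x * p y * b j y))" unfolding sum_distrib_left by (rule sum.swap)
  also have "... = (\<Sum>j\<in>K. T l j * b j x)" by (intro sum.cong refl arg_cong2[where f = "(*)"] pmom)
  finally show ?thesis using T[OF that] by simp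
 qed
 \<comment> \<open>The polynomial with coefficients e is orthogonal to all polynomials of degree m
   in the weighted inner product, hence to itself. Positivity in the basis b makes it vanish
   identically, and \<open>coefficient_bound\<close> with bound 0 makes its coefficients
   vanish.\<close>
 have uniq: "c' = c" if c': "\<forall>k. k \<notin> K --> c' k = 0" "\<forall>l\<in>K. (\<Sum>k\<in>K. c' k * (\<Sum>y\<in>X. w y x * B k y * B l y)) = B l x" for c'
 proof -
  define e where "e k = c' k - c k" for k
  define r where "r y = (\<Sum>k\<in>K. e k * B k y)" for y
  have rB: "(\<Sum>y\<in>X. w y x * r y * B l y) = 0" if "l \<in> K" for l
   using c'(2) cmom[OF that] that swap[of e l] by (simp add: e_def r_def left_diff_distrib sum_subtractf)
  have rb: "(\<Sum>y\<in>X. w y x * r y * b j y) = 0" if "j \<in> K" for j proof -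
   have "(\<Sum>y\<in>X. w y x * r y * b j y) = (\<Sum>y\<in>X. \<Sum>l\<in>K. S j l * (w y x * r y * B l y))"
    unfolding S[OF that] by (simp add: sum_distrib_left mult_ac)
   also have "... = (\<Sum>l\<in>K. S j l * (\<Sum>y\<in>X. w y x * r y * B l y))" unfolding sum_distrib_left by (rule sum.swap)
   finally show ?thesis by (simp add: rB)
  qed
  define f where "f j = (\<Sum>k\<in>K. e k * T k j)" for j
  have rf: "r y = (\<Sum>j\<in>K. f j * b j y)" for y proof -
   have "r y = (\<Sum>k\<in>K. \<Sum>j\<in>K. e k * T k j * b j y)" by (simp add: r_def T sum_distrib_left mult.assoc)
   also have "... = (\<Sum>j\<in>K. \<Sum>k\<in>K. e k * T k j * b j y)" by (rule sum.swap)
   finally show ?thesis by (simp add: f_def sum_distrib_right)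
  qed
  have "(\<Sum>y\<in>X. w y x * (\<Sum>k\<in>K. f k * b k y)\<^sup>2) = (\<Sum>y\<in>X. \<Sum>j\<in>K. f j * (w y x * r y * b j y))"
   unfolding rf[symmetric] power2_eq_square by (subst (2) rf) (simp add: sum_distrib_left mult_ac)
  also have "... = (\<Sum>j\<in>K. f j * (\<Sum>y\<in>X. w y x * r y * b j y))" unfolding sum_distrib_left by (rule sum.swap)
  also have "... = 0" by (simp add: rb)
  finally have "\<forall>k\<in>K. f k = 0" by (rule pd)
  then have r0: "r y = 0" for y by (simp add: rf)
  have "mpoly m e v = 0" for v proof -
   have "mpoly m e v = r (x' + h *\<^sub>R v)" unfolding r_def B mpoly_def K_def using h by simp
   then show ?thesis by (simp add: r0)
  qed
  moreover obtain Kc where "!!c S. (\<forall>v :: real^'d. norm v <= 1 --> \<bar>mpoly m c v\<bar> <= S) ==> (\<forall>\<gamma>. mi_size \<gamma> <= m --> \<bar>c \<gamma>\<bar> <= Kc * S)"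
   using coefficient_bound[where 'd = 'd, of m] by blast
  ultimately have "\<forall>\<gamma>. mi_size \<gamma> <= m --> \<bar>e \<gamma>\<bar> <= Kc * 0" by (metis abs_zero order_refl)
  then have "e k = 0" if "k \<in> K" for k using that by (simp add: K_def)
  then show "c' = c" using c'(1) by (auto simp: fun_eq_iff e_def c_def)
 qed
 have "mls_coeffs K B w X x = c" unfolding mls_coeffs_def by (rule the_equality) (use cmom uniq in "auto simp: c_def")
 then show ?thesis unfolding mls_shape_def B_def[symmetric] by (simp add: pc[symmetric] p_def)
qed


text \<open>By \<open>norming_ball\<close>, twice the largest nodal value bounds the polynomial on a
  ball that contains the scaled unit ball, and \<open>coefficient_bound\<close> passes to the
  coefficients. So a single node controls all coefficients, and its square already occurs in the
  weighted sum.\<close>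

lemma gram_lower_bound:
 fixes c :: "('d::finite => nat) => real" and z x :: "real^'d"
 assumes m: "m >= 1" and h: "h > 0" and \<rho>: "32 / 3 * (real m)\<^sup>2 * h <= \<rho>"
  and Kc: "Kc > 0" "!!c S. (\<forall>v :: real^'d. norm v <= 1 --> \<bar>mpoly m c v\<bar> <= S) ==> (\<forall>\<gamma>. mi_size \<gamma> <= m --> \<bar>c \<gamma>\<bar> <= Kc * S)"
  and X: "finite X" and fill: "!!y. y \<in> cball z \<rho> ==> \<exists>x\<in>X. norm (y - x) <= h"
  and w: "!!y. y \<in> X ==> 0 <= w y x" "!!y. y \<in> X ==> y \<in> cball z \<rho> ==> w0 <= w y x" and w0: "w0 > 0"
 shows "w0 / (4 * real (card {\<beta> :: 'd => nat. mi_size \<beta> <= m}) * Kc\<^sup>2) * (\<Sum>k | mi_size k <= m. (c k)\<^sup>2)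
  <= (\<Sum>y\<in>X. w y x * (\<Sum>k | mi_size k <= m. c k * mimono k ((1 / h) *\<^sub>R (y - z)))\<^sup>2)"
proof -
 let ?K = "{\<beta> :: 'd => nat. mi_size \<beta> <= m}"
 define Q where "Q y = mpoly m c ((1 / h) *\<^sub>R (y - z))" for y
 have lp: "line_poly m Q" unfolding Q_def by (rule line_poly_affine[OF mpoly_line_poly])
 have Qc: "continuous_on UNIV Q" unfolding Q_def
  by (rule continuous_on_compose2[OF mpoly_continuous[of UNIV]]) (auto intro!: continuous_intros)
 have m2: "(real m)\<^sup>2 >= 1" using m by simp
 then have "1 * h <= 32 / 3 * (real m)\<^sup>2 * h" using h by (intro mult_right_mono) auto
 then have h\<rho>: "h <= \<rho>" using \<rho> by simp
 have nb: "\<exists>x\<in>X \<inter> cball z \<rho>. \<bar>Q y\<bar> <= 2 * \<bar>Q x\<bar>" if "y \<in> cball z \<rho>" for y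
  by (rule norming_ball[OF m h \<rho> lp Qc fill that])
 have ne: "X \<inter> cball z \<rho> ~= {}" using nb[of z] h h\<rho> by fastforce
 define M where "M = Max ((%x. \<bar>Q x\<bar>) ` (X \<inter> cball z \<rho>))"
 have "M \<in> (%x. \<bar>Q x\<bar>) ` (X \<inter> cball z \<rho>)" unfolding M_def using X ne by (intro Max_in) auto
 then obtain s where s: "s \<in> X" "s \<in> cball z \<rho>" "M = \<bar>Q s\<bar>" by auto
 have "\<bar>mpoly m c v\<bar> <= 2 * M" if "norm v <= 1" for v proof -
  have "h * norm v <= \<rho>" using h h\<rho> mult_left_mono[OF that, of h] by linarith
  then have "z + h *\<^sub>R v \<in> cball z \<rho>" using h by (simp add: dist_norm)
  from nb[OF this] obtain x where x: "x \<in> X \<inter> cball z \<rho>" "\<bar>Q (z + h *\<^sub>R v)\<bar> <= 2 * \<bar>Q x\<bar>" by blast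
  moreover have "\<bar>Q x\<bar> <= M" unfolding M_def using X x(1) by (intro Max_ge) auto
  ultimately show ?thesis using h by (simp add: Q_def)
 qed
 then have ck: "\<bar>c k\<bar> <= Kc * (2 * M)" if "mi_size k <= m" for k using Kc(2) that by blast
 have N: "real (card ?K) > 0" by (simp add: card_gt_0_iff) (rule exI[of _ "%_. 0"], simp)
 have "(\<Sum>k\<in>?K. (c k)\<^sup>2) <= (\<Sum>k\<in>?K. (Kc * (2 * M))\<^sup>2)"
  using ck by (intro sum_mono) (auto simp: abs_le_square_iff[symmetric] intro: order_trans[OF _ abs_ge_self])
 also have "... = 4 * real (card ?K) * Kc\<^sup>2 * (Q s)\<^sup>2" using s(3) by (simp add: power_mult_distrib)
 finally have "w0 / (4 * real (card ?K) * Kc\<^sup>2) * (\<Sum>k\<in>?K. (c k)\<^sup>2) <= w0 / (4 * real (card ?K) * Kc\<^sup>2) * (4 * real (card ?K) * Kc\<^sup>2 * (Q s)\<^sup>2)"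
  using w0 Kc(1) by (intro mult_left_mono) auto
 also have "... = w0 * (Q s)\<^sup>2" proof -
  have "w0 / (4 * n * Kc\<^sup>2) * (4 * n * Kc\<^sup>2 * u) = w0 * u" if "n > 0" for n u :: real using that Kc(1) by simp
  from this[OF N] show ?thesis .
 qed
 also have "... <= w s x * (Q s)\<^sup>2" using w(2)[OF s(1,2)] by (intro mult_right_mono) auto
 also have "... <= (\<Sum>y\<in>X. w y x * (Q y)\<^sup>2)" using s(1) X w(1) by (intro member_le_sum) auto
 finally show ?thesis by (simp add: Q_def mpoly_def)
qed

text \<open>The purpose of \<open>mls_C2\<close>: a cone of height
  \<open>mls_C2 \<theta> m * h\<close> contains a ball of radius at least 32/3 m^2 h, as
  \<open>norming_ball\<close> requires. Since \<delta> is twice this height, nodes in that ball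
  satisfy |x - y|/\<delta> <= 1/2, where the profile is positive.\<close>

lemma mls_C2_ge:
 assumes "0 < \<theta>" "\<theta> < pi / 2" "m >= 1"
 shows "1 <= mls_C2 \<theta> m" and "32 / 3 * (real m)\<^sup>2 <= mls_C2 \<theta> m * sin \<theta> / (1 + sin \<theta>)"
proof -
 have s: "0 < sin \<theta>" "sin \<theta> <= 1" using assms sin_gt_zero[of \<theta>] by auto
 have m2: "(real m)\<^sup>2 >= 1" using assms(3) by simp
 have eq: "mls_C2 \<theta> m * sin \<theta> / (1 + sin \<theta>) = 16 / 3 * (real m)\<^sup>2 * ((1 + sin \<theta>) / sin \<theta>)" proof -
  have "16 * a\<^sup>2 * M / (3 * t\<^sup>2) * t / a = 16 / 3 * M * (a / t)" if "a > 0" "t > 0" for a t M :: real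
   using that by (simp add: power2_eq_square)
  from this[of "1 + sin \<theta>" "sin \<theta>"] s show ?thesis by (simp add: mls_C2_def)
 qed
 have "2 <= (1 + sin \<theta>) / sin \<theta>" using s by (simp add: pos_le_divide_eq)
 then have "16 / 3 * (real m)\<^sup>2 * 2 <= 16 / 3 * (real m)\<^sup>2 * ((1 + sin \<theta>) / sin \<theta>)" by (intro mult_left_mono) auto
 then show 2: "32 / 3 * (real m)\<^sup>2 <= mls_C2 \<theta> m * sin \<theta> / (1 + sin \<theta>)" unfolding eq by simp
 have "mls_C2 \<theta> m * sin \<theta> / (1 + sin \<theta>) <= mls_C2 \<theta> m * 1"
  unfolding times_divide_eq_right[symmetric] using s by (intro mult_left_mono) (auto simp: mls_C2_def)
 then show "1 <= mls_C2 \<theta> m" using 2 m2 by linarith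
qed

text \<open>Positivity at one point passes to a neighbourhood, at half the constant, by continuity
  of the entries. The tolerance is divided by the size of \<open>K\<close> because the square of the
  sum of the |c_k| is at most that size times the sum of squares.\<close>

lemma quadratic_form_perturb:
 fixes c :: "'k => real"
 assumes K: "finite K" and pd: "\<kappa> * (\<Sum>k\<in>K. (c k)\<^sup>2) <= (\<Sum>k\<in>K. \<Sum>l\<in>K. c k * c l * G k l)"
  and d: "!!k l. k \<in> K ==> l \<in> K ==> \<bar>G' k l - G k l\<bar> <= \<kappa> / (2 * real (card K) + 1)" and \<kappa>: "\<kappa> > 0"
 shows "\<kappa> / 2 * (\<Sum>k\<in>K. (c k)\<^sup>2) <= (\<Sum>k\<in>K. \<Sum>l\<in>K. c k * c l * G' k l)"
proof -
 let ?e = "\<kappa> / (2 * real (card K) + 1)" and ?S = "\<Sum>k\<in>K. (c k)\<^sup>2"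
 have "(\<Sum>k\<in>K. \<Sum>l\<in>K. c k * c l * G k l) - (\<Sum>k\<in>K. \<Sum>l\<in>K. c k * c l * G' k l)
   = (\<Sum>k\<in>K. \<Sum>l\<in>K. c k * c l * (G k l - G' k l))" by (simp add: sum_subtractf right_diff_distrib)
 also have "... <= (\<Sum>k\<in>K. \<Sum>l\<in>K. \<bar>c k\<bar> * \<bar>c l\<bar> * ?e)" proof (intro sum_mono)
  fix k l assume "k \<in> K" "l \<in> K"
  then have "\<bar>c k * c l * (G k l - G' k l)\<bar> <= \<bar>c k\<bar> * \<bar>c l\<bar> * ?e"
   unfolding abs_mult using d[of k l] by (intro mult_left_mono) (auto simp: abs_minus_commute)
  then show "c k * c l * (G k l - G' k l) <= \<bar>c k\<bar> * \<bar>c l\<bar> * ?e" by simp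
 qed
 also have "... = (\<Sum>k\<in>K. \<bar>c k\<bar>)\<^sup>2 * ?e" by (simp only: power2_eq_square sum_product sum_distrib_right[symmetric])
 also have "... <= (real (card K) * ?S) * ?e"
  using \<kappa> sum_squared_le_sum_of_squares[of "%k. \<bar>c k\<bar>" K] by (intro mult_right_mono) (auto simp: mult.commute)
 also have "... <= \<kappa> / 2 * ?S" proof -
  have "real (card K) * ?e <= \<kappa> / 2" using \<kappa> by (simp add: field_simps)
  then have "real (card K) * ?e * ?S <= \<kappa> / 2 * ?S" by (intro mult_right_mono sum_nonneg) auto
  then show ?thesis by (simp only: mult_ac)
 qed
 finally show ?thesis using pd by simp
qed

text \<open>Near each point the moment equations are solved in a basis with a fixed centre. The
  constants of \<open>pd_solve_CB\<close> depend neither on X nor on the point, so the local bounds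
  hold on all of \<Omega> with one \<open>C0\<close>.\<close>

lemma mls_shape_bounds:
 fixes \<Omega> :: "(real^'d::finite) set" and m :: nat
 defines "K \<equiv> {\<beta> :: 'd => nat. mi_size \<beta> <= m}"
 assumes bdd: "bounded \<Omega>" and opn: "open \<Omega>" and \<theta>: "0 < \<theta>" "\<theta> < pi / 2" and cone: "interior_cone_condition \<Omega> \<theta> r"
  and m: "m > 0" and \<phi>: "weight_profile m \<phi>" and cq: "c_qu > 0"
 shows "\<exists>C0\<ge>0. \<exists>N0\<ge>0. \<forall>X. finite X --> quasi_uniform c_qu X \<Omega> --> mls_C2 \<theta> m * fill_distance X \<Omega> <= r -->
  (let h = fill_distance X \<Omega>; \<delta> = 2 * mls_C2 \<theta> m * h;
     a = (%y x. mls_shape K (shifted_scaled_basis x h) (mls_weight \<phi> \<delta>) X y x)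
   in (\<forall>y\<in>X. CB (m - 1) h \<Omega> C0 (a y)) \<and> (\<forall>y\<in>X. \<forall>x. \<delta> < norm (x - y) --> a y x = 0) \<and>
    (\<forall>x\<in>\<Omega>. \<forall>w g. mi_size g <= m --> (\<Sum>y\<in>X. a y x * mimono g (y - w)) = mimono g (x - w)) \<and>
    (\<forall>x. real (card {y\<in>X. norm (x - y) <= \<delta>}) <= N0))"
proof -
 define C2 where "C2 = mls_C2 \<theta> m"
 have C2: "C2 >= 1" "32 / 3 * (real m)\<^sup>2 <= C2 * sin \<theta> / (1 + sin \<theta>)"
  using mls_C2_ge[OF \<theta>, of m] m by (auto simp: C2_def)
 have finK: "finite K" by (simp add: K_def)
 obtain Aw where Aw: "Aw >= 0" "CB (m - 1) 1 UNIV Aw (%v :: real^'d. \<phi> (norm v))" using weight_CB[OF \<phi> m] by blast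
 obtain w0 where w0: "w0 > 0" "!!t. t \<in> {0..1/2} ==> w0 <= \<phi> t" using weight_lower[OF \<phi> m] by blast
 obtain Kc where Kc: "Kc > 0" "!!c S. (\<forall>v :: real^'d. norm v <= 1 --> \<bar>mpoly m c v\<bar> <= S) ==> (\<forall>\<gamma>. mi_size \<gamma> <= m --> \<bar>c \<gamma>\<bar> <= Kc * S)"
  using coefficient_bound[where 'd = 'd, of m] by blast
 \<comment> \<open>Bounds |y - z|/h if the node y is within (2 \<open>C2\<close> + 1)h and the
   centre z within \<open>C2 * h\<close> of the same point, with nothing to spare.\<close>
 define A where "A = 3 * C2 + 1"
 have A: "A >= 1" using C2 by (simp add: A_def)
 \<comment> \<open>Packing with radius (2 \<open>C2\<close> + 1)h rather than \<delta> = 2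
   \<open>C2\<close> h: this counts all nodes that act somewhere in a ball of radius h.\<close>
 define N0 where "N0 = ((2 * C2 + 1) * c_qu + 1) ^ CARD('d)"
 have N0: "N0 >= 0" using C2 cq by (simp add: N0_def)
 have N: "real (card K) > 0" unfolding K_def by (simp add: card_gt_0_iff) (rule exI[of _ "%_. 0"], simp)
 define \<kappa> where "\<kappa> = w0 / (4 * real (card K) * Kc\<^sup>2)"
 have \<kappa>: "\<kappa> > 0" using w0(1) N Kc(1) by (simp add: \<kappa>_def)
 define AG where "AG = N0 * ((A ^ m * A ^ m) * Aw)"
 define B where "B = (\<Sum>\<gamma>\<in>K. \<Prod>i\<in>(UNIV :: 'd set). 2 ^ (m - 1) * (2 ^ (m - 1) * A) ^ \<gamma> i)"
 have B: "(\<Prod>i\<in>(UNIV :: 'd set). 2 ^ (m - 1) * (2 ^ (m - 1) * A) ^ \<gamma> i) <= B" if "\<gamma> \<in> K" for \<gamma>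
  unfolding B_def using that finK A by (intro member_le_sum) (auto intro!: prod_nonneg)
 have k2: "\<kappa> / 2 > 0" using \<kappa> by simp
 obtain Cl where Cl0: "Cl >= 0" and Cl: "\<forall>h U (G :: ('d => nat) => ('d => nat) => real^'d => real) b. h > 0 --> open U -->
   (\<forall>k\<in>K. \<forall>l\<in>K. CB (m - 1) h U AG (G k l) \<and> G k l = G l k) -->
   (\<forall>x\<in>U. \<forall>c. \<kappa> / 2 * (\<Sum>k\<in>K. (c k)\<^sup>2) <= (\<Sum>k\<in>K. \<Sum>l\<in>K. c k * c l * G k l x)) -->
   (\<forall>l\<in>K. CB (m - 1) h U B (b l)) -->
   (\<exists>lam. (\<forall>k\<in>K. CB (m - 1) h U Cl (lam k)) \<and> (\<forall>x\<in>U. \<forall>l\<in>K. (\<Sum>k\<in>K. lam k x * G k l x) = b l x))"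
  using pd_solve_CB[OF k2 finK, of "m - 1" AG B] by (elim exE conjE)
 define C0 where "C0 = 2 ^ (m - 1) * Aw * (\<Sum>k\<in>K. A ^ m * Cl)"
 have C0: "C0 >= 0" unfolding C0_def using Aw(1) A Cl0 by (intro mult_nonneg_nonneg sum_nonneg) auto
 have "(\<forall>y\<in>X. CB (m - 1) h \<Omega> C0 (%x. mls_shape K (shifted_scaled_basis x h) (mls_weight \<phi> \<delta>) X y x)) \<and>
   (\<forall>y\<in>X. \<forall>x. \<delta> < norm (x - y) --> mls_shape K (shifted_scaled_basis x h) (mls_weight \<phi> \<delta>) X y x = 0) \<and>
   (\<forall>x\<in>\<Omega>. \<forall>w g. mi_size g <= m --> (\<Sum>y\<in>X. mls_shape K (shifted_scaled_basis x h) (mls_weight \<phi> \<delta>) X y x * mimono g (y - w)) = mimono g (x - w)) \<and>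
   (\<forall>x. real (card {y\<in>X. norm (x - y) <= \<delta>}) <= N0)"
  if X: "finite X" and qu: "quasi_uniform c_qu X \<Omega>" and hr: "C2 * fill_distance X \<Omega> <= r"
   and hdef: "h = fill_distance X \<Omega>" and \<delta>def: "\<delta> = 2 * C2 * h" for X h \<delta> proof -
  define w where "w = (mls_weight \<phi> \<delta> :: real^'d => real^'d => real)"
  define a where "a = (%y x. mls_shape K (shifted_scaled_basis x h) w X y x)"
  have h: "h > 0" using quasi_uniform_separated(1)[OF X qu cq] hdef by simp
  have \<delta>: "h <= \<delta>" "\<delta> > 0" using C2(1) h mult_right_mono[of 1 "2 * C2" h] by (auto simp: \<delta>def)
  have Xne: "X ~= {}" using qu by (auto simp: quasi_uniform_def)
  have sep: "2 * (h / c_qu) <= norm (x - y)" if "x \<in> X" "y \<in> X" "x ~= y" for x y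
   using quasi_uniform_separated(2)[OF X qu cq that] hdef by simp
  have cardY: "real (card {y\<in>X. norm (x - y) <= (2 * C2 + 1) * h}) <= N0" for x
   using card_separated[OF X _ sep, of "(2 * C2 + 1) * h" x] h cq C2(1) by (simp add: N0_def)
  have w_eq: "w y x = \<phi> (norm ((1 / \<delta>) *\<^sub>R (x - y)))" for y x using \<delta> by (simp add: w_def mls_weight_def)
  have wCB: "CB (m - 1) h U Aw (w y)" if "open U" for U y using CB_scale[OF that h \<delta>(1) Aw] by (simp add: w_eq[abs_def])
  have w_nonneg: "0 <= w y x" for y x using \<phi> by (simp add: w_eq weight_profile_def)
  have w_zero: "w y x = 0" if "\<delta> < norm (x - y)" for y x
   using \<phi> that \<delta>(2) by (simp add: w_def mls_weight_def weight_profile_def)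
  have local: "\<exists>U. open U \<and> x0 \<in> U \<and> (\<forall>y\<in>X. CB (m - 1) h U C0 (a y)) \<and>
    (\<forall>w g. mi_size g <= m --> (\<Sum>y\<in>X. a y x0 * mimono g (y - w)) = mimono g (x0 - w))" if x0: "x0 \<in> \<Omega>" for x0
  proof -
   define \<rho> where "\<rho> = C2 * h * sin \<theta> / (1 + sin \<theta>)"
   obtain z where z: "norm (z - x0) <= C2 * h" "cball z \<rho> \<subseteq> \<Omega> \<inter> cball x0 (C2 * h)"
    using cone_contains_ball[OF cone \<theta> x0, of "C2 * h"] C2(1) h hr by (auto simp: \<rho>_def hdef)
   have \<rho>: "32 / 3 * (real m)\<^sup>2 * h <= \<rho>" using mult_right_mono[OF C2(2), of h] h by (simp add: \<rho>_def mult_ac)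
   define b where "b k y = mimono k ((1 / h) *\<^sub>R (y - z))" for k y
   define G where "G k l x = (\<Sum>y\<in>X. (b k y * b l y) * w y x)" for k l x
   define Y where "Y = {y\<in>X. norm (x0 - y) <= (2 * C2 + 1) * h}"
   have Y: "Y \<subseteq> X" "finite Y" "real (card Y) <= N0" using X cardY[of x0] by (auto simp: Y_def)
   have bY: "\<bar>b k y\<bar> <= A ^ m" if "y \<in> Y" "k \<in> K" for k y proof -
    have "norm (y - z) <= norm (x0 - y) + norm (z - x0)"
     using norm_triangle_ineq4[of "x0 - y" "x0 - z"] by (simp add: norm_minus_commute algebra_simps)
    also have "... <= A * h" using that(1) z(1) by (simp add: Y_def A_def algebra_simps)
    finally have "norm ((1 / h) *\<^sub>R (y - z)) <= A" using h by (simp add: divide_le_eq)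
    then have "norm ((1 / h) *\<^sub>R (y - z)) ^ mi_size k <= A ^ mi_size k" by (intro power_mono) auto
    also have "... <= A ^ m" using A that(2) by (intro power_increasing) (auto simp: K_def)
    finally show ?thesis using mimono_le[of k "(1 / h) *\<^sub>R (y - z)"] by (simp add: b_def)
   qed
   have wfar: "w y x = 0" if "y \<in> X - Y" "x \<in> ball x0 h" for x y proof (rule w_zero)
    have "norm (x0 - y) <= norm (x - y) + norm (x0 - x)" using norm_triangle_ineq[of "x0 - x" "x - y"] by (simp add: add.commute)
    then show "\<delta> < norm (x - y)" using that by (auto simp: Y_def \<delta>def dist_norm algebra_simps)
   qed
   have quad: "(\<Sum>k\<in>K. \<Sum>l\<in>K. c k * c l * G k l x) = (\<Sum>y\<in>X. w y x * (\<Sum>k\<in>K. c k * b k y)\<^sup>2)" for c x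
   proof -
    have "(\<Sum>y\<in>X. w y x * (\<Sum>k\<in>K. c k * b k y)\<^sup>2) = (\<Sum>y\<in>X. \<Sum>k\<in>K. \<Sum>l\<in>K. c k * c l * ((b k y * b l y) * w y x))"
     by (simp add: power2_eq_square sum_product sum_distrib_left mult_ac)
    also have "... = (\<Sum>k\<in>K. \<Sum>y\<in>X. \<Sum>l\<in>K. c k * c l * ((b k y * b l y) * w y x))" by (rule sum.swap)
    also have "... = (\<Sum>k\<in>K. \<Sum>l\<in>K. \<Sum>y\<in>X. c k * c l * ((b k y * b l y) * w y x))" by (intro sum.cong refl sum.swap)
    finally show ?thesis by (simp add: G_def sum_distrib_left)
   qed
   have pd0: "\<kappa> * (\<Sum>k\<in>K. (c k)\<^sup>2) <= (\<Sum>k\<in>K. \<Sum>l\<in>K. c k * c l * G k l x0)" for c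
    unfolding quad unfolding \<kappa>_def K_def b_def proof (rule gram_lower_bound[OF _ h \<rho> Kc X _ w_nonneg _ w0(1)])
    show "\<exists>x\<in>X. norm (y - x) <= h" if "y \<in> cball z \<rho>" for y
     using fill_distance_node[OF bdd X Xne, of y] that z(2) hdef by auto
    show "w0 <= w y x0" if "y \<in> X" "y \<in> cball z \<rho>" for y proof -
     have "norm (x0 - y) <= C2 * h" using that z(2) by (auto simp: dist_norm)
     then have "norm (x0 - y) / \<delta> \<in> {0..1/2}" using \<delta>(2) by (simp add: \<delta>def divide_le_eq)
     then show ?thesis unfolding w_def mls_weight_def by (rule w0(2))
    qed
   qed (use m in auto)
   have Gc: "isCont (G k l) x0" for k l proof -
    have "isCont (w y) x0" for y using CB_continuous[OF wCB[OF open_UNIV, of y]] by (simp add: continuous_on_eq_continuous_at)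
    then show ?thesis unfolding G_def[abs_def] by (intro continuous_intros)
   qed
   have "\<forall>\<^sub>F x in nhds x0. \<forall>k\<in>K. \<forall>l\<in>K. \<bar>G k l x - G k l x0\<bar> <= \<kappa> / (2 * real (card K) + 1)"
   proof (intro eventually_ball_finite finK ballI)
    fix k l
    have "(G k l \<longlongrightarrow> G k l x0) (nhds x0)" using Gc by (simp add: isCont_def tendsto_at_iff_tendsto_nhds)
    then have "\<forall>\<^sub>F x in nhds x0. dist (G k l x) (G k l x0) < \<kappa> / (2 * real (card K) + 1)"
     using \<kappa> by (intro tendstoD) auto
    then show "\<forall>\<^sub>F x in nhds x0. \<bar>G k l x - G k l x0\<bar> <= \<kappa> / (2 * real (card K) + 1)"
     by eventually_elim (simp add: dist_real_def)
   qed
   then obtain U0 where U0: "open U0" "x0 \<in> U0" "!!x k l. x \<in> U0 ==> k \<in> K ==> l \<in> K ==> \<bar>G k l x - G k l x0\<bar> <= \<kappa> / (2 * real (card K) + 1)"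
    unfolding eventually_nhds by blast
   define U where "U = U0 \<inter> ball x0 h"
   have U: "open U" "x0 \<in> U" using U0 h by (auto simp: U_def)
   have pd: "\<kappa> / 2 * (\<Sum>k\<in>K. (c k)\<^sup>2) <= (\<Sum>k\<in>K. \<Sum>l\<in>K. c k * c l * G k l x)" if "x \<in> U" for x c
    by (rule quadratic_form_perturb[OF finK pd0 _ \<kappa>]) (use U0(3) that in "auto simp: U_def")
   have GCB: "CB (m - 1) h U AG (G k l)" if "k \<in> K" "l \<in> K" for k l proof -
    have "CB (m - 1) h U (\<Sum>y\<in>Y. \<bar>b k y * b l y\<bar> * Aw) (%x. \<Sum>y\<in>Y. (b k y * b l y) * w y x)"
     using Y(2) by (intro CB_sum U(1) h CB_cmult wCB) auto
    then have 1: "CB (m - 1) h U (\<Sum>y\<in>Y. \<bar>b k y * b l y\<bar> * Aw) (G k l)" proof (rule CB_cong[OF U(1), rotated])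
     show "(\<Sum>y\<in>Y. (b k y * b l y) * w y x) = G k l x" if "x \<in> U" for x
      unfolding G_def using wfar that Y(1) X by (intro sum.mono_neutral_left) (auto simp: U_def)
    qed
    have "(\<Sum>y\<in>Y. \<bar>b k y * b l y\<bar> * Aw) <= (\<Sum>y\<in>Y. (A ^ m * A ^ m) * Aw)"
     using bY that Aw(1) A unfolding abs_mult by (intro sum_mono mult_right_mono mult_mono) auto
    also have "... <= AG" using Y(3) Aw(1) A by (simp add: AG_def mult_right_mono)
    finally show ?thesis by (rule CB_mono[OF h 1])
   qed
   have bCB: "CB (m - 1) h U B (b l)" if "l \<in> K" for l proof (rule CB_mono[OF h _ B[OF that]])
    have "\<bar>x $ i - z $ i\<bar> <= A * h" if "x \<in> U" for x i proof -
     have "\<bar>x $ i - z $ i\<bar> <= norm (x - z)" using component_le_norm_cart[of "x - z" i] by simp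
     also have "... <= norm (x - x0) + norm (z - x0)" using norm_triangle_ineq4[of "x - x0" "z - x0"] by simp
     also have "... <= 1 * h + C2 * h" using that z(1) by (auto simp: U_def dist_norm norm_minus_commute intro!: add_mono)
     also have "... <= A * h" unfolding distrib_right[symmetric] using h C2(1) by (intro mult_right_mono) (auto simp: A_def)
     finally show ?thesis .
    qed
    then show "CB (m - 1) h U (\<Prod>i\<in>(UNIV :: 'd set). 2 ^ (m - 1) * (2 ^ (m - 1) * A) ^ l i) (b l)"
     unfolding b_def[abs_def] by (intro CB_mimono U(1) h A)
   qed
   have "\<exists>lam. (\<forall>k\<in>K. CB (m - 1) h U Cl (lam k)) \<and> (\<forall>x\<in>U. \<forall>l\<in>K. (\<Sum>k\<in>K. lam k x * G k l x) = b l x)"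
   proof (rule Cl[THEN spec, THEN spec, THEN spec, THEN spec, THEN mp, THEN mp, THEN mp, THEN mp, THEN mp, OF h U(1)])
    show "\<forall>k\<in>K. \<forall>l\<in>K. CB (m - 1) h U AG (G k l) \<and> G k l = G l k"
     using GCB by (auto simp: G_def fun_eq_iff mult.commute)
   qed (use pd bCB in blast)+
   then obtain lam where lam: "!!k. k \<in> K ==> CB (m - 1) h U Cl (lam k)" "!!x l. x \<in> U ==> l \<in> K ==> (\<Sum>k\<in>K. lam k x * G k l x) = b l x"
    by blast
   have a_eq: "a y x = w y x * (\<Sum>k\<in>K. b k y * lam k x)" if x: "x \<in> U" for y x proof -
    have p: "\<forall>k\<in>K. c k = 0" if "(\<Sum>y\<in>X. w y x * (\<Sum>k\<in>K. c k * b k y)\<^sup>2) = 0" for c proof -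
     have "\<kappa> / 2 * (\<Sum>k\<in>K. (c k)\<^sup>2) <= 0" using pd[OF x, of c] that by (simp only: quad)
     then have "(\<Sum>k\<in>K. (c k)\<^sup>2) <= 0" using \<kappa> by (simp add: mult_le_0_iff)
     then have "(\<Sum>k\<in>K. (c k)\<^sup>2) = 0" by (intro antisym sum_nonneg) auto
     then show "\<forall>k\<in>K. c k = 0" using finK by (simp add: sum_nonneg_eq_0_iff)
    qed
    have q: "(\<Sum>k\<in>K. lam k x * (\<Sum>y\<in>X. w y x * b k y * b l y)) = b l x" if "l \<in> K" for l proof -
     have "(\<Sum>y\<in>X. w y x * b k y * b l y) = G k l x" for k by (simp add: G_def mult_ac)
     then show ?thesis using lam(2)[OF x that] by simp
    qed
    have "a y x = w y x * (\<Sum>k\<in>K. lam k x * b k y)"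
     using mls_shape_basis_change[where w = w and lam = "%k. lam k x" and z = z and m = m and h = h and X = X and x = x and x' = x and y = y,
       OF X h p[unfolded K_def b_def] q[unfolded K_def b_def]] unfolding a_def b_def K_def by blast
    then show ?thesis by (simp add: mult.commute)
   qed
   have "CB (m - 1) h U C0 (a y)" if y: "y \<in> X" for y proof (cases "y \<in> Y")
    case True
    have "CB (m - 1) h U (2 ^ (m - 1) * Aw * (\<Sum>k\<in>K. \<bar>b k y\<bar> * Cl)) (%x. w y x * (\<Sum>k\<in>K. b k y * lam k x))"
     using Aw(1) Cl0 finK lam(1) by (intro CB_mult U(1) h wCB CB_sum CB_cmult sum_nonneg) auto
    then have "CB (m - 1) h U (2 ^ (m - 1) * Aw * (\<Sum>k\<in>K. \<bar>b k y\<bar> * Cl)) (a y)"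
     by (rule CB_cong[OF U(1), rotated]) (simp add: a_eq)
    moreover have "2 ^ (m - 1) * Aw * (\<Sum>k\<in>K. \<bar>b k y\<bar> * Cl) <= C0"
     unfolding C0_def using bY[OF True] Aw(1) Cl0 by (intro mult_left_mono sum_mono mult_right_mono) auto
    ultimately show ?thesis by (rule CB_mono[OF h])
   next
    case False
    have "CB (m - 1) h U C0 (%_. 0)" using C0 by (intro CB_const U(1) h) auto
    then show ?thesis by (rule CB_cong[OF U(1), rotated]) (use wfar False y in "simp add: a_eq U_def")
   qed
   moreover have "(\<Sum>y\<in>X. a y x0 * mimono g (y - v)) = mimono g (x0 - v)" if g: "mi_size g <= m" for g v proof -
    obtain T where T: "!!u. mimono g (u + (1 / h) *\<^sub>R (z - v)) = (\<Sum>l | mi_size l <= m. T l * mimono l u)"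
     using mimono_shift[OF g] by blast
    have mono: "mimono g (y - v) = h ^ mi_size g * (\<Sum>l\<in>K. T l * b l y)" for y proof -
     have "mimono g (y - v) = h ^ mi_size g * mimono g ((1 / h) *\<^sub>R (y - v))"
      using h by (simp add: mimono_def power_divide prod_dividef mi_size_def power_sum)
     also have "(1 / h) *\<^sub>R (y - v) = (1 / h) *\<^sub>R (y - z) + (1 / h) *\<^sub>R (z - v)" by (simp add: scaleR_add_right[symmetric])
     finally show ?thesis unfolding T b_def K_def .
    qed
    have mom: "(\<Sum>y\<in>X. a y x0 * b l y) = b l x0" if "l \<in> K" for l proof -
     have "(\<Sum>y\<in>X. a y x0 * b l y) = (\<Sum>y\<in>X. \<Sum>k\<in>K. lam k x0 * ((b k y * b l y) * w y x0))"
      by (simp add: a_eq[OF U(2)] sum_distrib_left sum_distrib_right mult_ac)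
     also have "... = (\<Sum>k\<in>K. \<Sum>y\<in>X. lam k x0 * ((b k y * b l y) * w y x0))" by (rule sum.swap)
     also have "... = b l x0" using lam(2)[OF U(2) that] by (simp add: G_def sum_distrib_left)
     finally show ?thesis .
    qed
    have "(\<Sum>y\<in>X. a y x0 * mimono g (y - v)) = (\<Sum>y\<in>X. \<Sum>l\<in>K. h ^ mi_size g * T l * (a y x0 * b l y))"
     unfolding mono by (simp add: sum_distrib_left mult_ac)
    also have "... = (\<Sum>l\<in>K. \<Sum>y\<in>X. h ^ mi_size g * T l * (a y x0 * b l y))" by (rule sum.swap)
    also have "... = (\<Sum>l\<in>K. h ^ mi_size g * T l * b l x0)"
     unfolding sum_distrib_left[symmetric] by (intro sum.cong refl arg_cong2[where f = "(*)"] mom)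
    finally show ?thesis unfolding mono by (simp add: sum_distrib_left mult_ac)
   qed
   ultimately show ?thesis using U by blast
  qed
  have "CB (m - 1) h \<Omega> C0 (a y)" if "y \<in> X" for y by (rule CB_local) (use local that in meson)
  moreover have "a y x = 0" if "\<delta> < norm (x - y)" for x y using w_zero[OF that] by (simp add: a_def mls_shape_def)
  moreover have "real (card {y\<in>X. norm (x - y) <= \<delta>}) <= N0" for x proof -
   have "card {y\<in>X. norm (x - y) <= \<delta>} <= card {y\<in>X. norm (x - y) <= (2 * C2 + 1) * h}"
    using X h by (intro card_mono) (auto simp: \<delta>def algebra_simps)
   then show ?thesis using cardY[of x] by linarith
  qed
  ultimately show ?thesis using local unfolding a_def w_def by meson
 qed
 note main = this
 show ?thesis unfolding Let_def by (intro exI[of _ C0] exI[of _ N0] conjI C0 N0 allI impI)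
    (use main[OF _ _ _ refl refl, unfolded C2_def] in meson)+
qed


section \<open>Weak derivatives of smooth functions\<close>


lemma partial_deriv_support: "x \<notin> closure {x. f x ~= 0} ==> partial_deriv i f x = 0"
 by (rule partial_deriv_zero_open[of "- closure {x. f x ~= 0}"]) (use closure_subset[of "{x. f x ~= 0}"] in auto)

lemma test_function_partial:
 assumes "test_function \<Omega> \<psi>" shows "test_function \<Omega> (partial_deriv i \<psi>)"
proof -
 let ?S = "closure {x. \<psi> x ~= 0}"
 have "{x. partial_deriv i \<psi> x ~= 0} \<subseteq> ?S" using partial_deriv_support by blast
 then have sub: "closure {x. partial_deriv i \<psi> x ~= 0} \<subseteq> ?S" by (intro closure_minimal) auto
 have "compact ?S" "?S \<subseteq> \<Omega>" using assms by (auto simp: test_function_def)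
 then have "compact (closure {x. partial_deriv i \<psi> x ~= 0})"
  using sub compact_Int_closed[of ?S "closure {x. partial_deriv i \<psi> x ~= 0}"] by (simp add: Int_absorb1)
 moreover have "iter_partial is (partial_deriv i \<psi>) differentiable_on UNIV" for "is"
  using assms iter_partial_append[of "is" "[i]" \<psi>] by (simp add: test_function_def) metis
 ultimately show ?thesis using sub \<open>?S \<subseteq> \<Omega>\<close> by (auto simp: test_function_def)
qed

lemma test_function_continuous: "test_function \<Omega> \<psi> ==> continuous_on S \<psi>"
 and test_function_differentiable: "test_function \<Omega> \<psi> ==> \<psi> differentiable (at x)"
proof -
 assume "test_function \<Omega> \<psi>"
 then have "iter_partial [] \<psi> differentiable_on UNIV" unfolding test_function_def by blast
 then have d: "\<psi> differentiable_on UNIV" by simp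
 then show "continuous_on S \<psi>" using differentiable_imp_continuous_on continuous_on_subset by blast
 show "\<psi> differentiable (at x)" using d by (auto simp: differentiable_on_def)
qed

text \<open>The extension by zero is continuous because \<psi> has compact support in \<Omega>,
  although g may be unbounded near the frontier.\<close>

lemma test_product_extension:
 assumes \<Omega>: "open \<Omega>" and g: "continuous_on \<Omega> g" and \<psi>: "test_function \<Omega> \<psi>"
 shows "continuous_on UNIV (%x. indicator \<Omega> x * (g x * \<psi> x))"
  and "integrable lborel (%x. indicator \<Omega> x * (g x * \<psi> x))"
  and "(\<integral>x. g x * \<psi> x \<partial>lebesgue_on \<Omega>) = (LBINT x. indicator \<Omega> x * (g x * \<psi> x))"
proof -
 let ?S = "closure {x. \<psi> x ~= 0}" and ?F = "%x. indicator \<Omega> x * (g x * \<psi> x)"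
 have S: "compact ?S" "?S \<subseteq> \<Omega>" using \<psi> by (auto simp: test_function_def)
 have z: "?F x = 0" if "x \<notin> ?S" for x using that closure_subset[of "{x. \<psi> x ~= 0}"] by auto
 have "continuous_on \<Omega> ?F" by (rule continuous_on_eq[of _ "%x. g x * \<psi> x"])
    (auto intro!: continuous_on_mult g test_function_continuous[OF \<psi>])
 moreover have "continuous_on (- ?S) ?F" by (rule continuous_on_eq[of _ "%x. 0"]) (use z in auto)
 ultimately have "continuous_on (\<Omega> \<union> - ?S) ?F" using \<Omega> by (intro continuous_on_open_Un) auto
 moreover have "\<Omega> \<union> - ?S = UNIV" using S(2) by blast
 ultimately show c: "continuous_on UNIV ?F" by simp
 have "integrable lborel (%x. indicator ?S x *\<^sub>R ?F x)" by (rule borel_integrable_compact[OF S(1) continuous_on_subset[OF c]]) auto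
 also have "(%x. indicator ?S x *\<^sub>R ?F x) = ?F" using z by (auto simp: fun_eq_iff indicator_def)
 finally show "integrable lborel ?F" .
 have "(\<integral>x. g x * \<psi> x \<partial>lebesgue_on \<Omega>) = (\<integral>x. indicator \<Omega> x *\<^sub>R (g x * \<psi> x) \<partial>lebesgue)"
  by (rule integral_restrict_space) (simp add: \<Omega>)
 also have "... = (LBINT x. ?F x)" using borel_measurable_continuous_onI[OF c] by (subst integral_completion[symmetric]) auto
 finally show "(\<integral>x. g x * \<psi> x \<partial>lebesgue_on \<Omega>) = (LBINT x. ?F x)" .
qed

lemma integration_by_parts:
 assumes \<Omega>: "open \<Omega>" and f: "!!x. x \<in> \<Omega> ==> f differentiable (at x)" "continuous_on \<Omega> (partial_deriv i f)"
  and \<psi>: "test_function \<Omega> \<psi>"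
 shows "(\<integral>x. f x * partial_deriv i \<psi> x \<partial>lebesgue_on \<Omega>) = - (\<integral>x. partial_deriv i f x * \<psi> x \<partial>lebesgue_on \<Omega>)"
proof -
 let ?S = "closure {x. \<psi> x ~= 0}" and ?F = "%x. indicator \<Omega> x * (f x * \<psi> x)"
 have S: "compact ?S" "?S \<subseteq> \<Omega>" using \<psi> by (auto simp: test_function_def)
 have z: "?F x = 0" if "x \<notin> ?S" for x using that closure_subset[of "{x. \<psi> x ~= 0}"] by auto
 have fc: "continuous_on \<Omega> f" using f(1) by (simp add: continuous_at_imp_continuous_on differentiable_imp_continuous_within)
 note \<psi>' = test_function_partial[OF \<psi>, of i]
 note E1 = test_product_extension[OF \<Omega> fc \<psi>'] and E2 = test_product_extension[OF \<Omega> f(2) \<psi>]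
 have D: "partial_deriv i ?F x = indicator \<Omega> x * (f x * partial_deriv i \<psi> x) + indicator \<Omega> x * (partial_deriv i f x * \<psi> x)
   \<and> ?F differentiable (at x)" for x proof (cases "x \<in> \<Omega>")
  case True
  have "partial_deriv i ?F x = partial_deriv i (%x. f x * \<psi> x) x" by (rule partial_deriv_cong_open[OF \<Omega> True]) simp
  moreover have "?F differentiable (at x)" by (rule differentiable_cong_open[OF \<Omega> True, of "%x. f x * \<psi> x"])
     (auto intro!: differentiable_mult f(1) True test_function_differentiable[OF \<psi>])
  ultimately show ?thesis using True partial_deriv_mult[OF f(1)[OF True] test_function_differentiable[OF \<psi>]] by simp
 next
  case False
  then have x: "x \<in> - ?S" using S(2) by blast
  have "partial_deriv i ?F x = 0" by (rule partial_deriv_zero_open[OF _ x]) (use z in auto)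
  moreover have "?F differentiable (at x)" by (rule differentiable_cong_open[OF _ x, of "%_. 0"]) (use z in auto)
  ultimately show ?thesis using False by simp
 qed
 have pF: "partial_deriv i ?F = (%x. indicator \<Omega> x * (f x * partial_deriv i \<psi> x) + indicator \<Omega> x * (partial_deriv i f x * \<psi> x))"
  using D by blast
 obtain a b where "?S \<subseteq> cbox a b" using bounded_subset_cbox_symmetric compact_imp_bounded[OF S(1)] by metis
 have "(LBINT x. partial_deriv i ?F x) = 0" proof (rule integral_partial_deriv_zero)
  show "?F differentiable (at x)" for x using D by blast
  show "continuous_on UNIV (partial_deriv i ?F)" unfolding pF by (intro continuous_on_add E1(1) E2(1))
  show "?F x = 0" if "x \<notin> cbox a b" for x using z that \<open>?S \<subseteq> cbox a b\<close> by blast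
 qed
 then show ?thesis unfolding pF E1(3) E2(3) using E1(2) E2(2) by simp
qed

text \<open>Derivatives are moved to f one at a time, and the outermost one on \<psi> becomes the
  innermost one on f. The reversed list records this, so mixed partial derivatives are never
  interchanged.\<close>

lemma integration_by_parts_iter:
 assumes \<Omega>: "open \<Omega>"
 shows "CB k h \<Omega> A f ==> length is <= k ==> test_function \<Omega> \<psi> ==>
  (\<integral>x. f x * iter_partial is \<psi> x \<partial>lebesgue_on \<Omega>) = (-1) ^ length is * (\<integral>x. iter_partial (rev is) f x * \<psi> x \<partial>lebesgue_on \<Omega>)"
proof (induction "is" arbitrary: f k A)
 case (Cons i "is")
 then obtain k' where k: "k = Suc k'" by (cases k) auto
 have f: "!!x. x \<in> \<Omega> ==> f differentiable (at x)" "CB k' h \<Omega> (A / h) (partial_deriv i f)" using Cons.prems k by auto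
 have t: "test_function \<Omega> (iter_partial js \<psi>)" for js by (induction js) (use Cons.prems test_function_partial in auto)
 have "(\<integral>x. f x * partial_deriv i (iter_partial is \<psi>) x \<partial>lebesgue_on \<Omega>) = - (\<integral>x. partial_deriv i f x * iter_partial is \<psi> x \<partial>lebesgue_on \<Omega>)"
  by (rule integration_by_parts[OF \<Omega> f(1) CB_continuous[OF f(2)] t])
 also have "(\<integral>x. partial_deriv i f x * iter_partial is \<psi> x \<partial>lebesgue_on \<Omega>) =
   (-1) ^ length is * (\<integral>x. iter_partial (rev is) (partial_deriv i f) x * \<psi> x \<partial>lebesgue_on \<Omega>)"
  by (rule Cons.IH[OF f(2)]) (use Cons.prems k in auto)
 finally show ?case by (simp add: iter_partial_append)
qed simp

lemma continuous_locally_integrable: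
 assumes "continuous_on \<Omega> f" shows "locally_integrable \<Omega> f" unfolding locally_integrable_def set_integrable_def
proof (intro allI impI)
 fix K assume K: "compact K \<and> K \<subseteq> \<Omega>"
 then have "integrable lborel (%x. indicator K x *\<^sub>R f x)" by (intro borel_integrable_compact continuous_on_subset[OF assms]) auto
 then show "integrable lebesgue (%x. indicator K x *\<^sub>R f x)" by (subst integrable_completion) (auto dest: borel_measurable_integrable)
qed

lemma has_weak_deriv_classical:
 assumes \<Omega>: "open \<Omega>" and f: "CB k h \<Omega> A f" and \<beta>: "mi_size \<beta> <= k"
 shows "has_weak_deriv \<Omega> \<beta> f (iter_partial (rev (mi_list \<beta>)) f)" unfolding has_weak_deriv_def
proof (intro conjI allI impI)
 show "locally_integrable \<Omega> f" by (rule continuous_locally_integrable[OF CB_continuous[OF f]])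
 have "CB (k - mi_size \<beta>) h \<Omega> (A / h ^ mi_size \<beta>) (iter_partial (rev (mi_list \<beta>)) f)"
  using CB_iter_partial[OF f, of "rev (mi_list \<beta>)"] \<beta> by simp
 then show "locally_integrable \<Omega> (iter_partial (rev (mi_list \<beta>)) f)" by (rule continuous_locally_integrable[OF CB_continuous])
 fix \<psi> assume "test_function \<Omega> \<psi>"
 then show "(\<integral>x. f x * multi_deriv \<beta> \<psi> x \<partial>lebesgue_on \<Omega>) =
    (-1) ^ mi_size \<beta> * (\<integral>x. iter_partial (rev (mi_list \<beta>)) f x * \<psi> x \<partial>lebesgue_on \<Omega>)"
  unfolding multi_deriv_mi_list using integration_by_parts_iter[OF \<Omega> f, of "mi_list \<beta>"] \<beta> by simp
qed

lemma integrable_times_test: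
 assumes \<Omega>: "open \<Omega>" and u: "locally_integrable \<Omega> u" and \<psi>: "test_function \<Omega> \<psi>"
 shows "integrable (lebesgue_on \<Omega>) (%x. u x * \<psi> x)"
proof -
 let ?S = "closure {x. \<psi> x ~= 0}"
 have S: "compact ?S" "?S \<subseteq> \<Omega>" using \<psi> by (auto simp: test_function_def)
 have "compact (\<psi> ` ?S)" by (intro compact_continuous_image S test_function_continuous[OF \<psi>])
 then obtain B where B: "!!x. x \<in> ?S ==> \<bar>\<psi> x\<bar> <= B" using compact_imp_bounded by (force simp: bounded_iff)
 have z: "\<psi> x = 0" if "x \<notin> ?S" for x using that closure_subset[of "{x. \<psi> x ~= 0}"] by auto
 have B': "\<bar>\<psi> x\<bar> <= max B 0" for x using B[of x] z[of x] by (cases "x \<in> ?S") auto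
 have "integrable lebesgue (%x. indicator ?S x *\<^sub>R u x)" using u S by (auto simp: locally_integrable_def set_integrable_def)
 then have "integrable lebesgue (%x. (indicator ?S x *\<^sub>R u x) * \<psi> x)" proof (rule integrable_mult_bounded[OF _ _ B'])
  show "\<psi> \<in> borel_measurable lebesgue" using borel_measurable_continuous_onI[OF test_function_continuous[OF \<psi>]]
   by (intro measurable_completion) simp
 qed
 also have "(%x. (indicator ?S x *\<^sub>R u x) * \<psi> x) = (%x. indicator \<Omega> x *\<^sub>R (u x * \<psi> x))" proof
  fix x show "(indicator ?S x *\<^sub>R u x) * \<psi> x = indicator \<Omega> x *\<^sub>R (u x * \<psi> x)"
   using z[of x] S(2) by (cases "x \<in> ?S") auto
 qed
 finally show ?thesis by (subst integrable_restrict_space) (use \<Omega> in auto)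
qed

lemma has_weak_deriv_diff:
 assumes \<Omega>: "open \<Omega>" and u: "has_weak_deriv \<Omega> \<beta> u g" and v: "has_weak_deriv \<Omega> \<beta> v g'"
 shows "has_weak_deriv \<Omega> \<beta> (%x. u x - v x) (%x. g x - g' x)"
proof -
 have li: "locally_integrable \<Omega> u" "locally_integrable \<Omega> v" "locally_integrable \<Omega> g" "locally_integrable \<Omega> g'"
  using u v by (auto simp: has_weak_deriv_def)
 have d: "locally_integrable \<Omega> (%x. f x - f' x)" if "locally_integrable \<Omega> f" "locally_integrable \<Omega> f'" for f f'
  using that unfolding locally_integrable_def by (blast intro: set_integral_diff(1))
 have t: "test_function \<Omega> (multi_deriv \<beta> \<psi>)" if "test_function \<Omega> \<psi>" for \<psi> proof -
  have "test_function \<Omega> (iter_partial js \<psi>)" for js by (induction js) (use that test_function_partial in auto)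
  then show ?thesis by (simp add: multi_deriv_mi_list)
 qed
 show ?thesis unfolding has_weak_deriv_def left_diff_distrib proof (intro conjI allI impI d li)
  fix \<psi> assume \<psi>: "test_function \<Omega> \<psi>"
  show "(\<integral>x. u x * multi_deriv \<beta> \<psi> x - v x * multi_deriv \<beta> \<psi> x \<partial>lebesgue_on \<Omega>) =
    (-1) ^ mi_size \<beta> * (\<integral>x. g x * \<psi> x - g' x * \<psi> x \<partial>lebesgue_on \<Omega>)"
   using integrable_times_test[OF \<Omega> li(1) t[OF \<psi>]] integrable_times_test[OF \<Omega> li(2) t[OF \<psi>]]
    integrable_times_test[OF \<Omega> li(3) \<psi>] integrable_times_test[OF \<Omega> li(4) \<psi>] u v \<psi>
   by (simp add: has_weak_deriv_def right_diff_distrib)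
 qed
qed


section \<open>Hoelder's inequality, bumps and patching of local representatives\<close>

lemma powr_pointwise:
 fixes t l p :: real
 assumes "t >= 0" "l > 0" "p >= 1"
 shows "t <= l + l powr (1 - p) * t powr p"
proof (cases "t <= l")
 case True
 then show ?thesis using assms by (simp add: add_increasing2)
next
 case False
 then have t: "t > l" "t > 0" using assms by auto
 have "t = t powr (1 - p) * t powr p" using t by (simp add: powr_add[symmetric])
 also have "... <= l powr (1 - p) * t powr p" using t assms by (intro mult_right_mono powr_mono2') auto
 finally show ?thesis using assms by simp
qed

text \<open>Hoelder's inequality up to the factor 2, by integrating the pointwise bound above with the
  optimal \<open>l\<close>.\<close>

lemma weighted_hoelder:
 fixes f \<rho> :: "'a => real"
 assumes [measurable]: "f \<in> borel_measurable M" "\<rho> \<in> borel_measurable M"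
  and nn: "!!x. 0 <= f x" "!!x. 0 <= \<rho> x" and p: "p >= 1"
  and V: "V > 0" "(\<integral>\<^sup>+x. ennreal (\<rho> x) \<partial>M) <= ennreal V"
  and N: "N >= 0" "(\<integral>\<^sup>+x. ennreal (\<rho> x * f x powr p) \<partial>M) <= ennreal N"
 shows "(\<integral>\<^sup>+x. ennreal (\<rho> x * f x) \<partial>M) <= ennreal (2 * V powr (1 - 1 / p) * N powr (1 / p))"
proof (cases "N = 0")
 case True
 then have "(\<integral>\<^sup>+x. ennreal (\<rho> x * f x powr p) \<partial>M) = 0" using N by simp
 then have "AE x in M. ennreal (\<rho> x * f x powr p) = 0" by (subst (asm) nn_integral_0_iff_AE) auto
 then have "AE x in M. ennreal (\<rho> x * f x) = 0" proof eventually_elim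
  case (elim x)
  then have "\<rho> x * f x powr p <= 0" unfolding ennreal_eq_0_iff .
  moreover have "\<rho> x * f x powr p >= 0" using nn[of x] by simp
  ultimately have "\<rho> x * f x powr p = 0" by (rule antisym)
  then show ?case by auto
 qed
 then have "(\<integral>\<^sup>+x. ennreal (\<rho> x * f x) \<partial>M) = 0" by (subst nn_integral_0_iff_AE) auto
 then show ?thesis by simp
next
 case False
 then have N0: "N > 0" using N by simp
 \<comment> \<open>This choice makes the two terms l V and l^(1 - p) N equal. It degenerates for N =
   0, which is treated separately above.\<close>
 define l where "l = (N / V) powr (1 / p)"
 have l: "l > 0" using N0 V by (simp add: l_def)
 have quot: "(N / V) powr a = N powr a * V powr - a" for a using N0 V by (simp add: powr_divide powr_minus_divide)
 have "(\<integral>\<^sup>+x. ennreal (\<rho> x * f x) \<partial>M) <= (\<integral>\<^sup>+x. ennreal l * ennreal (\<rho> x) + ennreal (l powr (1 - p)) * ennreal (\<rho> x * f x powr p) \<partial>M)"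
 proof (intro nn_integral_mono)
  fix x
  have "\<rho> x * f x <= \<rho> x * (l + l powr (1 - p) * f x powr p)" by (intro mult_left_mono powr_pointwise nn l p)
  also have "... = l * \<rho> x + l powr (1 - p) * (\<rho> x * f x powr p)" by (simp add: algebra_simps)
  finally show "ennreal (\<rho> x * f x) <= ennreal l * ennreal (\<rho> x) + ennreal (l powr (1 - p)) * ennreal (\<rho> x * f x powr p)"
   using nn[of x] l by (simp add: ennreal_mult[symmetric] ennreal_plus[symmetric] ennreal_leI del: ennreal_plus)
 qed
 also have "... = ennreal l * (\<integral>\<^sup>+x. ennreal (\<rho> x) \<partial>M) + ennreal (l powr (1 - p)) * (\<integral>\<^sup>+x. ennreal (\<rho> x * f x powr p) \<partial>M)"
  by (simp add: nn_integral_add nn_integral_cmult)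
 also have "... <= ennreal l * ennreal V + ennreal (l powr (1 - p)) * ennreal N" using V N by (intro add_mono mult_left_mono) auto
 also have "... = ennreal (l * V + l powr (1 - p) * N)" using l V N by (simp add: ennreal_mult ennreal_plus)
 also have "l * V + l powr (1 - p) * N = 2 * V powr (1 - 1 / p) * N powr (1 / p)" proof -
  have "l * V = N powr (1 / p) * (V powr 1 * V powr (- (1 / p)))" using N0 V unfolding l_def quot by simp
  also have "... = V powr (1 - 1 / p) * N powr (1 / p)" unfolding powr_add[symmetric] by simp
  finally have 1: "l * V = V powr (1 - 1 / p) * N powr (1 / p)" .
  have e: "(1 / p) * (1 - p) = 1 / p - 1" using p by (simp add: field_simps)
  have "l powr (1 - p) * N = (N powr (1 / p - 1) * N powr 1) * V powr (- (1 / p - 1))"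
   unfolding l_def powr_powr e quot[of "1 / p - 1"] using N0 by simp
  also have "... = V powr (1 - 1 / p) * N powr (1 / p)" unfolding powr_add[symmetric] by simp
  finally show ?thesis using 1 by simp
 qed
 finally show ?thesis .
qed

lemma emeasure_open_neq_0:
 fixes U :: "'a::euclidean_space set"
 assumes "open U" "U ~= {}"
 shows "emeasure lborel U ~= 0"
proof
 assume "emeasure lborel U = 0"
 then have "U \<in> null_sets lborel" using assms(1) by (auto simp: null_sets_def)
 then have "negligible U" unfolding negligible_iff_null_sets by (rule null_sets_completionI)
 then show False using open_not_negligible[OF assms] by simp
qed

text \<open>Rescaled copies of one product; \<open>b0\<close> is fixed before the centre and the
  scale. The half side h/d keeps the box inside the ball of radius h around c.\<close>

lemma bump_exists:
 "\<exists>b0\<ge>0. \<forall>(c :: real^'d::finite) h. h > 0 --> (\<exists>G. (\<forall>i. smooth1 (G i)) \<and>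
   (\<forall>i s. s \<notin> {(c - (\<chi> i. h / real CARD('d))) $ i..(c + (\<chi> i. h / real CARD('d))) $ i} --> G i s = 0) \<and>
   (\<forall>i s. 0 <= G i s \<and> G i s <= b0 / h) \<and> (LBINT x. prodf G x) = 1)"
proof -
 let ?n = "real CARD('d)"
 define \<sigma> where "\<sigma> = 1 / ?n"
 have \<sigma>: "\<sigma> > 0" by (simp add: \<sigma>_def)
 define g where "g t = exp_step (t + \<sigma>) * exp_step (\<sigma> - t)" for t
 have g_sm: "smooth1 g" proof -
  have "smooth1 (%t. exp_step (1 * t + \<sigma>) * exp_step ((- 1) * t + \<sigma>))" by (intro smooth1_mult smooth1_affine smooth1_exp_step)
  then show ?thesis by (simp add: g_def[abs_def])
 qed
 have g: "0 <= g t" "g t <= 1" for t by (auto simp: g_def exp_step_bounds mult_le_one)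
 have g0: "g t = 0" if "t \<notin> {-\<sigma>..\<sigma>}" for t using that by (auto simp: g_def exp_step_bounds)
 have gpos: "g t > 0" if "t \<in> {-\<sigma><..<\<sigma>}" for t using that by (auto simp: g_def exp_step_bounds)
 let ?g = "%_ :: 'd. g" and ?a = "\<chi> i. \<sigma> :: real^'d"
 have sup: "prodf ?g x = 0" if "x \<notin> cbox (- ?a) ?a" for x by (rule prodf_zero_outside[of "- ?a" ?a]) (use g0 that in auto)
 have gc: "continuous_on S (prodf ?g)" for S by (rule prodf_continuous[of ?g]) (rule g_sm)
 have int: "integrable lborel (prodf ?g)" proof -
  have "integrable lborel (%x. indicator (cbox (- ?a) ?a) x *\<^sub>R prodf ?g x)" by (rule borel_integrable_compact) (auto intro: gc)
  also have "(%x. indicator (cbox (- ?a) ?a) x *\<^sub>R prodf ?g x) = prodf ?g" using sup by (auto simp: fun_eq_iff indicator_def)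
  finally show ?thesis .
 qed
 have nn: "0 <= prodf ?g x" for x unfolding prodf_def by (intro prod_nonneg) (use g in auto)
 define Z where "Z = (LBINT x. prodf ?g x)"
 have "Z ~= 0" proof
  assume "Z = 0"
  then have "AE x in lborel. prodf ?g x = 0" unfolding Z_def using integral_nonneg_eq_0_iff_AE[OF int] nn by simp
  then have "AE x in lborel. x \<notin> box (- ?a) ?a" proof eventually_elim
   case (elim x)
   show ?case proof
    assume "x \<in> box (- ?a) ?a"
    then have "prodf ?g x > 0" unfolding prodf_def by (intro prod_pos) (use gpos in "auto simp: mem_box_cart")
    then show False using elim by simp
   qed
  qed
  then have "emeasure lborel (box (- ?a) ?a) = 0" by (subst (asm) AE_iff_measurable[OF _ refl]) auto
  moreover have "box (- ?a) ?a ~= {}" using \<sigma> by (auto simp: interval_ne_empty_cart)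
  ultimately show False using emeasure_open_neq_0[of "box (- ?a) ?a"] by auto
 qed
 moreover have "Z >= 0" unfolding Z_def by (intro integral_nonneg_AE) (use nn in auto)
 ultimately have Z: "Z > 0" by simp
 \<comment> \<open>The normalisation 1/Z is shared equally among the d factors, because
   \<open>kf_bound\<close> asks for a bound on each factor.\<close>
 define b0 where "b0 = Z powr (- 1 / ?n)"
 have b0: "b0 ^ CARD('d) = 1 / Z" proof -
  have "b0 ^ CARD('d) = b0 powr ?n" using Z by (subst powr_realpow) (auto simp: b0_def)
  also have "... = Z powr (-1)" by (simp add: b0_def powr_powr)
  finally show ?thesis using Z by (simp add: powr_minus divide_inverse)
 qed
 show ?thesis proof (intro exI[of _ b0] conjI allI impI)
  show "b0 >= 0" by (simp add: b0_def)
  fix c :: "real^'d" and h :: real assume h: "h > 0"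
  define G where "G i s = (b0 / h) * g ((s - c $ i) / h)" for i s
  have G_sm: "smooth1 (G i)" for i proof -
   have "smooth1 (%s. (b0 / h) * g ((1 / h) * s + (- c $ i / h)))" by (intro smooth1_mult smooth1_const smooth1_affine g_sm)
   then show ?thesis by (simp add: G_def[abs_def] diff_divide_distrib)
  qed
  moreover have "G i s = 0" if "s \<notin> {(c - (\<chi> i. h / ?n)) $ i..(c + (\<chi> i. h / ?n)) $ i}" for i s proof -
   have "(s - c $ i) / h \<notin> {-\<sigma>..\<sigma>}" using that h by (auto simp: \<sigma>_def field_simps)
   then show ?thesis using g0 by (simp add: G_def)
  qed
  moreover have "0 <= G i s \<and> G i s <= b0 / h" for i s
   using g[of "(s - c $ i) / h"] h mult_left_le[of "g ((s - c $ i) / h)" "b0 / h"] by (auto simp: G_def b0_def)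
  moreover have "(LBINT x. prodf G x) = 1" proof -
   have "prodf G (c + h *\<^sub>R z) = (b0 / h) ^ CARD('d) * prodf ?g z" for z
    using h by (simp add: prodf_def G_def prod.distrib power_divide prod_dividef)
   moreover have "(LBINT x. prodf G x) = \<bar>h\<bar> ^ DIM(real^'d) * (LBINT z. prodf G (c + h *\<^sub>R z))"
    by (rule integral_lborel_affine) (use h prodf_measurable[of G, OF G_sm] in auto)
   ultimately show ?thesis using h Z b0 by (simp add: Z_def[symmetric] power_divide)
  qed
  ultimately show "\<exists>G. (\<forall>i. smooth1 (G i)) \<and>
   (\<forall>i s. s \<notin> {(c - (\<chi> i. h / ?n)) $ i..(c + (\<chi> i. h / ?n)) $ i} --> G i s = 0) \<and>
   (\<forall>i s. 0 <= G i s \<and> G i s <= b0 / h) \<and> (LBINT x. prodf G x) = 1" by (intro exI[of _ G] conjI allI impI) auto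
 qed
qed

lemma continuous_AE_eq:
 fixes f g :: "'a::euclidean_space => real"
 assumes U: "open U" and c: "continuous_on U f" "continuous_on U g" and ae: "AE x in lborel. x \<in> U --> f x = g x" and x: "x \<in> U"
 shows "f x = g x"
proof (rule ccontr)
 assume ne: "f x ~= g x"
 have "open (U \<inter> (%x. f x - g x) -` (- {0}))"
  by (rule continuous_open_preimage[OF continuous_on_diff[OF c] U]) (simp add: open_Compl)
 moreover have "U \<inter> (%x. f x - g x) -` (- {0}) = {x \<in> U. f x ~= g x}" by auto
 ultimately have o: "open {x \<in> U. f x ~= g x}" by simp
 have "AE x in lborel. x \<notin> {x \<in> U. f x ~= g x}" using ae by eventually_elim auto
 then have "emeasure lborel {x \<in> U. f x ~= g x} = 0" by (subst (asm) AE_iff_measurable[OF _ refl]) (use o in auto)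
 then show False using emeasure_open_neq_0[OF o] x ne by blast
qed

text \<open>Local continuous representatives agree on overlaps, since continuous functions that are
  equal almost everywhere on an open set are equal there.\<close>

lemma patch_continuous:
 fixes f :: "'a::euclidean_space => real"
 assumes \<Omega>: "open \<Omega>" and loc: "!!x. x \<in> \<Omega> ==> \<exists>U v. open U \<and> x \<in> U \<and> U \<subseteq> \<Omega> \<and> continuous_on U v \<and> (AE y in lborel. y \<in> U --> v y = f y)"
 shows "\<exists>v. continuous_on \<Omega> v \<and> (AE y in lborel. y \<in> \<Omega> --> v y = f y)"
proof -
 obtain U V where UV: "!!x. x \<in> \<Omega> ==> open (U x) \<and> x \<in> U x \<and> U x \<subseteq> \<Omega> \<and> continuous_on (U x) (V x) \<and> (AE y in lborel. y \<in> U x --> V x y = f y)"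
  using loc by metis
 define v where "v x = V x x" for x
 have eq: "v y = V x y" if x: "x \<in> \<Omega>" and y: "y \<in> U x" for x y proof -
  have y\<Omega>: "y \<in> \<Omega>" using UV[OF x] y by blast
  have "V y y = V x y" proof (rule continuous_AE_eq[of "U x \<inter> U y" "V y" "V x" y])
   show "AE z in lborel. z \<in> U x \<inter> U y --> V y z = V x z"
    using UV[OF x, THEN conjunct2, THEN conjunct2, THEN conjunct2, THEN conjunct2]
     UV[OF y\<Omega>, THEN conjunct2, THEN conjunct2, THEN conjunct2, THEN conjunct2] by eventually_elim auto
  qed (use UV[OF x] UV[OF y\<Omega>] y in "auto intro: continuous_on_subset")
  then show ?thesis by (simp add: v_def)
 qed
 have "continuous_on \<Omega> v" proof (rule continuous_at_imp_continuous_on, rule ballI)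
  fix x assume x: "x \<in> \<Omega>"
  have "continuous_on (U x) v" by (rule continuous_on_eq[of _ "V x"]) (use UV[OF x] eq[OF x] in auto)
  then show "isCont v x" using UV[OF x] by (simp add: continuous_on_eq_continuous_at)
 qed
 moreover have "AE y in lborel. y \<in> \<Omega> --> v y = f y" proof (rule AE_local[OF \<Omega>])
  fix x assume x: "x \<in> \<Omega>"
  have "AE y in lborel. y \<in> U x --> V x y = f y" using UV[OF x] by blast
  then have "AE y in lborel. y \<in> U x --> v y = f y" by eventually_elim (use eq[OF x] in auto)
  then show "\<exists>U. open U \<and> x \<in> U \<and> (AE y in lborel. y \<in> U --> v y = f y)" using UV[OF x] by blast
 qed
 ultimately show ?thesis by blast
qed


section \<open>Local polynomial approximation\<close>


lemma iter_partial_lincomb: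
 assumes \<Omega>: "open \<Omega>" and a: "!!y. y \<in> X ==> CB k h \<Omega> A (a y)"
 shows "length is <= k ==> x \<in> \<Omega> ==> iter_partial is (%x. \<Sum>y\<in>X. a y x * c y) x = (\<Sum>y\<in>X. iter_partial is (a y) x * c y)"
proof (induction "is" arbitrary: x)
 case (Cons i "is")
 have d: "iter_partial is (a y) differentiable (at x)" if "y \<in> X" for y proof -
  obtain j where j: "k - length is = Suc j" using Cons.prems(1) by (cases "k - length is") auto
  have "length is <= k" using Cons.prems(1) by simp
  from CB_iter_partial[OF a[OF that] this] show ?thesis using Cons.prems(2) j by simp
 qed
 have "partial_deriv i (iter_partial is (%x. \<Sum>y\<in>X. a y x * c y)) x = partial_deriv i (%x. \<Sum>y\<in>X. iter_partial is (a y) x * c y) x"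
  by (rule partial_deriv_cong_open[OF \<Omega> Cons.prems(2)]) (use Cons in auto)
 also have "... = (\<Sum>y\<in>X. frechet_derivative (iter_partial is (a y)) (at x) (axis i 1) * c y)" by (rule partial_derivI)
    (auto intro!: has_derivative_sum has_derivative_mult_left simp: frechet_derivative_works[symmetric] d)
 finally show ?case by (simp add: partial_deriv_def)
qed simp

lemma funpow_deriv_power_shift:
 "(deriv ^^ n) (%t. (t - a :: real) ^ k) = (%t. if n <= k then fact k / fact (k - n) * (t - a) ^ (k - n) else 0)"
proof (induction n)
 case (Suc n)
 have "deriv (%t. if n <= k then fact k / fact (k - n) * (t - a) ^ (k - n) else 0) t
   = (if Suc n <= k then fact k / fact (k - Suc n) * (t - a) ^ (k - Suc n) else 0)" for t proof (cases "n <= k")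
  case True
  have "((%t. fact k / fact (k - n) * (t - a) ^ (k - n)) has_real_derivative
    fact k / fact (k - n) * (real (k - n) * (t - a) ^ (k - n - 1))) (at t)" by (auto intro!: derivative_eq_intros)
  then have "deriv (%t. fact k / fact (k - n) * (t - a) ^ (k - n)) t
    = fact k / fact (k - n) * (real (k - n) * (t - a) ^ (k - n - 1))" by (rule DERIV_imp_deriv)
  moreover have "fact k / fact (k - n) * (real (k - n) * (t - a) ^ (k - n - 1)) = fact k / fact (k - Suc n) * (t - a) ^ (k - Suc n)"
   if "n < k" proof -
   define j where "j = k - Suc n"
   then have "k - n = Suc j" using Suc_diff_Suc[OF that] by simp
   moreover have "k - Suc n = j" by (simp add: j_def)
   ultimately show ?thesis by (simp add: field_simps del: of_nat_Suc)
  qed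
  ultimately show ?thesis using True by (cases "n = k") auto
 qed simp
 then show ?case by (simp only: funpow.simps o_apply Suc.IH)
qed simp

lemma smooth1_power_shift: "smooth1 (%t. (t - a) ^ k)"
proof -
 have "smooth1 (%t. (1 * t + (- a)) ^ k)" by (rule smooth1_power[OF smooth1_affine[OF smooth1_ident]])
 then show ?thesis by simp
qed

lemma iter_partial_mimono:
 assumes c: "!!i. count_list is i = \<beta> i"
 shows "iter_partial is (%x. mimono g (x - w)) x =
  (if \<forall>i. \<beta> i <= g i then mi_fact g / mi_fact (%i. g i - \<beta> i) * mimono (%i. g i - \<beta> i) (x - w) else 0)"
proof -
 have "(%x. mimono g (x - w)) = prodf (%i t. (t - w $ i) ^ g i)" by (simp add: mimono_def prodf_def fun_eq_iff)
 then have "iter_partial is (%x. mimono g (x - w)) x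
   = (\<Prod>i\<in>UNIV. if \<beta> i <= g i then fact (g i) / fact (g i - \<beta> i) * (x $ i - w $ i) ^ (g i - \<beta> i) else 0)"
  by (simp add: iter_partial_prodf[OF smooth1_power_shift] funpow_deriv_power_shift prodf_def c)
 also have "... = (if \<forall>i. \<beta> i <= g i then mi_fact g / mi_fact (%i. g i - \<beta> i) * mimono (%i. g i - \<beta> i) (x - w) else 0)"
 proof (cases "\<forall>i. \<beta> i <= g i")
  case True
  then show ?thesis by (simp add: mi_fact_def mimono_def prod.distrib prod_dividef)
 next
  case False
  then show ?thesis by (auto intro!: prod_zero)
 qed
 finally show ?thesis .
qed

text \<open>The formal derivative \<open>D\<^sup>\<beta>\<close> of the averaged Taylor polynomial with derivatives \<open>\<kappa>\<close> and weight \<open>prodf G\<close>.\<close>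

definition avg_taylor ::
 "nat => (('d::finite => nat) => real^'d => real) => ('d => real => real) => ('d => nat) => real^'d => real" where
 "avg_taylor m \<kappa> G \<beta> y = (\<Sum>\<gamma> | mi_size \<gamma> <= m - mi_size \<beta>.
   (LBINT w. \<kappa> (%i. \<gamma> i + \<beta> i) w * (prodf G w * mimono \<gamma> (y - w))) / mi_fact \<gamma>)"

lemma mi_size_add: "mi_size (%i. \<gamma> i + \<beta> i) = mi_size \<gamma> + mi_size \<beta>" by (simp add: mi_size_def sum.distrib)

text \<open>The shape functions reproduce every monomial centred at any w. Differentiating this
  identity produces the factor \<gamma>!/(\<gamma> - \<beta>)!, which together with the 1/\<gamma>!
  of the Taylor formula and integration over w gives the formal derivative of the averaged
  polynomial.\<close>

lemma avg_taylor_reproduction: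
 fixes \<Omega> :: "(real^'d::finite) set"
 assumes \<Omega>: "open \<Omega>" "bounded \<Omega>" and h: "h > 0"
  and \<kappa>: "!!\<gamma>. mi_size \<gamma> <= m ==> integrable lborel (\<kappa> \<gamma>)" "!!\<gamma> w. mi_size \<gamma> <= m ==> w \<notin> \<Omega> ==> \<kappa> \<gamma> w = 0"
  and G: "!!i. smooth1 (G i)"
  and a: "!!y. y \<in> X ==> CB k h \<Omega> A (a y)"
  and rep: "!!x w g. x \<in> \<Omega> ==> mi_size g <= m ==> (\<Sum>y\<in>X. a y x * mimono g (y - w)) = mimono g (x - w)"
  and \<beta>: "mi_size \<beta> <= k" "mi_size \<beta> <= m" and x: "x \<in> \<Omega>"
 shows "(\<Sum>y\<in>X. iter_partial (rev (mi_list \<beta>)) (a y) x * avg_taylor m \<kappa> G (%_. 0) y) = avg_taylor m \<kappa> G \<beta> x"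
proof -
 let ?is = "rev (mi_list \<beta>)"
 let ?D = "%y. iter_partial ?is (a y) x"
 let ?I = "%\<delta> \<gamma> y. \<integral>w. \<kappa> \<delta> w * (prodf G w * mimono \<gamma> (y - w)) \<partial>lborel"
 have cl: "compact (closure \<Omega>)" using \<Omega> by (simp add: compact_closure)
 have int: "integrable lborel (%w. \<kappa> \<delta> w * (prodf G w * mimono \<gamma> (y - w)))" if "mi_size \<delta> <= m" for \<delta> \<gamma> y
  by (rule integrable_times_continuous[OF \<kappa>(1)[OF that] _ cl])
    (use \<kappa>(2)[OF that] closure_subset in "auto intro!: continuous_intros prodf_continuous[of G, OF G] simp: mimono_def")
 have D: "(\<Sum>y\<in>X. ?D y * mimono g (y - w)) =
   (if \<forall>i. \<beta> i <= g i then mi_fact g / mi_fact (%i. g i - \<beta> i) * mimono (%i. g i - \<beta> i) (x - w) else 0)"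
  if g: "mi_size g <= m" for g w proof -
  have "(\<Sum>y\<in>X. ?D y * mimono g (y - w)) = iter_partial ?is (%x. \<Sum>y\<in>X. a y x * mimono g (y - w)) x"
   by (rule iter_partial_lincomb[OF \<Omega>(1) a _ x, symmetric]) (use \<beta> in auto)
  also have "... = iter_partial ?is (%x. mimono g (x - w)) x" proof -
   have "x \<in> \<Omega> ==> iter_partial js (%x. \<Sum>y\<in>X. a y x * mimono g (y - w)) x = iter_partial js (%x. mimono g (x - w)) x" for js x
   proof (induction js arbitrary: x)
    case (Cons i js)
    show ?case unfolding iter_partial_Cons by (rule partial_deriv_cong_open[OF \<Omega>(1) Cons.prems]) (rule Cons.IH)
   qed (simp add: rep[OF _ g])
   then show ?thesis using x by blast
  qed
  also have "... = (if \<forall>i. \<beta> i <= g i then mi_fact g / mi_fact (%i. g i - \<beta> i) * mimono (%i. g i - \<beta> i) (x - w) else 0)"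
   by (rule iter_partial_mimono) simp
  finally show ?thesis .
 qed
 have "(\<Sum>y\<in>X. ?D y * avg_taylor m \<kappa> G (%_. 0) y) = (\<Sum>y\<in>X. \<Sum>g | mi_size g <= m. ?D y * (?I g g y / mi_fact g))"
  by (simp add: avg_taylor_def sum_distrib_left)
 also have "... = (\<Sum>g | mi_size g <= m. \<Sum>y\<in>X. ?D y * (?I g g y / mi_fact g))" by (rule sum.swap)
 also have "... = (\<Sum>g | mi_size g <= m. if \<forall>i. \<beta> i <= g i then ?I g (%i. g i - \<beta> i) x / mi_fact (%i. g i - \<beta> i) else 0)"
 proof (rule sum.cong[OF refl])
  fix g assume "g \<in> {g :: 'd => nat. mi_size g <= m}"
  then have g: "mi_size g <= m" by simp
  have "(\<Sum>y\<in>X. ?D y * ?I g g y) = (LBINT w. (\<Sum>y\<in>X. ?D y * (\<kappa> g w * (prodf G w * mimono g (y - w)))))"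
   by (subst Bochner_Integration.integral_sum) (auto intro: int[OF g])
  also have "... = (LBINT w. \<kappa> g w * (prodf G w * (\<Sum>y\<in>X. ?D y * mimono g (y - w))))" by (simp add: sum_distrib_left mult_ac)
  also have "... = (if \<forall>i. \<beta> i <= g i then mi_fact g / mi_fact (%i. g i - \<beta> i) * ?I g (%i. g i - \<beta> i) x else 0)"
  proof (cases "\<forall>i. \<beta> i <= g i")
   case True
   have "(LBINT w. \<kappa> g w * (prodf G w * (\<Sum>y\<in>X. ?D y * mimono g (y - w))))
     = (LBINT w. mi_fact g / mi_fact (%i. g i - \<beta> i) * (\<kappa> g w * (prodf G w * mimono (%i. g i - \<beta> i) (x - w))))"
    unfolding D[OF g] using True by (intro Bochner_Integration.integral_cong) auto
   then show ?thesis using True by simp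
  next
   case False
   then have F: "(\<forall>i. \<beta> i <= g i) = False" by simp
   show ?thesis unfolding D[OF g] F if_False by simp
  qed
  finally have e: "(\<Sum>y\<in>X. ?D y * ?I g g y) = (if \<forall>i. \<beta> i <= g i then mi_fact g / mi_fact (%i. g i - \<beta> i) * ?I g (%i. g i - \<beta> i) x else 0)" .
  have "(\<Sum>y\<in>X. ?D y * (?I g g y / mi_fact g)) = (\<Sum>y\<in>X. ?D y * ?I g g y) / mi_fact g" by (simp add: sum_divide_distrib)
  then show "(\<Sum>y\<in>X. ?D y * (?I g g y / mi_fact g)) = (if \<forall>i. \<beta> i <= g i then ?I g (%i. g i - \<beta> i) x / mi_fact (%i. g i - \<beta> i) else 0)"
   unfolding e by simp
 qed
 also have "... = (\<Sum>g | mi_size g <= m \<and> (\<forall>i. \<beta> i <= g i). ?I g (%i. g i - \<beta> i) x / mi_fact (%i. g i - \<beta> i))"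
  by (rule sum.mono_neutral_cong_right) auto
 also have "... = (\<Sum>\<gamma> | mi_size \<gamma> <= m - mi_size \<beta>. ?I (%i. \<gamma> i + \<beta> i) \<gamma> x / mi_fact \<gamma>)"
 proof (rule sum.reindex_bij_witness[where i = "%\<gamma> i. \<gamma> i + \<beta> i" and j = "%g i. g i - \<beta> i"])
  fix g assume g: "g \<in> {g. mi_size g <= m \<and> (\<forall>i. \<beta> i <= g i)}"
  then show e: "(%i. g i - \<beta> i + \<beta> i) = g" by (auto simp: fun_eq_iff)
  then have "mi_size (%i. g i - \<beta> i) + mi_size \<beta> = mi_size g" by (simp add: mi_size_add[symmetric])
  then show "(%i. g i - \<beta> i) \<in> {\<gamma>. mi_size \<gamma> <= m - mi_size \<beta>}" using g by auto
  show "?I (%i. g i - \<beta> i + \<beta> i) (%i. g i - \<beta> i) x / mi_fact (%i. g i - \<beta> i) = ?I g (%i. g i - \<beta> i) x / mi_fact (%i. g i - \<beta> i)"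
   unfolding e ..
 next
  fix \<gamma> assume "\<gamma> \<in> {\<gamma> :: 'd => nat. mi_size \<gamma> <= m - mi_size \<beta>}"
  then show "(%i. \<gamma> i + \<beta> i) \<in> {g. mi_size g <= m \<and> (\<forall>i. \<beta> i <= g i)}" using \<beta> by (auto simp: mi_size_add)
 qed auto
 finally show ?thesis by (simp add: avg_taylor_def)
qed

lemma mimono_uminus: "mimono \<gamma> (- v) = (-1) ^ mi_size \<gamma> * mimono \<gamma> v"
proof -
 have "mimono \<gamma> (- v) = (\<Prod>i\<in>UNIV. (-1) ^ \<gamma> i * (v $ i) ^ \<gamma> i)"
  unfolding mimono_def by (intro prod.cong refl) (simp add: power_minus[of "v $ _"])
 also have "... = (\<Prod>i\<in>UNIV. (-1) ^ \<gamma> i) * mimono \<gamma> v" by (simp add: prod.distrib mimono_def)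
 also have "(\<Prod>i\<in>UNIV. (-1 :: real) ^ \<gamma> i) = (-1) ^ mi_size \<gamma>" by (simp add: mi_size_def power_sum)
 finally show ?thesis .
qed

lemma kf_at_1: "kf G y 1 \<gamma> w = prodf G w * mimono \<gamma> (w - y)"
 by (simp add: kf_def kfac_def[abs_def] kern1_def prodf_def mimono_def prod.distrib)

text \<open>At t = 1 nothing is contracted and the path is the averaged polynomial itself. With the
  derivatives shifted by \<beta>, D^\<beta> of the polynomial for u becomes the polynomial for
  D^\<beta> u.\<close>

lemma (in taylor_path) avg_taylor_pathF:
 assumes "mi_size \<beta> <= m" and M: "M = m - mi_size \<beta>"
  and \<kappa>1: "!!\<gamma> w. mi_size \<gamma> < M ==> \<kappa> (%i. \<gamma> i + \<beta> i) w = W \<gamma> w"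
  and \<kappa>2: "!!\<gamma> w. mi_size \<gamma> = M ==> \<kappa> (%i. \<gamma> i + \<beta> i) w = c \<gamma> * indicator \<Omega> w"
 shows "avg_taylor m \<kappa> G \<beta> y = pathF y 1"
proof -
 let ?J = "%\<gamma>. (LBINT w. \<kappa> (%i. \<gamma> i + \<beta> i) w * (prodf G w * mimono \<gamma> (y - w)))"
 let ?J' = "%\<gamma>. (LBINT w. \<kappa> (%i. \<gamma> i + \<beta> i) w * kf G y 1 \<gamma> w)"
 have J: "?J \<gamma> = (-1) ^ mi_size \<gamma> * ?J' \<gamma>" for \<gamma> proof -
  have "mimono \<gamma> (y - w) = (-1) ^ mi_size \<gamma> * mimono \<gamma> (w - y)" for w using mimono_uminus[of \<gamma> "w - y"] by simp
  then have "?J \<gamma> = (LBINT w. (-1) ^ mi_size \<gamma> * (\<kappa> (%i. \<gamma> i + \<beta> i) w * kf G y 1 \<gamma> w))"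
   by (intro Bochner_Integration.integral_cong) (auto simp: kf_at_1)
  then show ?thesis by simp
 qed
 have "avg_taylor m \<kappa> G \<beta> y = (\<Sum>\<gamma> | mi_size \<gamma> <= M. (-1) ^ mi_size \<gamma> * ?J' \<gamma> / mi_fact \<gamma>)"
  by (simp add: avg_taylor_def M J)
 also have "{\<gamma> :: 'd => nat. mi_size \<gamma> <= M} = (\<Union>n\<in>{..M}. {\<gamma>. mi_size \<gamma> = n})" by auto
 also have "(\<Sum>\<gamma>\<in>(\<Union>n\<in>{..M}. {\<gamma>. mi_size \<gamma> = n}). (-1) ^ mi_size \<gamma> * ?J' \<gamma> / mi_fact \<gamma>)
   = (\<Sum>n\<le>M. \<Sum>\<gamma> | mi_size \<gamma> = n. (-1) ^ mi_size \<gamma> * ?J' \<gamma> / mi_fact \<gamma>)"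
  by (rule sum.UNION_disjoint) auto
 also have "... = (\<Sum>n\<le>M. (-1) ^ n * (\<Sum>\<gamma> | mi_size \<gamma> = n. ?J' \<gamma> / mi_fact \<gamma>))"
  by (simp add: sum_distrib_left)
 also have "... = (\<Sum>n<M. (-1) ^ n * (\<Sum>\<gamma> | mi_size \<gamma> = n. ?J' \<gamma> / mi_fact \<gamma>)) + (-1) ^ M * (\<Sum>\<gamma> | mi_size \<gamma> = M. ?J' \<gamma> / mi_fact \<gamma>)"
  by (simp add: lessThan_Suc_atMost[symmetric])
 also have "(\<Sum>\<gamma> | mi_size \<gamma> = M. ?J' \<gamma> / mi_fact \<gamma>) = pathC y 1" proof -
  have "?J' \<gamma> = c \<gamma> * (LBINT w. indicator \<Omega> w * kf G y 1 \<gamma> w)" if "mi_size \<gamma> = M" for \<gamma>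
   by (simp add: \<kappa>2[OF that] mult.assoc)
  then show ?thesis unfolding pathC_def by (intro sum.cong) auto
 qed
 also have "(\<Sum>n<M. (-1) ^ n * (\<Sum>\<gamma> | mi_size \<gamma> = n. ?J' \<gamma> / mi_fact \<gamma>)) = (\<Sum>n<M. (-1) ^ n * pathS y n 1)"
  unfolding pathS_def by (intro sum.cong refl arg_cong2[of _ _ _ _ "(*)"]) (simp add: \<kappa>1)
 finally show ?thesis unfolding pathF_def .
qed


text \<open>The constant of \<open>local_rep\<close> after all powers of h are taken out, times the
  constant from Hoelder's inequality on balls.\<close>

definition taylor_const :: "'d::finite itself => nat => real => real => real => real" where
 "taylor_const _ M p b R = (real M / (real M - real CARD('d) / p) + 4 * real M / real CARD('d))
   * b ^ CARD('d) * R powr (real M + real CARD('d) - real CARD('d) / p)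
   * (2 * unit_ball_vol (real CARD('d)) powr (1 - 1 / p))"

text \<open>\<open>local_rep\<close> for the family \<gamma> \<mapsto> W(\<gamma> + \<beta>). Its
  oscillation of order m - |\<beta>| consists of some of the terms of the oscillation of order m, so
  that a single bound \<open>N\<close> serves every \<beta>.\<close>

lemma local_taylor_estimate:
 fixes \<Omega> U A :: "(real^'d::finite) set" and a b :: "real^'d"
 assumes opn: "open \<Omega>" and bdd: "bounded \<Omega>"
  and Wi: "!!\<gamma>. mi_size \<gamma> <= m ==> integrable lborel (W \<gamma>)"
  and Wz: "!!\<gamma> w. mi_size \<gamma> <= m ==> w \<notin> \<Omega> ==> W \<gamma> w = 0"
  and Ww: "!!\<gamma> i. mi_size \<gamma> < m ==> weak_partial \<Omega> i (W \<gamma>) (W (mi_inc \<gamma> i))"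
  and sm: "!!i. smooth1 (G i)" and supp: "!!i s. s \<notin> {a $ i..b $ i} ==> G i s = 0"
  and G: "!!i s. \<bar>G i s\<bar> <= b0 / h" "(LBINT x. prodf G x) = 1"
  and h: "h > 0" "R > 0" and \<beta>: "mi_size \<beta> <= m"
  and p: "1 <= p" "p > 1 ==> real CARD('d) / p < real (m - mi_size \<beta>)" "p = 1 ==> CARD('d) <= m - mi_size \<beta>"
  and U: "open U" "U \<subseteq> \<Omega>" and A: "A \<in> sets borel"
  and sub: "!!y t. y \<in> U ==> t \<in> {0<..1} ==> cbox (y + t *\<^sub>R (a - y)) (y + t *\<^sub>R (b - y)) \<subseteq> \<Omega> \<inter> A"
  and R: "!!y. y \<in> U ==> cbox a b \<subseteq> cball y (R * h)"
  and N: "N >= 0" "(LNN w. ennreal ((indicator A w * (\<Sum>\<delta> | mi_size \<delta> = m. \<bar>W \<delta> w - k \<delta> * indicator \<Omega> w\<bar>)) powr p)) <= ennreal N"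
  and \<kappa>: "!!\<delta>. mi_size \<delta> < m ==> \<kappa> \<delta> = W \<delta>" "!!\<delta>. mi_size \<delta> = m ==> \<kappa> \<delta> = (%w. k \<delta> * indicator \<Omega> w)"
 shows "\<exists>v. continuous_on U v \<and> (AE y in lborel. y \<in> U --> v y = W \<beta> y) \<and>
  (\<forall>y\<in>U. \<bar>avg_taylor m \<kappa> G \<beta> y - v y\<bar>
    <= taylor_const TYPE('d) (m - mi_size \<beta>) p b0 R * h powr (real (m - mi_size \<beta>) - real CARD('d) / p) * N powr (1 / p))"
proof -
 define M where "M = m - mi_size \<beta>"
 let ?d = "real CARD('d)"
 define W' where "W' \<gamma> = W (%i. \<gamma> i + \<beta> i)" for \<gamma>
 define c' where "c' \<gamma> = k (%i. \<gamma> i + \<beta> i)" for \<gamma>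
 define D where "D w = indicator A w * (\<Sum>\<delta> | mi_size \<delta> = m. \<bar>W \<delta> w - k \<delta> * indicator \<Omega> w\<bar>)" for w
 interpret taylor_path \<Omega> W' M c' G a b proof
  fix \<gamma> :: "'d => nat" and i assume "mi_size \<gamma> < M"
  then have "weak_partial \<Omega> i (W (%i. \<gamma> i + \<beta> i)) (W (mi_inc (%i. \<gamma> i + \<beta> i) i))"
   by (intro Ww) (simp add: mi_size_add M_def)
  moreover have "mi_inc (%i. \<gamma> i + \<beta> i) i = (%j. mi_inc \<gamma> i j + \<beta> j)" by (auto simp: mi_inc_def)
  ultimately show "weak_partial \<Omega> i (W' \<gamma>) (W' (mi_inc \<gamma> i))" by (simp add: W'_def)
 qed (use opn bdd Wi Wz sm supp \<beta> in "auto simp: W'_def mi_size_add M_def")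
 have D0: "0 <= D w" for w unfolding D_def by (intro mult_nonneg_nonneg sum_nonneg) auto
 have Dm [measurable]: "D \<in> borel_measurable lborel" proof -
  have [measurable]: "W \<delta> \<in> borel_measurable borel" if "\<delta> \<in> {\<delta>. mi_size \<delta> = m}" for \<delta>
   using borel_measurable_integrable[OF Wi[of \<delta>]] that by simp
  have [measurable]: "\<Omega> \<in> sets borel" "A \<in> sets borel" using opn A by auto
  show ?thesis unfolding D_def[abs_def] by measurable
 qed
 have dD: "defect A w <= D w" for w proof -
  have inj: "inj_on (%\<gamma> i. \<gamma> i + \<beta> i) {\<gamma> :: 'd => nat. mi_size \<gamma> = M}" by (auto simp: inj_on_def fun_eq_iff)
  have "(\<Sum>\<gamma> | mi_size \<gamma> = M. \<bar>W' \<gamma> w - c' \<gamma> * indicator \<Omega> w\<bar>)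
    = (\<Sum>\<delta>\<in>(%\<gamma> i. \<gamma> i + \<beta> i) ` {\<gamma>. mi_size \<gamma> = M}. \<bar>W \<delta> w - k \<delta> * indicator \<Omega> w\<bar>)"
   by (simp add: sum.reindex[OF inj] W'_def c'_def)
  also have "... <= (\<Sum>\<delta> | mi_size \<delta> = m. \<bar>W \<delta> w - k \<delta> * indicator \<Omega> w\<bar>)"
   by (rule sum_mono2) (use \<beta> in "auto simp: mi_size_add M_def")
  finally show ?thesis unfolding defect_def D_def by (intro mult_left_mono) auto
 qed
 define vd where "vd = unit_ball_vol ?d"
 have vd: "vd > 0" by (simp add: vd_def unit_ball_vol_pos)
 define E where "E = 2 * vd powr (1 - 1 / p) * N powr (1 / p)"
 have E0: "E >= 0" by (simp add: E_def)
 \<comment> \<open>Hoelder's inequality on a ball of radius r: its volume to the power 1 - 1/p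
   contributes r^(d - d/p).\<close>
 have est: "(LBINT w. defect A w * indicator (cball y r) w) <= E * r powr (?d - ?d / p)" if r: "r > 0" for y r proof -
  have "ennreal (LBINT w. defect A w * indicator (cball y r) w) = (LNN w. ennreal (defect A w * indicator (cball y r) w))"
   by (rule nn_integral_eq_integral[symmetric])
     (auto intro!: integrable_real_mult_indicator defect_int A simp: defect_nonneg)
  also have "... <= (LNN w. ennreal (indicator (cball y r) w * D w))"
   by (intro nn_integral_mono ennreal_leI) (use dD in "auto simp: indicator_def")
  also have "... <= ennreal (2 * (vd * r ^ CARD('d)) powr (1 - 1 / p) * N powr (1 / p))" proof (rule weighted_hoelder)
   have "(LNN w. ennreal (indicator (cball y r) w)) = emeasure lborel (cball y r)" by (simp add: ennreal_indicator)
   also have "... = ennreal (vd * r ^ CARD('d))" using r by (simp add: emeasure_cball vd_def)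
   finally show "(LNN w. ennreal (indicator (cball y r) w)) <= ennreal (vd * r ^ CARD('d))" by simp
   have "(LNN w. ennreal (indicator (cball y r) w * D w powr p)) <= (LNN w. ennreal (D w powr p))"
    by (intro nn_integral_mono ennreal_leI) (auto simp: indicator_def)
   also have "... <= ennreal N" using N(2) unfolding D_def .
   finally show "(LNN w. ennreal (indicator (cball y r) w * D w powr p)) <= ennreal N" .
  qed (use D0 p vd r N Dm in "auto intro!: borel_measurable_indicator")
  also have "2 * (vd * r ^ CARD('d)) powr (1 - 1 / p) * N powr (1 / p) = E * r powr (?d - ?d / p)" proof -
   have "(r ^ CARD('d)) powr (1 - 1 / p) = r powr (?d - ?d / p)" using r by (simp add: powr_realpow[symmetric] powr_powr right_diff_distrib)
   then show ?thesis using vd r by (simp add: E_def powr_mult)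
  qed
  finally show ?thesis using E0 by (subst (asm) ennreal_le_iff) auto
 qed
 have "\<exists>v. continuous_on U v \<and> (AE y in lborel. y \<in> U --> v y = W' (%_. 0) y) \<and>
  (\<forall>y\<in>U. \<bar>pathF y 1 - v y\<bar> <= (real M / (real M - ?d / p) + 4 * real M / ?d)
    * (b0 / h) ^ CARD('d) * (R * h) powr (real M + ?d - ?d / p) * E)"
  by (rule local_rep[OF U A sub _ R G p(1) p(2,3)[folded M_def] E0 est]) (use h in auto)
 moreover have "(real M / (real M - ?d / p) + 4 * real M / ?d)
    * (b0 / h) ^ CARD('d) * (R * h) powr (real M + ?d - ?d / p) * E
   = taylor_const TYPE('d) M p b0 R * h powr (real M - ?d / p) * N powr (1 / p)" proof -
  have "real M + ?d - ?d / p = (real M - ?d / p) + ?d" by simp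
  then have "h powr (real M + ?d - ?d / p) = h powr (real M - ?d / p) * h ^ CARD('d)" using h by (simp only: powr_add powr_realpow)
  then have "(b0 / h) ^ CARD('d) * (R * h) powr (real M + ?d - ?d / p)
    = b0 ^ CARD('d) * (R powr (real M + ?d - ?d / p) * h powr (real M - ?d / p))" using h by (simp add: powr_mult power_divide)
  then show ?thesis unfolding taylor_const_def E_def vd_def by (simp add: mult_ac) (simp only: mult_ac)?
 qed
 moreover have "avg_taylor m \<kappa> G \<beta> y = pathF y 1" for y
  by (rule avg_taylor_pathF[OF \<beta> M_def]) (use \<beta> in "auto simp: \<kappa> mi_size_add M_def W'_def c'_def")
 ultimately show ?thesis by (simp add: W'_def M_def)
qed

text \<open>The averaging ball sits at distance of order \<open>h\<close> from \<open>x\<close> inside the uniform cone, so that it is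
  visible in \<open>\<Omega>\<close> from every point near \<open>x\<close>.\<close>

lemma star_shaped_box:
 fixes \<Omega> :: "(real^'d::finite) set"
 assumes cone: "!!y v t. y \<in> \<Omega> \<inter> ball x \<tau> ==> norm (v - n) <= \<epsilon> ==> t \<in> {0..\<tau>} ==> y + t *\<^sub>R v \<in> \<Omega>"
  and n: "norm n = 1" and x: "x \<in> \<Omega>" and \<epsilon>: "0 < \<epsilon>" "\<epsilon> <= 1" and L: "L > 0" and h: "h > 0" "(L + 2) / \<epsilon> * h <= \<tau>"
 defines "K \<equiv> (L + 2) / \<epsilon>" and "e \<equiv> (\<chi> i. h / real CARD('d)) :: real^'d"
 defines "c \<equiv> x + (K * h) *\<^sub>R n" and "U \<equiv> \<Omega> \<inter> ball x ((L + 1) * h)"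
 shows "!!y t. y \<in> U ==> t \<in> {0<..1} ==>
    cbox (y + t *\<^sub>R ((c - e) - y)) (y + t *\<^sub>R ((c + e) - y)) \<subseteq> \<Omega> \<inter> cball x ((K + L + 2) * h)"
  and "!!y. y \<in> U ==> cbox (c - e) (c + e) \<subseteq> cball y ((K + L + 2) * h)"
  and "cbox (c - e) (c + e) \<subseteq> \<Omega> \<inter> cball x ((K + L + 2) * h)"
proof -
 \<comment> \<open>Why K = (L + 2)/\<epsilon>: for y in \<open>U\<close> and w in the box, (w -
   y)/(Kh) differs from n by at most (h + (L + 1)h)/(Kh) = \<epsilon>, so the cone at y contains the
   segment to w.\<close>
 have K: "K > 0" "K * \<epsilon> = L + 2" using L \<epsilon> by (auto simp: K_def)
 moreover have "K * \<epsilon> <= K" using K(1) \<epsilon> by (intro mult_left_le) auto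
 ultimately have K: "K > 0" "K * \<epsilon> = L + 2" "L + 2 <= K" by auto
 have box: "norm (w - c) <= h" if "w \<in> cbox (c - e) (c + e)" for w proof -
  have "\<bar>(w - c) $ i\<bar> <= h / real CARD('d)" for i using that[unfolded mem_box_cart, rule_format, of i] by (auto simp: e_def)
  then have "(\<Sum>i\<in>UNIV. \<bar>(w - c) $ i\<bar>) <= (\<Sum>i\<in>(UNIV :: 'd set). h / real CARD('d))" by (intro sum_mono) auto
  then show ?thesis using norm_le_l1_cart[of "w - c"] by simp
 qed
 have c: "norm (c - x) = K * h" using n K h by (simp add: c_def)
 show R: "cbox (c - e) (c + e) \<subseteq> cball y ((K + L + 2) * h)" if "y \<in> U" for y proof
  fix w assume "w \<in> cbox (c - e) (c + e)"
  from box[OF this] have "norm (w - c) <= h" .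
  moreover have "norm (x - y) <= (L + 1) * h" using that by (simp add: U_def dist_norm)
  ultimately have "norm ((w - c) + (c - x) + (x - y)) <= h + K * h + (L + 1) * h"
   using c by (intro order_trans[OF norm_triangle_ineq] add_mono) auto
  then show "w \<in> cball y ((K + L + 2) * h)" by (simp add: dist_norm norm_minus_commute algebra_simps)
 qed
 have seg: "y + t *\<^sub>R (w - y) \<in> \<Omega>" if y: "y \<in> U" and w: "w \<in> cbox (c - e) (c + e)" and t: "t \<in> {0..1}" for y w t
 proof -
  define v where "v = (1 / (K * h)) *\<^sub>R (w - y)"
  have Kh: "K * h > 0" using K h by simp
  have "v - n = (1 / (K * h)) *\<^sub>R ((w - c) + (x - y))" using K(1) h(1) by (simp add: v_def c_def algebra_simps)
  moreover have "norm ((w - c) + (x - y)) <= h + (L + 1) * h"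
   using box[OF w] y by (intro order_trans[OF norm_triangle_ineq] add_mono) (auto simp: U_def dist_norm)
  ultimately have "norm (v - n) <= (h + (L + 1) * h) / (K * h)" using Kh by (simp add: divide_right_mono)
  also have "h + (L + 1) * h = (L + 2) * h" by (simp add: algebra_simps)
  also have "(L + 2) * h / (K * h) = (L + 2) / K" using h(1) by simp
  also have "... = \<epsilon>" using K by (simp add: field_simps)
  finally have v: "norm (v - n) <= \<epsilon>" .
  have "y \<in> \<Omega> \<inter> ball x \<tau>" proof -
   have "(L + 1) * h <= K * h" using K h by (intro mult_right_mono) auto
   also have "... <= \<tau>" using h by (simp add: K_def)
   finally show ?thesis using y by (auto simp: U_def)
  qed
  moreover have "t * (K * h) \<in> {0..\<tau>}" proof -
   have "t * (K * h) <= 1 * (K * h)" using t Kh by (intro mult_right_mono) auto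
   moreover have "0 <= t * (K * h)" using t by (intro mult_nonneg_nonneg less_imp_le[OF Kh]) auto
   moreover have "K * h <= \<tau>" using h by (simp add: K_def)
   ultimately show ?thesis by simp
  qed
  ultimately have "y + (t * (K * h)) *\<^sub>R v \<in> \<Omega>" using cone v by blast
  moreover have "(t * (K * h)) *\<^sub>R v = t *\<^sub>R (w - y)" using K(1) h(1) by (simp add: v_def)
  ultimately show ?thesis by simp
 qed
 have xU: "x \<in> U" using x L h by (simp add: U_def)
 show "cbox (c - e) (c + e) \<subseteq> \<Omega> \<inter> cball x ((K + L + 2) * h)" using seg[OF xU, of _ 1] R[OF xU] by fastforce
 show "cbox (y + t *\<^sub>R ((c - e) - y)) (y + t *\<^sub>R ((c + e) - y)) \<subseteq> \<Omega> \<inter> cball x ((K + L + 2) * h)"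
  if y: "y \<in> U" and t: "t \<in> {0<..1}" for y t proof
  fix z assume z: "z \<in> cbox (y + t *\<^sub>R ((c - e) - y)) (y + t *\<^sub>R ((c + e) - y))"
  define w where "w = y + (1 / t) *\<^sub>R (z - y)"
  have zw: "z = y + t *\<^sub>R (w - y)" using t by (simp add: w_def)
  have w: "w \<in> cbox (c - e) (c + e)" unfolding mem_box_cart proof
   fix i
   have "y $ i + t * (c $ i - e $ i - y $ i) <= z $ i" "z $ i <= y $ i + t * (c $ i + e $ i - y $ i)"
    using z[unfolded mem_box_cart, rule_format, of i] by auto
   moreover have "z $ i = y $ i + t * (w $ i - y $ i)" by (subst zw) simp
   ultimately have "t * (c $ i - e $ i - y $ i) <= t * (w $ i - y $ i)" "t * (w $ i - y $ i) <= t * (c $ i + e $ i - y $ i)" by auto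
   then show "(c - e) $ i <= w $ i \<and> w $ i <= (c + e) $ i" using t by simp
  qed
  have "z \<in> \<Omega>" unfolding zw by (rule seg[OF y w]) (use t in auto)
  moreover have "z \<in> cball x ((K + L + 2) * h)" proof -
   have "w \<in> cball x ((K + L + 2) * h)" using R[OF xU] w by blast
   moreover have "y \<in> cball x ((K + L + 2) * h)" proof -
    have "(L + 1) * h <= (K + L + 2) * h" using K h by (intro mult_right_mono) auto
    then show ?thesis using y by (auto simp: U_def)
   qed
   ultimately have "(1 - t) *\<^sub>R y + t *\<^sub>R w \<in> cball x ((K + L + 2) * h)" by (intro convexD[OF convex_cball]) (use t in auto)
   then show ?thesis unfolding zw by (simp add: algebra_simps)
  qed
  ultimately show "z \<in> \<Omega> \<inter> cball x ((K + L + 2) * h)" by simp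
 qed
qed


section \<open>Sobolev norms through Borel representatives, and oscillation at scale h\<close>

lemma ennreal_powr_ennreal: "0 <= t ==> ennreal_powr (ennreal t) a = ennreal (t powr a)" by (simp add: ennreal_powr_def)

lemma ennreal_powr_lt_top: "ennreal_powr x a < \<infinity> \<longleftrightarrow> x < \<infinity>" by (auto simp: ennreal_powr_def less_top)

lemma ennreal_powr_cancel: "a > 0 ==> ennreal_powr (ennreal_powr x (1 / a)) a = x" by (cases x) (auto simp: ennreal_powr_def powr_powr)

lemma ennreal_powr_mono: "a >= 0 ==> x <= y ==> ennreal_powr x a <= ennreal_powr y a"
 by (cases x; cases y) (auto simp: ennreal_powr_def powr_mono2 top_unique intro!: ennreal_leI)

lemma nn_integral_lebesgue_on:
 assumes "open \<Omega>" "AE x in lebesgue. x \<in> \<Omega> --> F x = H x"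
 shows "(\<integral>\<^sup>+x. F x \<partial>lebesgue_on \<Omega>) = (LNN x. H x * indicator \<Omega> x)"
proof -
 have "(\<integral>\<^sup>+x. F x \<partial>lebesgue_on \<Omega>) = (\<integral>\<^sup>+x. F x * indicator \<Omega> x \<partial>lebesgue)"
  using assms(1) by (intro nn_integral_restrict_space) auto
 also have "... = (\<integral>\<^sup>+x. H x * indicator \<Omega> x \<partial>lebesgue)"
  by (rule nn_integral_cong_AE) (use assms(2) in "eventually_elim, auto simp: indicator_def")
 finally show ?thesis by (simp add: nn_integral_completion)
qed

definition sobolev_reps ::
 "(real^'d::finite) set => nat => (real^'d => real) => (('d => nat) => real^'d => real) => bool" where
 "sobolev_reps \<Omega> m u W \<longleftrightarrow> (\<forall>\<gamma>. mi_size \<gamma> <= m -->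
   has_weak_deriv \<Omega> \<gamma> u (weak_deriv \<Omega> \<gamma> u) \<and> borel_rep \<Omega> (weak_deriv \<Omega> \<gamma> u) (W \<gamma>) \<and> integrable lborel (W \<gamma>))"

lemma sobolev_reps_zero: "sobolev_reps \<Omega> m u W ==> mi_size \<gamma> <= m ==> w \<notin> \<Omega> ==> W \<gamma> w = 0"
 by (simp add: sobolev_reps_def borel_rep_def)

lemma sobolev_reps_weak:
 assumes "open \<Omega>" "sobolev_reps \<Omega> m u W" "mi_size \<gamma> < m"
 shows "weak_partial \<Omega> i (W \<gamma>) (W (mi_inc \<gamma> i))"
 by (rule weak_partial_rep[OF assms(1), where \<beta> = \<gamma> and u = u and g = "weak_deriv \<Omega> \<gamma> u" and g' = "weak_deriv \<Omega> (mi_inc \<gamma> i) u"])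
   (use assms(2,3) in "auto simp: sobolev_reps_def")

text \<open>On a bounded set a finite p-norm implies integrability, by t <= 1 + t^p; the path
  argument needs integrable representatives.\<close>

lemma sobolev_reps_exist:
 fixes \<Omega> :: "(real^'d::finite) set"
 assumes opn: "open \<Omega>" and bdd: "bounded \<Omega>" and p: "1 <= p" and fin: "sobolev_norm \<Omega> m (ennreal p) u < \<infinity>"
 shows "\<exists>W. sobolev_reps \<Omega> m u W \<and>
  (\<Sum>\<beta> | mi_size \<beta> <= m. \<integral>\<^sup>+w. ennreal (\<bar>W \<beta> w\<bar> powr p) \<partial>lborel) = ennreal_powr (sobolev_norm \<Omega> m (ennreal p) u) p"
proof -
 have ex: "\<exists>g. has_weak_deriv \<Omega> \<beta> u g" if "mi_size \<beta> <= m" for \<beta>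
  using fin that by (auto simp: sobolev_norm_def split: if_splits)
 have wd: "has_weak_deriv \<Omega> \<beta> u (weak_deriv \<Omega> \<beta> u)" if "mi_size \<beta> <= m" for \<beta>
  unfolding weak_deriv_def by (rule someI_ex[OF ex[OF that]])
 have "\<exists>W. \<forall>\<beta>. mi_size \<beta> <= m --> borel_rep \<Omega> (weak_deriv \<Omega> \<beta> u) (W \<beta>)"
  using borel_rep_exists[OF opn] wd unfolding has_weak_deriv_def by (intro choice) blast
 then obtain W where W: "!!\<beta>. mi_size \<beta> <= m ==> borel_rep \<Omega> (weak_deriv \<Omega> \<beta> u) (W \<beta>)" by blast
 let ?I = "%\<beta>. \<integral>\<^sup>+w. ennreal (\<bar>W \<beta> w\<bar> powr p) \<partial>lborel"
 have Lp: "(\<integral>\<^sup>+x. ennreal (\<bar>weak_deriv \<Omega> \<beta> u x\<bar> powr p) \<partial>lebesgue_on \<Omega>) = ?I \<beta>"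
  if \<beta>: "mi_size \<beta> <= m" for \<beta> proof -
  have "(\<integral>\<^sup>+x. ennreal (\<bar>weak_deriv \<Omega> \<beta> u x\<bar> powr p) \<partial>lebesgue_on \<Omega>) = (LNN x. ennreal (\<bar>W \<beta> x\<bar> powr p) * indicator \<Omega> x)"
  proof (rule nn_integral_lebesgue_on[OF opn])
   have "AE x in lebesgue. x \<in> \<Omega> --> W \<beta> x = weak_deriv \<Omega> \<beta> u x" using W[OF \<beta>] by (simp add: borel_rep_def)
   then show "AE x in lebesgue. x \<in> \<Omega> --> ennreal (\<bar>weak_deriv \<Omega> \<beta> u x\<bar> powr p) = ennreal (\<bar>W \<beta> x\<bar> powr p)"
    by eventually_elim auto
  qed
  also have "... = ?I \<beta>" by (rule nn_integral_cong) (use W[OF \<beta>] p in "auto simp: borel_rep_def indicator_def")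
  finally show ?thesis .
 qed
 have norm: "ennreal_powr (sobolev_norm \<Omega> m (ennreal p) u) p = (\<Sum>\<beta> | mi_size \<beta> <= m. ?I \<beta>)"
  using p ex by (auto simp: sobolev_norm_def Lp_norm_def ennreal_powr_cancel Lp intro!: sum.cong)
 have "integrable lborel (W \<beta>)" if \<beta>: "mi_size \<beta> <= m" for \<beta> proof (rule integrableI_bounded)
  have [measurable]: "W \<beta> \<in> borel_measurable borel" using W[OF \<beta>] by (simp add: borel_rep_def)
  have [measurable]: "\<Omega> \<in> sets borel" using opn by simp
  show "W \<beta> \<in> borel_measurable lborel" by simp
  have "(LNN w. ennreal (norm (W \<beta> w))) <= (LNN w. indicator \<Omega> w + ennreal (\<bar>W \<beta> w\<bar> powr p))"
  proof (rule nn_integral_mono)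
   fix w
   show "ennreal (norm (W \<beta> w)) <= indicator \<Omega> w + ennreal (\<bar>W \<beta> w\<bar> powr p)" proof (cases "w \<in> \<Omega>")
    case True
    have "\<bar>W \<beta> w\<bar> <= 1 + \<bar>W \<beta> w\<bar> powr p" using powr_pointwise[of "\<bar>W \<beta> w\<bar>" 1 p] p by simp
    then have "ennreal \<bar>W \<beta> w\<bar> <= ennreal (1 + \<bar>W \<beta> w\<bar> powr p)" by (rule ennreal_leI)
    then show ?thesis using True by (simp add: ennreal_plus)
   qed (use W[OF \<beta>] in "auto simp: borel_rep_def")
  qed
  also have "... = emeasure lborel \<Omega> + ?I \<beta>" by (simp add: nn_integral_add)
  also have "... < \<infinity>" proof -
   have "?I \<beta> <= ennreal_powr (sobolev_norm \<Omega> m (ennreal p) u) p" unfolding norm by (rule member_le_sum) (use \<beta> in auto)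
   also have "... < \<infinity>" using fin unfolding ennreal_powr_lt_top .
   finally show ?thesis using emeasure_bounded_finite[OF bdd] by (simp add: less_top)
  qed
  finally show "(LNN w. ennreal (norm (W \<beta> w))) < \<infinity>" .
 qed
 then have "sobolev_reps \<Omega> m u W" using wd W by (simp add: sobolev_reps_def)
 then show ?thesis using norm by (intro exI[of _ W]) simp
qed

lemma frac_seminorm_reps:
 fixes \<Omega> :: "(real^'d::finite) set"
 assumes opn: "open \<Omega>" and p: "1 <= p" and W: "sobolev_reps \<Omega> m u W"
 shows "ennreal_powr (frac_sobolev_seminorm \<Omega> m s p u) p = (\<Sum>\<beta> | mi_size \<beta> = m. \<integral>\<^sup>+y. indicator \<Omega> y *
   (LNN x. ennreal (\<bar>W \<beta> x - W \<beta> y\<bar> powr p / norm (x - y) powr (real CARD('d) + p * s)) * indicator \<Omega> x) \<partial>lborel)"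
 unfolding frac_sobolev_seminorm_def using p
proof (subst ennreal_powr_cancel, simp, intro sum.cong refl)
 fix \<beta> :: "'d => nat" assume "\<beta> \<in> {\<beta>. mi_size \<beta> = m}"
 then have ae: "AE x in lebesgue. x \<in> \<Omega> --> W \<beta> x = weak_deriv \<Omega> \<beta> u x" using W by (auto simp: sobolev_reps_def borel_rep_def)
 let ?g = "weak_deriv \<Omega> \<beta> u" and ?e = "real CARD('d) + p * s"
 let ?I = "%y. \<integral>\<^sup>+x. ennreal (\<bar>W \<beta> x - W \<beta> y\<bar> powr p / norm (x - y) powr ?e) * indicator \<Omega> x \<partial>lborel"
 let ?G = "%y. \<integral>\<^sup>+x. ennreal (\<bar>?g x - ?g y\<bar> powr p / norm (x - y) powr ?e) \<partial>lebesgue_on \<Omega>"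
 have "(\<integral>\<^sup>+y. ?G y \<partial>lebesgue_on \<Omega>)
   = (LNN y. ?I y * indicator \<Omega> y)" proof (rule nn_integral_lebesgue_on[OF opn])
  show "AE y in lebesgue. y \<in> \<Omega> --> ?G y = ?I y" using ae proof eventually_elim
   case (elim y)
   show ?case proof
    assume y: "y \<in> \<Omega>"
    show "?G y = ?I y" by (rule nn_integral_lebesgue_on[OF opn]) (use ae in "eventually_elim, use elim y in auto")
   qed
  qed
 qed
 then show "(\<integral>\<^sup>+y. ?G y \<partial>lebesgue_on \<Omega>)
   = (LNN y. indicator \<Omega> y * ?I y)" by (simp add: mult.commute)
qed

lemma sum_powr_le:
 fixes f :: "'b => real"
 assumes S: "finite S" and nn: "!!x. x \<in> S ==> 0 <= f x" and p: "p >= 1"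
 shows "(\<Sum>x\<in>S. f x) powr p <= real (card S) powr p * (\<Sum>x\<in>S. f x powr p)"
proof (cases "S = {}")
 case False
 have "Max (f ` S) \<in> f ` S" using S False by (intro Max_in) auto
 then obtain z where z: "z \<in> S" "f z = Max (f ` S)" by (metis imageE)
 have "(\<Sum>x\<in>S. f x) <= (\<Sum>x\<in>S. f z)" using S by (intro sum_mono) (simp add: z)
 then have "(\<Sum>x\<in>S. f x) powr p <= (real (card S) * f z) powr p" using p nn by (intro powr_mono2) (auto intro: sum_nonneg)
 also have "... = real (card S) powr p * f z powr p" using nn[OF z(1)] by (simp add: powr_mult)
 also have "... <= real (card S) powr p * (\<Sum>x\<in>S. f x powr p)" using S z(1) by (intro mult_left_mono member_le_sum) auto
 finally show ?thesis .
qed (use p in simp)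

text \<open>The bump has mass 1, so f(w) minus the mean is an average of f(w) - f(y). Since |y - w|
  <= 2Rh, dividing and multiplying by |y - w|^(d + ps) brings in the inner integral of the seminorm;
  of the resulting power of h, the part h^d cancels against the height (\<open>b0\<close>/h)^d of
  the bump.\<close>

lemma fractional_oscillation:
 fixes \<Omega> A :: "(real^'d::finite) set" and f :: "real^'d => real"
 assumes opn: "open \<Omega>" and f: "integrable lborel f" and p: "1 <= p" and s: "0 <= s"
  and sm: "!!i. smooth1 (G i)" and supp: "!!i s. s \<notin> {a $ i..b $ i} ==> G i s = 0"
  and G: "!!i s. 0 <= G i s \<and> G i s <= b0 / h" "(LBINT x. prodf G x) = 1"
  and h: "h > 0" "R > 0" and box: "cbox a b \<subseteq> \<Omega> \<inter> cball x (R * h)" and w: "w \<in> cball x (R * h)" "w \<in> \<Omega>"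
  and \<Phi>: "(LNN y. ennreal (\<bar>f y - f w\<bar> powr p / norm (y - w) powr (real CARD('d) + p * s)) * indicator \<Omega> y) <= ennreal \<Phi>" "\<Phi> >= 0"
 shows "\<bar>f w - (LBINT y. prodf G y * f y)\<bar> powr p
   <= 2 powr p * (b0 ^ CARD('d) * (2 * R) powr (real CARD('d) + p * s)) * h powr (p * s) * \<Phi>"
proof -
 let ?q = "%y. \<bar>f y - f w\<bar> powr p / norm (y - w) powr (real CARD('d) + p * s)"
 let ?d = "real CARD('d)" and ?n = "prodf G"
 let ?e = "?d + p * s"
 have [measurable]: "f \<in> borel_measurable borel" using borel_measurable_integrable[OF f] by simp
 have nm [measurable]: "?n \<in> borel_measurable borel" by (rule prodf_measurable[of G]) (rule sm)
 have n0: "0 <= ?n y" for y unfolding prodf_def by (intro prod_nonneg) (use G in auto)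
 have nb: "?n y <= (b0 / h) ^ CARD('d)" for y proof -
  have "?n y <= (\<Prod>i\<in>(UNIV :: 'd set). b0 / h)" unfolding prodf_def by (intro prod_mono) (use G in auto)
  then show ?thesis by simp
 qed
 have b0: "b0 >= 0" using G(1)[of undefined 0] h by (metis order_trans zero_le_divide_iff less_le_not_le)
 have nz: "?n y = 0" if "y \<notin> cbox a b" for y by (rule prodf_zero_outside[of a b]) (use supp that in auto)
 have ni: "integrable lborel ?n" proof (rule ccontr)
  assume "\<not> integrable lborel ?n"
  then have "(LBINT x. ?n x) = 0" by (rule not_integrable_integral_eq)
  then show False using G(2) by simp
 qed
 have nfi: "integrable lborel (%y. ?n y * f y)" by (rule Bochner_Integration.integrable_bound[where f = "%y. (b0 / h) ^ CARD('d) * f y"])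
    (use f n0 nb in "auto simp: abs_mult intro!: AE_I2 mult_mono order_trans[OF nb abs_ge_self]")
 have "f w - (LBINT y. ?n y * f y) = (LBINT y. ?n y * f w - ?n y * f y)" using ni nfi G(2) by simp
 also have "\<bar>...\<bar> <= (LBINT y. \<bar>?n y * f w - ?n y * f y\<bar>)" by (rule integral_abs_bound)
 also have "... = (LBINT y. ?n y * \<bar>f y - f w\<bar>)"
  by (intro Bochner_Integration.integral_cong) (use n0 in "auto simp: right_diff_distrib[symmetric] abs_mult abs_minus_commute")
 finally have le: "\<bar>f w - (LBINT y. ?n y * f y)\<bar> <= (LBINT y. ?n y * \<bar>f y - f w\<bar>)" .
 have i: "integrable lborel (%y. ?n y * \<bar>f y - f w\<bar>)" proof -
  have "integrable lborel (%y. \<bar>?n y * f y - ?n y * f w\<bar>)" using ni nfi by (intro integrable_abs Bochner_Integration.integrable_diff) auto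
  then show ?thesis by (simp add: right_diff_distrib[symmetric] abs_mult n0)
 qed
 define C where "C = (b0 / h) ^ CARD('d) * (2 * R * h) powr ?e"
 have C: "C >= 0" using b0 h by (simp add: C_def)
 have N: "(LNN y. ennreal (?n y * \<bar>f y - f w\<bar> powr p)) <= ennreal (C * \<Phi>)" proof -
  have "(LNN y. ennreal (?n y * \<bar>f y - f w\<bar> powr p))
    <= (LNN y. ennreal C * (ennreal (?q y) * indicator \<Omega> y))" proof (rule nn_integral_mono)
   fix y
   show "ennreal (?n y * \<bar>f y - f w\<bar> powr p) <= ennreal C * (ennreal (?q y) * indicator \<Omega> y)"
   proof (cases "y \<in> cbox a b \<and> y ~= w")
    case True
    then have y: "y \<in> \<Omega>" "y \<in> cball x (R * h)" "norm (y - w) > 0" using box by auto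
    have "norm (y - w) <= 2 * R * h" using y(2) w(1) dist_triangle[of y w x] by (simp add: dist_norm[symmetric] dist_commute)
    then have "norm (y - w) powr ?e <= (2 * R * h) powr ?e" using p s by (intro powr_mono2) auto
    then have "?n y * norm (y - w) powr ?e <= C" unfolding C_def by (intro mult_mono nb) (use b0 h in auto)
    then have "?n y * norm (y - w) powr ?e * (?q y) <= C * (?q y)" by (intro mult_right_mono) auto
    then have "?n y * \<bar>f y - f w\<bar> powr p <= C * (?q y)" using y(3) by simp
    then show ?thesis using y(1) C by (simp add: ennreal_mult[symmetric] ennreal_leI)
   qed (use nz p in auto)
  qed
  also have "... = ennreal C * (LNN y. ennreal (?q y) * indicator \<Omega> y)" using opn by (intro nn_integral_cmult) measurable
  also have "... <= ennreal C * ennreal \<Phi>" using \<Phi> by (intro mult_left_mono) auto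
  finally show ?thesis using C \<Phi> by (simp add: ennreal_mult)
 qed
 have "ennreal (LBINT y. ?n y * \<bar>f y - f w\<bar>) = (LNN y. ennreal (?n y * \<bar>f y - f w\<bar>))"
  by (rule nn_integral_eq_integral[symmetric]) (use i n0 in auto)
 also have "... <= ennreal (2 * 1 powr (1 - 1 / p) * (C * \<Phi>) powr (1 / p))" proof (rule weighted_hoelder[OF _ _ _ _ p _ _ _ N])
  show "(LNN y. ennreal (?n y)) <= ennreal 1" using nn_integral_eq_integral[OF ni] n0 G(2) by simp
 qed (use n0 C \<Phi> in auto)
 finally have "(LBINT y. ?n y * \<bar>f y - f w\<bar>) <= 2 * (C * \<Phi>) powr (1 / p)" by (subst (asm) ennreal_le_iff) auto
 with le have "\<bar>f w - (LBINT y. ?n y * f y)\<bar> powr p <= (2 * (C * \<Phi>) powr (1 / p)) powr p" using p by (intro powr_mono2) auto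
 also have "... = 2 powr p * (C * \<Phi>)" using p C \<Phi> by (simp add: powr_mult powr_powr)
 also have "C = b0 ^ CARD('d) * (2 * R) powr ?e * h powr (p * s)" proof -
  have "(2 * R * h) powr ?e = (2 * R) powr ?e * (h ^ CARD('d) * h powr (p * s))" using h by (simp add: powr_mult powr_add powr_realpow)
  then show ?thesis using h by (simp add: C_def power_divide)
 qed
 finally show ?thesis by (simp add: mult_ac)
qed


definition bump_on :: "(real^'d::finite) set => real => ('d => real => real) => real^'d => real^'d => bool" where
 "bump_on S B G a b \<longleftrightarrow> (\<forall>i. smooth1 (G i)) \<and> (\<forall>i s. s \<notin> {a $ i..b $ i} --> G i s = 0) \<and>
   (\<forall>i s. 0 <= G i s \<and> G i s <= B) \<and> (LBINT x. prodf G x) = 1 \<and> cbox a b \<subseteq> S"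

text \<open>\<open>\<Psi>\<close> dominates, up to powers of \<open>h\<close>, the oscillation of the derivatives of order \<open>m\<close> at scale \<open>h\<close>.\<close>

definition oscillation_majorant ::
 "(real^'d::finite) set => nat => real => real => real => real => real => (('d => nat) => real^'d => real) => (real^'d => ennreal) => bool" where
 "oscillation_majorant \<Omega> m p s R b0 C W \<Psi> \<longleftrightarrow> \<Psi> \<in> borel_measurable borel \<and>
   (\<forall>h>0. \<forall>x a b G. bump_on (\<Omega> \<inter> cball x (R * h)) (b0 / h) G a b --> (\<exists>k.
    (LNN w. ennreal ((indicator (cball x (R * h)) w * (\<Sum>\<delta> | mi_size \<delta> = m. \<bar>W \<delta> w - k \<delta> * indicator \<Omega> w\<bar>)) powr p))
     <= ennreal (C * h powr (p * s)) * (LNN w. \<Psi> w * indicator (cball x (R * h)) w)))"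

lemma sobolev_reps_measurable: "sobolev_reps \<Omega> m u W ==> mi_size \<gamma> <= m ==> W \<gamma> \<in> borel_measurable borel"
 by (simp add: sobolev_reps_def borel_rep_def)

text \<open>For s = 0 the oscillation is not small, so the constants are 0 and the derivatives of
  order m themselves supply the density.\<close>

lemma oscillation_majorant_integer:
 fixes \<Omega> :: "(real^'d::finite) set"
 assumes p: "1 <= p" and W: "sobolev_reps \<Omega> m u W"
 shows "oscillation_majorant \<Omega> m p 0 R b0 (real (card {\<delta> :: 'd => nat. mi_size \<delta> = m}) powr p) W
  (%w. \<Sum>\<delta> | mi_size \<delta> = m. ennreal (\<bar>W \<delta> w\<bar> powr p))" unfolding oscillation_majorant_def
proof (intro conjI allI impI)
 have [measurable]: "W \<delta> \<in> borel_measurable borel" if "\<delta> \<in> {\<delta>. mi_size \<delta> = m}" for \<delta>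
  using sobolev_reps_measurable[OF W] that by simp
 show [measurable]: "(%w. \<Sum>\<delta> | mi_size \<delta> = m. ennreal (\<bar>W \<delta> w\<bar> powr p)) \<in> borel_measurable borel" by measurable
 fix h :: real and x a b :: "real^'d" and G assume h: "h > 0"
 have [measurable]: "cball x (R * h) \<in> sets borel" by simp
 let ?P = "%w. \<Sum>\<delta> | mi_size \<delta> = m. ennreal (\<bar>W \<delta> w\<bar> powr p)" and ?A = "cball x (R * h)" and ?S = "{\<delta> :: 'd => nat. mi_size \<delta> = m}"
 have "(LNN w. ennreal ((indicator ?A w * (\<Sum>\<delta>\<in>?S. \<bar>W \<delta> w\<bar>)) powr p))
   <= (LNN w. ennreal (real (card ?S) powr p) * (?P w * indicator ?A w))" proof (rule nn_integral_mono)
  fix w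
  have "ennreal ((\<Sum>\<delta>\<in>?S. \<bar>W \<delta> w\<bar>) powr p) <= ennreal (real (card ?S) powr p * (\<Sum>\<delta>\<in>?S. \<bar>W \<delta> w\<bar> powr p))"
   by (intro ennreal_leI sum_powr_le p) auto
  also have "... = ennreal (real (card ?S) powr p) * ?P w" by (simp add: ennreal_mult sum_nonneg)
  finally show "ennreal ((indicator ?A w * (\<Sum>\<delta>\<in>?S. \<bar>W \<delta> w\<bar>)) powr p)
    <= ennreal (real (card ?S) powr p) * (?P w * indicator ?A w)" by (auto simp: indicator_def)
 qed
 also have "... = ennreal (real (card ?S) powr p) * (LNN w. ?P w * indicator ?A w)" by (rule nn_integral_cmult) measurable
 finally show "\<exists>k. (LNN w. ennreal ((indicator ?A w * (\<Sum>\<delta>\<in>?S. \<bar>W \<delta> w - k \<delta> * indicator \<Omega> w\<bar>)) powr p))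
   <= ennreal (real (card ?S) powr p * h powr (p * 0)) * (LNN w. ?P w * indicator ?A w)" by (intro exI[of _ "%_. 0"]) (use h in simp)
qed

text \<open>The density is the inner integral of the seminorm as a function of the outer variable,
  and the constants are the means with respect to the bump. The inner integral may be infinite on a
  null set, so the pointwise bound is proved almost everywhere.\<close>

lemma oscillation_majorant_fractional:
 fixes \<Omega> :: "(real^'d::finite) set"
 assumes opn: "open \<Omega>" and p: "1 <= p" and s: "0 <= s" and R: "R > 0" and b0: "b0 >= 0" and W: "sobolev_reps \<Omega> m u W"
  and fin: "ennreal_powr (frac_sobolev_seminorm \<Omega> m s p u) p < \<infinity>"
 defines "\<Psi> \<equiv> (%w. \<Sum>\<delta> | mi_size \<delta> = m. indicator \<Omega> w *
   (LNN y. ennreal (\<bar>W \<delta> y - W \<delta> w\<bar> powr p / norm (y - w) powr (real CARD('d) + p * s)) * indicator \<Omega> y))"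
 shows "oscillation_majorant \<Omega> m p s R b0 (real (card {\<delta> :: 'd => nat. mi_size \<delta> = m}) powr p *
   (2 powr p * (b0 ^ CARD('d) * (2 * R) powr (real CARD('d) + p * s)))) W \<Psi>"
  and "(LNN w. \<Psi> w) = ennreal_powr (frac_sobolev_seminorm \<Omega> m s p u) p"
proof -
 let ?S = "{\<delta> :: 'd => nat. mi_size \<delta> = m}"
 let ?e = "real CARD('d) + p * s"
 define I where "I \<delta> w = (LNN y. ennreal (\<bar>W \<delta> y - W \<delta> w\<bar> powr p / norm (y - w) powr ?e) * indicator \<Omega> y)" for \<delta> w
 have \<Psi>: "\<Psi> = (%w. \<Sum>\<delta>\<in>?S. indicator \<Omega> w * I \<delta> w)" by (simp add: \<Psi>_def I_def)
 have [measurable]: "\<Omega> \<in> sets borel" using opn by simp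
 have Im [measurable]: "I \<delta> \<in> borel_measurable borel" if "\<delta> \<in> ?S" for \<delta> proof -
  have [measurable]: "W \<delta> \<in> borel_measurable borel" using sobolev_reps_measurable[OF W] that by simp
  have "I \<delta> \<in> borel_measurable lborel" unfolding I_def[abs_def] by measurable
  then show ?thesis by simp
 qed
 have \<Psi>m [measurable]: "\<Psi> \<in> borel_measurable borel" unfolding \<Psi> by measurable
 show int: "(LNN w. \<Psi> w) = ennreal_powr (frac_sobolev_seminorm \<Omega> m s p u) p" proof -
  have "(LNN w. \<Psi> w) = (\<Sum>\<delta>\<in>?S. \<integral>\<^sup>+w. indicator \<Omega> w * I \<delta> w \<partial>lborel)"
   unfolding \<Psi> by (rule nn_integral_sum) measurable
  then show ?thesis by (simp add: frac_seminorm_reps[OF opn p W] I_def)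
 qed
 have ae: "AE w in lborel. \<Psi> w ~= \<infinity>" by (rule nn_integral_PInf_AE) (use fin in "auto simp: int less_top")
 let ?C1 = "2 powr p * (b0 ^ CARD('d) * (2 * R) powr ?e)"
 let ?N = "real (card ?S) powr p"
 have C1: "0 <= ?C1" using b0 by simp
 show "oscillation_majorant \<Omega> m p s R b0 (?N * ?C1) W \<Psi>" unfolding oscillation_majorant_def proof (intro conjI allI impI)
  fix h :: real and x a b :: "real^'d" and G assume h: "h > 0" and bump: "bump_on (\<Omega> \<inter> cball x (R * h)) (b0 / h) G a b"
  let ?A = "cball x (R * h)"
  have [measurable]: "?A \<in> sets borel" by simp
  define k where "k \<delta> = (LBINT y. prodf G y * W \<delta> y)" for \<delta>
  have osc: "\<bar>W \<delta> w - k \<delta>\<bar> powr p <= ?C1 * h powr (p * s) * enn2real (I \<delta> w)"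
   if \<delta>: "\<delta> \<in> ?S" and w: "w \<in> \<Omega>" "w \<in> ?A" and fi: "I \<delta> w < \<infinity>" for \<delta> w
   unfolding k_def proof (rule fractional_oscillation[where a = a and b = b, OF opn _ p s _ _ _ _ h R _ w(2,1)])
   show "integrable lborel (W \<delta>)" using W \<delta> by (simp add: sobolev_reps_def)
   show "(LNN y. ennreal (\<bar>W \<delta> y - W \<delta> w\<bar> powr p / norm (y - w) powr ?e) * indicator \<Omega> y) <= ennreal (enn2real (I \<delta> w))"
    unfolding I_def[symmetric] using fi by (simp add: less_top)
  qed (use bump in "auto simp: bump_on_def")
  have "(LNN w. ennreal ((indicator ?A w * (\<Sum>\<delta>\<in>?S. \<bar>W \<delta> w - k \<delta> * indicator \<Omega> w\<bar>)) powr p))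
   <= (LNN w. ennreal (?N * ?C1 * h powr (p * s)) * (\<Psi> w * indicator ?A w))"
  proof (rule nn_integral_mono_AE, use ae in eventually_elim)
   case (elim w)
   show ?case proof (cases "w \<in> \<Omega> \<and> w \<in> ?A")
    case True
    have fi: "I \<delta> w < \<infinity>" if "\<delta> \<in> ?S" for \<delta> using elim True that unfolding \<Psi> by (auto simp: less_top)
    have "(\<Sum>\<delta>\<in>?S. \<bar>W \<delta> w - k \<delta>\<bar>) powr p <= ?N * (\<Sum>\<delta>\<in>?S. \<bar>W \<delta> w - k \<delta>\<bar> powr p)"
     by (intro sum_powr_le p) auto
    also have "... <= ?N * (\<Sum>\<delta>\<in>?S. ?C1 * h powr (p * s) * enn2real (I \<delta> w))"
     using osc fi True by (intro mult_left_mono sum_mono) auto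
    also have "... = ?N * ?C1 * h powr (p * s) * (\<Sum>\<delta>\<in>?S. enn2real (I \<delta> w))"
     by (simp only: sum_distrib_left[symmetric] mult.assoc)
    finally have "ennreal ((\<Sum>\<delta>\<in>?S. \<bar>W \<delta> w - k \<delta>\<bar>) powr p) <= ennreal (?N * ?C1 * h powr (p * s) * (\<Sum>\<delta>\<in>?S. enn2real (I \<delta> w)))"
     by (rule ennreal_leI)
    also have "... = ennreal (?N * ?C1 * h powr (p * s)) * ennreal (\<Sum>\<delta>\<in>?S. enn2real (I \<delta> w))"
     using C1 by (intro ennreal_mult) (auto intro: sum_nonneg)
    also have "ennreal (\<Sum>\<delta>\<in>?S. enn2real (I \<delta> w)) = (\<Sum>\<delta>\<in>?S. ennreal (enn2real (I \<delta> w)))"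
     by (rule sum_ennreal[symmetric]) auto
    also have "... = \<Psi> w" unfolding \<Psi> using True fi by (intro sum.cong) (auto simp: less_top)
    finally show ?thesis using True by simp
   next
    case False
    then have "indicator ?A w * (\<Sum>\<delta>\<in>?S. \<bar>W \<delta> w - k \<delta> * indicator \<Omega> w\<bar>) = 0"
     by (cases "w \<in> ?A") (auto simp: sobolev_reps_zero[OF W])
    then show ?thesis by (simp only: powr_0 ennreal_0 zero_le)
   qed
  qed
  also have "... = ennreal (?N * ?C1 * h powr (p * s)) * (LNN w. \<Psi> w * indicator ?A w)" by (rule nn_integral_cmult) measurable
  finally show "\<exists>k. (LNN w. ennreal ((indicator ?A w * (\<Sum>\<delta>\<in>?S. \<bar>W \<delta> w - k \<delta> * indicator \<Omega> w\<bar>)) powr p))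
   <= ennreal (?N * ?C1 * h powr (p * s)) * (LNN w. \<Psi> w * indicator ?A w)" by blast
 qed measurable
qed

lemma frac_sobolev_majorant:
 fixes \<Omega> :: "(real^'d::finite) set"
 assumes opn: "open \<Omega>" and bdd: "bounded \<Omega>" and p: "1 <= p" and s: "0 <= s" and R: "R > 0" and b0: "b0 >= 0"
 shows "\<exists>C\<ge>0. \<forall>u. frac_sobolev_norm \<Omega> m s p u < \<infinity> --> (\<exists>W \<Psi>. sobolev_reps \<Omega> m u W \<and> oscillation_majorant \<Omega> m p s R b0 C W \<Psi> \<and>
   (LNN w. \<Psi> w) <= ennreal_powr (frac_sobolev_norm \<Omega> m s p u) p)"
proof (cases "s = 0")
 case True
 let ?S = "{\<delta> :: 'd => nat. mi_size \<delta> = m}"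
 show ?thesis proof (intro exI[of _ "real (card ?S) powr p"] conjI allI impI)
  fix u assume "frac_sobolev_norm \<Omega> m s p u < \<infinity>"
  then have "sobolev_norm \<Omega> m (ennreal p) u < \<infinity>" using True by (simp add: frac_sobolev_norm_def)
  from sobolev_reps_exist[OF opn bdd p this] obtain W where W: "sobolev_reps \<Omega> m u W"
   "(\<Sum>\<beta> | mi_size \<beta> <= m. \<integral>\<^sup>+w. ennreal (\<bar>W \<beta> w\<bar> powr p) \<partial>lborel) = ennreal_powr (sobolev_norm \<Omega> m (ennreal p) u) p" by blast
  have "(LNN w. (\<Sum>\<delta>\<in>?S. ennreal (\<bar>W \<delta> w\<bar> powr p))) = (\<Sum>\<delta>\<in>?S. \<integral>\<^sup>+w. ennreal (\<bar>W \<delta> w\<bar> powr p) \<partial>lborel)"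
   using sobolev_reps_measurable[OF W(1)] by (intro nn_integral_sum) auto
  also have "... <= (\<Sum>\<beta> | mi_size \<beta> <= m. \<integral>\<^sup>+w. ennreal (\<bar>W \<beta> w\<bar> powr p) \<partial>lborel)"
   by (rule sum_mono2) auto
  also have "... = ennreal_powr (frac_sobolev_norm \<Omega> m s p u) p" using W(2) True by (simp add: frac_sobolev_norm_def)
  finally have "(LNN w. (\<Sum>\<delta>\<in>?S. ennreal (\<bar>W \<delta> w\<bar> powr p))) <= ennreal_powr (frac_sobolev_norm \<Omega> m s p u) p" .
  then show "\<exists>W \<Psi>. sobolev_reps \<Omega> m u W \<and> oscillation_majorant \<Omega> m p s R b0 (real (card ?S) powr p) W \<Psi> \<and>
    (LNN w. \<Psi> w) <= ennreal_powr (frac_sobolev_norm \<Omega> m s p u) p"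
   unfolding True using W(1) oscillation_majorant_integer[OF p W(1), of R b0] by blast
 qed simp
next
 case False
 let ?C = "real (card {\<delta> :: 'd => nat. mi_size \<delta> = m}) powr p * (2 powr p * (b0 ^ CARD('d) * (2 * R) powr (real CARD('d) + p * s)))"
 show ?thesis proof (intro exI[of _ ?C] conjI allI impI)
  fix u assume fin: "frac_sobolev_norm \<Omega> m s p u < \<infinity>"
  let ?A = "ennreal_powr (sobolev_norm \<Omega> m (ennreal p) u) p" and ?B = "ennreal_powr (frac_sobolev_seminorm \<Omega> m s p u) p"
  have eq: "ennreal_powr (frac_sobolev_norm \<Omega> m s p u) p = ?A + ?B"
   using False p by (simp add: frac_sobolev_norm_def ennreal_powr_cancel)
  have "?A + ?B < \<infinity>" using fin unfolding eq[symmetric] ennreal_powr_lt_top .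
  then have B: "?B < \<infinity>" and "?A < \<infinity>" by auto
  then have "sobolev_norm \<Omega> m (ennreal p) u < \<infinity>" unfolding ennreal_powr_lt_top by simp
  from sobolev_reps_exist[OF opn bdd p this] obtain W where W: "sobolev_reps \<Omega> m u W" by blast
  show "\<exists>W \<Psi>. sobolev_reps \<Omega> m u W \<and> oscillation_majorant \<Omega> m p s R b0 ?C W \<Psi> \<and>
    (LNN w. \<Psi> w) <= ennreal_powr (frac_sobolev_norm \<Omega> m s p u) p" unfolding eq
   by (rule exI, rule exI, rule conjI, rule W, rule conjI,
     rule oscillation_majorant_fractional(1)[OF opn p s R b0 W B],
     subst oscillation_majorant_fractional(2)[OF opn p s R b0 W B], simp)
 qed (use b0 in simp)
qed


text \<open>One polynomial, given by \<kappa> and the bump, has to approximate all derivatives up to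
  order \<open>k\<close> at once: the moving least squares error combines nodal values of u with a
  derivative at x.\<close>

definition local_approximant ::
 "(real^'d::finite) set => nat => nat => (('d => nat) => real^'d => real) => (real^'d) set => (nat => real) =>
  (('d => nat) => real^'d => real) => ('d => real => real) => bool" where
 "local_approximant \<Omega> m k W U E \<kappa> G \<longleftrightarrow>
   (\<forall>\<gamma>. mi_size \<gamma> <= m --> integrable lborel (\<kappa> \<gamma>) \<and> (\<forall>w. w \<notin> \<Omega> --> \<kappa> \<gamma> w = 0)) \<and> (\<forall>i. smooth1 (G i)) \<and>
   (\<forall>\<beta>. mi_size \<beta> <= k --> (\<exists>v. continuous_on U v \<and> (AE y in lborel. y \<in> U --> v y = W \<beta> y) \<and>
    (\<forall>y\<in>U. \<bar>avg_taylor m \<kappa> G \<beta> y - v y\<bar> <= E (mi_size \<beta>))))"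

definition local_mass :: "(real^'d::finite => ennreal) => real => real^'d => ennreal" where
 "local_mass \<Psi> \<rho> x = (LNN w. \<Psi> w * indicator (cball x \<rho>) w)"

definition oscillation_density ::
 "(real^'d::finite) set => nat => real => real => (real^'d => real) => (real^'d => ennreal) => bool" where
 "oscillation_density \<Omega> m s p u \<Psi> \<longleftrightarrow> \<Psi> \<in> borel_measurable borel \<and>
   (LNN w. \<Psi> w) <= ennreal_powr (frac_sobolev_norm \<Omega> m s p u) p"

text \<open>The approximation holds on radius (L + 1)h, strictly beyond Lh. With L = 2
  \<open>C2\<close> the open ball then contains every node at distance at most \<delta>.\<close>

definition locally_approximable where
 "locally_approximable \<Omega> m k s p L C R h1 W \<Psi> \<longleftrightarrow>
   (\<forall>h x. 0 < h --> h <= h1 --> x \<in> \<Omega> --> (\<exists>\<kappa> G. local_approximant \<Omega> m k W (\<Omega> \<inter> ball x ((L + 1) * h))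
   (%b. C * h powr (real m - real b + s - real CARD('d) / p) * enn2real (local_mass \<Psi> (R * h) (x :: real^'d::finite)) powr (1 / p)) \<kappa> G))"

lemma local_approximation:
 fixes \<Omega> :: "(real^'d::finite) set"
 assumes bdd: "bounded \<Omega>" and lip: "lipschitz_boundary \<Omega>" and L: "L > 0" and s: "0 <= s" and p: "1 <= p"
  "p > 1 ==> real m > real k + real CARD('d) / p" "p = 1 ==> m >= k + CARD('d)"
 shows "\<exists>C\<ge>0. \<exists>R>0. \<exists>h1>0. \<forall>u. frac_sobolev_norm \<Omega> m s p u < \<infinity> --> (\<exists>W \<Psi>. sobolev_reps \<Omega> m u W \<and>
  oscillation_density \<Omega> m s p u \<Psi> \<and> locally_approximable \<Omega> m k s p L C R h1 W \<Psi>)"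
proof -
 let ?d = "real CARD('d)"
 have opn: "open \<Omega>" by (rule lipschitz_boundary_open[OF lip])
 have km: "k <= m" proof (cases "p = 1")
  case False
  then have "real m > real k + ?d / p" using p by simp
  moreover have "?d / p >= 0" using p(1) by simp
  ultimately have "real k < real m" by linarith
  then show ?thesis by simp
 qed (use p(3) in simp)
 obtain \<tau> \<epsilon> where \<tau>: "\<tau> > 0" "\<epsilon> > 0" "\<epsilon> <= 1" and cone: "\<forall>x\<in>\<Omega>. \<exists>n. norm n = 1 \<and>
  (\<forall>y\<in>\<Omega> \<inter> ball x \<tau>. \<forall>v. norm (v - n) <= \<epsilon> --> (\<forall>t\<in>{0..\<tau>}. y + t *\<^sub>R v \<in> \<Omega>))"
  using uniform_cone[OF bdd lip] by blast
 define K where "K = (L + 2) / \<epsilon>"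
 define R where "R = K + L + 2"
 have K: "K > 0" using L \<tau> by (simp add: K_def)
 have R: "R > 0" using K L by (simp add: R_def)
 obtain b0 where b0: "b0 >= 0" "\<forall>(c :: real^'d) h. h > 0 --> (\<exists>G. (\<forall>i. smooth1 (G i)) \<and>
   (\<forall>i s. s \<notin> {(c - (\<chi> i. h / ?d)) $ i..(c + (\<chi> i. h / ?d)) $ i} --> G i s = 0) \<and>
   (\<forall>i s. 0 <= G i s \<and> G i s <= b0 / h) \<and> (LBINT x. prodf G x) = 1)" using bump_exists[where 'd = 'd] by blast
 obtain C0 where C0: "C0 >= 0" "\<forall>u. frac_sobolev_norm \<Omega> m s p u < \<infinity> --> (\<exists>W \<Psi>. sobolev_reps \<Omega> m u W \<and> oscillation_majorant \<Omega> m p s R b0 C0 W \<Psi> \<and>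
   (LNN w. \<Psi> w) <= ennreal_powr (frac_sobolev_norm \<Omega> m s p u) p)"
  using frac_sobolev_majorant[OF opn bdd p(1) s R b0(1), of m] by blast
 \<comment> \<open>One constant for each order b <= k; their sum is a bound for all of them.\<close>
 define T where "T b = \<bar>taylor_const TYPE('d) (m - b) p b0 R\<bar> * C0 powr (1 / p)" for b
 define C where "C = (\<Sum>b\<le>k. T b)"
 have T0: "0 <= T b" for b by (simp add: T_def)
 have TC: "T b <= C" if "b <= k" for b unfolding C_def by (rule member_le_sum) (use that T0 in auto)
 have Cp: "C >= 0" unfolding C_def by (intro sum_nonneg T0)
 have \<tau>K: "\<tau> / K > 0" using \<tau> K by simp
 show ?thesis
 proof (rule exI[of _ C], rule conjI[OF Cp], rule exI[of _ R], rule conjI[OF R], rule exI[of _ "\<tau> / K"], rule conjI[OF \<tau>K], rule allI, rule impI)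
  fix u assume fin: "frac_sobolev_norm \<Omega> m s p u < \<infinity>"
  have "\<exists>W \<Psi>. sobolev_reps \<Omega> m u W \<and> oscillation_majorant \<Omega> m p s R b0 C0 W \<Psi> \<and>
   (LNN w. \<Psi> w) <= ennreal_powr (frac_sobolev_norm \<Omega> m s p u) p" by (rule C0(2)[rule_format, OF fin])
  then obtain W \<Psi> where W: "sobolev_reps \<Omega> m u W" and \<Psi>: "oscillation_majorant \<Omega> m p s R b0 C0 W \<Psi>"
   "(LNN w. \<Psi> w) <= ennreal_powr (frac_sobolev_norm \<Omega> m s p u) p" by (elim exE conjE)
  have J: "local_mass \<Psi> \<rho> x < \<infinity>" for \<rho> x proof -
   have "local_mass \<Psi> \<rho> x <= (LNN w. \<Psi> w)" unfolding local_mass_def by (intro nn_integral_mono) (auto simp: indicator_def)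
   also have "... < \<infinity>" using \<Psi>(2) fin ennreal_powr_lt_top[of "frac_sobolev_norm \<Omega> m s p u" p] by (simp add: order_le_less_trans)
   finally show ?thesis .
  qed
  show "\<exists>W \<Psi>. sobolev_reps \<Omega> m u W \<and> oscillation_density \<Omega> m s p u \<Psi> \<and> locally_approximable \<Omega> m k s p L C R (\<tau> / K) W \<Psi>"
   unfolding oscillation_density_def locally_approximable_def
  proof (rule exI[of _ W], rule exI[of _ \<Psi>], intro conjI W \<Psi>(2) allI impI)
   show "\<Psi> \<in> borel_measurable borel" using \<Psi>(1) by (simp add: oscillation_majorant_def)
   fix h and x :: "real^'d" assume h: "0 < h" "h <= \<tau> / K" and x: "x \<in> \<Omega>"
   have Kh: "(L + 2) / \<epsilon> * h <= \<tau>" using h(2) K by (simp add: K_def[symmetric] pos_le_divide_eq mult.commute)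
   obtain n where n: "norm n = 1" "\<forall>y\<in>\<Omega> \<inter> ball x \<tau>. \<forall>v. norm (v - n) <= \<epsilon> --> (\<forall>t\<in>{0..\<tau>}. y + t *\<^sub>R v \<in> \<Omega>)"
    using cone x by blast
   let ?U = "\<Omega> \<inter> ball x ((L + 1) * h)" and ?A = "cball x (R * h)"
   define e :: "real^'d" where "e = (\<chi> i. h / ?d)"
   define c where "c = x + (K * h) *\<^sub>R n"
   have "y + t *\<^sub>R v \<in> \<Omega>" if "y \<in> \<Omega> \<inter> ball x \<tau>" "norm (v - n) <= \<epsilon>" "t \<in> {0..\<tau>}" for y v t
    using n(2) that by blast
   note star = star_shaped_box[OF this n(1) x \<tau>(2,3) L h(1) Kh, folded K_def, folded R_def, folded c_def e_def]
   obtain G where G: "!!i. smooth1 (G i)" "!!i s. s \<notin> {(c - e) $ i..(c + e) $ i} ==> G i s = 0"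
    "!!i s. 0 <= G i s \<and> G i s <= b0 / h" "(LBINT x. prodf G x) = 1"
    using b0(2)[rule_format, OF h(1), of c, folded e_def] by (elim exE conjE) blast
   have "bump_on (\<Omega> \<inter> ?A) (b0 / h) G (c - e) (c + e)" using G star(3) by (auto simp: bump_on_def)
   then obtain \<mu> where \<mu>: "(LNN w. ennreal ((indicator ?A w * (\<Sum>\<delta> | mi_size \<delta> = m. \<bar>W \<delta> w - \<mu> \<delta> * indicator \<Omega> w\<bar>)) powr p))
     <= ennreal (C0 * h powr (p * s)) * local_mass \<Psi> (R * h) x"
    using \<Psi>(1) h(1) unfolding oscillation_majorant_def local_mass_def by blast
   define j where "j = enn2real (local_mass \<Psi> (R * h) x)"
   define N where "N = C0 * h powr (p * s) * j"
   have j0: "j >= 0" by (simp add: j_def)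
   have N: "N >= 0" "ennreal (C0 * h powr (p * s)) * local_mass \<Psi> (R * h) x = ennreal N"
    using C0(1) J[of "R * h" x] j0 by (auto simp: N_def j_def ennreal_mult less_top)
   \<comment> \<open>Derivatives below order m keep their true values; only those of order m are
     replaced by constants, as \<open>avg_taylor_pathF\<close> expects.\<close>
   define \<kappa> where "\<kappa> \<delta> = (if mi_size \<delta> < m then W \<delta> else (%w. \<mu> \<delta> * indicator \<Omega> w))" for \<delta>
   have "local_approximant \<Omega> m k W ?U (%b. C * h powr (real m - real b + s - ?d / p) * j powr (1 / p)) \<kappa> G"
    unfolding local_approximant_def proof (intro conjI allI impI G(1))
    have ind: "integrable lborel (indicator \<Omega> :: _ => real)"
     using opn emeasure_bounded_finite[OF bdd] by (intro integrable_real_indicator) auto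
    show "integrable lborel (\<kappa> \<gamma>)" if "mi_size \<gamma> <= m" for \<gamma>
     using W that ind by (auto simp: \<kappa>_def sobolev_reps_def)
    show "\<kappa> \<gamma> w = 0" if "mi_size \<gamma> <= m" "w \<notin> \<Omega>" for \<gamma> w
     using sobolev_reps_zero[OF W that] that by (simp add: \<kappa>_def)
    fix \<beta> :: "'d => nat" assume \<beta>: "mi_size \<beta> <= k"
    let ?b = "mi_size \<beta>"
    let ?t = "taylor_const TYPE('d) (m - ?b) p b0 R" and ?s = "real m - real ?b + s - ?d / p"
    have bm: "?b <= m" using \<beta> km by simp
    have "\<exists>v. continuous_on ?U v \<and> (AE y in lborel. y \<in> ?U --> v y = W \<beta> y) \<and>
     (\<forall>y\<in>?U. \<bar>avg_taylor m \<kappa> G \<beta> y - v y\<bar>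
       <= ?t * h powr (real (m - ?b) - ?d / p) * N powr (1 / p))"
    proof (rule local_taylor_estimate[where a = "c - e" and b = "c + e" and A = ?A and k = \<mu>, OF opn bdd _ _ _ G(1) _ _ G(4) h(1) R bm p(1)])
     show "\<bar>G i s\<bar> <= b0 / h" for i s using G(3)[of i s] by simp
     show "1 < p ==> ?d / p < real (m - ?b)" using p(2) \<beta> bm by (simp add: of_nat_diff)
     show "p = 1 ==> CARD('d) <= m - ?b" using p(3) \<beta> by simp
     show "(LNN w. ennreal ((indicator ?A w * (\<Sum>\<delta> | mi_size \<delta> = m. \<bar>W \<delta> w - \<mu> \<delta> * indicator \<Omega> w\<bar>)) powr p)) <= ennreal N"
      using \<mu> unfolding N(2) .
     show "weak_partial \<Omega> i (W \<gamma>) (W (mi_inc \<gamma> i))" if "mi_size \<gamma> < m" for \<gamma> i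
      by (rule sobolev_reps_weak[OF opn W that])
    qed (use W sobolev_reps_zero[OF W] opn N star G(2) in "auto simp: \<kappa>_def sobolev_reps_def")
    moreover have "?t * h powr (real (m - ?b) - ?d / p) * N powr (1 / p)
      <= C * h powr ?s * j powr (1 / p)" proof -
     have "N powr (1 / p) = C0 powr (1 / p) * h powr s * j powr (1 / p)" using C0(1) j0 p(1) by (simp add: N_def powr_mult powr_powr)
     then have "?t * h powr (real (m - ?b) - ?d / p) * N powr (1 / p)
      = ?t * C0 powr (1 / p) * ((h powr (real (m - ?b) - ?d / p) * h powr s) * j powr (1 / p))" by (simp add: mult_ac)
     also have "h powr (real (m - ?b) - ?d / p) * h powr s = h powr ?s"
      using bm by (simp add: powr_add[symmetric] of_nat_diff algebra_simps)
     also have "?t * C0 powr (1 / p) * (h powr ?s * j powr (1 / p))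
      <= C * (h powr ?s * j powr (1 / p))" proof (rule mult_right_mono)
      have "?t * C0 powr (1 / p) <= T ?b" unfolding T_def by (intro mult_right_mono) auto
      then show "?t * C0 powr (1 / p) <= C" using TC[OF \<beta>] by linarith
     qed simp
     finally show ?thesis by (simp add: mult.assoc)
    qed
    ultimately show "\<exists>v. continuous_on ?U v \<and> (AE y in lborel. y \<in> ?U --> v y = W \<beta> y) \<and>
     (\<forall>y\<in>?U. \<bar>avg_taylor m \<kappa> G \<beta> y - v y\<bar> <= C * h powr ?s * j powr (1 / p))"
     by (elim exE conjE) (rule exI, rule conjI, assumption, rule conjI, assumption, rule ballI, drule bspec, assumption, erule order_trans, assumption)
   qed
   then show "\<exists>\<kappa> G. local_approximant \<Omega> m k W ?U (%b. C * h powr (real m - real b + s - ?d / p) * enn2real (local_mass \<Psi> (R * h) x) powr (1 / p)) \<kappa> G"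
    unfolding j_def by blast
  qed
 qed
qed

text \<open>\<open>continuous_rep\<close> is an arbitrary choice, but on an open set a continuous
  representative is unique; v shows that one exists.\<close>

lemma continuous_rep_eq:
 fixes \<Omega> :: "(real^'d::finite) set"
 assumes opn: "open \<Omega>" and W: "sobolev_reps \<Omega> m u W" and v: "continuous_on \<Omega> v" "AE y in lborel. y \<in> \<Omega> --> v y = W (%_. 0) y"
  and x: "x \<in> \<Omega>"
 shows "continuous_rep \<Omega> u x = v x"
proof -
 let ?z = "%_ :: 'd. 0 :: nat"
 have wd: "has_weak_deriv \<Omega> ?z u (weak_deriv \<Omega> ?z u)" and rep: "borel_rep \<Omega> (weak_deriv \<Omega> ?z u) (W ?z)"
  using W by (auto simp: sobolev_reps_def)
 have l0: "mi_list ?z = []" by (simp flip: length_0_conv)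
 have "has_weak_deriv \<Omega> ?z u u" using wd by (simp add: has_weak_deriv_def multi_deriv_mi_list l0)
 from has_weak_deriv_unique[OF opn wd this] have u: "AE x in lebesgue. x \<in> \<Omega> --> weak_deriv \<Omega> ?z u x = u x"
  using opn by (simp add: AE_lebesgue_on_iff)
 have "AE x in lebesgue. x \<in> \<Omega> --> v x = u x"
  using AE_lebesgue_lborel[OF v(2)] u rep[unfolded borel_rep_def, THEN conjunct2, THEN conjunct2] by eventually_elim auto
 then have "\<exists>v. continuous_on \<Omega> v \<and> (AE x in lebesgue_on \<Omega>. v x = u x)" using v(1) opn by (auto simp: AE_lebesgue_on_iff)
 then have c: "continuous_on \<Omega> (continuous_rep \<Omega> u)" "AE x in lebesgue_on \<Omega>. continuous_rep \<Omega> u x = u x"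
  unfolding continuous_rep_def by (rule someI_ex[THEN conjunct1], rule someI_ex[THEN conjunct2])
 have "AE x in lebesgue. x \<in> \<Omega> --> continuous_rep \<Omega> u x = v x"
  using \<open>AE x in lebesgue. x \<in> \<Omega> --> v x = u x\<close> c(2)[unfolded AE_lebesgue_on_iff[OF opn]] by eventually_elim auto
 then have "AE x in lborel. x \<in> \<Omega> --> continuous_rep \<Omega> u x = v x" by (simp add: AE_completion_iff)
 then show ?thesis by (rule continuous_AE_eq[OF opn c(1) v(1) _ x])
qed


section \<open>The error of moving least squares\<close>


lemma iter_partial_zero_open:
 assumes "open U" "!!x. x \<in> U ==> f x = 0"
 shows "x \<in> U ==> iter_partial is f x = 0"
proof (induction "is" arbitrary: x)
 case (Cons i "is")
 show ?case unfolding iter_partial_Cons by (rule partial_deriv_zero_open[OF assms(1) Cons.prems Cons.IH])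
qed (simp add: assms)

text \<open>The error \<open>D\<^sup>\<beta> s - v\<close> is split at the averaged Taylor polynomial, which moving least squares reproduce.\<close>

lemma mls_deriv_error:
 fixes \<Omega> :: "(real^'d::finite) set" and v :: "('d => nat) => real^'d => real"
 assumes \<Omega>: "open \<Omega>" "bounded \<Omega>" and h: "h > 0" and X: "finite X" "X \<subseteq> \<Omega>" and k: "k <= n" "n <= m"
  and la: "local_approximant \<Omega> m k W (\<Omega> \<inter> ball x \<rho>) E \<kappa> G" and \<rho>: "\<rho> > 0" "\<delta> < \<rho>" and x: "x \<in> \<Omega>"
  and v: "!!\<beta>. mi_size \<beta> <= k ==> continuous_on \<Omega> (v \<beta>) \<and> (AE y in lborel. y \<in> \<Omega> --> v \<beta> y = W \<beta> y)"
  and a: "!!y. y \<in> X ==> CB n h \<Omega> C0 (a y)" "!!y x. y \<in> X ==> \<delta> < norm (x - y) ==> a y x = 0"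
   "!!x w g. x \<in> \<Omega> ==> mi_size g <= m ==> (\<Sum>y\<in>X. a y x * mimono g (y - w)) = mimono g (x - w)"
  and N0: "real (card {y\<in>X. norm (x - y) <= \<delta>}) <= N0" and C0: "C0 >= 0" and \<beta>: "mi_size \<beta> <= k"
 shows "\<bar>iter_partial (rev (mi_list \<beta>)) (%x. \<Sum>y\<in>X. a y x * v (%_. 0) y) x - v \<beta> x\<bar>
  <= N0 * (C0 / h ^ mi_size \<beta> * E 0) + E (mi_size \<beta>)"
proof -
 let ?U = "\<Omega> \<inter> ball x \<rho>" and ?z = "%_ :: 'd. 0 :: nat" and ?D = "%y. iter_partial (rev (mi_list \<beta>)) (a y) x"
 let ?T = "avg_taylor m \<kappa> G"
 have err: "\<bar>?T \<gamma> y - v \<gamma> y\<bar> <= E (mi_size \<gamma>)" if \<gamma>: "mi_size \<gamma> <= k" and y: "y \<in> ?U" for \<gamma> y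
 proof -
  obtain v' where v': "continuous_on ?U v'" "AE y in lborel. y \<in> ?U --> v' y = W \<gamma> y" "\<forall>y\<in>?U. \<bar>?T \<gamma> y - v' y\<bar> <= E (mi_size \<gamma>)"
   using la \<gamma> unfolding local_approximant_def by blast
  have "v' y = v \<gamma> y" proof (rule continuous_AE_eq[OF _ v'(1) _ _ y])
   show "AE y in lborel. y \<in> ?U --> v' y = v \<gamma> y" using v'(2) v[OF \<gamma>, THEN conjunct2] by eventually_elim auto
   show "continuous_on ?U (v \<gamma>)" using v[OF \<gamma>] continuous_on_subset by blast
  qed (use \<Omega> in auto)
  then show ?thesis using bspec[OF v'(3) y] by simp
 qed
 have len: "length (rev (mi_list \<beta>)) <= n" using \<beta> k by simp
 have D: "\<bar>?D y\<bar> <= C0 / h ^ mi_size \<beta>" if "y \<in> X" for y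
  using CB_bound[OF CB_iter_partial[OF a(1)[OF that] len] x] by simp
 have D0: "?D y = 0" if "y \<in> X" "\<delta> < norm (x - y)" for y proof (rule iter_partial_zero_open[of "{x. \<delta> < norm (x - y)}"])
  show "open {x. \<delta> < norm (x - y)}" by (intro open_Collect_less continuous_intros)
 qed (use a(2) that in auto)
 have "iter_partial (rev (mi_list \<beta>)) (%x. \<Sum>y\<in>X. a y x * v ?z y) x = (\<Sum>y\<in>X. ?D y * v ?z y)"
  by (rule iter_partial_lincomb[OF \<Omega>(1) a(1) len x])
 moreover have "(\<Sum>y\<in>X. ?D y * ?T ?z y) = ?T \<beta> x"
  using la k \<beta> by (intro avg_taylor_reproduction[OF \<Omega> h _ _ _ a(1,3) _ _ x]) (auto simp: local_approximant_def)
 ultimately have "iter_partial (rev (mi_list \<beta>)) (%x. \<Sum>y\<in>X. a y x * v ?z y) x - v \<beta> x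
   = (\<Sum>y\<in>X. ?D y * (v ?z y - ?T ?z y)) + (?T \<beta> x - v \<beta> x)" by (simp add: right_diff_distrib sum_subtractf)
 also have "\<bar>...\<bar> <= (\<Sum>y\<in>X. \<bar>?D y * (v ?z y - ?T ?z y)\<bar>) + E (mi_size \<beta>)"
  using err[OF \<beta>, of x] x \<rho> by (intro order_trans[OF abs_triangle_ineq] add_mono sum_abs) auto
 also have "(\<Sum>y\<in>X. \<bar>?D y * (v ?z y - ?T ?z y)\<bar>) = (\<Sum>y\<in>{y\<in>X. norm (x - y) <= \<delta>}. \<bar>?D y * (v ?z y - ?T ?z y)\<bar>)"
 proof (intro sum.mono_neutral_right ballI)
  fix y assume "y \<in> X - {y\<in>X. norm (x - y) <= \<delta>}"
  then show "\<bar>?D y * (v ?z y - ?T ?z y)\<bar> = 0" using D0[of y] by auto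
 qed (use X(1) in auto)
 also have "... <= (\<Sum>y\<in>{y\<in>X. norm (x - y) <= \<delta>}. C0 / h ^ mi_size \<beta> * E 0)" proof (rule sum_mono)
  fix y assume y: "y \<in> {y\<in>X. norm (x - y) <= \<delta>}"
  then have "\<bar>v ?z y - ?T ?z y\<bar> <= E 0" using err[of ?z y] X(2) \<rho> by (auto simp: dist_norm abs_minus_commute)
  then show "\<bar>?D y * (v ?z y - ?T ?z y)\<bar> <= C0 / h ^ mi_size \<beta> * E 0"
   unfolding abs_mult using y D[of y] C0 h by (intro mult_mono) auto
 qed
 also have "... <= N0 * (C0 / h ^ mi_size \<beta> * E 0)" proof -
  have "0 <= E 0" using err[of ?z x] x \<rho> by auto
  then show ?thesis unfolding sum_constant using C0 h by (intro mult_right_mono N0 mult_nonneg_nonneg) auto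
 qed
 finally show ?thesis by simp
qed

definition mls_errors where
 "mls_errors \<Omega> m k s p c_qu \<theta> \<phi> C R h1 u \<Psi> \<longleftrightarrow> (\<forall>X \<beta>. finite X --> X \<subseteq> \<Omega> --> quasi_uniform c_qu X \<Omega> --> fill_distance X \<Omega> <= h1 --> mi_size \<beta> <= k -->
   (let h = fill_distance X \<Omega>; e = (%x. u x - mls_approx m h (mls_weight \<phi> (2 * mls_C2 \<theta> m * h)) X (continuous_rep \<Omega> u) x)
    in has_weak_deriv \<Omega> \<beta> e (weak_deriv \<Omega> \<beta> e) \<and> (AE x in lebesgue. x \<in> \<Omega> -->
     \<bar>weak_deriv \<Omega> \<beta> e x\<bar> <= C * h powr (real m - real (mi_size \<beta>) + s - real CARD('d) / p) * enn2real (local_mass \<Psi> (R * h) (x :: real^'d::finite)) powr (1 / p))))"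

lemma mls_weak_deriv_error:
 fixes \<Omega> :: "(real^'d::finite) set"
 assumes bdd: "bounded \<Omega>" and lip: "lipschitz_boundary \<Omega>" and \<theta>: "0 < \<theta>" "\<theta> < pi / 2" and r: "r > 0" and cone: "interior_cone_condition \<Omega> \<theta> r"
  and m: "m > 0" and \<phi>: "weight_profile m \<phi>" and cq: "c_qu > 0" and s: "0 <= s" and p: "1 <= p"
  "p > 1 ==> real m > real k + real CARD('d) / p" "p = 1 ==> m >= k + CARD('d)"
 shows "\<exists>C\<ge>0. \<exists>R>0. \<exists>h1>0. \<forall>u. frac_sobolev_norm \<Omega> m s p u < \<infinity> --> (\<exists>\<Psi>. oscillation_density \<Omega> m s p u \<Psi> \<and> mls_errors \<Omega> m k s p c_qu \<theta> \<phi> C R h1 u \<Psi>)"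
proof -
 let ?d = "real CARD('d)"
 have opn: "open \<Omega>" by (rule lipschitz_boundary_open[OF lip])
 \<comment> \<open>Order m - 1 is the smoothness available for the shape functions. The strict gap
   comes from d/p > 0 and, for p = 1, from d >= 1.\<close>
 have km: "k <= m - 1" proof (cases "p = 1")
  case False
  have "?d / p > 0" using p(1) by simp
  then have "real k < real m" using p False by linarith
  then show ?thesis by simp
 next
  case True
  have "CARD('d) > 0" by simp
  then show ?thesis using p(3)[OF True] by linarith
 qed
 define C2 where "C2 = mls_C2 \<theta> m"
 have C2: "C2 >= 1" using mls_C2_ge[OF \<theta>, of m] m by (simp add: C2_def)
 let ?a = "%X y x. mls_shape {\<beta> :: 'd => nat. mi_size \<beta> <= m} (shifted_scaled_basis x (fill_distance X \<Omega>)) (mls_weight \<phi> (2 * C2 * fill_distance X \<Omega>)) X y x"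
 obtain C0 N0 where CN: "C0 >= 0" "N0 >= 0" and shape: "\<forall>X. finite X --> quasi_uniform c_qu X \<Omega> --> C2 * fill_distance X \<Omega> <= r -->
   (\<forall>y\<in>X. CB (m - 1) (fill_distance X \<Omega>) \<Omega> C0 (?a X y)) \<and> (\<forall>y\<in>X. \<forall>x. 2 * C2 * fill_distance X \<Omega> < norm (x - y) --> ?a X y x = 0) \<and>
    (\<forall>x\<in>\<Omega>. \<forall>w g. mi_size g <= m --> (\<Sum>y\<in>X. ?a X y x * mimono g (y - w)) = mimono g (x - w)) \<and>
    (\<forall>x. real (card {y\<in>X. norm (x - y) <= 2 * C2 * fill_distance X \<Omega>}) <= N0)"
  using mls_shape_bounds[OF bdd opn \<theta> cone m \<phi> cq] unfolding Let_def C2_def by (elim exE conjE)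
 have L: "0 < 2 * C2" using C2 by simp
 obtain C1 R h1 where C1: "C1 >= 0" "R > 0" "h1 > 0" and loc: "\<forall>u. frac_sobolev_norm \<Omega> m s p u < \<infinity> --> (\<exists>W \<Psi>. sobolev_reps \<Omega> m u W \<and>
  oscillation_density \<Omega> m s p u \<Psi> \<and> locally_approximable \<Omega> m k s p (2 * C2) C1 R h1 W \<Psi>)"
  using local_approximation[where k = k and m = m, OF bdd lip L s p, simplified simp_thms implies_True_equals True_implies_equals] by (elim exE conjE)
 have C: "0 <= (N0 * C0 + 1) * C1" using CN C1 by simp
 \<comment> \<open>The second bound keeps \<open>C2 * h\<close> below the cone radius r, as
   \<open>mls_shape_bounds\<close> requires.\<close>
 have h2: "min h1 (r / C2) > 0" using C1 r C2 by simp
 show ?thesis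
 proof (rule exI[of _ "(N0 * C0 + 1) * C1"], rule conjI[OF C], rule exI[of _ R], rule conjI[OF C1(2)], rule exI[of _ "min h1 (r / C2)"], rule conjI[OF h2], rule allI, rule impI)
  fix u assume "frac_sobolev_norm \<Omega> m s p u < \<infinity>"
  from loc[rule_format, OF this] obtain W \<Psi> where W: "sobolev_reps \<Omega> m u W" and \<Psi>: "oscillation_density \<Omega> m s p u \<Psi>"
   and la: "locally_approximable \<Omega> m k s p (2 * C2) C1 R h1 W \<Psi>" by (elim exE conjE)
  note la = la[unfolded locally_approximable_def]
  have "\<exists>v. continuous_on \<Omega> v \<and> (AE y in lborel. y \<in> \<Omega> --> v y = W \<beta> y)" if \<beta>: "mi_size \<beta> <= k" for \<beta>
  \<comment> \<open>The continuous representatives are built once, at the fixed scale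
    \<open>h1\<close>, so they depend on neither X nor h.\<close>
  proof (rule patch_continuous[OF opn])
   fix x assume x: "x \<in> \<Omega>"
   let ?U = "\<Omega> \<inter> ball x ((2 * C2 + 1) * h1)"
   obtain v where "continuous_on ?U v" "AE y in lborel. y \<in> ?U --> v y = W \<beta> y"
    using la[rule_format, OF C1(3) order_refl x] \<beta> unfolding local_approximant_def by blast
   moreover have "open ?U" "x \<in> ?U" using opn x C2 C1(3) by auto
   ultimately show "\<exists>U v. open U \<and> x \<in> U \<and> U \<subseteq> \<Omega> \<and> continuous_on U v \<and> (AE y in lborel. y \<in> U --> v y = W \<beta> y)" by blast
  qed
  then obtain v where v: "!!\<beta>. mi_size \<beta> <= k ==> continuous_on \<Omega> (v \<beta>) \<and> (AE y in lborel. y \<in> \<Omega> --> v \<beta> y = W \<beta> y)" by metis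
  show "\<exists>\<Psi>. oscillation_density \<Omega> m s p u \<Psi> \<and> mls_errors \<Omega> m k s p c_qu \<theta> \<phi> ((N0 * C0 + 1) * C1) R (min h1 (r / C2)) u \<Psi>"
   unfolding mls_errors_def proof (rule exI[of _ \<Psi>], intro conjI \<Psi> allI impI)
   fix X and \<beta> :: "'d => nat"
   assume X: "finite X" "X \<subseteq> \<Omega>" and qu: "quasi_uniform c_qu X \<Omega>" and fd: "fill_distance X \<Omega> <= min h1 (r / C2)" and \<beta>: "mi_size \<beta> <= k"
   define h where "h = fill_distance X \<Omega>"
   have h: "h > 0" "h <= h1" "C2 * h <= r"
    using quasi_uniform_separated(1)[OF X(1) qu cq] fd C2 by (auto simp: h_def pos_le_divide_eq mult.commute)
   define a where "a = ?a X"
   define S where "S = (%x. \<Sum>y\<in>X. a y x * v (%_. 0) y)"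
   let ?D = "iter_partial (rev (mi_list \<beta>)) S"
   let ?E = "%x b. C1 * h powr (real m - real b + s - ?d / p) * enn2real (local_mass \<Psi> (R * h) x) powr (1 / p)"
   have a: "!!y. y \<in> X ==> CB (m - 1) h \<Omega> C0 (a y)" "!!y x. y \<in> X ==> 2 * C2 * h < norm (x - y) ==> a y x = 0"
    "!!x w g. x \<in> \<Omega> ==> mi_size g <= m ==> (\<Sum>y\<in>X. a y x * mimono g (y - w)) = mimono g (x - w)"
    "!!x. real (card {y\<in>X. norm (x - y) <= 2 * C2 * h}) <= N0"
    using shape[rule_format, OF X(1) qu h(3)[unfolded h_def], folded h_def a_def[unfolded h_def[symmetric]]] by (auto simp: a_def h_def)
   have S: "mls_approx m h (mls_weight \<phi> (2 * mls_C2 \<theta> m * h)) X (continuous_rep \<Omega> u) = S" proof -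
    have "continuous_rep \<Omega> u y = v (%_. 0) y" if "y \<in> X" for y
     by (rule continuous_rep_eq[OF opn W]) (use v[of "%_. 0"] X that in auto)
    then show ?thesis by (auto simp: mls_approx_def S_def a_def h_def C2_def fun_eq_iff intro!: sum.cong)
   qed
   have bnd: "\<bar>?D x - v \<beta> x\<bar> <= (N0 * C0 + 1) * ?E x (mi_size \<beta>)" if x: "x \<in> \<Omega>" for x proof -
    obtain \<kappa> G where "local_approximant \<Omega> m k W (\<Omega> \<inter> ball x ((2 * C2 + 1) * h)) (?E x) \<kappa> G"
     using la[rule_format, OF h(1,2) x] by (elim exE)
    from mls_deriv_error[OF opn bdd h(1) X km _ this _ _ x v a(1-3) a(4) CN(1) \<beta>]
    have "\<bar>?D x - v \<beta> x\<bar> <= N0 * (C0 / h ^ mi_size \<beta> * ?E x 0) + ?E x (mi_size \<beta>)"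
     using C2 h(1) unfolding S_def by simp
    also have "N0 * (C0 / h ^ mi_size \<beta> * ?E x 0) = N0 * (C0 * (?E x 0 / h ^ mi_size \<beta>))" by simp
    \<comment> \<open>The factor h^(-|\<beta>|) lost by differentiating the shape functions is
      exactly what the approximation of u gains over that of its derivative of order
      |\<beta>|.\<close>
    also have "?E x 0 / h ^ mi_size \<beta> = ?E x (mi_size \<beta>)" proof -
     have "h powr (real m - real 0 + s - ?d / p) = h powr (real m - real (mi_size \<beta>) + s - ?d / p) * h ^ mi_size \<beta>"
      using h(1) by (simp add: powr_realpow[symmetric] powr_add[symmetric] algebra_simps)
     then show ?thesis using h(1) by simp
    qed
    also have "N0 * (C0 * ?E x (mi_size \<beta>)) + ?E x (mi_size \<beta>) = (N0 * C0 + 1) * ?E x (mi_size \<beta>)" by (simp only: distrib_right mult_1_left mult.assoc)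
    finally show ?thesis .
   qed
   have CBS: "CB (m - 1) h \<Omega> (\<Sum>y\<in>X. \<bar>v (%_. 0) y\<bar> * C0) S" unfolding S_def proof (rule CB_sum[OF opn h(1) X(1)])
    show "CB (m - 1) h \<Omega> (\<bar>v (%_. 0) y\<bar> * C0) (%x. a y x * v (%_. 0) y)" if "y \<in> X" for y
     using CB_cmult[OF opn a(1)[OF that], of "v (%_. 0) y"] by (simp add: mult.commute)
   qed
   let ?e = "%x. u x - S x"
   have wu: "has_weak_deriv \<Omega> \<beta> u (weak_deriv \<Omega> \<beta> u)" and rep: "borel_rep \<Omega> (weak_deriv \<Omega> \<beta> u) (W \<beta>)"
    using W \<beta> km by (auto simp: sobolev_reps_def)
   have we: "has_weak_deriv \<Omega> \<beta> ?e (%x. weak_deriv \<Omega> \<beta> u x - ?D x)"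
    by (rule has_weak_deriv_diff[OF opn wu has_weak_deriv_classical[OF opn CBS]]) (use \<beta> km in simp)
   have we': "has_weak_deriv \<Omega> \<beta> ?e (weak_deriv \<Omega> \<beta> ?e)" unfolding weak_deriv_def by (rule someI[of "has_weak_deriv \<Omega> \<beta> ?e", OF we])
   have "AE x in lebesgue. x \<in> \<Omega> --> \<bar>weak_deriv \<Omega> \<beta> ?e x\<bar> <= (N0 * C0 + 1) * ?E x (mi_size \<beta>)"
    using has_weak_deriv_unique[OF opn we' we, unfolded AE_lebesgue_on_iff[OF opn]] rep[unfolded borel_rep_def, THEN conjunct2, THEN conjunct2]
     AE_lebesgue_lborel[OF v[OF \<beta>, THEN conjunct2]] by eventually_elim (rule impI, frule bnd, simp add: abs_minus_commute)
   then show "let h = fill_distance X \<Omega>; e = (%x. u x - mls_approx m h (mls_weight \<phi> (2 * mls_C2 \<theta> m * h)) X (continuous_rep \<Omega> u) x)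
    in has_weak_deriv \<Omega> \<beta> e (weak_deriv \<Omega> \<beta> e) \<and> (AE x in lebesgue. x \<in> \<Omega> -->
     \<bar>weak_deriv \<Omega> \<beta> e x\<bar> <= (N0 * C0 + 1) * C1 * h powr (real m - real (mi_size \<beta>) + s - ?d / p) * enn2real (local_mass \<Psi> (R * h) x) powr (1 / p))"
    unfolding Let_def h_def[symmetric] S using we' by (simp add: mult.assoc)
  qed
 qed
qed


section \<open>Integrating local masses over \<Omega>\<close>

lemma measurable_dist_le: "{z :: (real^'d::finite) \<times> (real^'d). dist (fst z) (snd z) <= \<rho>} \<in> sets (lborel \<Otimes>\<^sub>M lborel)"
proof -
 have "closed {z :: (real^'d) \<times> (real^'d). dist (fst z) (snd z) <= \<rho>}" by (intro closed_Collect_le continuous_intros)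
 then have "{z :: (real^'d) \<times> (real^'d). dist (fst z) (snd z) <= \<rho>} \<in> sets (borel \<Otimes>\<^sub>M borel)"
  unfolding borel_prod by simp
 moreover have "sets (lborel \<Otimes>\<^sub>M lborel) = sets (borel \<Otimes>\<^sub>M borel :: ((real^'d) \<times> (real^'d)) measure)"
  by (intro sets_pair_measure_cong) auto
 ultimately show ?thesis by simp
qed

lemma local_mass_alt:
 "local_mass \<Psi> \<rho> x = (LNN w. \<Psi> w * indicator {z. dist (fst z) (snd z) <= \<rho>} (x, w))"
 unfolding local_mass_def by (intro nn_integral_cong) (auto simp: indicator_def)

lemma local_mass_measurable:
 assumes [measurable]: "\<Psi> \<in> borel_measurable borel"
 shows "local_mass \<Psi> \<rho> \<in> borel_measurable lborel"
 unfolding local_mass_alt[abs_def] using measurable_dist_le[of \<rho>] by measurable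

text \<open>By Tonelli's theorem a point w contributes its density for every x in the ball of radius
  \<rho> around w.\<close>

lemma integral_local_mass:
 fixes \<Psi> :: "real^'d::finite => ennreal"
 assumes [measurable]: "\<Psi> \<in> borel_measurable borel" and \<rho>: "\<rho> >= 0"
 shows "(LNN x. local_mass \<Psi> \<rho> x) = ennreal (unit_ball_vol (real CARD('d)) * \<rho> ^ CARD('d)) * (LNN w. \<Psi> w)"
proof -
 note [measurable] = measurable_dist_le[of \<rho>]
 have "(LNN x. local_mass \<Psi> \<rho> x) = (LNN w. (LNN x. \<Psi> w * indicator {z. dist (fst z) (snd z) <= \<rho>} (x, w)))"
  unfolding local_mass_alt by (rule lborel_pair.Fubini'[symmetric]) measurable
 also have "... = (LNN w. \<Psi> w * ennreal (unit_ball_vol (real CARD('d)) * \<rho> ^ CARD('d)))" proof (rule nn_integral_cong)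
  fix w
  have "(LNN x. \<Psi> w * indicator {z. dist (fst z) (snd z) <= \<rho>} (x, w)) = (LNN x. \<Psi> w * indicator (cball w \<rho>) x)"
   by (intro nn_integral_cong) (auto simp: indicator_def dist_commute)
  also have "... = \<Psi> w * emeasure lborel (cball w \<rho>)" by (rule nn_integral_cmult_indicator) simp
  finally show "(LNN x. \<Psi> w * indicator {z. dist (fst z) (snd z) <= \<rho>} (x, w)) = \<Psi> w * ennreal (unit_ball_vol (real CARD('d)) * \<rho> ^ CARD('d))"
   using \<rho> by (simp add: emeasure_cball)
 qed
 also have "... = (LNN w. \<Psi> w) * ennreal (unit_ball_vol (real CARD('d)) * \<rho> ^ CARD('d))" by (rule nn_integral_multc) measurable
 finally show ?thesis by (simp add: mult.commute)
qed

lemma local_mass_le: "local_mass \<Psi> \<rho> x <= (LNN w. \<Psi> w)"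
 unfolding local_mass_def by (intro nn_integral_mono) (auto simp: indicator_def)

text \<open>Here t stands for q/p. If t >= 1, one factor of the local mass is integrated, which
  gains h^d, and the remaining power is bounded by the total mass. If t < 1, the gain h^(dt) is
  obtained as in Hoelder's inequality, by comparison with a level l.\<close>

lemma local_mass_powr_integral:
 fixes \<Omega> :: "(real^'d::finite) set"
 assumes \<Omega>: "open \<Omega>" "bounded \<Omega>" and \<Psi>: "\<Psi> \<in> borel_measurable borel" "(LNN w. \<Psi> w) <= ennreal A"
  and A: "A >= 0" and t: "t > 0" and h: "h > 0" "R > 0"
 shows "(LNN x. ennreal (enn2real (local_mass \<Psi> (R * h) x) powr t) * indicator \<Omega> x)
  <= ennreal ((measure lborel \<Omega> + unit_ball_vol (real CARD('d)) * R ^ CARD('d)) * h powr (real CARD('d) * min 1 t) * A powr t)"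
proof (cases "A = 0")
 case True
 then have "local_mass \<Psi> (R * h) x = 0" for x using order_trans[OF local_mass_le \<Psi>(2)] by (simp add: le_zero_eq)
 then show ?thesis by simp
next
 case False
 then have A0: "A > 0" using A by simp
 let ?V = "unit_ball_vol (real CARD('d)) * (R * h) ^ CARD('d)" and ?J = "local_mass \<Psi> (R * h)" and ?d = "real CARD('d)"
 define v where "v = unit_ball_vol ?d * R ^ CARD('d)"
 define \<mu> where "\<mu> = measure lborel \<Omega>"
 have v: "v >= 0" "\<mu> >= 0" using h by (auto simp: v_def \<mu>_def)
 have JA: "?J x <= ennreal A" for x using order_trans[OF local_mass_le \<Psi>(2)] .
 have J: "?J x = ennreal (enn2real (?J x))" "enn2real (?J x) <= A" for x proof -
  have "?J x < top" using le_less_trans[OF JA ennreal_less_top] .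
  then show "?J x = ennreal (enn2real (?J x))" by simp
  show "enn2real (?J x) <= A" using JA[of x] A by (intro enn2real_leI)
 qed
 \<comment> \<open>For t < 1 the level h^d A has the size of the mean local mass, so both terms of
   the pointwise bound contribute h^(dt) A^t.\<close>
 define l where "l = (if t >= 1 then A else h powr ?d * A)"
 have l: "l > 0" using A0 h by (simp add: l_def)
 define c where "c = (if t >= 1 then 0 else l powr t)"
 have c: "c >= 0" by (simp add: c_def)
 have pw: "j powr t <= c + l powr (t - 1) * j" if j: "0 <= j" "j <= A" for j proof (cases "j = 0")
  case False
  then have e: "j powr t = j powr (t - 1) * j" using j by (simp add: powr_diff)
  consider "t >= 1" | "t < 1" "j <= l" | "t < 1" "l < j" by linarith
  then show ?thesis proof cases
   case 1
   then have "j powr (t - 1) <= l powr (t - 1)" using j by (intro powr_mono2) (auto simp: l_def)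
   then show ?thesis unfolding e using j c by (simp add: mult_right_mono add_increasing)
  next
   case 2
   then have "j powr t <= l powr t" using j t by (intro powr_mono2) auto
   then show ?thesis using 2 j by (simp add: c_def add_increasing2)
  next
   case 3
   then have "j powr (t - 1) <= l powr (t - 1)" using l by (intro powr_mono2') auto
   then show ?thesis unfolding e using j c by (simp add: mult_right_mono add_increasing)
  qed
 qed (use c in simp)
 have [measurable]: "?J \<in> borel_measurable lborel" "\<Omega> \<in> sets lborel" using local_mass_measurable[OF \<Psi>(1)] \<Omega> by auto
 have "(LNN x. ennreal (enn2real (?J x) powr t) * indicator \<Omega> x)
  <= (LNN x. ennreal c * indicator \<Omega> x + ennreal (l powr (t - 1)) * ?J x)" proof (rule nn_integral_mono)
  fix x
  have "ennreal (enn2real (?J x) powr t) <= ennreal (c + l powr (t - 1) * enn2real (?J x))" by (intro ennreal_leI pw J(2)) simp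
  also have "... = ennreal c + ennreal (l powr (t - 1)) * ennreal (enn2real (?J x))" using c by (simp add: ennreal_mult)
  also have "... = ennreal c + ennreal (l powr (t - 1)) * ?J x" using J(1)[of x] by simp
  finally show "ennreal (enn2real (?J x) powr t) * indicator \<Omega> x <= ennreal c * indicator \<Omega> x + ennreal (l powr (t - 1)) * ?J x"
   by (auto simp: indicator_def)
 qed
 also have "... = ennreal c * emeasure lborel \<Omega> + ennreal (l powr (t - 1)) * (ennreal ?V * (LNN w. \<Psi> w))"
  using h \<Omega>(1) by (simp add: nn_integral_add nn_integral_cmult integral_local_mass[OF \<Psi>(1)])
 also have "... <= ennreal c * ennreal \<mu> + ennreal (l powr (t - 1)) * (ennreal (v * h ^ CARD('d)) * ennreal A)"
 proof (intro add_mono mult_left_mono \<Psi>(2))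
  show "emeasure lborel \<Omega> <= ennreal \<mu>"
   unfolding \<mu>_def using emeasure_bounded_finite[OF \<Omega>(2)] by (subst emeasure_eq_ennreal_measure) auto
  show "ennreal ?V * (LNN w. \<Psi> w) <= ennreal (v * h ^ CARD('d)) * ennreal A"
   using \<Psi>(2) by (simp add: v_def power_mult_distrib mult.assoc mult_left_mono)
 qed auto
 also have "... = ennreal (c * \<mu> + l powr (t - 1) * (v * h ^ CARD('d) * A))" using c v h A by (simp add: ennreal_mult ennreal_plus)
 also have "c * \<mu> + l powr (t - 1) * (v * h ^ CARD('d) * A) <= (\<mu> + v) * h powr (?d * min 1 t) * A powr t" proof (cases "t >= 1")
  case True
  have "A powr (t - 1) * A = A powr t" using A0 by (simp add: powr_diff)
  then have "l powr (t - 1) * (v * h ^ CARD('d) * A) = v * (h ^ CARD('d) * A powr t)" using True by (simp add: l_def mult_ac)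
  also have "... <= (\<mu> + v) * (h ^ CARD('d) * A powr t)" using v h by (intro mult_right_mono) auto
  finally show ?thesis using True h by (simp add: c_def powr_realpow mult.assoc)
 next
  case False
  have "h ^ CARD('d) * A = l" using False h by (simp add: l_def powr_realpow)
  then have e1: "l powr (t - 1) * (v * h ^ CARD('d) * A) = v * l powr t" using l by (simp add: powr_diff mult.assoc)
  have e2: "l powr t = h powr (?d * min 1 t) * A powr t" using False h A0 by (simp add: l_def powr_mult powr_powr)
  show ?thesis unfolding e1 unfolding mult.assoc e2[symmetric] using False by (simp add: c_def distrib_right mult.commute)
 qed
 finally show ?thesis unfolding v_def \<mu>_def by (meson ennreal_leI order_trans)
qed

text \<open>The power of h is d min(1/p, 1/q), written through the positive part. For q =
  \<infinity> it is 0, and the local mass is simply bounded by the total mass.\<close>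

lemma Lp_norm_local_mass:
 fixes \<Omega> :: "(real^'d::finite) set"
 assumes \<Omega>: "open \<Omega>" "bounded \<Omega>" and \<Psi>: "\<Psi> \<in> borel_measurable borel" "(LNN w. \<Psi> w) <= ennreal A"
  and A: "A >= 0" and p: "p >= 1" and q: "q >= 1" and h: "h > 0" "R > 0" and c: "c >= 0"
  and g: "locally_integrable \<Omega> g" "AE x in lebesgue. x \<in> \<Omega> --> \<bar>g x\<bar> <= c * enn2real (local_mass \<Psi> (R * h) x) powr (1 / p)"
 defines "D \<equiv> max 1 (measure lborel \<Omega> + unit_ball_vol (real CARD('d)) * R ^ CARD('d))"
 shows "Lp_norm \<Omega> q g <= ennreal (c * D * h powr (real CARD('d) * (1 / p - max 0 (1 / p - enn2real (1 / q)))) * A powr (1 / p))"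
proof -
 let ?d = "real CARD('d)"
 let ?h = "h powr (?d * (1 / p - max 0 (1 / p - enn2real (1 / q))))" and ?j = "%x. enn2real (local_mass \<Psi> (R * h) x)"
 have jA: "?j x <= A" for x using order_trans[OF local_mass_le \<Psi>(2)] A by (intro enn2real_leI) auto
 have D: "D >= 1" by (simp add: D_def)
 have ae: "AE x in lebesgue_on \<Omega>. \<bar>g x\<bar> <= c * ?j x powr (1 / p)" using g(2) unfolding AE_lebesgue_on_iff[OF \<Omega>(1)] .
 show ?thesis proof (cases "q = \<infinity>")
  case True
  have [measurable]: "g \<in> borel_measurable (lebesgue_on \<Omega>)"
   using locally_integrable_measurable[OF \<Omega>(1) g(1)] \<Omega>(1) by (subst borel_measurable_restrict_space_iff) auto
  have "Lp_norm \<Omega> q g = esssup (lebesgue_on \<Omega>) (%x. ennreal \<bar>g x\<bar>)" using True by (simp add: Lp_norm_def)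
  also have "... <= ennreal (c * D * A powr (1 / p))" proof (rule esssup_I)
   show "AE x in lebesgue_on \<Omega>. ennreal \<bar>g x\<bar> <= ennreal (c * D * A powr (1 / p))" using ae proof eventually_elim
    case (elim x)
    also have "c * ?j x powr (1 / p) <= c * A powr (1 / p)" using c p jA by (intro mult_left_mono powr_mono2) auto
    also have "... <= c * D * A powr (1 / p)" using mult_left_mono[OF D c] by (intro mult_right_mono) auto
    finally show ?case by (rule ennreal_leI)
   qed
  qed measurable
  finally show ?thesis using True p h by simp
 next
  case False
  define t where "t = enn2real q"
  have q': "q = ennreal t" using False by (simp add: t_def less_top)
  have t: "t >= 1" using q unfolding q' ennreal_1[symmetric] by (subst (asm) ennreal_le_iff) (auto simp: t_def)
  have inv: "enn2real (1 / q) = 1 / t" using t divide_ennreal[of 1 t] by (simp add: q')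
  let ?M = "measure lborel \<Omega> + unit_ball_vol ?d * R ^ CARD('d)"
  let ?X = "c powr t * (?M * h powr (?d * min 1 (t / p)) * A powr (t / p))"
  have M: "?M >= 0" using h by simp
  have "(\<integral>\<^sup>+x. ennreal (\<bar>g x\<bar> powr t) \<partial>lebesgue_on \<Omega>) <= (\<integral>\<^sup>+x. ennreal (c powr t) * ennreal (?j x powr (t / p)) \<partial>lebesgue_on \<Omega>)"
  proof (rule nn_integral_mono_AE, use ae in eventually_elim)
   case (elim x)
   then have "\<bar>g x\<bar> powr t <= (c * ?j x powr (1 / p)) powr t" using t by (intro powr_mono2) auto
   also have "... = c powr t * ?j x powr (t / p)" using c by (simp add: powr_mult powr_powr)
   finally show ?case by (simp add: ennreal_mult[symmetric] ennreal_leI)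
  qed
  also have "... = (LNN x. ennreal (c powr t) * ennreal (?j x powr (t / p)) * indicator \<Omega> x)"
   by (rule nn_integral_lebesgue_on[OF \<Omega>(1)]) simp
  also have "... = ennreal (c powr t) * (LNN x. ennreal (?j x powr (t / p)) * indicator \<Omega> x)" proof -
   have [measurable]: "local_mass \<Psi> (R * h) \<in> borel_measurable lborel" "\<Omega> \<in> sets lborel"
    using local_mass_measurable[OF \<Psi>(1)] \<Omega>(1) by auto
   show ?thesis unfolding mult.assoc by (rule nn_integral_cmult) measurable
  qed
  also have "... <= ennreal (c powr t) * ennreal (?M * h powr (?d * min 1 (t / p)) * A powr (t / p))"
   using t p by (intro mult_left_mono local_mass_powr_integral \<Omega> \<Psi> A h) auto
  also have "... = ennreal ?X" using M by (intro ennreal_mult[symmetric]) auto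
  finally have "Lp_norm \<Omega> q g <= ennreal_powr (ennreal ?X) (1 / t)"
   unfolding Lp_norm_def t_def[symmetric] using False t by (simp add: ennreal_powr_mono)
  also have "... = ennreal (?X powr (1 / t))" using M by (intro ennreal_powr_ennreal) auto
  also have "?X powr (1 / t)
    = c * ?M powr (1 / t) * h powr (?d * min 1 (t / p) / t) * A powr (1 / p)" using M c t A by (simp add: powr_mult powr_powr)
  also have "?d * min 1 (t / p) / t = ?d * (1 / p - max 0 (1 / p - enn2real (1 / q)))"
   unfolding inv using t p by (auto simp: min_def max_def field_simps)
  also have "c * ?M powr (1 / t) * ?h * A powr (1 / p)
    <= c * D * ?h * A powr (1 / p)" proof (intro mult_right_mono mult_left_mono c)
   have "?M powr (1 / t) <= D powr (1 / t)" using M t by (intro powr_mono2) (auto simp: D_def)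
   also have "... <= D powr 1" using D t by (intro powr_mono) auto
   finally show "?M powr (1 / t) <= D" using D by simp
  qed auto
  finally show ?thesis by (simp add: ennreal_leI)
 qed
qed

text \<open>The number of multi-indices is a crude factor that serves finite q and q = \<infinity>
  alike. Existence of the weak derivatives is part of the hypothesis because the norm is \<infinity>
  without it.\<close>

lemma sobolev_norm_le:
 fixes e :: "real^'d::finite => real"
 assumes q: "q >= 1" and T: "T >= 0"
  and e: "!!\<beta>. mi_size \<beta> <= k ==> has_weak_deriv \<Omega> \<beta> e (weak_deriv \<Omega> \<beta> e) \<and> Lp_norm \<Omega> q (weak_deriv \<Omega> \<beta> e) <= ennreal T"
 shows "sobolev_norm \<Omega> k q e <= ennreal (real (card {\<beta> :: 'd => nat. mi_size \<beta> <= k}) * T)"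
proof -
 let ?S = "{\<beta> :: 'd => nat. mi_size \<beta> <= k}"
 have "(%_. 0) \<in> ?S" by simp
 then have n: "real (card ?S) >= 1" using card_gt_0_iff[of ?S] by (metis One_nat_def Suc_leI empty_iff finite_mi_size_le of_nat_1 of_nat_mono)
 have nex: "\<not> (\<exists>\<beta>. mi_size \<beta> <= k \<and> \<not> (\<exists>g. has_weak_deriv \<Omega> \<beta> e g))" using e by blast
 have Tn: "T <= real (card ?S) * T" using n T by (simp add: mult_le_cancel_right1)
 show ?thesis proof (cases "q = \<infinity>")
  case True
  then have "sobolev_norm \<Omega> k q e = (SUP \<beta>\<in>?S. Lp_norm \<Omega> \<infinity> (weak_deriv \<Omega> \<beta> e))"
   unfolding sobolev_norm_def if_not_P[OF nex] by (simp only: if_True simp_thms)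
  also have "... <= ennreal T" using e True by (intro SUP_least) auto
  also have "... <= ennreal (real (card ?S) * T)" using Tn by (rule ennreal_leI)
  finally show ?thesis .
 next
  case False
  define t where "t = enn2real q"
  have q': "q = ennreal t" using False by (simp add: t_def less_top)
  have t: "t >= 1" using q unfolding q' ennreal_1[symmetric] by (subst (asm) ennreal_le_iff) (auto simp: t_def)
  have "sobolev_norm \<Omega> k q e = ennreal_powr (\<Sum>\<beta>\<in>?S. ennreal_powr (Lp_norm \<Omega> q (weak_deriv \<Omega> \<beta> e)) t) (1 / t)"
   unfolding sobolev_norm_def if_not_P[OF nex] t_def using False by (simp only: if_False)
  also have "... <= ennreal_powr (\<Sum>\<beta>\<in>?S. ennreal (T powr t)) (1 / t)"
   using e t T by (intro ennreal_powr_mono sum_mono order_trans[OF ennreal_powr_mono eq_refl[OF ennreal_powr_ennreal]]) auto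
  also have "... = ennreal ((real (card ?S) * T powr t) powr (1 / t))"
   by (simp add: ennreal_of_nat_eq_real_of_nat ennreal_mult[symmetric] ennreal_powr_ennreal)
  also have "(real (card ?S) * T powr t) powr (1 / t) = real (card ?S) powr (1 / t) * T" using t T by (simp add: powr_mult powr_powr)
  also have "... <= real (card ?S) powr 1 * T" using n t T by (intro mult_right_mono powr_mono) auto
  finally show ?thesis using n by (simp add: ennreal_leI)
 qed
qed


theorem theorem3p12:
  fixes \<Omega> :: "(real^'d::finite) set" and \<theta> r s p c_qu :: real and m :: nat
    and q :: ennreal and \<alpha> :: "'d \<Rightarrow> nat" and \<phi> :: "real \<Rightarrow> real"
  assumes "bounded \<Omega>" and "lipschitz_boundary \<Omega>"
    and "0 < \<theta>" and "\<theta> < pi / 2" and "0 < r" and "interior_cone_condition \<Omega> \<theta> r"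
    and "0 < m" and "0 \<le> s" and "s < 1" and "1 \<le> p" and "1 \<le> q"
    and "p > 1 \<Longrightarrow> real m > real (mi_size \<alpha>) + real CARD('d) / p"
    and "p = 1 \<Longrightarrow> m \<ge> mi_size \<alpha> + CARD('d)"
    and "weight_profile m \<phi>" and "0 < c_qu"
  shows "\<exists>C>0. \<exists>h0>0. \<forall>u \<in> frac_sobolev_space \<Omega> m s p. \<forall>X.
    finite X \<and> X \<subseteq> \<Omega> \<and> fill_distance X \<Omega> \<le> min h0 1 \<and> quasi_uniform c_qu X \<Omega> \<longrightarrow>
    (let h = fill_distance X \<Omega>;
         w = mls_weight \<phi> (2 * mls_C2 \<theta> m * h);
         s_uX = mls_approx m h w X (continuous_rep \<Omega> u)
     in sobolev_norm \<Omega> (mi_size \<alpha>) q (\<lambda>x. u x - s_uX x)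
        \<le> ennreal (C * h powr (real m + s - real (mi_size \<alpha>)
                                - real CARD('d) * max 0 (1 / p - enn2real (1 / q))))
          * frac_sobolev_norm \<Omega> m s p u)"
proof -
 let ?d = "real CARD('d)" and ?k = "mi_size \<alpha>" and ?e = "max 0 (1 / p - enn2real (1 / q))"
 have opn: "open \<Omega>" by (rule lipschitz_boundary_open[OF assms(2)])
 obtain C R h1 where C: "C >= 0" "R > 0" "h1 > 0" and main: "\<forall>u. frac_sobolev_norm \<Omega> m s p u < \<infinity> -->
   (\<exists>\<Psi>. oscillation_density \<Omega> m s p u \<Psi> \<and> mls_errors \<Omega> m ?k s p c_qu \<theta> \<phi> C R h1 u \<Psi>)"
  using mls_weak_deriv_error[where k = ?k, OF assms(1-6) \<open>0 < m\<close> \<open>weight_profile m \<phi>\<close> \<open>0 < c_qu\<close> \<open>0 <= s\<close> \<open>1 <= p\<close> assms(12,13), simplified simp_thms implies_True_equals True_implies_equals]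
  by (elim exE conjE)
 define err where "err u X = (%x. u x - mls_approx m (fill_distance X \<Omega>) (mls_weight \<phi> (2 * mls_C2 \<theta> m * fill_distance X \<Omega>)) X (continuous_rep \<Omega> u) x)" for u X
 define D where "D = max 1 (measure lborel \<Omega> + unit_ball_vol ?d * R ^ CARD('d))"
 define n where "n = real (card {\<beta> :: 'd => nat. mi_size \<beta> <= ?k})"
 have D: "D >= 1" and n: "n >= 0" by (auto simp: D_def n_def)
 have est: "sobolev_norm \<Omega> ?k q (err u X) <= ennreal ((n * (C * D) + 1) * h powr (real m + s - real ?k - ?d * ?e)) * frac_sobolev_norm \<Omega> m s p u"
  if u: "frac_sobolev_norm \<Omega> m s p u < \<infinity>" and X: "finite X" "X \<subseteq> \<Omega>" and fd: "fill_distance X \<Omega> <= h1" "fill_distance X \<Omega> <= 1"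
   and qu: "quasi_uniform c_qu X \<Omega>" and h_def: "h = fill_distance X \<Omega>" for u X h proof -
  from main[rule_format, OF u] obtain \<Psi> where "oscillation_density \<Omega> m s p u \<Psi>" and err: "mls_errors \<Omega> m ?k s p c_qu \<theta> \<phi> C R h1 u \<Psi>"
   by (elim exE conjE)
  then have \<Psi>: "\<Psi> \<in> borel_measurable borel" "(LNN w. \<Psi> w) <= ennreal_powr (frac_sobolev_norm \<Omega> m s p u) p"
   by (auto simp: oscillation_density_def)
  note err = err[unfolded mls_errors_def Let_def, folded err_def]
  have h: "h > 0" "h <= 1" using quasi_uniform_separated(1)[OF X(1) qu \<open>0 < c_qu\<close>] fd by (auto simp: h_def)
  define N where "N = enn2real (frac_sobolev_norm \<Omega> m s p u)"
  have N: "N >= 0" "frac_sobolev_norm \<Omega> m s p u = ennreal N" using u by (auto simp: N_def)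
  have \<Psi>N: "(LNN w. \<Psi> w) <= ennreal (N powr p)" using \<Psi>(2) N by (simp add: ennreal_powr_ennreal)
  define T where "T = C * D * h powr (real m + s - real ?k - ?d * ?e) * N"
  have T: "T >= 0" using C D N by (simp add: T_def)
  have "sobolev_norm \<Omega> ?k q (err u X) <= ennreal (n * T)" unfolding n_def proof (rule sobolev_norm_le[OF \<open>1 <= q\<close> T])
   fix \<beta> :: "'d => nat" assume \<beta>: "mi_size \<beta> <= ?k"
   let ?g = "weak_deriv \<Omega> \<beta> (err u X)" and ?\<sigma> = "real m - real (mi_size \<beta>) + s - ?d / p"
   have wd: "has_weak_deriv \<Omega> \<beta> (err u X) ?g" and ae: "AE x in lebesgue. x \<in> \<Omega> -->
     \<bar>?g x\<bar> <= C * h powr ?\<sigma> * enn2real (local_mass \<Psi> (R * h) x) powr (1 / p)"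
    using err[rule_format, OF X qu fd(1) \<beta>] unfolding h_def by simp_all
   have "Lp_norm \<Omega> q ?g <= ennreal (C * h powr ?\<sigma> * D * h powr (?d * (1 / p - ?e)) * (N powr p) powr (1 / p))" unfolding D_def
    by (rule Lp_norm_local_mass[OF opn \<open>bounded \<Omega>\<close> \<Psi>(1) \<Psi>N _ \<open>1 <= p\<close> \<open>1 <= q\<close> h(1) C(2) _ _ ae])
      (use wd C in "auto simp: has_weak_deriv_def")
   also have "C * h powr ?\<sigma> * D * h powr (?d * (1 / p - ?e)) * (N powr p) powr (1 / p)
     = C * D * (h powr ?\<sigma> * h powr (?d * (1 / p - ?e))) * N" using N \<open>1 <= p\<close> by (simp add: powr_powr)
   \<comment> \<open>The loss d/p of the pointwise bound is made up by integrating the local masses,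
     except for d(1/p - 1/q)_+.\<close>
   also have "h powr ?\<sigma> * h powr (?d * (1 / p - ?e)) = h powr (real m + s - real (mi_size \<beta>) - ?d * ?e)"
    unfolding powr_add[symmetric] by (rule arg_cong[where f = "(powr) h"]) (simp add: right_diff_distrib)
   \<comment> \<open>Since h <= 1, the highest order |\<alpha>| has the smallest exponent and
     dominates the lower ones; here the bound 1 on the fill distance enters.\<close>
   also have "C * D * ... * N <= T" unfolding T_def using C D N \<beta> h by (intro mult_right_mono mult_left_mono powr_mono') auto
   finally have "Lp_norm \<Omega> q ?g <= ennreal T" by (simp add: ennreal_leI)
   then show "has_weak_deriv \<Omega> \<beta> (err u X) ?g \<and> Lp_norm \<Omega> q ?g <= ennreal T" using wd by simp
  qed
  also have "ennreal (n * T) <= ennreal ((n * (C * D) + 1) * h powr (real m + s - real ?k - ?d * ?e) * N)"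
   using N by (intro ennreal_leI) (simp add: T_def algebra_simps)
  also have "... = ennreal ((n * (C * D) + 1) * h powr (real m + s - real ?k - ?d * ?e)) * ennreal N"
   using N n C D by (intro ennreal_mult) auto
  finally show ?thesis unfolding N(2) .
 qed
 \<comment> \<open>The summand 1 makes the constant positive.\<close>
 show ?thesis proof (rule exI[of _ "n * (C * D) + 1"], rule conjI)
  show "n * (C * D) + 1 > 0" using n C D by (intro add_nonneg_pos mult_nonneg_nonneg) auto
 next
  show "\<exists>h0>0. \<forall>u \<in> frac_sobolev_space \<Omega> m s p. \<forall>X.
  finite X \<and> X \<subseteq> \<Omega> \<and> fill_distance X \<Omega> <= min h0 1 \<and> quasi_uniform c_qu X \<Omega> -->
  (let h = fill_distance X \<Omega>;
     w = mls_weight \<phi> (2 * mls_C2 \<theta> m * h);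
     s_uX = mls_approx m h w X (continuous_rep \<Omega> u)
   in sobolev_norm \<Omega> (mi_size \<alpha>) q (%x. u x - s_uX x)
    <= ennreal ((n * (C * D) + 1) * h powr (real m + s - real (mi_size \<alpha>)
                - real CARD('d) * max 0 (1 / p - enn2real (1 / q))))
     * frac_sobolev_norm \<Omega> m s p u)" unfolding Let_def using C(3) est[unfolded err_def, OF _ _ _ _ _ _ refl]
   by (intro exI[of _ h1]) (auto simp: frac_sobolev_space_def)
 qed
qed


end
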